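(* Let $K$ be an algebraically closed field and let $A = KQ/I$ be a monomial special multiserial $K$-algebra. Then $\operatorname{repdim}(A)\leq 3$.
   Context: $K$ is an algebraically closed field. A quiver $Q=(Q_0,Q_1,s,e)$ has a finite set of vertices $Q_0$, a finite set of arrows $Q_1$, and maps $s,e:Q_1\to Q_0$ giving the start and end of each arrow. Paths are composed left to right: for arrows $a,b$ with $e(a)=s(b)$, $ab$ denotes the path "first $a$, then $b$" in the path algebra $KQ$ (and $ab=0$ in $KQ$ if $e(a)\neq s(b)$). Whenever one writes $KQ/I$, the ideal $I$ is assumed admissible. Condition (S) for $KQ/I$: for every $a\in Q_1$ there is at most one arrow $b\in Q_1$ such that $ab\notin I$, and at most one arrow $c\in Q_1$ such that $ca\notin I$. A finite dimensional $K$-algebra is special multiserial if it is Morita equivalent to an algebra $KQ/I$ for which (S) holds. An algebra $KQ/I$ is monomial if $I$ is generated by paths. A monomial special multiserial algebra is an algebra $A=KQ/I$ with $I$ admissible and generated by paths and such that (S) holds. All modules are finitely generated right modules. $D(A)=\operatorname{Hom}_K(A,K)$. A module $M$ is a generator-cogenerator of $A$ if $A\oplus D(A)\in\operatorname{add} M$, where $\operatorname{add} M$ is the category of direct sums of direct summands of $M$. The global dimension $\operatorname{gldim}$ is the supremum of the projective dimensions of finitely generated right modules. The representation dimension is $$\operatorname{repdim}(A)=\inf\{\operatorname{gldim}(\operatorname{End}_A(M)^{op}) \mid M \text{ is a generator-cogenerator of } A\}.$$ *)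

theory Defs
  imports
    "HOL-Computational_Algebra.Polynomial"
    "HOL-Library.Extended_Nat"
    "Graph_Theory.Graph_Theory"
    "HOL-Algebra.QuotRing"
    "HOL-Algebra.Ideal_Product"
    "HOL-Algebra.Module"
begin

section \<open>Path algebras\<close>

text \<open>
  A quiver is a \<open>fin_digraph\<close> (loops and multiple arrows are allowed), with \<open>tail\<close> and \<open>head\<close>
  the start and the end of an arrow. The path \<open>a\<^sub>1 a\<^sub>2 \<dots> a\<^sub>n\<close> starting at \<open>u\<close> is the pair
  \<open>(u, [a\<^sub>1, \<dots>, a\<^sub>n])\<close>, and \<open>(u, [])\<close> is the trivial path at \<open>u\<close>. Elements of the path algebra are
  finitely supported coefficient functions on paths.
\<close>

definition quiver_paths :: "('v, 'e) pre_digraph \<Rightarrow> ('v \<times> 'e list) set" where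
  "quiver_paths Q = {(u, p). \<exists>v. pre_digraph.awalk Q u p v}"

definition path_algebra ::
    "('v, 'e) pre_digraph \<Rightarrow> ('k::field, 'v \<times> 'e list \<Rightarrow> 'k) module" where
  "path_algebra Q =
    \<lparr>carrier = {f. {x. f x \<noteq> 0} \<subseteq> quiver_paths Q \<and> finite {x. f x \<noteq> 0}},
     mult = (\<lambda>f g (u, r). \<Sum>(p, q) | p @ q = r. f (u, p) * g (pre_digraph.awlast Q u p, q)),
     one = (\<lambda>(u, p). if u \<in> verts Q \<and> p = [] then 1 else 0),
     zero = (\<lambda>x. 0),
     add = (\<lambda>f g x. f x + g x),
     smult = (\<lambda>c f x. c * f x)\<rparr>"

definition path_elem :: "'v \<times> 'e list \<Rightarrow> 'v \<times> 'e list \<Rightarrow> 'k::field" where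
  "path_elem x = (\<lambda>y. if y = x then 1 else 0)"

definition arrow_elem :: "('v, 'e) pre_digraph \<Rightarrow> 'e \<Rightarrow> 'v \<times> 'e list \<Rightarrow> 'k::field" where
  "arrow_elem Q a = path_elem (tail Q a, [a])"

definition arrow_ideal :: "('v, 'e) pre_digraph \<Rightarrow> ('v \<times> 'e list \<Rightarrow> 'k::field) set" where
  "arrow_ideal Q = Idl\<^bsub>path_algebra Q\<^esub> (arrow_elem Q ` arcs Q)"

primrec ideal_power :: "('a, 'b) ring_scheme \<Rightarrow> 'a set \<Rightarrow> nat \<Rightarrow> 'a set" where
  "ideal_power R J 0 = carrier R"
| "ideal_power R J (Suc n) = ideal_power R J n \<cdot>\<^bsub>R\<^esub> J"

definition admissible_ideal ::
    "('v, 'e) pre_digraph \<Rightarrow> ('v \<times> 'e list \<Rightarrow> 'k::field) set \<Rightarrow> bool" where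
  "admissible_ideal Q I \<longleftrightarrow>
    ideal I (path_algebra Q) \<and>
    I \<subseteq> ideal_power (path_algebra Q) (arrow_ideal Q) 2 \<and>
    (\<exists>m\<ge>2. ideal_power (path_algebra Q) (arrow_ideal Q) m \<subseteq> I)"

definition monomial_ideal ::
    "('v, 'e) pre_digraph \<Rightarrow> ('v \<times> 'e list \<Rightarrow> 'k::field) set \<Rightarrow> bool" where
  "monomial_ideal Q I \<longleftrightarrow>
    (\<exists>S \<subseteq> quiver_paths Q. I = Idl\<^bsub>path_algebra Q\<^esub> (path_elem ` S))"

text \<open>
  The product of two non-composable arrows is zero, hence lies in every ideal.
\<close>

definition condition_S ::
    "('v, 'e) pre_digraph \<Rightarrow> ('v \<times> 'e list \<Rightarrow> 'k::field) set \<Rightarrow> bool" where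
  "condition_S Q I \<longleftrightarrow> (\<forall>a \<in> arcs Q.
    (\<forall>b \<in> arcs Q. \<forall>b' \<in> arcs Q.
      arrow_elem Q a \<otimes>\<^bsub>path_algebra Q\<^esub> arrow_elem Q b \<notin> I \<longrightarrow>
      arrow_elem Q a \<otimes>\<^bsub>path_algebra Q\<^esub> arrow_elem Q b' \<notin> I \<longrightarrow> b = b') \<and>
    (\<forall>c \<in> arcs Q. \<forall>c' \<in> arcs Q.
      arrow_elem Q c \<otimes>\<^bsub>path_algebra Q\<^esub> arrow_elem Q a \<notin> I \<longrightarrow>
      arrow_elem Q c' \<otimes>\<^bsub>path_algebra Q\<^esub> arrow_elem Q a \<notin> I \<longrightarrow> c = c'))"

text \<open>
  The library factor ring, equipped with the induced scalar multiplication
  \<open>c \<odot> (I +> x) = I +> (c \<odot> x)\<close>.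
\<close>

definition quotient_algebra ::
    "('k, 'a, 'b) module_scheme \<Rightarrow> 'a set \<Rightarrow> ('k, 'a set) module" where
  "quotient_algebra A I =
    ring.extend (A Quot I) (module.fields (\<lambda>c X. \<Union>x\<in>X. I +>\<^bsub>A\<^esub> (c \<odot>\<^bsub>A\<^esub> x)))"

section \<open>Right modules over a ring\<close>

text \<open>
  As with the library's modules, only the additive part of the underlying ring record is used.
\<close>

record ('r, 'm) rmodule = "'m ring" +
  ract :: "'m \<Rightarrow> 'r \<Rightarrow> 'm" (infixl \<open>\<triangleleft>\<index>\<close> 70)

locale right_module = R?: ring R + M?: abelian_group M
  for R :: "('r, 'x) ring_scheme" (structure) and M :: "('r, 'm, 'y) rmodule_scheme" (structure) +
  assumes ract_closed: "\<lbrakk>x \<in> carrier M; r \<in> carrier R\<rbrakk> \<Longrightarrow> x \<triangleleft>\<^bsub>M\<^esub> r \<in> carrier M"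
    and ract_add_right: "\<lbrakk>x \<in> carrier M; r \<in> carrier R; s \<in> carrier R\<rbrakk>
      \<Longrightarrow> x \<triangleleft>\<^bsub>M\<^esub> (r \<oplus>\<^bsub>R\<^esub> s) = (x \<triangleleft>\<^bsub>M\<^esub> r) \<oplus>\<^bsub>M\<^esub> (x \<triangleleft>\<^bsub>M\<^esub> s)"
    and ract_add_left: "\<lbrakk>x \<in> carrier M; y \<in> carrier M; r \<in> carrier R\<rbrakk>
      \<Longrightarrow> (x \<oplus>\<^bsub>M\<^esub> y) \<triangleleft>\<^bsub>M\<^esub> r = (x \<triangleleft>\<^bsub>M\<^esub> r) \<oplus>\<^bsub>M\<^esub> (y \<triangleleft>\<^bsub>M\<^esub> r)"
    and ract_mult: "\<lbrakk>x \<in> carrier M; r \<in> carrier R; s \<in> carrier R\<rbrakk>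
      \<Longrightarrow> x \<triangleleft>\<^bsub>M\<^esub> (r \<otimes>\<^bsub>R\<^esub> s) = (x \<triangleleft>\<^bsub>M\<^esub> r) \<triangleleft>\<^bsub>M\<^esub> s"
    and ract_one: "x \<in> carrier M \<Longrightarrow> x \<triangleleft>\<^bsub>M\<^esub> \<one>\<^bsub>R\<^esub> = x"

definition fg_module :: "('r, 'x) ring_scheme \<Rightarrow> ('r, 'm, 'y) rmodule_scheme \<Rightarrow> bool" where
  "fg_module R M \<longleftrightarrow> right_module R M \<and>
    (\<exists>S \<subseteq> carrier M. finite S \<and>
      (\<forall>x \<in> carrier M. \<exists>f. f ` S \<subseteq> carrier R \<and> x = (\<Oplus>\<^bsub>M\<^esub>s\<in>S. s \<triangleleft>\<^bsub>M\<^esub> f s)))"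

definition rmod_hom :: "('r, 'x) ring_scheme \<Rightarrow> ('r, 'm, 'y) rmodule_scheme \<Rightarrow>
    ('r, 'n, 'z) rmodule_scheme \<Rightarrow> ('m \<Rightarrow> 'n) set" where
  "rmod_hom R M N = {f \<in> hom (add_monoid M) (add_monoid N).
    \<forall>x \<in> carrier M. \<forall>r \<in> carrier R. f (x \<triangleleft>\<^bsub>M\<^esub> r) = f x \<triangleleft>\<^bsub>N\<^esub> r}"

definition rmod_isomorphic :: "('r, 'x) ring_scheme \<Rightarrow> ('r, 'm, 'y) rmodule_scheme \<Rightarrow>
    ('r, 'n, 'z) rmodule_scheme \<Rightarrow> bool" where
  "rmod_isomorphic R M N \<longleftrightarrow> (\<exists>f \<in> rmod_hom R M N. bij_betw f (carrier M) (carrier N))"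

definition rsubmodule ::
    "('r, 'x) ring_scheme \<Rightarrow> ('r, 'm, 'y) rmodule_scheme \<Rightarrow> 'm set \<Rightarrow> bool" where
  "rsubmodule R M U \<longleftrightarrow> subgroup U (add_monoid M) \<and>
    (\<forall>x \<in> U. \<forall>r \<in> carrier R. x \<triangleleft>\<^bsub>M\<^esub> r \<in> U)"

definition direct_summand ::
    "('r, 'x) ring_scheme \<Rightarrow> ('r, 'm, 'y) rmodule_scheme \<Rightarrow> 'm set \<Rightarrow> bool" where
  "direct_summand R M U \<longleftrightarrow> rsubmodule R M U \<and>
    (\<exists>W. rsubmodule R M W \<and> U \<inter> W = {\<zero>\<^bsub>M\<^esub>} \<and> U <+>\<^bsub>M\<^esub> W = carrier M)"

definition direct_sum2 :: "('r, 'm, 'y) rmodule_scheme \<Rightarrow> ('r, 'n, 'z) rmodule_scheme \<Rightarrow>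
    ('r, 'm \<times> 'n) rmodule" where
  "direct_sum2 M N =
    \<lparr>carrier = carrier M \<times> carrier N,
     mult = undefined, one = undefined,
     zero = (\<zero>\<^bsub>M\<^esub>, \<zero>\<^bsub>N\<^esub>),
     add = (\<lambda>(x, y) (x', y'). (x \<oplus>\<^bsub>M\<^esub> x', y \<oplus>\<^bsub>N\<^esub> y')),
     ract = (\<lambda>(x, y) r. (x \<triangleleft>\<^bsub>M\<^esub> r, y \<triangleleft>\<^bsub>N\<^esub> r))\<rparr>"

definition direct_sum :: "nat \<Rightarrow> (nat \<Rightarrow> ('r, 'm, 'y) rmodule_scheme) \<Rightarrow>
    ('r, nat \<Rightarrow> 'm) rmodule" where
  "direct_sum n N =
    \<lparr>carrier = (\<Pi>\<^sub>E i\<in>{..<n}. carrier (N i)),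
     mult = undefined, one = undefined,
     zero = (\<lambda>i\<in>{..<n}. \<zero>\<^bsub>N i\<^esub>),
     add = (\<lambda>x y. \<lambda>i\<in>{..<n}. x i \<oplus>\<^bsub>N i\<^esub> y i),
     ract = (\<lambda>x r. \<lambda>i\<in>{..<n}. x i \<triangleleft>\<^bsub>N i\<^esub> r)\<rparr>"

definition in_add :: "('r, 'x) ring_scheme \<Rightarrow> ('r, 'm, 'y) rmodule_scheme \<Rightarrow>
    ('r, 'n, 'z) rmodule_scheme \<Rightarrow> bool" where
  "in_add R M X \<longleftrightarrow> (\<exists>n U. (\<forall>i<n. direct_summand R M (U i)) \<and>
    rmod_isomorphic R X (direct_sum n (\<lambda>i. M\<lparr>carrier := U i\<rparr>)))"

definition regular_module :: "('r, 'x) ring_scheme \<Rightarrow> ('r, 'r) rmodule" where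
  "regular_module R = ring.extend (ring.truncate R) (rmodule.fields (\<otimes>\<^bsub>R\<^esub>))"

section \<open>Projective and global dimension\<close>

text \<open>
  Every finitely generated right \<open>R\<close>-module is isomorphic to a quotient of some \<open>R\<^sup>n\<close>, hence to a
  module whose elements are sets of functions \<open>nat \<Rightarrow> 'r\<close>. Quantifying over the modules on this
  fixed type therefore covers all finitely generated modules up to isomorphism.
\<close>

type_synonym 'r fgmod = "('r, (nat \<Rightarrow> 'r) set) rmodule"

definition projective_module :: "('r, 'x) ring_scheme \<Rightarrow> 'r fgmod \<Rightarrow> bool" where
  "projective_module R P \<longleftrightarrow> fg_module R P \<and>
    (\<forall>(X :: 'r fgmod) (Y :: 'r fgmod). \<forall>g \<in> rmod_hom R X Y. \<forall>f \<in> rmod_hom R P Y.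
      fg_module R X \<and> fg_module R Y \<and> g ` carrier X = carrier Y \<longrightarrow>
      (\<exists>h \<in> rmod_hom R P X. \<forall>x \<in> carrier P. g (h x) = f x))"

text \<open>
  An exact sequence \<open>0 \<rightarrow> X (n+1) \<rightarrow> \<dots> \<rightarrow> X 1 \<rightarrow> X 0 = M \<rightarrow> 0\<close> with \<open>X 1, \<dots>, X (n+1)\<close> projective,
  where \<open>d i\<close> maps \<open>X (i+1)\<close> to \<open>X i\<close>.
\<close>

definition has_projective_resolution :: "('r, 'x) ring_scheme \<Rightarrow> 'r fgmod \<Rightarrow> nat \<Rightarrow> bool" where
  "has_projective_resolution R M n \<longleftrightarrow>
    (\<exists>(X :: nat \<Rightarrow> 'r fgmod) d.
      X 0 = M \<and>
      (\<forall>i\<le>n. projective_module R (X (Suc i))) \<and>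
      (\<forall>i\<le>n. d i \<in> rmod_hom R (X (Suc i)) (X i)) \<and>
      d 0 ` carrier (X 1) = carrier M \<and>
      (\<forall>i<n. d (Suc i) ` carrier (X (Suc (Suc i))) = a_kernel (X (Suc i)) (X i) (d i)) \<and>
      a_kernel (X (Suc n)) (X n) (d n) = {\<zero>\<^bsub>X (Suc n)\<^esub>})"

definition proj_dim :: "('r, 'x) ring_scheme \<Rightarrow> 'r fgmod \<Rightarrow> enat" where
  "proj_dim R M = Inf {enat n | n. has_projective_resolution R M n}"

definition gldim :: "('r, 'x) ring_scheme \<Rightarrow> enat" where
  "gldim R = Sup {proj_dim R M | M :: 'r fgmod. fg_module R M}"

section \<open>Representation dimension\<close>

definition opposite_ring :: "('r, 'x) ring_scheme \<Rightarrow> ('r, 'x) ring_scheme" where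
  "opposite_ring R = R\<lparr>mult := (\<lambda>x y. y \<otimes>\<^bsub>R\<^esub> x)\<rparr>"

definition endo_ring ::
    "('r, 'x) ring_scheme \<Rightarrow> ('r, 'm, 'y) rmodule_scheme \<Rightarrow> ('m \<Rightarrow> 'm) ring" where
  "endo_ring R M =
    \<lparr>carrier = rmod_hom R M M \<inter> extensional (carrier M),
     mult = (\<lambda>f g. compose (carrier M) f g),
     one = (\<lambda>x\<in>carrier M. x),
     zero = (\<lambda>x\<in>carrier M. \<zero>\<^bsub>M\<^esub>),
     add = (\<lambda>f g. \<lambda>x\<in>carrier M. f x \<oplus>\<^bsub>M\<^esub> g x)\<rparr>"

text \<open>
  The right module \<open>Hom\<^sub>K(A, K)\<close>, with action \<open>(\<phi> \<triangleleft> a) x = \<phi> (a x)\<close>.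
\<close>

definition dual_module :: "('k::field, 'a, 'b) module_scheme \<Rightarrow> ('a, 'a \<Rightarrow> 'k) rmodule" where
  "dual_module A =
    \<lparr>carrier = {\<phi> \<in> extensional (carrier A).
       (\<forall>x \<in> carrier A. \<forall>y \<in> carrier A. \<phi> (x \<oplus>\<^bsub>A\<^esub> y) = \<phi> x + \<phi> y) \<and>
       (\<forall>c. \<forall>x \<in> carrier A. \<phi> (c \<odot>\<^bsub>A\<^esub> x) = c * \<phi> x)},
     mult = undefined, one = undefined,
     zero = (\<lambda>x\<in>carrier A. 0),
     add = (\<lambda>\<phi> \<psi>. \<lambda>x\<in>carrier A. \<phi> x + \<psi> x),
     ract = (\<lambda>\<phi> a. \<lambda>x\<in>carrier A. \<phi> (a \<otimes>\<^bsub>A\<^esub> x))\<rparr>"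

definition generator_cogenerator ::
    "('k::field, 'a, 'b) module_scheme \<Rightarrow> ('a, 'm, 'y) rmodule_scheme \<Rightarrow> bool" where
  "generator_cogenerator A M \<longleftrightarrow>
    fg_module A M \<and> in_add A M (direct_sum2 (regular_module A) (dual_module A))"

definition repdim :: "('k::field, 'a, 'b) module_scheme \<Rightarrow> enat" where
  "repdim A = Inf {gldim (opposite_ring (endo_ring A M)) | M :: 'a fgmod.
    generator_cogenerator A M}"

end

theory Submission
  imports Defs "HOL-Library.Function_Algebras"
begin

text \<open>
  By (S), a nonzero path is determined by its first (or last) arrow and its length, so the modules
  \<open>A\<close> and \<open>D(A)\<close> and the uniserial modules given by nonzero paths have bases on which the
  arrows act as partial injections. Let \<open>M\<close> be the sum of all of them. It is enough to approximate every
  submodule \<open>F\<close> of a power of \<open>M\<close> (all modules here are dualised to representations on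
  coefficient functions) by an object of \<open>add M\<close> whose kernel is again in \<open>add M\<close>: then second
  syzygies over \<open>End(M)\<close> have projective dimension at most one.
  The approximation is found by induction on \<open>dim F\<close>. An injective summand of \<open>F\<close> splits off.
  If \<open>F\<close> has none, every map from an injective to \<open>F\<close> kills the socle and hence factors through
  uniserials. Choosing a family of maps from uniserials to \<open>F\<close> that generates all others and has
  minimal total length forces the kernel into the socle; the remaining projective part contributes
  only radicals of projectives, which are sums of uniserials by (S).
\<close>

section \<open>Representations of a set of words\<close>

text \<open>Below, M also denotes the dualised representation with basis \<open>Bs\<close>. A
  finitely generated module over the opposite endomorphism ring is presented by a matrix M^m -> M^n,
  and its second syzygy is Hom(M, F) with F the kernel of that matrix. F itself need not lie in add
  M; a map from a power of M through which all maps M -> F factor, with kernel in add M, resolves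
  Hom(M, F) in length one, and 3 = 2 + 1. Transposing turns the opposite endomorphism ring into the
  plain endomorphism ring of a representation of the reversed quiver. Projectives and injectives
  trade places: \<open>BP\<close> will account for D(A) and \<open>BI\<close> for A. Words of length
  zero put the simple modules into M, so a semisimple kernel is harmless. Injectives are the
  obstacle, as they need not be uniserial; but their socle is simple, so a map not killing it is an
  embedding. (S) makes words with equal first letter comparable as prefixes, which splits radicals
  of projectives, and words with equal last letter comparable as suffixes, which splits injectives
  modulo socle and drives the exchange in a minimal family.\<close>

text \<open>
  \<open>BP v w\<close> is the basis element \<open>w\<close> of the projective at \<open>v\<close>, \<open>BI u w\<close> the basis element dual to \<open>w\<close>
  of the injective at \<open>u\<close>, and \<open>BU v w i\<close> the \<open>i\<close>-th basis element of the uniserial of the word \<open>w\<close>.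
\<close>

datatype ('v, 'e) node = BP 'v "'e list" | BI 'v "'e list" | BU 'v "'e list" nat

text \<open>The first index of a vector numbers the copies in a power of M, the second is a basis
  node. All powers of M and their subrepresentations thus live in one ambient vector space.\<close>

definition sc :: "'k::field \<Rightarrow> (nat \<Rightarrow> 'b \<Rightarrow> 'k) \<Rightarrow> nat \<Rightarrow> 'b \<Rightarrow> 'k" where
  "sc c y = (\<lambda>l \<beta>. c * y l \<beta>)"

lemma sc_apply [simp]: "sc c y l \<beta> = c * y l \<beta>"
  by (simp add: sc_def)

global_interpretation V: vector_space "sc :: 'k::field \<Rightarrow> (nat \<Rightarrow> 'b \<Rightarrow> 'k) \<Rightarrow> nat \<Rightarrow> 'b \<Rightarrow> 'k"
  by unfold_locales (auto simp: fun_eq_iff algebra_simps)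

lemma sum_fun_apply2: "(\<Sum>i\<in>S. f i) x = (\<Sum>i\<in>S. f i x)"
  for f :: "'i \<Rightarrow> 'a \<Rightarrow> 'c::comm_monoid_add"
  by (induction S rule: infinite_finite_induct) auto

lemma diff_fun_apply2 [simp]: "(f - g) x = f x - g x" for f g :: "'a \<Rightarrow> 'c::minus"
  by (simp add: fun_diff_def)

definition un :: "nat \<Rightarrow> 'b \<Rightarrow> nat \<Rightarrow> 'b \<Rightarrow> 'k::field" where
  "un l \<beta> = (\<lambda>l' \<beta>'. if l' = l \<and> \<beta>' = \<beta> then 1 else 0)"

text \<open>This is what remains of the algebra: \<open>W\<close> stands for the nonzero words,
  closed under factors. \<open>fin_W\<close> is the trace of admissibility, and
  \<open>W_right\<close> and \<open>W_left\<close> are the two halves of (S).\<close>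

locale words =
  fixes Vs :: "'v set" and As :: "'e set" and src tgt :: "'e \<Rightarrow> 'v" and W :: "'e list set"
  assumes fin_Vs: "finite Vs" and fin_As: "finite As" and fin_W: "finite W"
    and src_in: "a \<in> As \<Longrightarrow> src a \<in> Vs" and tgt_in: "a \<in> As \<Longrightarrow> tgt a \<in> Vs"
    and Nil_W: "[] \<in> W" and single_W: "a \<in> As \<Longrightarrow> [a] \<in> W"
    and W_set: "w \<in> W \<Longrightarrow> set w \<subseteq> As"
    and W_append: "u @ w \<in> W \<Longrightarrow> u \<in> W \<and> w \<in> W"
    and W_comp: "[a, b] \<in> W \<Longrightarrow> tgt a = src b"
    and W_right: "[a, b] \<in> W \<Longrightarrow> [a, c] \<in> W \<Longrightarrow> b = c"
    and W_left: "[a, c] \<in> W \<Longrightarrow> [b, c] \<in> W \<Longrightarrow> a = b"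
begin

lemma W_prefix: "u @ w \<in> W \<Longrightarrow> u \<in> W" and W_suffix: "u @ w \<in> W \<Longrightarrow> w \<in> W"
  using W_append by blast+

lemma W_nth2: assumes "w \<in> W" "Suc i < length w" shows "[w!i, w!(Suc i)] \<in> W"
proof -
  have "w = take i w @ [w!i, w!(Suc i)] @ drop (Suc (Suc i)) w"
    using assms(2) by (metis Cons_nth_drop_Suc Suc_lessD append_Cons append_Nil append_take_drop_id)
  then show ?thesis using assms(1) W_prefix W_suffix by metis
qed

text \<open>By \<open>W_right\<close> each letter fixes its successor, so a word is read off from
  its first letter and its length.\<close>

lemma prefix_comparable_Cons:
  "c # u \<in> W \<Longrightarrow> c # w \<in> W \<Longrightarrow> length u \<le> length w \<Longrightarrow> \<exists>r. w = u @ r"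
proof (induction u arbitrary: c w)
  case (Cons a u)
  then obtain b w' where w: "w = b # w'" by (cases w) auto
  have "[c, a] \<in> W" "[c, b] \<in> W"
    using Cons.prems W_prefix[of "[c, a]" u] W_prefix[of "[c, b]" w'] w by auto
  then have "a = b" by (rule W_right)
  moreover have "a # u \<in> W" "b # w' \<in> W"
    using Cons.prems W_suffix[of "[c]"] w by auto
  ultimately show ?case using Cons.IH[of a w'] Cons.prems(3) w by auto
qed simp

lemma suffix_comparable_snoc:
  "u @ [c] \<in> W \<Longrightarrow> w @ [c] \<in> W \<Longrightarrow> length u \<le> length w \<Longrightarrow> \<exists>q. w = q @ u"
proof (induction u arbitrary: c w rule: rev_induct)
  case (snoc a u)
  then obtain b w' where w: "w = w' @ [b]" by (cases w rule: rev_cases) auto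
  have "[a, c] \<in> W" "[b, c] \<in> W"
    using snoc.prems W_suffix[of u "[a, c]"] W_suffix[of w' "[b, c]"] w by auto
  then have "a = b" by (rule W_left)
  moreover have "u @ [a] \<in> W" "w' @ [b] \<in> W"
    using snoc.prems W_prefix[of _ "[c]"] w by auto
  ultimately show ?case using snoc.IH[of a w'] snoc.prems(3) w by auto
qed simp

lemma prefix_comparable:
  assumes "u \<in> W" "w \<in> W" "u \<noteq> []" "w \<noteq> []" "hd u = hd w" "length u \<le> length w"
  shows "\<exists>r. w = u @ r"
  using assms prefix_comparable_Cons[of "hd u" "tl u" "tl w"] by (cases u; cases w) auto

lemma suffix_comparable:
  assumes "u \<in> W" "w \<in> W" "u \<noteq> []" "w \<noteq> []" "last u = last w" "length u \<le> length w"
  shows "\<exists>q. w = q @ u"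
  using assms suffix_comparable_snoc[of "butlast u" "last u" "butlast w"]
  by (cases u rule: rev_cases; cases w rule: rev_cases) auto

text \<open>The vertex is carried along because the empty word does not determine one.
  \<open>ok\<close> anchors a word at its start, \<open>eok\<close> at its end.\<close>

definition ok :: "'v \<Rightarrow> 'e list \<Rightarrow> bool" where
  "ok v w \<longleftrightarrow> v \<in> Vs \<and> w \<in> W \<and> (w \<noteq> [] \<longrightarrow> src (hd w) = v)"

definition eok :: "'v \<Rightarrow> 'e list \<Rightarrow> bool" where
  "eok u w \<longleftrightarrow> u \<in> Vs \<and> w \<in> W \<and> (w \<noteq> [] \<longrightarrow> tgt (last w) = u)"

definition Bs :: "('v, 'e) node set" where
  "Bs = {BP v w | v w. ok v w} \<union> {BI u w | u w. eok u w} \<union> {BU v w i | v w i. ok v w \<and> i \<le> length w}"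

lemma Bs_simps [simp]:
  "BP v w \<in> Bs \<longleftrightarrow> ok v w" "BI u w \<in> Bs \<longleftrightarrow> eok u w" "BU v w i \<in> Bs \<longleftrightarrow> ok v w \<and> i \<le> length w"
  by (auto simp: Bs_def)

fun vt :: "('v, 'e) node \<Rightarrow> 'v" where
  "vt (BP v w) = (if w = [] then v else tgt (last w))"
| "vt (BI u w) = (if w = [] then u else src (hd w))"
| "vt (BU v w i) = (if i = 0 then v else tgt (w!(i - 1)))"

text \<open>\<open>None\<close> stands for zero. A projective is walked through by appending
  letters, an injective by deleting the first letter, so that \<open>BI u []\<close> spans its
  socle.\<close>

fun lst :: "'e \<Rightarrow> ('v, 'e) node \<Rightarrow> ('v, 'e) node option" where
  "lst a (BP v w) = (if ok v (w @ [a]) then Some (BP v (w @ [a])) else None)"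
| "lst a (BI u w) = (if w \<noteq> [] \<and> hd w = a then Some (BI u (tl w)) else None)"
| "lst a (BU v w i) = (if i < length w \<and> w!i = a then Some (BU v w (Suc i)) else None)"

fun rst :: "'e \<Rightarrow> ('v, 'e) node \<Rightarrow> ('v, 'e) node option" where
  "rst a (BP v w) = (if w \<noteq> [] \<and> last w = a then Some (BP v (butlast w)) else None)"
| "rst a (BI u w) = (if eok u (a # w) then Some (BI u (a # w)) else None)"
| "rst a (BU v w i) = (if 0 < i \<and> i \<le> length w \<and> w!(i - 1) = a then Some (BU v w (i - 1)) else None)"

lemma ok_butlast: "ok v w \<Longrightarrow> ok v (butlast w)"
  unfolding ok_def
  by (metis W_prefix append_butlast_last_id butlast.simps(1) hd_append2)

lemma eok_tl: "eok u w \<Longrightarrow> eok u (tl w)"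
  unfolding eok_def
  by (metis W_suffix append_Cons append_Nil hd_Cons_tl last_tl list.sel(2))

lemma lst_Bs: "\<beta> \<in> Bs \<Longrightarrow> lst a \<beta> = Some \<gamma> \<Longrightarrow> \<gamma> \<in> Bs"
  by (cases \<beta>) (auto split: if_splits simp: eok_tl)

lemma rst_Bs: "\<gamma> \<in> Bs \<Longrightarrow> rst a \<gamma> = Some \<beta> \<Longrightarrow> \<beta> \<in> Bs"
  by (cases \<gamma>) (auto split: if_splits simp: ok_butlast)

lemma lst_iff_rst: "\<beta> \<in> Bs \<Longrightarrow> \<gamma> \<in> Bs \<Longrightarrow> lst a \<beta> = Some \<gamma> \<longleftrightarrow> rst a \<gamma> = Some \<beta>"
  by (cases \<beta>; cases \<gamma>) (auto split: if_splits simp: butlast_append dest: arg_cong[of _ _ butlast] arg_cong[of _ _ tl])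

lemma lst_As: "\<beta> \<in> Bs \<Longrightarrow> lst a \<beta> = Some \<gamma> \<Longrightarrow> a \<in> As"
proof (cases \<beta>)
  case (BP v w) assume "lst a \<beta> = Some \<gamma>"
  with BP have "w @ [a] \<in> W" by (auto split: if_splits simp: ok_def)
  then show ?thesis using W_set by fastforce
next
  case (BI v w) assume "lst a \<beta> = Some \<gamma>" "\<beta> \<in> Bs"
  with BI have "w \<in> W" "a \<in> set w" by (auto split: if_splits simp: eok_def)
  then show ?thesis using W_set by fastforce
next
  case (BU v w i) assume "lst a \<beta> = Some \<gamma>" "\<beta> \<in> Bs"
  with BU have "w \<in> W" "a \<in> set w" by (auto split: if_splits simp: ok_def)
  then show ?thesis using W_set by fastforce
qed

lemma src_lst: "\<beta> \<in> Bs \<Longrightarrow> lst a \<beta> = Some \<gamma> \<Longrightarrow> src a = vt \<beta>"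
proof (cases \<beta>)
  case (BP v w) assume "lst a \<beta> = Some \<gamma>"
  with BP have *: "ok v (w @ [a])" by (auto split: if_splits)
  show ?thesis
  proof (cases w rule: rev_cases)
    case (snoc w' b)
    then have "[b, a] \<in> W" using * W_suffix[of w' "[b,a]"] by (simp add: ok_def)
    then show ?thesis using BP snoc W_comp by auto
  qed (use BP * in \<open>auto simp: ok_def\<close>)
next
  case (BU v w i) assume "lst a \<beta> = Some \<gamma>" "\<beta> \<in> Bs"
  with BU have *: "ok v w" "i < length w" "w!i = a" by (auto split: if_splits)
  show ?thesis
  proof (cases i)
    case 0 then show ?thesis using BU * by (auto simp: ok_def hd_conv_nth)
  next
    case (Suc j)
    then have "[w!j, a] \<in> W" using W_nth2[of w j] * by (auto simp: ok_def)
    then show ?thesis using BU Suc W_comp by auto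
  qed
qed (auto split: if_splits)

lemma tgt_lst: "\<beta> \<in> Bs \<Longrightarrow> lst a \<beta> = Some \<gamma> \<Longrightarrow> vt \<gamma> = tgt a"
proof (cases \<beta>)
  case (BI u w) assume "lst a \<beta> = Some \<gamma>" "\<beta> \<in> Bs"
  with BI have *: "eok u w" "w \<noteq> []" "hd w = a" "\<gamma> = BI u (tl w)" by (auto split: if_splits)
  show ?thesis
  proof (cases "tl w")
    case (Cons b w')
    then have "w = [a, b] @ w'" using * by (metis append_Cons append_Nil list.collapse)
    then have "[a, b] \<in> W" using * W_prefix[of "[a,b]"] by (auto simp: eok_def)
    then show ?thesis using * Cons W_comp by auto
  next
    case Nil
    then have "w = [a]" using * by (metis list.collapse)
    then show ?thesis using * by (auto simp: eok_def)
  qed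
qed (auto split: if_splits)

lemma vt_Vs: "\<beta> \<in> Bs \<Longrightarrow> vt \<beta> \<in> Vs"
proof (cases \<beta>)
  case (BP v w) assume "\<beta> \<in> Bs"
  with BP have "ok v w" by auto
  then have "w \<noteq> [] \<Longrightarrow> last w \<in> As" using W_set unfolding ok_def by (meson last_in_set subsetD)
  then show ?thesis using BP \<open>ok v w\<close> tgt_in by (auto simp: ok_def)
next
  case (BI v w) assume "\<beta> \<in> Bs"
  with BI have "eok v w" by auto
  then have "w \<noteq> [] \<Longrightarrow> hd w \<in> As" using W_set unfolding eok_def by (meson list.set_sel(1) subsetD)
  then show ?thesis using BI \<open>eok v w\<close> src_in by (auto simp: eok_def)
next
  case (BU v w i) assume "\<beta> \<in> Bs"
  with BU have "ok v w" "i \<le> length w" by auto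
  then have "i > 0 \<Longrightarrow> w!(i-1) \<in> As" using W_set unfolding ok_def
    by (meson nth_mem subsetD diff_less less_le_trans zero_less_one)
  then show ?thesis using BU \<open>ok v w\<close> tgt_in by (auto simp: ok_def)
qed

lemma fin_Bs: "finite Bs"
proof -
  have "finite (BP ` fst ` (Vs \<times> W) )" using fin_Vs fin_W by auto
  let ?N = "Max (length ` W)"
  have "w \<in> W \<Longrightarrow> length w \<le> ?N" for w using fin_W by auto
  then have "Bs \<subseteq> (\<lambda>(v,w). BP v w) ` (Vs \<times> W) \<union> (\<lambda>(v,w). BI v w) ` (Vs \<times> W)
      \<union> (\<lambda>(v,w,i). BU v w i) ` (Vs \<times> W \<times> {..?N})"
    by (fastforce simp: Bs_def ok_def eok_def image_iff intro: le_trans)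
  then show ?thesis using fin_Vs fin_W by (meson finite_SigmaI finite_UnI finite_atMost finite_imageI finite_subset)
qed

definition ea :: "'v \<Rightarrow> (('v,'e) node \<Rightarrow> 'k::field) \<Rightarrow> ('v,'e) node \<Rightarrow> 'k" where
  "ea v x = (\<lambda>\<beta>. if vt \<beta> = v then x \<beta> else 0)"

text \<open>The linear extension of \<open>lst a\<close>: as \<open>lst a\<close> is injective where
  it is defined, the coefficient at a node is that of its only possible predecessor, given by
  \<open>rst a\<close>.\<close>

definition la :: "'e \<Rightarrow> (('v,'e) node \<Rightarrow> 'k::field) \<Rightarrow> ('v,'e) node \<Rightarrow> 'k" where
  "la a x = (\<lambda>\<beta>. if \<beta> \<in> Bs then case rst a \<beta> of None \<Rightarrow> 0 | Some \<beta>' \<Rightarrow> x \<beta>' else 0)"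

definition E :: "'v \<Rightarrow> (nat \<Rightarrow> ('v,'e) node \<Rightarrow> 'k::field) \<Rightarrow> nat \<Rightarrow> ('v,'e) node \<Rightarrow> 'k" where
  "E v y = (\<lambda>l. ea v (y l))"

definition L :: "'e \<Rightarrow> (nat \<Rightarrow> ('v,'e) node \<Rightarrow> 'k::field) \<Rightarrow> nat \<Rightarrow> ('v,'e) node \<Rightarrow> 'k" where
  "L a y = (\<lambda>l. la a (y l))"

lemma linear_E: "Vector_Spaces.linear sc sc (E v)"
  by unfold_locales (auto simp: E_def ea_def fun_eq_iff)

lemma linear_L: "Vector_Spaces.linear sc sc (L a)"
  by unfold_locales (auto simp: L_def la_def fun_eq_iff split: option.splits)

interpretation E: Vector_Spaces.linear sc sc "E v" for v by (rule linear_E)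
interpretation L: Vector_Spaces.linear sc sc "L a" for a by (rule linear_L)

abbreviation wact where "wact w y \<equiv> fold L w y"

lemma linear_wact: "Vector_Spaces.linear sc sc (fold L w)"
proof (induction w rule: rev_induct)
  case Nil
  show ?case by (simp only: fold.simps id_def V.linear_ident)
next
  case (snoc a w)
  have "fold L (w @ [a]) = L a \<circ> fold L w" by auto
  then show ?case using Vector_Spaces.linear_compose[OF snoc linear_L] by metis
qed

text \<open>The power M^m, as the vectors supported on the first \<open>m\<close> copies of the
  basis.\<close>

definition Sup :: "nat \<Rightarrow> (nat \<Rightarrow> ('v,'e) node \<Rightarrow> 'k::field) set" where
  "Sup m = {y. \<forall>l \<beta>. y l \<beta> \<noteq> 0 \<longrightarrow> l < m \<and> \<beta> \<in> Bs}"

lemma L_un: "\<beta> \<in> Bs \<Longrightarrow> L a (un l \<beta>) = (case lst a \<beta> of None \<Rightarrow> 0 | Some \<gamma> \<Rightarrow> un l \<gamma>)"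
  by (auto simp: L_def la_def un_def fun_eq_iff split: option.splits)
    (metis lst_Bs lst_iff_rst rst_Bs option.inject option.distinct(1))+

lemma E_un: "E v (un l \<beta>) = (if vt \<beta> = v then un l \<beta> else 0)"
  by (auto simp: E_def ea_def un_def fun_eq_iff)

lemma L_E: "y \<in> Sup m \<Longrightarrow> L a (E v y) = (if src a = v then L a y else 0)"
  by (auto simp: L_def la_def E_def ea_def fun_eq_iff split: option.splits dest: src_lst)
    (metis lst_iff_rst rst_Bs src_lst)+

lemma E_L: "E v (L a y) = (if tgt a = v then L a y else 0)"
  by (auto simp: L_def la_def E_def ea_def fun_eq_iff split: option.splits)
    (metis lst_iff_rst rst_Bs tgt_lst)+

lemma E_E: "E v (E w y) = (if v = w then E v y else 0)"
  by (auto simp: E_def ea_def fun_eq_iff)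

lemma sum_E: "y \<in> Sup m \<Longrightarrow> (\<Sum>v\<in>Vs. E v y) = y"
  by (auto simp: Sup_def E_def ea_def fun_eq_iff sum_fun_apply2 fin_Vs)
    (metis vt_Vs)

lemma un_Sup: "l < m \<Longrightarrow> \<beta> \<in> Bs \<Longrightarrow> un l \<beta> \<in> Sup m"
  by (auto simp: un_def Sup_def split: if_splits)

lemma Sup_expand: "y \<in> Sup m \<Longrightarrow> y = (\<Sum>l<m. \<Sum>\<beta>\<in>Bs. sc (y l \<beta>) (un l \<beta>))"
proof (intro ext)
  fix l \<beta> assume y: "y \<in> Sup m"
  have "(\<Sum>l'<m. \<Sum>\<beta>'\<in>Bs. sc (y l' \<beta>') (un l' \<beta>')) l \<beta>
     = (\<Sum>l'<m. \<Sum>\<beta>'\<in>Bs. if l' = l then if \<beta>' = \<beta> then y l \<beta> else 0 else 0)"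
    unfolding sum_fun_apply2 by (intro sum.cong) (auto simp: un_def)
  also have "\<dots> = (\<Sum>l'<m. if l' = l then (\<Sum>\<beta>'\<in>Bs. if \<beta>' = \<beta> then y l \<beta> else 0) else 0)"
    by (intro sum.cong) auto
  also have "\<dots> = y l \<beta>" using y fin_Bs by (auto simp: Sup_def)
  finally show "y l \<beta> = (\<Sum>l'<m. \<Sum>\<beta>'\<in>Bs. sc (y l' \<beta>') (un l' \<beta>')) l \<beta>" by simp
qed

definition lsts :: "'e list \<Rightarrow> ('v,'e) node \<Rightarrow> ('v,'e) node option" where
  "lsts w \<beta> = fold (\<lambda>a x. Option.bind x (lst a)) w (Some \<beta>)"

lemma lsts_Nil [simp]: "lsts [] \<beta> = Some \<beta>" by (simp add: lsts_def)
lemma lsts_snoc: "lsts (w @ [a]) \<beta> = Option.bind (lsts w \<beta>) (lst a)" by (simp add: lsts_def)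
lemma lsts_append: "lsts (u @ w) \<beta> = Option.bind (lsts u \<beta>) (lsts w)"
proof (induction w rule: rev_induct)
  case (snoc a w)
  have "lsts (u @ w @ [a]) \<beta> = Option.bind (lsts (u @ w) \<beta>) (lst a)"
    using lsts_snoc[of "u @ w" a \<beta>] by simp
  then show ?case by (simp add: snoc lsts_snoc)
qed simp

lemma lsts_Bs: "\<beta> \<in> Bs \<Longrightarrow> lsts w \<beta> = Some \<gamma> \<Longrightarrow> \<gamma> \<in> Bs"
  by (induction w arbitrary: \<gamma> rule: rev_induct) (auto simp: lsts_snoc bind_eq_Some_conv dest: lst_Bs)

lemma wact_un: "\<beta> \<in> Bs \<Longrightarrow> wact w (un l \<beta>) = (case lsts w \<beta> of None \<Rightarrow> 0 | Some \<gamma> \<Rightarrow> un l \<gamma>)"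
  by (induction w rule: rev_induct) (auto simp: lsts_snoc L_un lsts_Bs split: option.splits bind_splits)

lemma lsts_BP: "ok v u \<Longrightarrow> lsts w (BP v u) = (if ok v (u @ w) then Some (BP v (u @ w)) else None)"
proof (induction w rule: rev_induct)
  case (snoc a w)
  have "ok v (u @ w @ [a]) \<Longrightarrow> ok v (u @ w)" using ok_butlast[of v "u @ w @ [a]"] by (simp add: butlast_append)
  then show ?case using snoc by (auto simp: lsts_snoc)
qed simp

lemma lsts_BI: "lsts w (BI v u) = (if \<exists>r. u = w @ r then Some (BI v (drop (length w) u)) else None)"
proof (induction w rule: rev_induct)
  case (snoc a w)
  then show ?case by (auto simp: lsts_snoc neq_Nil_conv hd_append)
qed simp

lemma lsts_BU: "i \<le> length u \<Longrightarrow> lsts w (BU v u i) =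
  (if \<exists>r. drop i u = w @ r then Some (BU v u (i + length w)) else None)"
proof (induction w rule: rev_induct)
  case (snoc a w)
  show ?case
  proof (cases "\<exists>r. drop i u = w @ r")
    case True
    then obtain r where r: "drop i u = w @ r" by blast
    then have "drop (i + length w) u = r" by (metis add.commute append_eq_conv_conj drop_drop)
    moreover have "i + length w < length u \<longleftrightarrow> r \<noteq> []" using calculation by auto
    moreover have "i + length w < length u \<Longrightarrow> u!(i + length w) = hd r" using calculation(1) by (simp add: hd_drop_conv_nth[symmetric])
    ultimately show ?thesis using snoc r by (auto simp: lsts_snoc neq_Nil_conv)
  qed (use snoc in \<open>auto simp: lsts_snoc\<close>)
qed simp

text \<open>In each of the three kinds of module, letters that act one after the other without
  giving zero form a factor of a word in \<open>W\<close>. Hence words outside \<open>W\<close>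
  annihilate every power of M, see \<open>wact_zero\<close>.\<close>

lemma lsts_W: assumes "\<beta> \<in> Bs" "lsts w \<beta> = Some \<gamma>" shows "w \<in> W"
proof (cases \<beta>)
  case (BP v u)
  then show ?thesis using assms lsts_BP[of v u w] by (auto split: if_splits simp: ok_def dest: W_suffix)
next
  case (BI v u)
  then show ?thesis using assms lsts_BI[of w v u] by (auto split: if_splits simp: eok_def dest: W_prefix)
next
  case (BU v u i)
  then obtain r where "drop i u = w @ r" using assms lsts_BU[of i u w v] by (auto split: if_splits)
  then have "u = take i u @ w @ r" by (metis append_take_drop_id)
  then show ?thesis using assms(1) BU by (metis Bs_simps(3) W_prefix W_suffix ok_def)
qed

lemma wact_zero: assumes "y \<in> Sup m" "w \<notin> W" shows "wact w y = 0"
proof -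
  interpret w: Vector_Spaces.linear sc sc "fold L w" by (rule linear_wact)
  have "lsts w \<beta> = None" if "\<beta> \<in> Bs" for \<beta> using lsts_W that assms(2) by (metis not_Some_eq)
  then show ?thesis
    by (subst Sup_expand[OF assms(1)]) (simp add: w.sum w.scale wact_un)
qed

lemma L_zero: "y \<in> Sup m \<Longrightarrow> a \<notin> As \<Longrightarrow> L a y = 0"
  using wact_zero[of y m "[a]"] W_set[of "[a]"] by auto

lemma L_Sup: "y \<in> Sup m \<Longrightarrow> L a y \<in> Sup m"
  by (auto simp: Sup_def L_def la_def split: option.splits if_splits)

lemma E_Sup: "y \<in> Sup m \<Longrightarrow> E a y \<in> Sup m"
  by (auto simp: Sup_def E_def ea_def split: option.splits if_splits)

lemma subspace_Sup: "V.subspace (Sup m)"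
  by (auto simp: V.subspace_def Sup_def) (metis add.right_neutral)+

lemma Sup_finite_span:
  "\<exists>S :: (nat \<Rightarrow> ('v,'e) node \<Rightarrow> 'k::field) set. finite S \<and> Sup m \<subseteq> V.span S"
proof (intro exI conjI subsetI)
  let ?S = "(\<lambda>(l,\<beta>). un l \<beta> :: nat \<Rightarrow> ('v,'e) node \<Rightarrow> 'k) ` ({..<m} \<times> Bs)"
  show "finite ?S" using fin_Bs by auto
  fix y :: "nat \<Rightarrow> ('v,'e) node \<Rightarrow> 'k" assume "y \<in> Sup m"
  then have "y = (\<Sum>l<m. \<Sum>\<beta>\<in>Bs. sc (y l \<beta>) (un l \<beta>))" by (rule Sup_expand)
  also have "\<dots> \<in> V.span ?S"
    by (intro V.span_sum V.span_scale V.span_base) auto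
  finally show "y \<in> V.span ?S" .
qed

end

section \<open>Maps out of M, maps into M, and retracts of powers of M\<close>

context words
begin

interpretation E: Vector_Spaces.linear sc sc "E v" for v by (rule linear_E)
interpretation L: Vector_Spaces.linear sc sc "L a" for a by (rule linear_L)
interpretation wact: Vector_Spaces.linear sc sc "fold L w" for w by (rule linear_wact)

lemma lst_rst: "\<beta> \<in> Bs \<Longrightarrow> lst a \<beta> = Some \<gamma> \<Longrightarrow> rst a \<gamma> = Some \<beta>"
  using lst_iff_rst lst_Bs by blast

lemma rst_lst: "\<gamma> \<in> Bs \<Longrightarrow> rst a \<gamma> = Some \<beta> \<Longrightarrow> lst a \<beta> = Some \<gamma>"
  using lst_iff_rst rst_Bs by blast

lemma L_zero_arg [simp]: "L a 0 = 0" and E_zero_arg [simp]: "E v 0 = 0" and wact_zero_arg [simp]: "fold L w 0 = 0"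
  by (rule L.zero E.zero wact.zero)+

definition subrep :: "nat \<Rightarrow> (nat \<Rightarrow> ('v,'e) node \<Rightarrow> 'k::field) set \<Rightarrow> bool" where
  "subrep m F \<longleftrightarrow> F \<subseteq> Sup m \<and> V.subspace F \<and> (\<forall>y\<in>F. (\<forall>v. E v y \<in> F) \<and> (\<forall>a. L a y \<in> F))"

lemma subrepD:
  assumes "subrep m F"
  shows "F \<subseteq> Sup m" "V.subspace F" "y \<in> F \<Longrightarrow> E v y \<in> F" "y \<in> F \<Longrightarrow> L a y \<in> F" "y \<in> F \<Longrightarrow> fold L w y \<in> F"
proof -
  show "y \<in> F \<Longrightarrow> fold L w y \<in> F"
    using assms by (induction w rule: rev_induct) (auto simp: subrep_def)
qed (use assms in \<open>auto simp: subrep_def\<close>)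

lemma subrep_Sup: "subrep m (Sup m)"
  by (auto simp: subrep_def subspace_Sup L_Sup E_Sup)

text \<open>A map of representations, given on basis nodes. The domain \<open>D\<close> may be a
  part of the basis because the splitting argument starts from a map defined on a single injective
  summand.\<close>

definition hm :: "('v,'e) node set \<Rightarrow> (nat \<Rightarrow> ('v,'e) node \<Rightarrow> 'k::field) set
    \<Rightarrow> (('v,'e) node \<Rightarrow> nat \<Rightarrow> ('v,'e) node \<Rightarrow> 'k) \<Rightarrow> bool" where
  "hm D F h \<longleftrightarrow> (\<forall>\<beta>\<in>D. h \<beta> \<in> F \<and> E (vt \<beta>) (h \<beta>) = h \<beta> \<and>
     (\<forall>a. L a (h \<beta>) = (case lst a \<beta> of None \<Rightarrow> 0 | Some \<gamma> \<Rightarrow> h \<gamma>)))"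

definition ex :: "(('v,'e) node \<Rightarrow> nat \<Rightarrow> ('v,'e) node \<Rightarrow> 'k::field) \<Rightarrow> (('v,'e) node \<Rightarrow> 'k) \<Rightarrow> nat \<Rightarrow> ('v,'e) node \<Rightarrow> 'k" where
  "ex h x = (\<Sum>\<beta>\<in>Bs. sc (x \<beta>) (h \<beta>))"

lemma ex_add: "ex h (x + x') = ex h x + ex h x'"
  by (simp add: ex_def V.scale_left_distrib sum.distrib)

lemma ex_scale: "ex h (\<lambda>\<beta>. c * x \<beta>) = sc c (ex h x)"
  by (simp add: ex_def V.scale_sum_right)

lemma ex_in: "V.subspace F \<Longrightarrow> (\<And>\<beta>. \<beta> \<in> Bs \<Longrightarrow> h \<beta> \<in> F) \<Longrightarrow> ex h x \<in> F"
  unfolding ex_def by (intro V.subspace_sum V.subspace_scale) auto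

lemma ex_ea: assumes "hm Bs F h" shows "ex h (ea v x) = E v (ex h x)"
proof -
  have "E v (h \<beta>) = (if vt \<beta> = v then h \<beta> else 0)" if "\<beta> \<in> Bs" for \<beta>
    using assms that E_E[of v "vt \<beta>" "h \<beta>"] by (auto simp: hm_def)
  then have "E v (ex h x) = (\<Sum>\<beta>\<in>Bs. sc (x \<beta>) (if vt \<beta> = v then h \<beta> else 0))"
    by (simp add: ex_def E.sum E.scale)
  also have "\<dots> = ex h (ea v x)" unfolding ex_def by (intro sum.cong) (auto simp: ea_def)
  finally show ?thesis by simp
qed

text \<open>\<open>lst a\<close> is a bijection from its domain onto the domain of
  \<open>rst a\<close>, so the sum over sources can be reindexed as a sum over targets.\<close>

lemma ex_la: assumes "hm Bs F h" shows "ex h (la a x) = L a (ex h x)"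
proof -
  let ?D = "{\<beta>\<in>Bs. lst a \<beta> \<noteq> None}" and ?R = "{\<gamma>\<in>Bs. rst a \<gamma> \<noteq> None}"
  have "L a (ex h x) = (\<Sum>\<beta>\<in>Bs. sc (x \<beta>) (case lst a \<beta> of None \<Rightarrow> 0 | Some \<gamma> \<Rightarrow> h \<gamma>))"
    using assms by (simp add: ex_def L.sum L.scale hm_def)
  also have "\<dots> = (\<Sum>\<beta>\<in>?D. sc (x \<beta>) (h (the (lst a \<beta>))))"
    using fin_Bs by (intro sum.mono_neutral_cong_right) (auto split: option.splits)
  also have "\<dots> = (\<Sum>\<gamma>\<in>?R. sc (la a x \<gamma>) (h \<gamma>))"
    by (rule sum.reindex_bij_witness[where j = "\<lambda>\<beta>. the (lst a \<beta>)" and i = "\<lambda>\<gamma>. the (rst a \<gamma>)"])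
      (auto dest: lst_Bs rst_Bs lst_rst rst_lst simp: la_def)
  also have "\<dots> = ex h (la a x)" unfolding ex_def
    using fin_Bs by (intro sum.mono_neutral_left) (auto simp: la_def)
  finally show ?thesis by simp
qed

text \<open>The map M^k -> F with component \<open>g l\<close> on the copy \<open>l\<close>.\<close>

definition gh :: "nat \<Rightarrow> (nat \<Rightarrow> ('v,'e) node \<Rightarrow> nat \<Rightarrow> ('v,'e) node \<Rightarrow> 'k::field)
    \<Rightarrow> (nat \<Rightarrow> ('v,'e) node \<Rightarrow> 'k) \<Rightarrow> nat \<Rightarrow> ('v,'e) node \<Rightarrow> 'k" where
  "gh k g y = (\<Sum>l<k. ex (g l) (y l))"

lemma linear_gh:
  fixes g :: "nat \<Rightarrow> ('v,'e) node \<Rightarrow> nat \<Rightarrow> ('v,'e) node \<Rightarrow> 'b::field"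
  shows "Vector_Spaces.linear sc sc (gh k g)"
proof -
  have "ex h (sc c y l) = sc c (ex h (y l))" for h :: "('v,'e) node \<Rightarrow> nat \<Rightarrow> ('v,'e) node \<Rightarrow> 'b::field" and c y l
    using ex_scale[of h c "y l"] by (simp add: sc_def)
  then show ?thesis
    by unfold_locales (simp_all only: gh_def plus_fun_apply ex_add sum.distrib V.scale_sum_right)
qed

interpretation gh: Vector_Spaces.linear sc sc "gh k g" for k g by (rule linear_gh)

lemma gh_E: "(\<And>l. l < k \<Longrightarrow> hm Bs F (g l)) \<Longrightarrow> gh k g (E v y) = E v (gh k g y)"
  unfolding gh_def E.sum by (rule sum.cong) (auto simp: E_def[of v y] ex_ea[of F])

lemma gh_L: "(\<And>l. l < k \<Longrightarrow> hm Bs F (g l)) \<Longrightarrow> gh k g (L a y) = L a (gh k g y)"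
  unfolding gh_def L.sum by (rule sum.cong) (auto simp: L_def[of a y] ex_la[of F])

lemma gh_wact: "(\<And>l. l < k \<Longrightarrow> hm Bs F (g l)) \<Longrightarrow> gh k g (fold L w y) = fold L w (gh k g y)"
  by (induction w rule: rev_induct) (auto simp: gh_L[of k F])

lemma gh_in: "V.subspace F \<Longrightarrow> (\<And>l. l < k \<Longrightarrow> hm Bs F (g l)) \<Longrightarrow> gh k g y \<in> F"
  unfolding gh_def by (intro V.subspace_sum ex_in) (auto simp: hm_def)

lemma gh_un: "l < k \<Longrightarrow> \<beta> \<in> Bs \<Longrightarrow> gh k g (un l \<beta>) = g l \<beta>"
proof -
  assume a: "l < k" "\<beta> \<in> Bs"
  have "ex (g l') (un l \<beta> l') = (if l' = l then g l \<beta> else 0)" for l'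
  proof -
    have "ex (g l') (un l \<beta> l') = (\<Sum>\<beta>'\<in>Bs. if \<beta>' = \<beta> then (if l' = l then g l \<beta> else 0) else 0)"
      unfolding ex_def by (intro sum.cong) (auto simp: un_def)
    then show ?thesis using a fin_Bs by simp
  qed
  then show ?thesis using a by (simp add: gh_def)
qed

text \<open>Maps in the other direction, from a subrepresentation to one copy of M. As
  \<open>K\<close> has no preferred basis, they are functions on vectors whose linearity is required
  on \<open>K\<close> only.\<close>

definition khom :: "(nat \<Rightarrow> ('v,'e) node \<Rightarrow> 'k::field) set \<Rightarrow> ((nat \<Rightarrow> ('v,'e) node \<Rightarrow> 'k) \<Rightarrow> ('v,'e) node \<Rightarrow> 'k) \<Rightarrow> bool" where
  "khom K i \<longleftrightarrow> (\<forall>y\<in>K. (\<forall>\<beta>. i y \<beta> \<noteq> 0 \<longrightarrow> \<beta> \<in> Bs) \<and> (\<forall>y'\<in>K. i (y + y') = i y + i y') \<and>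
     (\<forall>c. i (sc c y) = (\<lambda>\<beta>. c * i y \<beta>)) \<and> (\<forall>v. i (E v y) = ea v (i y)) \<and> (\<forall>a. i (L a y) = la a (i y)))"

text \<open>Membership in add M in dual basis form: the identity of \<open>K\<close> is a finite sum
  of maps K -> M -> K. Under Hom(M, -) this becomes the dual basis of a projective module.\<close>

definition retr :: "(nat \<Rightarrow> ('v,'e) node \<Rightarrow> 'k::field) set \<Rightarrow> bool" where
  "retr K \<longleftrightarrow> (\<exists>ps. (\<forall>(\<kappa>,i)\<in>set ps. hm Bs K \<kappa> \<and> khom K i) \<and> (\<forall>y\<in>K. y = (\<Sum>(\<kappa>,i)\<leftarrow>ps. ex \<kappa> (i y))))"

lemma hm_mono: "hm D N h \<Longrightarrow> N \<subseteq> K \<Longrightarrow> D' \<subseteq> D \<Longrightarrow> hm D' K h"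
  by (auto simp: hm_def)

text \<open>The defect, the identity minus the peeled part, is itself a map of representations from
  \<open>K\<close> to \<open>N\<close>. Composing it with a dual basis of \<open>N\<close> and
  adding the peeled maps gives a dual basis of \<open>K\<close>.\<close>

lemma retr_peel:
  assumes K: "subrep m K" and S: "finite S" and \<kappa>: "\<And>s. s \<in> S \<Longrightarrow> hm Bs K (\<kappa> s)"
    and i: "\<And>s. s \<in> S \<Longrightarrow> khom K (i s)"
    and N: "N \<subseteq> K" and r: "\<And>y. y \<in> K \<Longrightarrow> y - (\<Sum>s\<in>S. ex (\<kappa> s) (i s y)) \<in> N"
    and retr: "retr N"
  shows "retr K"
proof -
  define p where "p y = y - (\<Sum>s\<in>S. ex (\<kappa> s) (i s y))" for y
  obtain ps where ps: "\<And>\<kappa> i. (\<kappa>,i) \<in> set ps \<Longrightarrow> hm Bs N \<kappa> \<and> khom N i"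
    "\<And>y. y \<in> N \<Longrightarrow> y = (\<Sum>(\<kappa>,i)\<leftarrow>ps. ex \<kappa> (i y))"
    using retr unfolding retr_def by fast
  obtain xs where xs: "distinct xs" "set xs = S" using S finite_distinct_list by blast
  have pN: "p y \<in> N" if "y \<in> K" for y using r that by (simp add: p_def)
  have padd: "p (y + y') = p y + p y'" if "y \<in> K" "y' \<in> K" for y y'
    using i that by (simp add: p_def khom_def ex_add sum.distrib)
  have psc: "p (sc c y) = sc c (p y)" if "y \<in> K" for c y
    using i that by (simp add: p_def khom_def ex_scale V.scale_sum_right V.scale_right_diff_distrib)
  have pE: "p (E v y) = E v (p y)" if "y \<in> K" for v y
    using i that by (simp add: p_def khom_def ex_ea[OF \<kappa>] E.diff E.sum)
  have pL: "p (L v y) = L v (p y)" if "y \<in> K" for v y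
    using i that by (simp add: p_def khom_def ex_la[OF \<kappa>] L.diff L.sum)
  have kh: "khom K (\<lambda>y. j (p y))" if "khom N j" for j
    using that pN padd psc pE pL unfolding khom_def by auto
  show ?thesis unfolding retr_def
  proof (intro exI conjI ballI)
    let ?qs = "map (\<lambda>s. (\<kappa> s, i s)) xs @ map (\<lambda>(\<kappa>,j). (\<kappa>, \<lambda>y. j (p y))) ps"
    show "case x of (\<kappa>,j) \<Rightarrow> hm Bs K \<kappa> \<and> khom K j" if "x \<in> set ?qs" for x
      using that xs(2) \<kappa> i kh ps(1) hm_mono[OF _ N order.refl] by auto
    fix y assume y: "y \<in> K"
    have "(\<Sum>(\<kappa>,j)\<leftarrow>ps. ex \<kappa> (j (p y))) = p y" using ps(2)[OF pN[OF y]] by simp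
    moreover have "(\<Sum>s\<leftarrow>xs. ex (\<kappa> s) (i s y)) = (\<Sum>s\<in>S. ex (\<kappa> s) (i s y))"
      using sum.distinct_set_conv_list[OF xs(1), of "\<lambda>s. ex (\<kappa> s) (i s y)"] xs(2) by simp
    ultimately have "(\<Sum>(\<kappa>,i)\<leftarrow>?qs. ex \<kappa> (i y)) = (\<Sum>s\<in>S. ex (\<kappa> s) (i s y)) + p y"
      by (simp add: o_def case_prod_unfold)
    then show "y = (\<Sum>(\<kappa>,i)\<leftarrow>?qs. ex \<kappa> (i y))" by (simp add: p_def)
  qed
qed

lemma retr_0: "retr {0}"
  unfolding retr_def by (rule exI[of _ "[]"]) simp

definition homU :: "'v \<Rightarrow> 'e list \<Rightarrow> (nat \<Rightarrow> ('v,'e) node \<Rightarrow> 'k::field) \<Rightarrow> ('v,'e) node \<Rightarrow> nat \<Rightarrow> ('v,'e) node \<Rightarrow> 'k" where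
  "homU v w t = (\<lambda>\<beta>. case \<beta> of BU v' w' i \<Rightarrow> if v' = v \<and> w' = w then fold L (take i w) t else 0 | _ \<Rightarrow> 0)"

definition homP :: "'v \<Rightarrow> (nat \<Rightarrow> ('v,'e) node \<Rightarrow> 'k::field) \<Rightarrow> ('v,'e) node \<Rightarrow> nat \<Rightarrow> ('v,'e) node \<Rightarrow> 'k" where
  "homP v z = (\<lambda>\<beta>. case \<beta> of BP v' w \<Rightarrow> if v' = v then fold L w z else 0 | _ \<Rightarrow> 0)"

text \<open>The relations of the top of the uniserial of \<open>w\<close> at \<open>v\<close>. By
  \<open>hm_homU\<close> and \<open>hm_value_Hs\<close> this space stands for the maps from that
  uniserial to \<open>F\<close>, each represented by the image of the top.\<close>

definition Hs :: "(nat \<Rightarrow> ('v,'e) node \<Rightarrow> 'k::field) set \<Rightarrow> 'v \<Rightarrow> 'e list \<Rightarrow> (nat \<Rightarrow> ('v,'e) node \<Rightarrow> 'k) set" where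
  "Hs F v w = {x\<in>F. E v x = x \<and> (\<forall>a. (w = [] \<or> a \<noteq> hd w) \<longrightarrow> L a x = 0) \<and> (\<forall>a. fold L (w @ [a]) x = 0)}"

text \<open>The definition of \<open>Hs\<close> controls only the two ends of \<open>w\<close>. In
  between, \<open>W_right\<close> makes every letter other than the next one leave \<open>W\<close>,
  so it acts as zero.\<close>

lemma Hs_step:
  assumes F: "F \<subseteq> Sup m" and x: "x \<in> Hs F v w" and w: "w \<in> W" and i: "i \<le> length w"
  shows "L a (fold L (take i w) x) = (if i < length w \<and> w!i = a then fold L (take (Suc i) w) x else 0)"
proof (cases "i < length w \<and> w!i = a")
  case True
  then show ?thesis by (simp add: take_Suc_conv_app_nth)
next
  case False
  have xS: "x \<in> Sup m" using x F by (auto simp: Hs_def)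
  consider "i = length w" | "i < length w" "i = 0" | j where "i < length w" "i = Suc j"
    using i by (cases i) (auto simp: le_less)
  then have "L a (fold L (take i w) x) = 0"
  proof cases
    case 1
    then show ?thesis using x by (simp add: Hs_def)
  next
    case 2
    then have "a \<noteq> hd w" using False by (auto simp: hd_conv_nth)
    then show ?thesis using x 2 by (auto simp: Hs_def)
  next
    case 3
    have "[w!j, a] \<notin> W"
      using W_nth2[OF w, of j] W_right[of "w!j" a "w!i"] 3 False by auto
    moreover have "take i w @ [a] = take j w @ [w!j, a]"
      using 3 by (simp add: take_Suc_conv_app_nth)
    ultimately have "take i w @ [a] \<notin> W" using W_suffix by metis
    then have "fold L (take i w @ [a]) x = 0" using wact_zero[OF xS] by blast
    then show ?thesis by simp
  qed
  then show ?thesis using False by (simp only: if_False)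
qed

lemma E_fold_L:
  assumes "y \<in> Sup m" "w \<noteq> []" shows "E (tgt (last w)) (fold L w y) = fold L w y"
  using assms by (cases w rule: rev_cases) (auto simp: E_L)

lemma E_take: assumes "E v x = x" "ok v w" "i \<le> length w"
  shows "E (vt (BU v w i)) (fold L (take i w) x) = fold L (take i w) x"
proof (cases i)
  case (Suc j)
  then show ?thesis using assms by (simp add: take_Suc_conv_app_nth E_L)
qed (use assms in simp)

lemma hm_homU:
  assumes F: "subrep m F" and x: "x \<in> Hs F v w"
  shows "hm Bs F (homU v w x)"
  unfolding hm_def
proof (intro ballI conjI allI)
  fix \<beta> assume b: "\<beta> \<in> Bs"
  have z: "0 \<in> F" using subrepD(2)[OF F] V.subspace_0 by blast
  have xF: "x \<in> F" "E v x = x" using x by (auto simp: Hs_def)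
  show "homU v w x \<beta> \<in> F"
    using z subrepD(5)[OF F xF(1)] by (auto simp: homU_def split: node.splits)
  show "E (vt \<beta>) (homU v w x \<beta>) = homU v w x \<beta>"
    using b E_take[OF xF(2)] by (auto simp: homU_def simp del: vt.simps split: node.splits)
  fix a
  show "L a (homU v w x \<beta>) = (case lst a \<beta> of None \<Rightarrow> 0 | Some \<gamma> \<Rightarrow> homU v w x \<gamma>)"
  proof (cases \<beta>)
    case (BU v' w' i)
    show ?thesis
    proof (cases "v' = v \<and> w' = w")
      case True
      then show ?thesis using b BU Hs_step[OF subrepD(1)[OF F] x, of i a]
        by (auto simp: homU_def ok_def)
    qed (use BU in \<open>auto simp: homU_def\<close>)
  qed (auto simp: homU_def)
qed

lemma hm_homP:
  assumes F: "subrep m F" and x: "x \<in> F" "E v x = x"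
  shows "hm Bs F (homP v x)"
  unfolding hm_def
proof (intro ballI conjI allI)
  fix \<beta> assume b: "\<beta> \<in> Bs"
  have z: "0 \<in> F" using subrepD(2)[OF F] V.subspace_0 by blast
  have xS: "x \<in> Sup m" using x subrepD(1)[OF F] by auto
  show "homP v x \<beta> \<in> F"
    using z subrepD(5)[OF F x(1)] by (auto simp: homP_def split: node.splits)
  show "E (vt \<beta>) (homP v x \<beta>) = homP v x \<beta>"
    using x(2) E_fold_L[OF xS] by (auto simp: homP_def split: node.splits)
  fix a
  show "L a (homP v x \<beta>) = (case lst a \<beta> of None \<Rightarrow> 0 | Some \<gamma> \<Rightarrow> homP v x \<gamma>)"
  proof (cases \<beta>)
    case (BP v' w)
    have "\<not> ok v (w @ [a]) \<Longrightarrow> fold L (w @ [a]) x = 0" if "v' = v"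
    proof -
      assume n: "\<not> ok v (w @ [a])"
      have ok: "ok v w" using b BP that by auto
      show "fold L (w @ [a]) x = 0"
      proof (cases "w @ [a] \<in> W")
        case True
        \<comment> \<open>If \<open>w @ [a]\<close> is a word, \<open>ok\<close> can fail only at
          its start; since \<open>ok v w\<close> holds, this forces \<open>w\<close> to be empty and
          \<open>a\<close> to leave from a vertex other than \<open>v\<close>.\<close>
        then have "w = [] \<and> src a \<noteq> v" using n ok by (cases w) (auto simp: ok_def)
        then show ?thesis using L_E[OF xS, of a v] x(2) by simp
      qed (use wact_zero[OF xS] in blast)
    qed
    then show ?thesis using BP by (auto simp: homP_def)
  qed (auto simp: homP_def)
qed

text \<open>A recipe for maps into M that read the coordinates of one copy \<open>l\<close> through
  a relabelling \<open>f\<close> of nodes. \<open>st\<close> says that the relabelling respects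
  predecessors, and \<open>out\<close> that no arrow leads out of \<open>D\<close>.\<close>

lemma khom_coord:
  assumes K: "\<And>y \<beta>. y \<in> K \<Longrightarrow> i y \<beta> = (if \<beta> \<in> D then y l (f \<beta>) else 0)" and D: "D \<subseteq> Bs" 
    and vt: "\<And>\<beta>. \<beta> \<in> D \<Longrightarrow> vt (f \<beta>) = vt \<beta>" and fD: "\<And>\<beta>. \<beta> \<in> D \<Longrightarrow> f \<beta> \<in> Bs"
    and K': "V.subspace K" "\<And>y v. y \<in> K \<Longrightarrow> E v y \<in> K" "\<And>y v. y \<in> K \<Longrightarrow> L v y \<in> K"
    and st: "\<And>y \<beta> a. y \<in> K \<Longrightarrow> \<beta> \<in> D \<Longrightarrow> (case rst a (f \<beta>) of None \<Rightarrow> 0 | Some \<gamma> \<Rightarrow> y l \<gamma>) =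
       (case rst a \<beta> of None \<Rightarrow> 0 | Some \<gamma> \<Rightarrow> i y \<gamma>)"
    and out: "\<And>y \<beta> a \<gamma>. y \<in> K \<Longrightarrow> \<beta> \<in> Bs \<Longrightarrow> \<beta> \<notin> D \<Longrightarrow> rst a \<beta> = Some \<gamma> \<Longrightarrow> \<gamma> \<notin> D"
  shows "khom K i"
  unfolding khom_def
proof (intro ballI conjI allI impI)
  fix y assume y: "y \<in> K"
  show "i y \<beta> \<noteq> 0 \<Longrightarrow> \<beta> \<in> Bs" for \<beta> using K[OF y] D by (auto split: if_splits)
  show "i (y + y') = i y + i y'" if "y' \<in> K" for y'
    using K y that K'(1) by (auto simp: fun_eq_iff V.subspace_add)
  show "i (sc c y) = (\<lambda>\<beta>. c * i y \<beta>)" for c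
    using K y K'(1) by (auto simp: fun_eq_iff V.subspace_scale)
  show "i (E v y) = ea v (i y)" for v
    using K K' y vt by (auto simp: fun_eq_iff E_def ea_def)
  show "i (L a y) = la a (i y)" for a
  proof
    fix \<beta>
    show "i (L a y) \<beta> = la a (i y) \<beta>"
    proof (cases "\<beta> \<in> D")
      case True
      then have "i (L a y) \<beta> = (case rst a (f \<beta>) of None \<Rightarrow> 0 | Some \<gamma> \<Rightarrow> y l \<gamma>)"
        using K K' y fD by (simp add: L_def la_def)
      also have "\<dots> = la a (i y) \<beta>" using st[OF y True] True D by (auto simp: la_def)
      finally show ?thesis .
    next
      case False
      then show ?thesis using K K' y out[OF y] by (auto simp: la_def split: option.splits)
    qed
  qed
qed

text \<open>The simple representation at \<open>v\<close> is the uniserial of the empty word at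
  \<open>v\<close>. Bases of the spaces \<open>NV v\<close> therefore split \<open>N\<close> into
  summands of M.\<close>

lemma retr_semisimple:
  fixes N :: "(nat \<Rightarrow> ('v,'e) node \<Rightarrow> 'k::field) set"
  assumes N: "subrep m N" and z: "\<And>a y. y \<in> N \<Longrightarrow> L a y = 0"
  shows "retr N"
proof -
  define NV where "NV v = {y\<in>N. E v y = y}" for v
  have NVs: "V.subspace (NV v)" for v
    using subrepD(2)[OF N] by (auto simp: NV_def V.subspace_def E.add E.scale)
  have "\<exists>B. B \<subseteq> NV v \<and> V.independent B \<and> NV v \<subseteq> V.span B \<and> finite B" for v
  proof -
    obtain B where B: "B \<subseteq> NV v" "V.independent B" "NV v \<subseteq> V.span B"
      by (rule V.maximal_independent_subset)
    obtain S :: "(nat \<Rightarrow> ('v,'e) node \<Rightarrow> 'k) set" where "finite S" "Sup m \<subseteq> V.span S" using Sup_finite_span by blast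
    moreover have "B \<subseteq> Sup m" using B(1) subrepD(1)[OF N] by (auto simp: NV_def)
    ultimately have "finite B" using V.independent_span_bound B(2) by blast
    then show ?thesis using B by blast
  qed
  then obtain B where B: "\<And>v. B v \<subseteq> NV v" "\<And>v. V.independent (B v)" "\<And>v. NV v \<subseteq> V.span (B v)" "\<And>v. finite (B v)"
    by metis
  define S where "S = Sigma Vs B"
  define \<kappa> :: "'v \<times> (nat \<Rightarrow> ('v,'e) node \<Rightarrow> 'k) \<Rightarrow> ('v,'e) node \<Rightarrow> nat \<Rightarrow> ('v,'e) node \<Rightarrow> 'k"
    where "\<kappa> = (\<lambda>(v, b). homU v [] b)"
  define i :: "_ \<Rightarrow> _ \<Rightarrow> ('v,'e) node \<Rightarrow> 'k" where "i = (\<lambda>(v, b) y \<beta>. if \<beta> = BU v [] 0 then V.representation (B v) (E v y) b else 0)"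
  have Ny: "E v y \<in> NV v" if "y \<in> N" for v y using that N by (auto simp: NV_def E_E subrep_def)
  have rep: "E v y \<in> V.span (B v)" if "y \<in> N" for v y using Ny[OF that] B(3) by blast
  show ?thesis
  proof (rule retr_peel[OF N, of S \<kappa> i "{0}"])
    show "finite S" using B(4) fin_Vs by (auto simp: S_def)
    show "{0} \<subseteq> N" using subrepD(2)[OF N] V.subspace_0 by blast
    fix s assume s: "s \<in> S"
    then obtain v b where vb: "s = (v, b)" "v \<in> Vs" "b \<in> B v" by (auto simp: S_def)
    have "b \<in> N" "E v b = b" using vb B(1) by (auto simp: NV_def)
    then have "b \<in> Hs N v []" using z by (auto simp: Hs_def)
    then show "hm Bs N (\<kappa> s)" using hm_homU[OF N] vb by (simp add: \<kappa>_def)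
    show "khom N (i s)" unfolding khom_def
    proof (intro ballI conjI allI impI)
      fix y assume y: "y \<in> N"
      have ok: "ok v []" using vb(2) Nil_W by (simp add: ok_def)
      show "\<beta> \<in> Bs" if "i s y \<beta> \<noteq> 0" for \<beta> using that vb ok by (auto simp: i_def split: if_splits)
      show "i s (y + y') = i s y + i s y'" if "y' \<in> N" for y'
        using vb rep[OF y] rep[OF that] B(2) by (auto simp: i_def fun_eq_iff E.add V.representation_add)
      show "i s (sc c y) = (\<lambda>\<beta>. c * i s y \<beta>)" for c
        using vb rep[OF y] B(2) by (auto simp: i_def fun_eq_iff E.scale V.representation_scale)
      show "i s (E v' y) = ea v' (i s y)" for v'
        using vb by (auto simp: i_def fun_eq_iff ea_def E_E V.representation_zero)
      show "i s (L a y) = la a (i s y)" for a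
        unfolding z[OF y]
      proof
        fix \<beta>
        have "rst a \<beta> \<noteq> Some (BU v [] 0)" if "\<beta> \<in> Bs" using rst_lst[OF that, of a "BU v [] 0"] by auto
        then show "i s 0 \<beta> = la a (i s y) \<beta>"
          using vb(1) by (auto simp: i_def la_def V.representation_zero split: option.splits)
      qed
    qed
  next
    fix y assume y: "y \<in> N"
    have ex: "ex (homU v [] b) (i (v,b) y) = sc (V.representation (B v) (E v y) b) b" if "v \<in> Vs" for v b
    proof -
      have "ex (homU v [] b) (i (v,b) y) = (\<Sum>\<beta>\<in>Bs. if \<beta> = BU v [] 0 then sc (V.representation (B v) (E v y) b) b else 0)"
        unfolding ex_def by (intro sum.cong) (auto simp: i_def homU_def)
      then show ?thesis using that Nil_W fin_Bs by (simp add: ok_def)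
    qed
    have "(\<Sum>s\<in>S. ex (\<kappa> s) (i s y)) = (\<Sum>v\<in>Vs. \<Sum>b\<in>B v. ex (\<kappa> (v, b)) (i (v, b) y))"
      unfolding S_def using fin_Vs B(4) by (subst sum.Sigma) (auto simp: case_prod_unfold)
    also have "\<dots> = (\<Sum>v\<in>Vs. \<Sum>b\<in>B v. sc (V.representation (B v) (E v y) b) b)"
      by (intro sum.cong refl) (simp add: \<kappa>_def ex)
    also have "\<dots> = (\<Sum>v\<in>Vs. E v y)"
      using V.sum_representation_eq[OF B(2) rep[OF y] B(4) order.refl] by simp
    also have "\<dots> = y" using sum_E y subrepD(1)[OF N] by blast
    finally show "y - (\<Sum>s\<in>S. ex (\<kappa> s) (i s y)) \<in> {0}" by simp
  qed (rule retr_0)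
qed

end

section \<open>Families of maps from uniserials and the exchange argument\<close>

context words
begin

interpretation E: Vector_Spaces.linear sc sc "E v" for v by (rule linear_E)
interpretation L: Vector_Spaces.linear sc sc "L a" for a by (rule linear_L)
interpretation wact: Vector_Spaces.linear sc sc "fold L w" for w by (rule linear_wact)

text \<open>Maps U(v, w) -> U(v', q @ r) -> F: the word \<open>r\<close> is the shape of a quotient
  of U(v, w), because \<open>w = r @ r'\<close>, and of the submodule of U(v', q @ r) that begins at
  position \<open>length q\<close>. The top of U(v, w) then goes to
  \<open>fold L q x\<close>.\<close>

definition gens :: "('v \<times> 'e list \<times> (nat \<Rightarrow> ('v,'e) node \<Rightarrow> 'k::field)) set \<Rightarrow> 'v \<Rightarrow> 'e list \<Rightarrow> (nat \<Rightarrow> ('v,'e) node \<Rightarrow> 'k) set" where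
  "gens S v w = {fold L q x | q r v' x. (v', q @ r, x) \<in> S \<and> (\<exists>r'. w = r @ r') \<and> vt (BU v' (q @ r) (length q)) = v}"

definition good where
  "good F fam \<longleftrightarrow> (\<forall>(v,w,x)\<in>set fam. ok v w \<and> x \<in> Hs F v w) \<and>
     (\<forall>v w. ok v w \<longrightarrow> Hs F v w \<subseteq> V.span (gens (set fam) v w))"

text \<open>The dimension of the sum of the uniserials of the family: a word \<open>w\<close> has
  \<open>length w + 1\<close> nodes, counting its top.\<close>

definition tot :: "('v \<times> 'e list \<times> 'x) list \<Rightarrow> nat" where
  "tot fam = (\<Sum>(v,w,x)\<leftarrow>fam. Suc (length w))"

lemma finite_basis_Sup:
  fixes F :: "(nat \<Rightarrow> ('v,'e) node \<Rightarrow> 'k::field) set"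
  assumes "F \<subseteq> Sup m"
  shows "\<exists>B. B \<subseteq> F \<and> V.independent B \<and> F \<subseteq> V.span B \<and> finite B"
proof -
  obtain B where B: "B \<subseteq> F" "V.independent B" "F \<subseteq> V.span B"
    by (rule V.maximal_independent_subset)
  obtain S :: "(nat \<Rightarrow> ('v,'e) node \<Rightarrow> 'k) set" where "finite S" "Sup m \<subseteq> V.span S"
    using Sup_finite_span by blast
  then have "finite B" using V.independent_span_bound B(1,2) assms by blast
  then show ?thesis using B by blast
qed

lemma Hs_sub: "Hs F v w \<subseteq> F" by (auto simp: Hs_def)

lemma finite_ok: "finite {(v,w). ok v w}"
  by (rule finite_subset[of _ "Vs \<times> W"]) (auto simp: ok_def fin_Vs fin_W)

text \<open>There are finitely many pairs \<open>ok v w\<close>, and bases of all the spaces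
  \<open>Hs F v w\<close> together form a family; each basis element generates itself with empty
  \<open>q\<close>.\<close>

lemma good_exists: assumes "subrep m F" shows "\<exists>fam. good F fam"
proof -
  have "\<forall>v w. \<exists>B. B \<subseteq> Hs F v w \<and> Hs F v w \<subseteq> V.span B \<and> finite B"
    using finite_basis_Sup[of "Hs F _ _" m] Hs_sub subrepD(1)[OF assms] by (meson order.trans)
  then obtain B where B: "\<And>v w. B v w \<subseteq> Hs F v w" "\<And>v w. Hs F v w \<subseteq> V.span (B v w)" "\<And>v w. finite (B v w)"
    by metis
  let ?S = "\<Union>(v,w)\<in>{(v,w). ok v w}. (\<lambda>b. (v,w,b)) ` B v w"
  have "finite ?S" using finite_ok B(3) by auto
  then obtain fam where fam: "set fam = ?S" using finite_list[of ?S] by metis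
  have "B v w \<subseteq> gens (set fam) v w" if "ok v w" for v w
  proof
    fix b assume "b \<in> B v w"
    then have "(v, [] @ w, b) \<in> set fam" using that fam by auto
    moreover have "vt (BU v ([] @ w) (length [])) = v" by simp
    ultimately have "fold L [] b \<in> gens (set fam) v w" unfolding gens_def by blast
    then show "b \<in> gens (set fam) v w" by simp
  qed
  then have span: "Hs F v w \<subseteq> V.span (gens (set fam) v w)" if "ok v w" for v w
    using that B(2) V.span_mono by (meson order.trans)
  have "case e of (v,w,x) \<Rightarrow> ok v w \<and> x \<in> Hs F v w" if "e \<in> set fam" for e
    using that B(1) unfolding fam by auto
  with span have "good F fam" unfolding good_def by blast
  then show ?thesis ..
qed

text \<open>The first letter of \<open>u\<close> fixes the vertex where \<open>u\<close> begins. For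
  empty \<open>u\<close> nothing would tie \<open>v2\<close> to the longer word.\<close>

lemma vt_BU_append:
  assumes "ok v1 (p @ u)" "ok v2 u" "u \<noteq> []"
  shows "vt (BU v1 (p @ u) (length p + i)) = vt (BU v2 u i)"
proof (cases i)
  case 0
  show ?thesis
  proof (cases p rule: rev_cases)
    case Nil
    then show ?thesis using 0 assms by (simp add: ok_def)
  next
    case (snoc p' c)
    have "[c, hd u] \<in> W" using assms W_prefix[of "[c, hd u]" "tl u"] W_suffix[of p' "c # u"] snoc
      by (cases u) (auto simp: ok_def)
    then have "tgt c = v2" using W_comp assms by (auto simp: ok_def)
    then show ?thesis using 0 snoc by (simp add: nth_append)
  qed
qed (simp add: nth_append)

text \<open>A word \<open>r\<close> at least as long as the rest of \<open>w\<close> either is that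
  rest or gives zero: with a wrong first letter it dies at once, and otherwise comparability makes
  the rest a proper prefix of \<open>r\<close>, which then runs past the socle.\<close>

lemma Hs_long:
  assumes F: "F \<subseteq> Sup m" and x: "x \<in> Hs F v w" and w: "w \<in> W" and i: "i \<le> length w"
    and r: "r \<in> W" "r \<noteq> []" "length w - i \<le> length r"
  shows "fold L r (fold L (take i w) x) = (if drop i w = r then fold L w x else 0)"
proof (cases "drop i w = r")
  case True
  have "fold L r (fold L (take i w) x) = fold L (take i w @ r) x" by simp
  also have "take i w @ r = w" using True by auto
  finally show ?thesis using True by simp
next
  case ne: False
  obtain a r1 where ra: "r = a # r1" using r(2) by (cases r) auto
  have "fold L r (fold L (take i w) x) = 0"
  proof (cases "i < length w \<and> w!i = a")
    case True
    have "drop i w \<in> W" using w W_suffix by (metis append_take_drop_id)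
    moreover have "drop i w \<noteq> []" "hd (drop i w) = hd r" "length (drop i w) \<le> length r"
      using True ra r(3) by (auto simp: hd_drop_conv_nth)
    ultimately obtain s where s: "r = drop i w @ s" using prefix_comparable r(1,2) by blast
    then obtain b s' where "s = b # s'" using ne by (cases s) auto
    then have e: "take i w @ r = (w @ [b]) @ s'" using s
      by (metis append.assoc append_Cons append_Nil append_take_drop_id)
    have "fold L r (fold L (take i w) x) = fold L (take i w @ r) x" by simp
    also have "\<dots> = fold L s' (fold L (w @ [b]) x)" unfolding e by simp
    also have "\<dots> = 0" using x by (simp add: Hs_def wact.zero)
    finally show ?thesis .
  next
    case False
    then have "L a (fold L (take i w) x) = 0" using Hs_step[OF F x w i, of a] by auto
    then show ?thesis by (simp add: ra wact.zero)
  qed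
  then show ?thesis using ne by simp
qed

lemma Hs_wact_suffix:
  assumes F: "subrep m F" and x: "x \<in> Hs F v1 (p @ u)" and ok1: "ok v1 (p @ u)" and ok2: "ok v2 u" and u: "u \<noteq> []"
  shows "fold L p x \<in> F" "E v2 (fold L p x) = fold L p x" "a \<noteq> hd u \<Longrightarrow> L a (fold L p x) = 0"
proof -
  have W: "p @ u \<in> W" using ok1 by (simp add: ok_def)
  show "fold L p x \<in> F" using subrepD(5)[OF F] x by (auto simp: Hs_def)
  have "E (vt (BU v1 (p @ u) (length p))) (fold L (take (length p) (p @ u)) x) = fold L (take (length p) (p @ u)) x"
    using E_take[of v1 x "p @ u" "length p"] x ok1 by (auto simp: Hs_def)
  then show "E v2 (fold L p x) = fold L p x" using vt_BU_append[OF ok1 ok2 u, of 0] by simp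
  show "a \<noteq> hd u \<Longrightarrow> L a (fold L p x) = 0"
    using Hs_step[OF subrepD(1)[OF F] x W, of "length p" a] u by (auto simp: nth_append hd_conv_nth)
qed

text \<open>If the kernel were not contained in the socle, the generator of some uniserial summand
  could be exchanged for one that is killed earlier.\<close>

lemma minimal_family_kernel:
  fixes F :: "(nat \<Rightarrow> ('v,'e) node \<Rightarrow> 'k::field) set"
  assumes F: "subrep m F" and good: "good F fam" and min: "\<And>fam'. good F fam' \<Longrightarrow> tot fam \<le> tot fam'"
    and c: "(\<Sum>j<length fam. \<Sum>i\<le>length (fst (snd (fam!j))). sc (c j i) (fold L (take i (fst (snd (fam!j)))) (snd (snd (fam!j))))) = 0"
    and ji: "j < length fam" "i < length (fst (snd (fam!j)))"
  shows "c j i = 0"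
proof (rule ccontr)
  assume cji: "c j i \<noteq> 0"
  let ?d = "length fam"
  define vj where "vj j = fst (fam!j)" for j
  define wj where "wj j = fst (snd (fam!j))" for j
  define xj where "xj j = snd (snd (fam!j))" for j
  have fam: "fam!j = (vj j, wj j, xj j)" for j by (simp add: vj_def wj_def xj_def)
  have FS: "F \<subseteq> Sup m" using F subrepD by blast
  have okj: "ok (vj j) (wj j)" and Hj: "xj j \<in> Hs F (vj j) (wj j)" if "j < ?d" for j
    using good that nth_mem[OF that] unfolding good_def fam by auto
  have Wj: "wj j \<in> W" if "j < ?d" for j using okj[OF that] by (simp add: ok_def)
  have c0: "(\<Sum>j<?d. \<Sum>i\<le>length (wj j). sc (c j i) (fold L (take i (wj j)) (xj j))) = 0"
    using c by (simp add: wj_def xj_def)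
  define D where "D = {(j,i). j < ?d \<and> i < length (wj j) \<and> c j i \<noteq> 0}"
  have "D \<subseteq> Sigma {..<?d} (\<lambda>j. {..<length (wj j)})" by (auto simp: D_def)
  then have finD: "finite D" by (rule finite_subset) auto
  have Dne: "D \<noteq> {}" using ji cji by (auto simp: D_def wj_def)
  \<comment> \<open>The nonzero coefficient that is farthest from the end of its word. Applying the
    remaining tail kills every term closer to its end, and every term equally far whose tail is
    different.\<close>
  obtain js "is" where jis: "(js, is) \<in> D" and jmax: "\<And>j i. (j,i) \<in> D \<Longrightarrow> length (wj j) - i \<le> length (wj js) - is"
  proof -
    let ?M = "Max ((\<lambda>(j,i). length (wj j) - i) ` D)"
    have "?M \<in> (\<lambda>(j,i). length (wj j) - i) ` D" using finD Dne by (intro Max_in) auto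
    then obtain j0 i0 where "(j0,i0) \<in> D" "?M = length (wj j0) - i0" by auto
    moreover have "length (wj j) - i \<le> ?M" if "(j,i) \<in> D" for j i
      using finD that by (intro Max_ge) (auto intro: rev_image_eqI)
    ultimately show thesis using that by metis
  qed
  define r where "r = drop is (wj js)"
  have js: "js < ?d" "is < length (wj js)" "c js is \<noteq> 0" using jis by (auto simp: D_def)
  have rW: "r \<in> W" "r \<noteq> []" using Wj[OF js(1)] js(2) unfolding r_def
    by (metis W_suffix append_take_drop_id) (use js(2) in simp)
  have lr: "length r = length (wj js) - is" by (simp add: r_def)
  \<comment> \<open>After \<open>r\<close> has been applied, member \<open>j\<close> contributes at
    most a multiple of its socle element, coming from the position where \<open>r\<close> is the
    tail of its word.\<close>
  define \<mu> where "\<mu> j = (if \<exists>q. wj j = q @ r then c j (length (wj j) - length r) else 0)" for j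
  have *: "(\<Sum>i\<le>length (wj j). sc (c j i) (fold L r (fold L (take i (wj j)) (xj j)))) = sc (\<mu> j) (fold L (wj j) (xj j))"
    if j: "j < ?d" for j
  proof -
    have "sc (c j i) (fold L r (fold L (take i (wj j)) (xj j))) = (if drop i (wj j) = r then sc (c j i) (fold L (wj j) (xj j)) else 0)"
      if i: "i \<le> length (wj j)" for i
    proof -
      consider "c j i = 0" | "i = length (wj j)" | "(j,i) \<in> D" using i j unfolding D_def by (cases "c j i = 0"; cases "i = length (wj j)") auto
      then have "c j i = 0 \<or> length (wj j) - i \<le> length r"
        by cases (auto simp: lr jmax)
      then show ?thesis using Hs_long[OF FS Hj[OF j] Wj[OF j] i rW] by auto
    qed
    then have "(\<Sum>i\<le>length (wj j). sc (c j i) (fold L r (fold L (take i (wj j)) (xj j)))) =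
      (\<Sum>i\<le>length (wj j). if drop i (wj j) = r then sc (c j i) (fold L (wj j) (xj j)) else 0)" by simp
    also have "\<dots> = sc (\<mu> j) (fold L (wj j) (xj j))"
    proof (cases "\<exists>q. wj j = q @ r")
      case True
      then have "i \<le> length (wj j) \<Longrightarrow> drop i (wj j) = r \<longleftrightarrow> i = length (wj j) - length r" for i by auto
      then have "(\<Sum>i\<le>length (wj j). if drop i (wj j) = r then sc (c j i) (fold L (wj j) (xj j)) else 0)
        = (\<Sum>i\<le>length (wj j). if i = length (wj j) - length r then sc (c j i) (fold L (wj j) (xj j)) else 0)"
        by (intro sum.cong) auto
      then show ?thesis using True by (simp add: \<mu>_def)
    next
      case False
      then have "drop i (wj j) \<noteq> r" for i by (metis append_take_drop_id)
      then show ?thesis using False by (simp add: \<mu>_def)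
    qed
    finally show ?thesis .
  qed
  have "0 = fold L r (\<Sum>j<?d. \<Sum>i\<le>length (wj j). sc (c j i) (fold L (take i (wj j)) (xj j)))"
    unfolding c0 by (simp add: wact.zero)
  also have "\<dots> = (\<Sum>j<?d. \<Sum>i\<le>length (wj j). sc (c j i) (fold L r (fold L (take i (wj j)) (xj j))))"
    by (simp add: wact.sum wact.scale)
  also have "\<dots> = (\<Sum>j<?d. sc (\<mu> j) (fold L (wj j) (xj j)))" using * by simp
  finally have \<mu>0: "(\<Sum>j<?d. sc (\<mu> j) (fold L (wj j) (xj j))) = 0" by simp
  define J where "J = {j. j < ?d \<and> \<mu> j \<noteq> 0}"
  have "wj js = take is (wj js) @ r" by (simp add: r_def)
  then have "\<mu> js = c js is" using js lr by (auto simp: \<mu>_def)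
  then have Jne: "J \<noteq> {}" using js by (auto simp: J_def)
  have finJ: "finite J" by (auto simp: J_def)
  \<comment> \<open>All words with nonzero \<open>\<mu> j\<close> end in \<open>r\<close>, hence in
    the same letter. By (S) the shortest of them is a suffix of all the others.\<close>
  obtain j0 where j0: "j0 \<in> J" and jmin: "\<And>j. j \<in> J \<Longrightarrow> length (wj j0) \<le> length (wj j)"
    using ex_has_least_nat[of "\<lambda>j. j \<in> J" _ "\<lambda>j. length (wj j)"] Jne by blast
  have j0d: "j0 < ?d" and \<mu>j0: "\<mu> j0 \<noteq> 0" using j0 by (auto simp: J_def)
  have sufr: "\<exists>q. wj j = q @ r" if "j \<in> J" for j using that by (auto simp: J_def \<mu>_def split: if_splits)
  have ne: "wj j \<noteq> []" "last (wj j) = last r" if "j \<in> J" for j using sufr[OF that] rW(2) by auto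
  have "\<exists>q. wj j = q @ wj j0" if "j \<in> J" for j
    using that suffix_comparable[OF Wj Wj, of j0 j] ne j0 jmin[OF that] j0d by (auto simp: J_def)
  then obtain q where q: "\<And>j. j \<in> J \<Longrightarrow> wj j = q j @ wj j0" by metis
  let ?w = "wj j0"
  have jJ: "j \<in> J \<Longrightarrow> j < ?d" for j by (simp add: J_def)
  \<comment> \<open>The exchanged generator: a multiple of \<open>xj j0\<close> corrected by the
    longer members, pushed down to the same position. The relation between the socle elements says
    that it is killed one letter earlier.\<close>
  define x' where "x' = (\<Sum>j\<in>J. sc (\<mu> j) (fold L (q j) (xj j)))"
  have qH: "fold L (q j) (xj j) \<in> F" "E (vj j0) (fold L (q j) (xj j)) = fold L (q j) (xj j)"
    "a \<noteq> hd ?w \<Longrightarrow> L a (fold L (q j) (xj j)) = 0" if "j \<in> J" for j a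
    using Hs_wact_suffix[OF F, of "xj j" "vj j" "q j" ?w "vj j0"]
      Hj[OF jJ[OF that]] okj[OF jJ[OF that]] okj[OF j0d] ne(1)[OF j0] q[OF that] by auto
  have wx': "fold L ?w x' = 0"
  proof -
    have "fold L ?w x' = (\<Sum>j\<in>J. sc (\<mu> j) (fold L (wj j) (xj j)))"
      unfolding x'_def wact.sum wact.scale by (rule sum.cong) (simp_all add: q)
    also have "\<dots> = (\<Sum>j<?d. sc (\<mu> j) (fold L (wj j) (xj j)))"
      by (rule sum.mono_neutral_left) (auto simp: J_def)
    finally show ?thesis using \<mu>0 by simp
  qed
  have x'F: "x' \<in> F" unfolding x'_def
    using qH(1) subrepD(2)[OF F] by (intro V.subspace_sum V.subspace_scale) auto
  have x'E: "E (vj j0) x' = x'" unfolding x'_def E.sum E.scale using qH(2) by (intro sum.cong) auto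
  have x'L: "L a x' = 0" if "a \<noteq> hd ?w" for a unfolding x'_def L.sum L.scale using qH(3)[OF _ that] by (intro sum.neutral) auto
  have x'H: "x' \<in> Hs F (vj j0) (butlast ?w)"
  proof -
    have wne: "?w \<noteq> []" using ne j0 by blast
    have bl: "fold L (butlast ?w @ [a]) x' = 0" for a
    proof (cases "a = last ?w")
      case True
      then show ?thesis using wx' wne by (metis append_butlast_last_id)
    next
      case False
      show ?thesis
      proof (cases "butlast ?w = []")
        case True
        then have "?w = [last ?w]" using wne by (metis append_butlast_last_id append_Nil)
        then have "a \<noteq> hd ?w" using False by (metis list.sel(1))
        then show ?thesis using True x'L by simp
      next
        case nn: False
        then have "butlast ?w = butlast (butlast ?w) @ [last (butlast ?w)]" by simp
        then have e1: "?w = butlast (butlast ?w) @ [last (butlast ?w), last ?w]"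
          "butlast ?w @ [a] = butlast (butlast ?w) @ [last (butlast ?w), a]"
          using wne by (metis append.assoc append_Cons append_Nil append_butlast_last_id)+
        then have "[last (butlast ?w), last ?w] \<in> W" using Wj[OF j0d] W_suffix by metis
        then have "[last (butlast ?w), a] \<notin> W" using False W_right by metis
        then have "butlast ?w @ [a] \<notin> W" using e1(2) W_suffix by metis
        then show ?thesis using wact_zero x'F FS by blast
      qed
    qed
    have hd: "L a x' = 0" if "butlast ?w = [] \<or> a \<noteq> hd (butlast ?w)" for a
    proof (cases "butlast ?w = []")
      case True
      then show ?thesis using bl[of a] by simp
    next
      case False
      then have "hd (butlast ?w) = hd ?w" by (metis append_butlast_last_id hd_append2 wne)
      then show ?thesis using that False x'L by auto
    qed
    show ?thesis unfolding Hs_def using x'F x'E hd bl by blast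
  qed
  define fam' where "fam' = fam[j0 := (vj j0, butlast ?w, x')]"
  have q0: "q j0 = []" using q[OF j0] by simp
  \<comment> \<open>As \<open>q j0\<close> is empty and \<open>\<mu> j0\<close> is nonzero, the old
    generator is recovered from the new one and the other members, so nothing generated so far is
    lost.\<close>
  have x'eq: "sc (\<mu> j0) (xj j0) = x' - (\<Sum>j\<in>J - {j0}. sc (\<mu> j) (fold L (q j) (xj j)))"
    unfolding x'_def using q0 by (subst sum.remove[OF finJ j0]) simp
  have mem': "(vj j, wj j, xj j) \<in> set fam'" if "j < ?d" "j \<noteq> j0" for j
    using that unfolding fam'_def by (metis fam length_list_update nth_list_update_neq nth_mem)
  have mem0: "(vj j0, butlast ?w, x') \<in> set fam'" unfolding fam'_def by (rule set_update_memI[OF j0d])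
  have "good F fam'"
    unfolding good_def
  proof (intro conjI ballI allI impI)
    fix e assume "e \<in> set fam'"
    then have "e = (vj j0, butlast ?w, x') \<or> e \<in> set fam" unfolding fam'_def
      by (meson set_update_subset_insert subsetD insertE)
    then show "case e of (v,w,x) \<Rightarrow> ok v w \<and> x \<in> Hs F v w"
    proof
      assume "e \<in> set fam" then show ?thesis using good unfolding good_def by blast
    qed (use x'H okj[OF j0d] ok_butlast in auto)
  next
    fix v w assume okvw: "ok v w"
    have "gens (set fam) v w \<subseteq> V.span (gens (set fam') v w)"
    proof
      fix z assume "z \<in> gens (set fam) v w"
      then obtain p s v' x where z: "z = fold L p x" "(v', p @ s, x) \<in> set fam" "\<exists>r'. w = s @ r'"
        "vt (BU v' (p @ s) (length p)) = v" unfolding gens_def by blast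
      then obtain j where j: "j < ?d" "v' = vj j" "p @ s = wj j" "x = xj j"
        by (metis fam in_set_conv_nth prod.inject)
      show "z \<in> V.span (gens (set fam') v w)"
      proof (cases "j = j0")
        case False
        then have "(v', p @ s, x) \<in> set fam'" using mem'[OF j(1)] j by simp
        then have "z \<in> gens (set fam') v w" using z unfolding gens_def by blast
        then show ?thesis by (rule V.span_base)
      next
        case True
        have ps: "p @ s = ?w" using j True by simp
        have 1: "fold L p x' \<in> V.span (gens (set fam') v w)"
        proof (cases s rule: rev_cases)
          case Nil
          \<comment> \<open>Here \<open>p\<close> is the whole old word, one letter beyond the
            shortened one, and \<open>x'\<close> is already killed.\<close>
          then show ?thesis using ps wx' V.span_zero by auto
        next
          case (snoc s' b)
          then have "butlast ?w = p @ s'" using ps by (metis append_assoc butlast_snoc)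
          then have "(vj j0, p @ s', x') \<in> set fam'" using mem0 by simp
          moreover have "\<exists>r'. w = s' @ r'" using z(3) snoc by auto
          moreover have "vt (BU (vj j0) (p @ s') (length p)) = v"
            using z(4) j(2) True snoc by (auto simp: nth_append split: if_splits)
          ultimately have "fold L p x' \<in> gens (set fam') v w" unfolding gens_def by blast
          then show ?thesis by (rule V.span_base)
        qed
        have 2: "fold L p (fold L (q i) (xj i)) \<in> V.span (gens (set fam') v w)" if i: "i \<in> J - {j0}" for i
        proof -
          have wi: "wj i = (q i @ p) @ s" using q[of i] i ps by simp
          have "(vj i, (q i @ p) @ s, xj i) \<in> set fam'" using mem'[of i] i jJ wi by (metis DiffD1 DiffD2 singletonI)
          moreover have "vt (BU (vj i) ((q i @ p) @ s) (length (q i @ p))) = v"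
            using vt_BU_append[OF _ okj[OF j0d] ne(1)[OF j0], of "vj i" "q i" "length p"] okj[OF jJ[of i]] q[of i] i ps z(4) j(2) True
            by (simp del: vt.simps)
          ultimately have "fold L (q i @ p) (xj i) \<in> gens (set fam') v w" using z(3) unfolding gens_def by blast
          then show ?thesis using V.span_base by auto
        qed
        have "sc (\<mu> j0) z = fold L p (sc (\<mu> j0) (xj j0))" using z(1) j(4) True by (simp add: wact.scale)
        also have "\<dots> = fold L p x' - (\<Sum>j\<in>J - {j0}. sc (\<mu> j) (fold L p (fold L (q j) (xj j))))"
          unfolding x'eq by (simp add: wact.diff wact.sum wact.scale)
        also have "\<dots> \<in> V.span (gens (set fam') v w)"
          using 1 2 by (intro V.span_diff V.span_sum V.span_scale)
        finally have "sc (inverse (\<mu> j0)) (sc (\<mu> j0) z) \<in> V.span (gens (set fam') v w)" by (rule V.span_scale)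
        then show ?thesis using \<mu>j0 by simp
      qed
    qed
    then have "V.span (gens (set fam) v w) \<subseteq> V.span (gens (set fam') v w)"
      by (intro V.span_minimal) auto
    then show "Hs F v w \<subseteq> V.span (gens (set fam') v w)" using good okvw unfolding good_def by blast
  qed
  moreover have "tot fam' < tot fam"
  proof -
    let ?f = "\<lambda>(v,w,x). Suc (length w)"
    have "tot fam' = tot fam + length ?w - Suc (length ?w)"
      using j0d ne(1)[OF j0] unfolding tot_def fam'_def map_update
      by (subst sum_list_update) (auto simp: fam)
    moreover have "tot fam \<ge> Suc (length ?w)"
      using elem_le_sum_list[of j0 "map ?f fam"] j0d fam[of j0] unfolding tot_def by simp
    ultimately show ?thesis by linarith
  qed
  ultimately show False using min by (meson not_le)
qed

end

section \<open>Approximations, and the uniserials given by maximal words\<close>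

context words
begin

interpretation E: Vector_Spaces.linear sc sc "E v" for v by (rule linear_E)
interpretation L: Vector_Spaces.linear sc sc "L a" for a by (rule linear_L)
interpretation wact: Vector_Spaces.linear sc sc "fold L w" for w by (rule linear_wact)
interpretation gh: Vector_Spaces.linear sc sc "gh k g" for k g by (rule linear_gh)

text \<open>A right add M approximation of \<open>F\<close> by a power of M with kernel in add M.
  Under Hom(M, -) it turns into a projective resolution of length one.\<close>

definition approx :: "(nat \<Rightarrow> ('v,'e) node \<Rightarrow> 'k::field) set \<Rightarrow> bool" where
  "approx F \<longleftrightarrow> (\<exists>k g. (\<forall>l<k. hm Bs F (g l)) \<and>
     (\<forall>h. hm Bs F h \<longrightarrow> (\<exists>c. hm Bs (Sup k) c \<and> (\<forall>\<beta>\<in>Bs. h \<beta> = gh k g (c \<beta>)))) \<and>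
     retr {y \<in> Sup k. gh k g y = 0})"

lemma ker_subrep:
  assumes "\<And>l. l < k \<Longrightarrow> hm Bs F (g l)"
  shows "subrep k {y \<in> Sup k. gh k g y = 0}"
  unfolding subrep_def
proof (intro conjI ballI allI)
  show "V.subspace {y \<in> Sup k. gh k g y = 0}"
    using V.subspace_inter[OF subspace_Sup gh.subspace_kernel] by (simp add: Int_def)
qed (auto simp: E_Sup L_Sup gh_E[OF assms] gh_L[OF assms])

lemma subspace_Hs: "V.subspace F \<Longrightarrow> V.subspace (Hs F v w)"
  unfolding V.subspace_def Hs_def
  by (auto simp: E.add E.scale L.add L.scale wact.add wact.scale simp del: fold_append)

lemma hm_lsts: "hm Bs F h \<Longrightarrow> \<beta> \<in> Bs \<Longrightarrow> fold L w (h \<beta>) = (case lsts w \<beta> of None \<Rightarrow> 0 | Some \<gamma> \<Rightarrow> h \<gamma>)"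
proof (induction w rule: rev_induct)
  case (snoc a w)
  then show ?case using lsts_Bs[of \<beta> w] by (auto simp: lsts_snoc hm_def split: option.splits bind_splits)
qed simp

text \<open>By (S) the words that can follow \<open>a\<close> form a chain of prefixes. The longest
  one is the shape of the summand generated by \<open>a\<close> in the radical of a
  projective.\<close>

definition longest_right :: "'e \<Rightarrow> 'e list \<Rightarrow> bool" where
  "longest_right a p \<longleftrightarrow> a # p \<in> W \<and> (\<forall>p'. a # p' \<in> W \<longrightarrow> (\<exists>r. p = p' @ r))"

lemma longest_right_ex: assumes "a \<in> As" shows "\<exists>p. longest_right a p"
proof -
  have "finite (length ` {p. a # p \<in> W})"
    using fin_W by (intro finite_imageI finite_subset[OF _ finite_imageI[OF fin_W, of tl]]) force
  moreover have "length [] \<in> length ` {p. a # p \<in> W}" using single_W[OF assms] by force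
  ultimately have "Max (length ` {p. a # p \<in> W}) \<in> length ` {p. a # p \<in> W}" by (intro Max_in) auto
  then obtain p where p: "a # p \<in> W" "Max (length ` {p. a # p \<in> W}) = length p" by auto
  have "\<exists>r. p = p' @ r" if "a # p' \<in> W" for p'
  proof -
    have "length p' \<le> length p" using p(2) \<open>finite _\<close> that by (metis (mono_tags, lifting) Max_ge imageI mem_Collect_eq)
    then show ?thesis using prefix_comparable_Cons[OF that p(1)] by blast
  qed
  then show ?thesis using p(1) by (auto simp: longest_right_def)
qed

text \<open>Dually, the nonempty words ending in \<open>c\<close> form a chain of suffixes. The
  longest one, without its last letter, is the shape of the summand belonging to \<open>c\<close> in
  an injective modulo its socle.\<close>

definition longest_left :: "'e \<Rightarrow> 'e list \<Rightarrow> bool" where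
  "longest_left c w \<longleftrightarrow> w \<in> W \<and> w \<noteq> [] \<and> last w = c \<and> (\<forall>w'\<in>W. w' \<noteq> [] \<longrightarrow> last w' = c \<longrightarrow> (\<exists>q. w = q @ w'))"

lemma longest_left_ex: assumes "c \<in> As" shows "\<exists>p. longest_left c p"
proof -
  let ?S = "length ` {w\<in>W. w \<noteq> [] \<and> last w = c}"
  have fin: "finite ?S" using fin_W by auto
  moreover have "length [c] \<in> ?S" using single_W[OF assms] by (intro imageI) auto
  ultimately have "Max ?S \<in> ?S" by (intro Max_in) auto
  then obtain w where w: "w \<in> W" "w \<noteq> []" "last w = c" "Max ?S = length w" by auto
  have "\<exists>q. w = q @ w'" if "w' \<in> W" "w' \<noteq> []" "last w' = c" for w'
  proof -
    have "length w' \<in> ?S" using that by blast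
    then have "length w' \<le> length w" using Max_ge[OF fin] w(4) by metis
    then show ?thesis using suffix_comparable[OF that(1) w(1)] that w by auto
  qed
  then show ?thesis using w by (auto simp: longest_left_def)
qed

lemma ok_longest_right: "longest_right a p \<Longrightarrow> a \<in> As \<Longrightarrow> ok (tgt a) p"
  using W_suffix[of "[a]" p] W_comp[of a "hd p"] W_prefix[of "[a, hd p]" "tl p"] tgt_in[of a]
  by (cases p) (auto simp: ok_def longest_right_def)

text \<open>Only words that can follow \<open>a\<close> act nontrivially on \<open>L a y\<close>,
  and all of them are prefixes of \<open>p\<close>. So every element in the image of an arrow is the
  image of the top of a uniserial.\<close>

lemma L_in_Hs:
  assumes F: "subrep m F" and y: "y \<in> F" and p: "longest_right a p"
  shows "L a y \<in> Hs F (tgt a) p"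
proof -
  have yS: "y \<in> Sup m" using y subrepD(1)[OF F] by auto
  have 1: "fold L (p @ [b]) (L a y) = 0" for b
  proof -
    have "a # p @ [b] \<notin> W" using p by (auto simp: longest_right_def)
    then have "fold L (a # p @ [b]) y = 0" using wact_zero[OF yS] by blast
    then show ?thesis by simp
  qed
  have 2: "L b (L a y) = 0" if "p = [] \<or> b \<noteq> hd p" for b
  proof -
    have "[a, b] \<notin> W" using p that by (auto simp: longest_right_def dest!: spec[of _ "[b]"])
    then have "fold L [a, b] y = 0" using wact_zero[OF yS] by blast
    then show ?thesis by simp
  qed
  show ?thesis using 1 2 subrepD(4)[OF F y] by (auto simp: Hs_def E_L simp del: fold_append)
qed

text \<open>The injective at \<open>u\<close> modulo its socle, projected to the summand whose words
  are the nonempty suffixes of \<open>wc\<close>, and mapped on by sending the node of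
  \<open>wc\<close> itself to \<open>t\<close>. The condition \<open>w \<noteq> []\<close> kills the
  socle.\<close>

definition homI :: "'v \<Rightarrow> 'e list \<Rightarrow> (nat \<Rightarrow> ('v,'e) node \<Rightarrow> 'k::field) \<Rightarrow> ('v,'e) node \<Rightarrow> nat \<Rightarrow> ('v,'e) node \<Rightarrow> 'k" where
  "homI u wc t = (\<lambda>\<beta>. case \<beta> of BI u' w \<Rightarrow>
     if u' = u \<and> w \<noteq> [] \<and> (\<exists>q. wc = q @ w) then fold L (take (length wc - length w) wc) t else 0 | _ \<Rightarrow> 0)"

lemma hm_homI:
  assumes F: "subrep m F" and wc: "longest_left c wc" and x: "x \<in> Hs F (src (hd wc)) (butlast wc)"
  shows "hm Bs F (homI u wc x)"
  unfolding hm_def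
proof (intro ballI)
  fix \<beta> assume b: "\<beta> \<in> Bs"
  have z: "0 \<in> F" using subrepD(2)[OF F] V.subspace_0 by blast
  have xF: "x \<in> F" "E (src (hd wc)) x = x" using x by (auto simp: Hs_def)
  have xS: "x \<in> Sup m" using xF subrepD(1)[OF F] by auto
  have wcW: "wc \<in> W" "wc \<noteq> []" "last wc = c" using wc by (auto simp: longest_left_def)
  show "homI u wc x \<beta> \<in> F \<and> E (vt \<beta>) (homI u wc x \<beta>) = homI u wc x \<beta> \<and>
    (\<forall>a. L a (homI u wc x \<beta>) = (case lst a \<beta> of None \<Rightarrow> 0 | Some \<gamma> \<Rightarrow> homI u wc x \<gamma>))"
  proof (cases "\<exists>q w. \<beta> = BI u w \<and> w \<noteq> [] \<and> wc = q @ w")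
    case True
    then obtain q w where qw: "\<beta> = BI u w" "w \<noteq> []" "wc = q @ w" by blast
    have h: "homI u wc x \<beta> = fold L q x" using qw by (auto simp: homI_def)
    have qa: "q @ [hd w] \<in> W" using wcW(1) qw W_prefix[of "q @ [hd w]" "tl w"] by simp
    have e: "E (src (hd w)) (fold L q x) = fold L q x"
    proof (cases q rule: rev_cases)
      case Nil
      then show ?thesis using xF qw by simp
    next
      case (snoc q' b)
      then have "[b, hd w] \<in> W" using qa W_suffix[of q' "[b, hd w]"] by simp
      then show ?thesis using W_comp snoc by (auto simp: E_L)
    qed
    have "L a (fold L q x) = (case lst a \<beta> of None \<Rightarrow> 0 | Some \<gamma> \<Rightarrow> homI u wc x \<gamma>)" for a
    proof (cases "a = hd w")
      case True
      show ?thesis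
      proof (cases "tl w = []")
        case t: True
        then have "w = [a]" using True qw(2) by (metis list.collapse)
        then have "butlast wc @ [a] = q @ w" "q = butlast wc" using qw by auto
        then have "L a (fold L q x) = 0" using x by (auto simp: Hs_def)
        then show ?thesis using qw True t by (simp add: homI_def)
      next
        case False
        have "wc = (q @ [a]) @ tl w" using qw True by simp
        then have "homI u wc x (BI u (tl w)) = fold L (q @ [a]) x" using False unfolding homI_def by (auto simp del: append_assoc)
        then show ?thesis using qw True by simp
      qed
    next
      case False
      have "L a (fold L q x) = 0"
      proof (cases q rule: rev_cases)
        case Nil
        then have "butlast wc = [] \<or> a \<noteq> hd (butlast wc)" using qw False by (cases w) auto
        then show ?thesis using x Nil by (auto simp: Hs_def)
      next
        case (snoc q' b)
        then have "[b, hd w] \<in> W" using qa W_suffix[of q' "[b, hd w]"] by simp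
        then have "[b, a] \<notin> W" using False W_right by metis
        then have "q @ [a] \<notin> W" using snoc W_suffix[of q' "[b, a]"] by auto
        then have "fold L (q @ [a]) x = 0" using wact_zero[OF xS] by blast
        then show ?thesis by simp
      qed
      then show ?thesis using qw False by auto
    qed
    then show ?thesis using h e qw subrepD(5)[OF F xF(1)] by simp
  next
    case False
    then have h: "homI u wc x \<beta> = 0" by (auto simp: homI_def split: node.splits)
    have "(case lst a \<beta> of None \<Rightarrow> 0 | Some \<gamma> \<Rightarrow> homI u wc x \<gamma>) = 0" for a
    proof (cases \<beta>)
      case (BI u' w)
      show ?thesis
      proof (rule ccontr)
        assume "\<not> ?thesis"
        then have *: "w \<noteq> []" "u' = u" "tl w \<noteq> []" "\<exists>q. wc = q @ tl w" using BI
          by (auto simp: homI_def split: if_splits)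
        \<comment> \<open>A node whose successor is a nonzero node of the summand lies in the
          summand itself: it has the same last letter, and \<open>wc\<close> ends in every word with
          that last letter.\<close>
        then have "last w = c" using wcW by (metis last_appendR last_tl)
        then have "\<exists>q. wc = q @ w" using wc * b BI by (auto simp: longest_left_def eok_def)
        then show False using False * BI by blast
      qed
    qed (auto simp: homI_def)
    then show ?thesis using h z by simp
  qed
qed

end

section \<open>A cover by uniserials with semisimple kernel, and a complement to its image\<close>

context words
begin

interpretation E: Vector_Spaces.linear sc sc "E v" for v by (rule linear_E)
interpretation L: Vector_Spaces.linear sc sc "L a" for a by (rule linear_L)
interpretation wact: Vector_Spaces.linear sc sc "fold L w" for w by (rule linear_wact)
interpretation gh: Vector_Spaces.linear sc sc "gh k g" for k g by (rule linear_gh)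

definition UT :: "nat \<Rightarrow> (nat \<Rightarrow> 'v) \<Rightarrow> (nat \<Rightarrow> 'e list) \<Rightarrow> (nat \<Rightarrow> ('v,'e) node \<Rightarrow> 'k::field) set" where
  "UT d vj wj = {y \<in> Sup d. \<forall>l \<beta>. y l \<beta> \<noteq> 0 \<longrightarrow> (\<exists>i\<le>length (wj l). \<beta> = BU (vj l) (wj l) i)}"

text \<open>A \<open>good\<close> family of least \<open>tot\<close> does both jobs: generation by
  the family is factorisation through \<open>UT\<close>, and minimality kills all kernel
  coefficients above the socle.\<close>

lemma uniserial_approx:
  fixes F :: "(nat \<Rightarrow> ('v,'e) node \<Rightarrow> 'k::field) set"
  assumes F: "subrep m F"
  shows "\<exists>d vj wj xj. (\<forall>j<d. ok (vj j) (wj j) \<and> xj j \<in> Hs F (vj j) (wj j)) \<and>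
    (\<forall>v w. ok v w \<longrightarrow> (\<forall>x\<in>Hs F v w. \<exists>t\<in>Hs (UT d vj wj) v w. gh d (\<lambda>j. homU (vj j) (wj j) (xj j)) t = x)) \<and>
    (\<forall>t\<in>UT d vj wj. gh d (\<lambda>j. homU (vj j) (wj j) (xj j)) t = 0 \<longrightarrow> (\<forall>a. L a t = 0))"
proof -
  obtain fam0 where fam0: "good F fam0" using good_exists[OF F] by blast
  obtain fam where good: "good F fam" and min: "\<And>fam'. good F fam' \<Longrightarrow> tot fam \<le> tot fam'"
    using ex_has_least_nat[of "good F" fam0 tot] fam0 by blast
  define d where "d = length fam"
  define vj where "vj j = fst (fam!j)" for j
  define wj where "wj j = fst (snd (fam!j))" for j
  define xj where "xj j = snd (snd (fam!j))" for j
  define g where "g j = homU (vj j) (wj j) (xj j)" for j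
  define T :: "(nat \<Rightarrow> ('v,'e) node \<Rightarrow> 'k) set" where "T = {y \<in> Sup d. \<forall>l \<beta>. y l \<beta> \<noteq> 0 \<longrightarrow> (\<exists>i\<le>length (wj l). \<beta> = BU (vj l) (wj l) i)}"
  have fam: "fam!j = (vj j, wj j, xj j)" for j by (simp add: vj_def wj_def xj_def)
  have okj: "ok (vj j) (wj j)" and Hj: "xj j \<in> Hs F (vj j) (wj j)" if "j < d" for j
    using good that nth_mem[of j fam] unfolding good_def fam d_def by auto
  have subT: "V.subspace T"
    using subspace_Sup[of d] by (auto simp: V.subspace_def T_def) (metis add.right_neutral)
  have fac: "\<exists>t\<in>Hs T v w. gh d g t = x" if vw: "ok v w" and x: "x \<in> Hs F v w" for v w x
  proof -
    have "V.subspace (gh d g ` Hs T v w)" by (rule gh.subspace_image[OF subspace_Hs[OF subT]])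
    moreover have "gens (set fam) v w \<subseteq> gh d g ` Hs T v w"
    proof
      fix z assume "z \<in> gens (set fam) v w"
      then obtain q r v' x r' where z: "z = fold L q x" "(v', q @ r, x) \<in> set fam" "w = r @ r'"
        "vt (BU v' (q @ r) (length q)) = v" unfolding gens_def by blast
      then obtain j where j: "j < d" "v' = vj j" "q @ r = wj j" "x = xj j"
        by (metis fam in_set_conv_nth prod.inject d_def)
      let ?\<beta> = "BU v' (q @ r) (length q)"
      have lq: "length q \<le> length (wj j)" "?\<beta> = BU (vj j) (wj j) (length q)"
        using j(2) by (simp_all add: j(3)[symmetric])
      have B: "?\<beta> \<in> Bs" using okj[OF j(1)] lq by simp
      \<comment> \<open>The node at position \<open>length q\<close> realises the map of uniserials
        that is implicit in \<open>gens\<close>.\<close>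
      define t :: "nat \<Rightarrow> ('v,'e) node \<Rightarrow> 'k" where "t = un j ?\<beta>"
      have tS: "t \<in> Sup d" using un_Sup[OF j(1) B] by (simp add: t_def)
      have "l = j \<and> \<beta>' = ?\<beta>" if "t l \<beta>' \<noteq> 0" for l \<beta>'
        using that by (auto simp: t_def un_def split: if_splits)
      then have tT: "t \<in> T" using tS lq unfolding T_def by blast
      have "L a t = 0" if "w = [] \<or> a \<noteq> hd w" for a
      proof -
        have "lst a ?\<beta> = None" using that z(3) by (cases r) (auto simp: nth_append)
        then show ?thesis unfolding t_def by (simp only: L_un[OF B] option.case)
      qed
      moreover have "fold L (w @ [a]) t = 0" for a
      proof -
        have "lsts (w @ [a]) ?\<beta> = None" using z(3) by (simp add: lsts_BU)
        then show ?thesis unfolding t_def by (simp only: wact_un[OF B] option.case)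
      qed
      moreover have "E v t = t" using z(4) by (simp add: t_def E_un del: vt.simps)
      ultimately have "t \<in> Hs T v w" using tT by (simp add: Hs_def del: fold_append)
      moreover have "gh d g t = z"
        using gh_un[OF j(1) B, of g] z(1) j by (simp add: t_def g_def homU_def)
          (metis append_eq_conv_conj)
      ultimately show "z \<in> gh d g ` Hs T v w" by blast
    qed
    ultimately have "V.span (gens (set fam) v w) \<subseteq> gh d g ` Hs T v w" by (intro V.span_minimal)
    then show ?thesis using good vw x unfolding good_def by blast
  qed
  have ker: "L a t = 0" if t: "t \<in> T" "gh d g t = 0" for t a
  proof -
    define c where "c j i = t j (BU (vj j) (wj j) i)" for j i
    have e: "ex (g j) (t j) = (\<Sum>i\<le>length (wj j). sc (c j i) (fold L (take i (wj j)) (xj j)))" if j: "j < d" for j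
    proof -
      let ?I = "BU (vj j) (wj j) ` {..length (wj j)}"
      have "?I \<subseteq> Bs" using okj[OF j] by auto
      moreover have "\<forall>\<beta>\<in>Bs - ?I. sc (t j \<beta>) (g j \<beta>) = 0"
      proof
        fix \<beta> assume "\<beta> \<in> Bs - ?I"
        then have "t j \<beta> = 0" using t(1) unfolding T_def by blast
        then show "sc (t j \<beta>) (g j \<beta>) = 0" by simp
      qed
      ultimately have "ex (g j) (t j) = (\<Sum>\<beta>\<in>?I. sc (t j \<beta>) (g j \<beta>))"
        unfolding ex_def by (intro sum.mono_neutral_right fin_Bs)
      also have "\<dots> = (\<Sum>i\<le>length (wj j). sc (c j i) (fold L (take i (wj j)) (xj j)))"
        by (subst sum.reindex) (auto simp: inj_on_def c_def g_def homU_def)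
      finally show ?thesis .
    qed
    have "(\<Sum>j<length fam. \<Sum>i\<le>length (fst (snd (fam!j))). sc (c j i) (fold L (take i (fst (snd (fam!j)))) (snd (snd (fam!j))))) = gh d g t"
      unfolding gh_def using e by (simp add: d_def fam)
    then have c0: "c j i = 0" if "j < d" "i < length (wj j)" for i j
      using minimal_family_kernel[OF F good min, of c j i] that t(2) by (simp add: d_def wj_def)
    show ?thesis
    proof (intro ext)
      fix l \<beta>
      show "L a t l \<beta> = 0 l \<beta>"
      proof (rule ccontr)
        assume n: "L a t l \<beta> \<noteq> 0 l \<beta>"
        then obtain \<gamma> where g: "\<beta> \<in> Bs" "rst a \<beta> = Some \<gamma>" "t l \<gamma> \<noteq> 0"
          by (auto simp: L_def la_def split: option.splits if_splits)
        then obtain i where "l < d" "\<gamma> = BU (vj l) (wj l) i" using t(1) g(3) unfolding T_def Sup_def by blast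
        moreover have "lst a \<gamma> = Some \<beta>" using rst_lst g by blast
        ultimately show False using c0[of l i] g(3) by (auto simp: c_def split: if_splits)
      qed
    qed
  qed
  have e: "T = UT d vj wj" "g = (\<lambda>j. homU (vj j) (wj j) (xj j))"
    by (simp_all add: T_def UT_def g_def[abs_def])
  have B: "(\<forall>v w. ok v w \<longrightarrow> (\<forall>x\<in>Hs F v w. \<exists>t\<in>Hs (UT d vj wj) v w. gh d (\<lambda>j. homU (vj j) (wj j) (xj j)) t = x)) \<and>
    (\<forall>t\<in>UT d vj wj. gh d (\<lambda>j. homU (vj j) (wj j) (xj j)) t = 0 \<longrightarrow> (\<forall>a. L a t = 0))"
    using fac ker unfolding e by blast
  have A: "\<forall>j<d. ok (vj j) (wj j) \<and> xj j \<in> Hs F (vj j) (wj j)" using okj Hj by blast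
  show ?thesis
    by (rule exI[of _ d], rule exI[of _ vj], rule exI[of _ wj], rule exI[of _ xj], rule conjI[OF A B])
qed

text \<open>Elements concentrated at one vertex suffice because \<open>sum_E\<close> splits every
  vector. A list of least length is independent modulo \<open>M\<close>, since a member with nonzero
  coefficient in a relation could be dropped.\<close>

lemma minimal_homogeneous_complement:
  fixes F :: "(nat \<Rightarrow> ('v,'e) node \<Rightarrow> 'k::field) set"
  assumes F: "subrep m F" and M: "V.subspace M"
  shows "\<exists>(e::nat) vy yy. (\<forall>j<e. vy j \<in> Vs \<and> yy j \<in> F \<and> E (vy j) (yy j) = yy j) \<and>
    F \<subseteq> V.span (M \<union> yy ` {..<e}) \<and> (\<forall>c. (\<Sum>j<e. sc (c j) (yy j)) \<in> M \<longrightarrow> (\<forall>j<e. c j = 0))"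
proof -
  define P where "P ys \<longleftrightarrow> (\<forall>(v,y)\<in>set ys. v \<in> Vs \<and> y \<in> F \<and> E v y = y) \<and> F \<subseteq> V.span (M \<union> snd ` set ys)" for ys
  have "\<exists>ys. P ys"
  proof -
    obtain B where B: "B \<subseteq> F" "F \<subseteq> V.span B" "finite B" using finite_basis_Sup[OF subrepD(1)[OF F]] by metis
    obtain ys where ys: "set ys = (\<lambda>(v,b). (v, E v b)) ` (Vs \<times> B)"
      using finite_list[of "(\<lambda>(v,b). (v, E v b)) ` (Vs \<times> B)"] B(3) fin_Vs by auto
    have "b \<in> V.span (M \<union> snd ` set ys)" if "b \<in> B" for b
    proof -
      have "(\<Sum>v\<in>Vs. E v b) \<in> V.span (M \<union> snd ` set ys)"
        using that ys by (intro V.span_sum V.span_base) force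
      then show ?thesis using sum_E that B(1) subrepD(1)[OF F] by (metis subsetD)
    qed
    then have "V.span B \<subseteq> V.span (M \<union> snd ` set ys)" by (intro V.span_minimal) auto
    then have "F \<subseteq> V.span (M \<union> snd ` set ys)" using B(2) by blast
    then have "P ys" using ys B(1) subrepD(3)[OF F] by (auto simp: P_def E_E)
    then show ?thesis ..
  qed
  then obtain ys where ys: "P ys" and min: "\<And>ys'. P ys' \<Longrightarrow> length ys \<le> length ys'"
    using ex_has_least_nat[of P _ length] by metis
  let ?e = "length ys"
  have img: "snd ` set ys = (\<lambda>j. snd (ys!j)) ` {..<?e}" by (auto simp: set_conv_nth image_iff)
  have zero: "c j = 0" if c: "(\<Sum>j<?e. sc (c j) (snd (ys!j))) \<in> M" and j: "j < ?e" for c j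
  proof (rule ccontr)
    assume n: "c j \<noteq> 0"
    define ys' where "ys' = take j ys @ drop (Suc j) ys"
    have sub: "set ys' \<subseteq> set ys" unfolding ys'_def using set_take_subset set_drop_subset by fastforce
    let ?V = "V.span (M \<union> snd ` set ys')"
    have o: "snd (ys!i) \<in> ?V" if "i < ?e" "i \<noteq> j" for i
    proof -
      have "ys!i \<in> set ys'"
      proof (cases "i < j")
        case True
        then have "take j ys ! i \<in> set (take j ys)" using that by (intro nth_mem) simp
        then show ?thesis using True by (simp add: ys'_def)
      next
        case False
        then have "drop (Suc j) ys ! (i - Suc j) \<in> set (drop (Suc j) ys)" using that by (intro nth_mem) simp
        then show ?thesis using False that by (simp add: ys'_def)
      qed
      then show ?thesis by (intro V.span_base) auto
    qed
    have "sc (c j) (snd (ys!j)) = (\<Sum>j<?e. sc (c j) (snd (ys!j))) - (\<Sum>i\<in>{..<?e}-{j}. sc (c i) (snd (ys!i)))"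
      using j by (subst sum.remove[of "{..<?e}" j]) auto
    also have "\<dots> \<in> ?V"
    proof (rule V.span_diff)
      show "(\<Sum>j<?e. sc (c j) (snd (ys!j))) \<in> ?V" using c by (intro V.span_base) auto
      show "(\<Sum>i\<in>{..<?e}-{j}. sc (c i) (snd (ys!i))) \<in> ?V" using o by (intro V.span_sum V.span_scale) auto
    qed
    finally have "sc (inverse (c j)) (sc (c j) (snd (ys!j))) \<in> ?V" by (rule V.span_scale)
    then have "snd (ys!j) \<in> ?V" using n by simp
    then have "M \<union> snd ` set ys \<subseteq> ?V" unfolding img using o by (auto intro: V.span_base)
    then have "V.span (M \<union> snd ` set ys) \<subseteq> ?V" by (intro V.span_minimal) auto
    then have "P ys'" using ys sub unfolding P_def by blast
    then show False using min[of ys'] j by (simp add: ys'_def)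
  qed
  have A: "\<forall>j<?e. fst (ys!j) \<in> Vs \<and> snd (ys!j) \<in> F \<and> E (fst (ys!j)) (snd (ys!j)) = snd (ys!j)"
    using ys nth_mem[of _ ys] by (auto simp: P_def case_prod_unfold)
  have B: "F \<subseteq> V.span (M \<union> (\<lambda>j. snd (ys!j)) ` {..<?e})" using ys unfolding P_def img by blast
  have C: "\<forall>c. (\<Sum>j<?e. sc (c j) (snd (ys!j))) \<in> M \<longrightarrow> (\<forall>j<?e. c j = 0)" using zero by blast
  define vy yy where "vy = (\<lambda>j. fst (ys!j))" and "yy = (\<lambda>j. snd (ys!j))"
  have "(\<forall>j<?e. vy j \<in> Vs \<and> yy j \<in> F \<and> E (vy j) (yy j) = yy j) \<and>
    F \<subseteq> V.span (M \<union> yy ` {..<?e}) \<and> (\<forall>c. (\<Sum>j<?e. sc (c j) (yy j)) \<in> M \<longrightarrow> (\<forall>j<?e. c j = 0))"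
    using A B C unfolding vy_def yy_def by (intro conjI)
  then show ?thesis by (intro exI)
qed

end

section \<open>Lifting maps out of M along a cover\<close>

context words
begin

interpretation E: Vector_Spaces.linear sc sc "E v" for v by (rule linear_E)
interpretation L: Vector_Spaces.linear sc sc "L a" for a by (rule linear_L)
interpretation wact: Vector_Spaces.linear sc sc "fold L w" for w by (rule linear_wact)
interpretation gh: Vector_Spaces.linear sc sc "gh k g" for k g by (rule linear_gh)

lemma Hs_mono: "F \<subseteq> G \<Longrightarrow> Hs F v w \<subseteq> Hs G v w" by (auto simp: Hs_def)

lemma hm_value_Hs:
  assumes "hm Bs F h" "BU v w 0 \<in> Bs"
  shows "h (BU v w 0) \<in> Hs F v w"
proof -
  have "lst a (BU v w 0) = None" if "w = [] \<or> a \<noteq> hd w" for a using that by (auto simp: hd_conv_nth)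
  then have "L a (h (BU v w 0)) = 0" if "w = [] \<or> a \<noteq> hd w" for a
    using assms that unfolding hm_def by (metis option.case(1))
  moreover have "fold L (w @ [a]) (h (BU v w 0)) = 0" for a
  proof -
    have "lsts (w @ [a]) (BU v w 0) = None" by (simp add: lsts_BU)
    then show ?thesis by (simp only: hm_lsts[OF assms] option.case)
  qed
  moreover have "E v (h (BU v w 0)) = h (BU v w 0)" "h (BU v w 0) \<in> F"
    using assms unfolding hm_def by fastforce+
  ultimately show ?thesis unfolding Hs_def by blast
qed

text \<open>Projectives lift because the cover is onto, and uniserials lift by \<open>fac\<close>. A
  map from an injective that kills the socle factors through the quotient by it, a sum of uniserials
  with one summand for each arrow ending at \<open>u\<close>.\<close>

lemma lift_hom:
  assumes F: "subrep m F"
    and noinj: "\<And>u. u \<in> Vs \<Longrightarrow> h (BI u []) = 0" and h: "hm Bs F h"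
    and g: "\<And>l. l < k \<Longrightarrow> hm Bs F (g l)"
    and surj: "\<And>x. x \<in> F \<Longrightarrow> \<exists>z\<in>Sup k. gh k g z = x"
    and fac: "\<And>v w x. ok v w \<Longrightarrow> x \<in> Hs F v w \<Longrightarrow> \<exists>t\<in>Hs (Sup k) v w. gh k g t = x"
  shows "\<exists>c. hm Bs (Sup k) c \<and> (\<forall>\<beta>\<in>Bs. h \<beta> = gh k g (c \<beta>))"
proof -
  have hF: "h \<beta> \<in> F" if "\<beta> \<in> Bs" for \<beta> using h that by (auto simp: hm_def)
  have P: "\<exists>z. z \<in> Sup k \<and> E v z = z \<and> gh k g z = h (BP v [])" if v: "v \<in> Vs" for v
  proof -
    have B: "BP v [] \<in> Bs" using v Nil_W by (simp add: ok_def)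
    obtain z where z: "z \<in> Sup k" "gh k g z = h (BP v [])" using surj[OF hF[OF B]] by blast
    have "E v (h (BP v [])) = h (BP v [])" using h B unfolding hm_def by fastforce
    then have "gh k g (E v z) = h (BP v [])" using z(2) gh_E[OF g] by simp
    then show ?thesis using z(1) by (intro exI[of _ "E v z"]) (auto simp: E_Sup E_E)
  qed
  have U: "\<exists>t. t \<in> Hs (Sup k) v w \<and> gh k g t = h (BU v w 0)" if "ok v w" for v w
    using fac[OF that hm_value_Hs[OF h]] that by auto
  \<comment> \<open>The node of the longest word ending in \<open>c\<close> is the top of the
    summand belonging to \<open>c\<close>. Since the socle is killed, its image satisfies the
    relations of the word without its last letter.\<close>
  have I: "\<exists>t wc. longest_left c wc \<and> t \<in> Hs (Sup k) (src (hd wc)) (butlast wc) \<and> gh k g t = h (BI u wc)"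
    if c: "c \<in> As" "tgt c = u" for u c
  proof -
    obtain wc where wc: "longest_left c wc" using longest_left_ex c(1) by blast
    then have wcW: "wc \<in> W" "wc \<noteq> []" "last wc = c" by (auto simp: longest_left_def)
    have uV: "u \<in> Vs" using c tgt_in by blast
    have B: "BI u wc \<in> Bs" using wcW c uV by (simp add: eok_def)
    have okb: "ok (src (hd wc)) (butlast wc)"
      using wcW W_prefix[of "butlast wc" "[last wc]"] src_in[of "hd wc"] W_set[of wc]
      by (cases wc) (auto simp: ok_def)
    have 1: "L a (h (BI u wc)) = 0" if "butlast wc = [] \<or> a \<noteq> hd (butlast wc)" for a
    proof (cases "a = hd wc")
      case False
      then have "lst a (BI u wc) = None" by simp
      then show ?thesis using h B unfolding hm_def by (metis option.case(1))
    next
      case True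
      then have bn: "butlast wc = []" using that wcW(2) by (cases wc) (auto split: if_splits)
      then have "wc = [a]" using True wcW(2) by (metis append_butlast_last_id append_Nil list.sel(1))
      then have "lst a (BI u wc) = Some (BI u [])" by simp
      then show ?thesis using h B noinj[OF uV] unfolding hm_def by (metis option.case(2))
    qed
    have 2: "fold L (butlast wc @ [a]) (h (BI u wc)) = 0" for a
    proof -
      consider "lsts (butlast wc @ [a]) (BI u wc) = None" | "lsts (butlast wc @ [a]) (BI u wc) = Some (BI u [])"
        using wcW(2) unfolding lsts_BI by (cases "\<exists>r. wc = (butlast wc @ [a]) @ r") auto
      then show ?thesis
        by cases (simp_all only: hm_lsts[OF h B] option.case noinj[OF uV])
    qed
    have "E (src (hd wc)) (h (BI u wc)) = h (BI u wc)"
      using h B wcW(2) unfolding hm_def by fastforce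
    then have "h (BI u wc) \<in> Hs F (src (hd wc)) (butlast wc)"
      using 1 2 hF[OF B] by (simp add: Hs_def del: fold_append)
    then show ?thesis using fac[OF okb] wc by blast
  qed
  obtain zP where zP: "\<And>v. v \<in> Vs \<Longrightarrow> zP v \<in> Sup k \<and> E v (zP v) = zP v \<and> gh k g (zP v) = h (BP v [])"
    using P by metis
  obtain tU where tU: "\<And>v w. ok v w \<Longrightarrow> tU v w \<in> Hs (Sup k) v w \<and> gh k g (tU v w) = h (BU v w 0)"
    using U by metis
  have "\<forall>c\<in>As. \<exists>p. longest_left c (snd p) \<and> fst p \<in> Hs (Sup k) (src (hd (snd p))) (butlast (snd p)) \<and>
      gh k g (fst p) = h (BI (tgt c) (snd p))"
  proof
    fix c assume "c \<in> As"
    then obtain t wc where "longest_left c wc \<and> t \<in> Hs (Sup k) (src (hd wc)) (butlast wc) \<and> gh k g t = h (BI (tgt c) wc)"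
      using I[of c "tgt c"] by blast
    then show "\<exists>p. longest_left c (snd p) \<and> fst p \<in> Hs (Sup k) (src (hd (snd p))) (butlast (snd p)) \<and>
      gh k g (fst p) = h (BI (tgt c) (snd p))" by (intro exI[of _ "(t, wc)"]) simp
  qed
  then obtain p where p: "\<And>c. c \<in> As \<Longrightarrow> longest_left c (snd (p c)) \<and>
      fst (p c) \<in> Hs (Sup k) (src (hd (snd (p c)))) (butlast (snd (p c))) \<and> gh k g (fst (p c)) = h (BI (tgt c) (snd (p c)))"
    using bchoice by (metis (no_types, lifting))
  define tI wc where "tI = (\<lambda>(u::'v) c. fst (p c))" and "wc = (\<lambda>(u::'v) c. snd (p c))"
  have tI: "longest_left c (wc u c) \<and>
      tI u c \<in> Hs (Sup k) (src (hd (wc u c))) (butlast (wc u c)) \<and> gh k g (tI u c) = h (BI u (wc u c))"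
    if "c \<in> As" "tgt c = u" for c u using p[OF that(1)] that(2) by (simp add: tI_def wc_def)
  \<comment> \<open>The lifts are glued node by node: a nonempty word of an injective finds its
    uniserial by its last letter, and the socle node goes to 0.\<close>
  define c where "c \<beta> = (case \<beta> of BP v w \<Rightarrow> homP v (zP v) \<beta> | BU v w i \<Rightarrow> homU v w (tU v w) \<beta> |
      BI u w \<Rightarrow> if w = [] then 0 else homI u (wc u (last w)) (tI u (last w)) \<beta>)" for \<beta>
  have cl: "last w \<in> As \<and> tgt (last w) = u" if "eok u w" "w \<noteq> []" for u w
    using that W_set[of w] by (auto simp: eok_def)
  have pt: "c \<beta> \<in> Sup k \<and> E (vt \<beta>) (c \<beta>) = c \<beta> \<and> (\<forall>a. L a (c \<beta>) = (case lst a \<beta> of None \<Rightarrow> 0 | Some \<gamma> \<Rightarrow> c \<gamma>)) \<and>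
      h \<beta> = gh k g (c \<beta>)" if b: "\<beta> \<in> Bs" for \<beta>
  proof (cases \<beta>)
    case (BP v w)
    have v: "v \<in> Vs" using b BP by (simp add: ok_def)
    have hm: "hm Bs (Sup k) (homP v (zP v))" using hm_homP[OF subrep_Sup] zP[OF v] by blast
    have l: "(case lst a \<beta> of None \<Rightarrow> 0 | Some \<gamma> \<Rightarrow> c \<gamma>) = (case lst a \<beta> of None \<Rightarrow> 0 | Some \<gamma> \<Rightarrow> homP v (zP v) \<gamma>)" for a
      using BP by (simp add: c_def)
    have "gh k g (c \<beta>) = fold L w (h (BP v []))"
      using BP zP[OF v] gh_wact[OF g] by (simp add: c_def homP_def)
    also have "\<dots> = h \<beta>" using hm_lsts[OF h, of "BP v []" w] lsts_BP[of v "[]" w] b BP v Nil_W by (simp add: ok_def)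
    finally show ?thesis using hm b unfolding l hm_def by (simp add: c_def BP del: vt.simps lst.simps)
  next
    case (BU v w i)
    have v: "ok v w" "i \<le> length w" using b BU by simp_all
    have hm: "hm Bs (Sup k) (homU v w (tU v w))" using hm_homU[OF subrep_Sup] tU[OF v(1)] by blast
    have l: "(case lst a \<beta> of None \<Rightarrow> 0 | Some \<gamma> \<Rightarrow> c \<gamma>) = (case lst a \<beta> of None \<Rightarrow> 0 | Some \<gamma> \<Rightarrow> homU v w (tU v w) \<gamma>)" for a
      using BU by (simp add: c_def)
    have "gh k g (c \<beta>) = fold L (take i w) (h (BU v w 0))"
      using BU tU[OF v(1)] gh_wact[OF g] by (simp add: c_def homU_def)
    also have "lsts (take i w) (BU v w 0) = Some (BU v w i)"
      using v(2) by (auto simp: lsts_BU intro: exI[of _ "drop i w"])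
    then have "fold L (take i w) (h (BU v w 0)) = h \<beta>" using hm_lsts[OF h, of "BU v w 0" "take i w"] BU v(1) by simp
    finally show ?thesis using hm b unfolding l hm_def by (simp add: c_def BU del: vt.simps lst.simps)
  next
    case (BI u w)
    have e: "eok u w" "u \<in> Vs" using b BI by (simp_all add: eok_def)
    show ?thesis
    proof (cases "w = []")
      case True
      then show ?thesis using BI noinj[OF e(2)] subspace_Sup[of k] V.subspace_0 by (auto simp: c_def gh.zero)
    next
      case False
      let ?wc = "wc u (last w)" and ?t = "tI u (last w)"
      have t: "longest_left (last w) ?wc" "?t \<in> Hs (Sup k) (src (hd ?wc)) (butlast ?wc)" "gh k g ?t = h (BI u ?wc)"
        using tI[of "last w" u] cl[OF e(1) False] by auto
      have hm: "hm Bs (Sup k) (homI u ?wc ?t)" using hm_homI[OF subrep_Sup t(1,2)] .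
      have l: "(case lst a \<beta> of None \<Rightarrow> 0 | Some \<gamma> \<Rightarrow> c \<gamma>) = (case lst a \<beta> of None \<Rightarrow> 0 | Some \<gamma> \<Rightarrow> homI u ?wc ?t \<gamma>)" for a
        using BI False by (auto simp: c_def homI_def last_tl)
      obtain q where q: "?wc = q @ w" using t(1) e(1) False by (auto simp: longest_left_def eok_def)
      then have "gh k g (c \<beta>) = fold L q (h (BI u ?wc))"
        using BI False t(3) gh_wact[OF g] by (simp add: c_def homI_def)
      also have "\<dots> = h \<beta>"
      proof -
        have "BI u ?wc \<in> Bs" using t(1) e cl[OF e(1) False] by (auto simp: longest_left_def eok_def)
        moreover have "lsts q (BI u ?wc) = Some (BI u w)" using q by (auto simp: lsts_BI)
        ultimately show ?thesis using hm_lsts[OF h, of "BI u ?wc" q] BI by simp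
      qed
      finally show ?thesis using hm b False unfolding l hm_def by (simp add: c_def BI del: vt.simps lst.simps)
    qed
  qed
  then have "hm Bs (Sup k) c" unfolding hm_def by blast
  with pt show ?thesis by blast
qed

end

lemma sum_lessThan_add: "(\<Sum>l<d + e. f l) = (\<Sum>l<d. f l) + (\<Sum>j<e. f (d + j))"
  for f :: "nat \<Rightarrow> 'a::comm_monoid_add"
  by (induction e) (auto simp: add.assoc)

section \<open>The case where maps from injectives kill the socle\<close>

context words
begin

interpretation E: Vector_Spaces.linear sc sc "E v" for v by (rule linear_E)
interpretation L: Vector_Spaces.linear sc sc "L a" for a by (rule linear_L)
interpretation wact: Vector_Spaces.linear sc sc "fold L w" for w by (rule linear_wact)
interpretation gh: Vector_Spaces.linear sc sc "gh k g" for k g by (rule linear_gh)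

lemma ex_un_restrict:
  assumes "D \<subseteq> Bs"
  shows "ex (\<lambda>\<beta>. if \<beta> \<in> D then un l \<beta> else 0) (\<lambda>\<beta>. if \<beta> \<in> D then x \<beta> else 0) =
    (\<lambda>l' \<beta>. if l' = l \<and> \<beta> \<in> D then x \<beta> else 0)"
proof (intro ext)
  fix l' \<beta>
  have "ex (\<lambda>\<beta>. if \<beta> \<in> D then un l \<beta> else 0) (\<lambda>\<beta>. if \<beta> \<in> D then x \<beta> else 0) l' \<beta> =
    (\<Sum>\<gamma>\<in>Bs. if \<gamma> = \<beta> then (if l' = l \<and> \<beta> \<in> D then x \<beta> else 0) else 0)"
    unfolding ex_def sum_fun_apply2 by (intro sum.cong) (auto simp: un_def)
  also have "\<dots> = (if l' = l \<and> \<beta> \<in> D then x \<beta> else 0)" using fin_Bs assms by auto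
  finally show "ex (\<lambda>\<beta>. if \<beta> \<in> D then un l \<beta> else 0) (\<lambda>\<beta>. if \<beta> \<in> D then x \<beta> else 0) l' \<beta> =
    (if l' = l \<and> \<beta> \<in> D then x \<beta> else 0)" .
qed

lemma subrep_support:
  assumes K: "subrep k K" and C: "\<And>l a \<beta> \<gamma>. \<beta> \<in> Bs \<Longrightarrow> lst a \<beta> = Some \<gamma> \<Longrightarrow> \<beta> \<in> C l \<longleftrightarrow> \<gamma> \<in> C l"
  shows "subrep k {y\<in>K. \<forall>l \<beta>. y l \<beta> \<noteq> 0 \<longrightarrow> \<beta> \<in> C l}"
proof -
  have "\<beta> \<in> C l" if y: "\<forall>l \<beta>. y l \<beta> \<noteq> 0 \<longrightarrow> \<beta> \<in> C l" "L a y l \<beta> \<noteq> 0" for a y l \<beta>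
  proof -
    obtain \<gamma> where "\<beta> \<in> Bs" "rst a \<beta> = Some \<gamma>" "y l \<gamma> \<noteq> 0"
      using y(2) by (auto simp: L_def la_def split: option.splits if_splits)
    then show ?thesis using y(1) C rst_lst rst_Bs by blast
  qed
  moreover have "\<beta> \<in> C l" if "\<forall>l \<beta>. y l \<beta> \<noteq> 0 \<longrightarrow> \<beta> \<in> C l" "E a y l \<beta> \<noteq> 0" for a y l \<beta>
    using that by (auto simp: E_def ea_def split: if_splits)
  moreover have "V.subspace (K \<inter> {y. \<forall>l \<beta>. y l \<beta> \<noteq> 0 \<longrightarrow> \<beta> \<in> C l})"
    by (rule V.subspace_inter[OF subrepD(2)[OF K]]) (auto simp: V.subspace_def, metis add.right_neutral)
  moreover have "{y\<in>K. \<forall>l \<beta>. y l \<beta> \<noteq> 0 \<longrightarrow> \<beta> \<in> C l} = K \<inter> {y. \<forall>l \<beta>. y l \<beta> \<noteq> 0 \<longrightarrow> \<beta> \<in> C l}" by auto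
  ultimately show ?thesis using subrepD(1,3,4)[OF K] unfolding subrep_def
    by (intro conjI ballI allI) auto
qed

text \<open>The nodes outside \<open>C l\<close> span a summand of the power of M that lies inside
  \<open>K\<close>, so it splits off. This disposes of the parts of a copy of M on which an
  approximation is zero, when only one of its summands is really used.\<close>

lemma retr_peel_off:
  fixes K :: "(nat \<Rightarrow> ('v,'e) node \<Rightarrow> 'k::field) set"
  assumes K: "subrep k K" and C: "\<And>l a \<beta> \<gamma>. \<beta> \<in> Bs \<Longrightarrow> lst a \<beta> = Some \<gamma> \<Longrightarrow> \<beta> \<in> C l \<longleftrightarrow> \<gamma> \<in> C l"
    and un: "\<And>l \<beta>. l < k \<Longrightarrow> \<beta> \<in> Bs - C l \<Longrightarrow> un l \<beta> \<in> K"
    and r: "retr {y\<in>K. \<forall>l \<beta>. y l \<beta> \<noteq> 0 \<longrightarrow> \<beta> \<in> C l}"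
  shows "retr K"
proof -
  define \<kappa> :: "nat \<Rightarrow> ('v,'e) node \<Rightarrow> nat \<Rightarrow> ('v,'e) node \<Rightarrow> 'k" where "\<kappa> l = (\<lambda>\<beta>. if \<beta> \<in> Bs - C l then un l \<beta> else 0)" for l
  define i where "i l y = (\<lambda>\<beta>. if \<beta> \<in> Bs - C l then y l \<beta> else 0)" for l and y :: "nat \<Rightarrow> ('v,'e) node \<Rightarrow> 'k"
  show ?thesis
  proof (rule retr_peel[OF K, of "{..<k}" \<kappa> i])
    show "hm Bs K (\<kappa> l)" if l: "l \<in> {..<k}" for l
      unfolding hm_def
    proof (intro ballI conjI allI)
      fix \<beta> assume b: "\<beta> \<in> Bs"
      show "\<kappa> l \<beta> \<in> K" using un b l subrepD(2)[OF K] V.subspace_0 by (auto simp: \<kappa>_def)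
      show "E (vt \<beta>) (\<kappa> l \<beta>) = \<kappa> l \<beta>" by (simp add: \<kappa>_def E_un)
      show "L a (\<kappa> l \<beta>) = (case lst a \<beta> of None \<Rightarrow> 0 | Some \<gamma> \<Rightarrow> \<kappa> l \<gamma>)" for a
        using b L_un[OF b, of a l] C[OF b, of a _ l] lst_Bs[OF b] by (auto simp: \<kappa>_def split: option.splits)
    qed
    show "khom K (i l)" for l
    proof (rule khom_coord[where D = "Bs - C l" and f = "\<lambda>\<beta>. \<beta>" and l = l])
      show "(case rst a \<beta> of None \<Rightarrow> 0 | Some \<gamma> \<Rightarrow> y l \<gamma>) = (case rst a \<beta> of None \<Rightarrow> 0 | Some \<gamma> \<Rightarrow> i l y \<gamma>)"
        if "\<beta> \<in> Bs - C l" for y a \<beta>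
        using that rst_Bs[of \<beta> a] rst_lst[of \<beta> a] C by (auto simp: i_def split: option.splits)
      show "\<gamma> \<notin> Bs - C l" if "\<beta> \<in> Bs" "\<beta> \<notin> Bs - C l" "rst a \<beta> = Some \<gamma>" for \<beta> a \<gamma>
        using that rst_Bs rst_lst C by blast
    qed (use subrepD[OF K] in \<open>auto simp: i_def\<close>)
    show "y - (\<Sum>s<k. ex (\<kappa> s) (i s y)) \<in> {y\<in>K. \<forall>l \<beta>. y l \<beta> \<noteq> 0 \<longrightarrow> \<beta> \<in> C l}" if y: "y \<in> K" for y
    proof -
      have e: "ex (\<kappa> s) (i s y) = (\<lambda>l \<beta>. if l = s \<and> \<beta> \<in> Bs - C s then y s \<beta> else 0)" for s
        unfolding \<kappa>_def i_def by (rule ex_un_restrict) auto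
      have "(\<Sum>s<k. ex (\<kappa> s) (i s y)) = (\<lambda>l \<beta>. if \<beta> \<in> Bs - C l then y l \<beta> else 0)"
      proof (intro ext)
        fix l \<beta>
        have "(\<Sum>s<k. ex (\<kappa> s) (i s y)) l \<beta> = (\<Sum>s<k. if s = l then (if \<beta> \<in> Bs - C l then y l \<beta> else 0) else 0)"
          unfolding sum_fun_apply2 e by (intro sum.cong) auto
        also have "\<dots> = (if \<beta> \<in> Bs - C l then y l \<beta> else 0)"
          using y subrepD(1)[OF K] by (auto simp: Sup_def)
        finally show "(\<Sum>s<k. ex (\<kappa> s) (i s y)) l \<beta> = (if \<beta> \<in> Bs - C l then y l \<beta> else 0)" .
      qed
      then have 1: "(y - (\<Sum>s<k. ex (\<kappa> s) (i s y))) l \<beta> = (if \<beta> \<in> Bs - C l then 0 else y l \<beta>)" for l \<beta>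
        by (simp only: diff_fun_apply2) simp
      have "ex (\<kappa> s) (i s y) \<in> K" if "s < k" for s
        using un that subrepD(2)[OF K] V.subspace_0 by (intro ex_in) (auto simp: \<kappa>_def)
      then have "y - (\<Sum>s<k. ex (\<kappa> s) (i s y)) \<in> K"
        using y subrepD(2)[OF K] by (intro V.subspace_diff V.subspace_sum) auto
      moreover have "y l \<beta> \<noteq> 0 \<Longrightarrow> \<beta> \<in> Bs" for l \<beta> using y subrepD(1)[OF K] by (auto simp: Sup_def)
      ultimately show ?thesis using 1 by (auto split: if_splits)
    qed
  qed (use r in auto)
qed

lemma subrep_UT: "subrep d (UT d vj wj :: (nat \<Rightarrow> ('v,'e) node \<Rightarrow> 'k::field) set)"
proof -
  let ?C = "\<lambda>l. {BU (vj l) (wj l) i | i. i \<le> length (wj l)}"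
  have e: "(UT d vj wj :: (nat \<Rightarrow> ('v,'e) node \<Rightarrow> 'k) set) = {y \<in> Sup d. \<forall>l \<beta>. y l \<beta> \<noteq> 0 \<longrightarrow> \<beta> \<in> ?C l}" unfolding UT_def by auto
  have c: "\<beta> \<in> ?C l \<longleftrightarrow> \<gamma> \<in> ?C l" if "\<beta> \<in> Bs" "lst a \<beta> = Some \<gamma>" for l a \<beta> \<gamma>
    using that by (cases \<beta>) (auto split: if_splits)
  show ?thesis unfolding e by (rule subrep_support[OF subrep_Sup c])
qed

text \<open>The uniserials cover the image of every arrow, so projectives on elements independent
  modulo that cover complete it to a surjection and enter the kernel only through their radicals.
  The kernel is then an extension of a sum of radicals by a semisimple part, and it splits because
  each generator of a radical can be corrected by an element of \<open>T\<close> to lie in the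
  kernel.\<close>

lemma approx_base:
  fixes F :: "(nat \<Rightarrow> ('v,'e) node \<Rightarrow> 'k::field) set"
  assumes F: "subrep m F"
    and noinj: "\<And>u h. u \<in> Vs \<Longrightarrow> hm {BI u w | w. eok u w} F h \<Longrightarrow> h (BI u []) = 0"
  shows "approx F"
proof -
  obtain d vj wj xj where H: "(\<forall>j<d. ok (vj j) (wj j) \<and> xj j \<in> Hs F (vj j) (wj j)) \<and>
    (\<forall>v w. ok v w \<longrightarrow> (\<forall>x\<in>Hs F v w. \<exists>t\<in>Hs (UT d vj wj) v w. gh d (\<lambda>j. homU (vj j) (wj j) (xj j)) t = x)) \<and>
    (\<forall>t\<in>UT d vj wj. gh d (\<lambda>j. homU (vj j) (wj j) (xj j)) t = 0 \<longrightarrow> (\<forall>a. L a t = 0))"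
    using uniserial_approx[OF F] by (elim exE) (rule that)
  then have okj: "\<And>j. j < d \<Longrightarrow> ok (vj j) (wj j) \<and> xj j \<in> Hs F (vj j) (wj j)"
    and fac: "\<And>v w x. ok v w \<Longrightarrow> x \<in> Hs F v w \<Longrightarrow> \<exists>t\<in>Hs (UT d vj wj) v w. gh d (\<lambda>j. homU (vj j) (wj j) (xj j)) t = x"
    and ker: "\<And>t a. t \<in> UT d vj wj \<Longrightarrow> gh d (\<lambda>j. homU (vj j) (wj j) (xj j)) t = 0 \<Longrightarrow> L a t = 0"
    by blast+
  define T :: "(nat \<Rightarrow> ('v,'e) node \<Rightarrow> 'k) set" where "T = UT d vj wj"
  define g0 where "g0 = (\<lambda>j. homU (vj j) (wj j) (xj j))"
  define M where "M = gh d g0 ` T"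
  have T: "subrep d T" unfolding T_def by (rule subrep_UT)
  have subM: "V.subspace M" unfolding M_def by (rule gh.subspace_image[OF subrepD(2)[OF T]])
  have fac: "\<exists>t\<in>Hs T v w. gh d g0 t = x" if "ok v w" "x \<in> Hs F v w" for v w x
    using fac[OF that] by (simp add: T_def g0_def)
  have ker: "L a t = 0" if "t \<in> T" "gh d g0 t = 0" for a t using ker that by (simp add: T_def g0_def)
  obtain e :: nat and vy yy where H: "(\<forall>j<e. vy j \<in> Vs \<and> yy j \<in> F \<and> E (vy j) (yy j) = yy j) \<and>
    F \<subseteq> V.span (M \<union> yy ` {..<e}) \<and> (\<forall>c. (\<Sum>j<e. sc (c j) (yy j)) \<in> M \<longrightarrow> (\<forall>j<e. c j = 0))"
    using minimal_homogeneous_complement[OF F subM] by (elim exE) (rule that)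
  then have yy: "\<And>j. j < e \<Longrightarrow> vy j \<in> Vs \<and> yy j \<in> F \<and> E (vy j) (yy j) = yy j"
    and gen: "F \<subseteq> V.span (M \<union> yy ` {..<e})" and indep: "\<And>c j. (\<Sum>j<e. sc (c j) (yy j)) \<in> M \<Longrightarrow> j < e \<Longrightarrow> c j = 0"
    by blast+
  define k where "k = d + e"
  define g where "g l = (if l < d then g0 l else homP (vy (l - d)) (yy (l - d)))" for l
  have FS: "F \<subseteq> Sup m" using subrepD(1)[OF F] .
  have g0F: "hm Bs F (g0 l)" if "l < d" for l using hm_homU[OF F] okj[OF that] by (simp add: g0_def)
  have gF: "hm Bs F (g l)" if "l < k" for l
    using g0F hm_homP[OF F] yy[of "l - d"] that by (auto simp: g_def k_def)
  have TS: "T \<subseteq> Sup d" using subrepD(1)[OF T] .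
  have SS: "Sup d \<subseteq> Sup k" unfolding Sup_def k_def using trans_less_add1 by blast
  have ghT: "gh k g t = gh d g0 t" if "t \<in> Sup d" for t
  proof -
    have "t (d + j) = 0" for j using that by (auto simp: Sup_def fun_eq_iff)
    then show ?thesis unfolding gh_def k_def sum_lessThan_add by (simp add: g_def ex_def)
  qed
  obtain pa where pa: "\<And>a. a \<in> As \<Longrightarrow> longest_right a (pa a)" using longest_right_ex by metis
  \<comment> \<open>The radical of \<open>F\<close> lies in the image of \<open>T\<close>: an
    element \<open>L a y\<close> comes from the uniserial of the longest word after
    \<open>a\<close>.\<close>
  have LM: "L a y \<in> M" if y: "y \<in> F" for a y
  proof (cases "a \<in> As")
    case True
    obtain t where "t \<in> Hs T (tgt a) (pa a)" "gh d g0 t = L a y"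
      using fac[OF ok_longest_right[OF pa[OF True] True] L_in_Hs[OF F y pa[OF True]]] by blast
    then show ?thesis unfolding M_def using Hs_sub[of T "tgt a" "pa a"] by (metis imageI subsetD)
  next
    case False
    then show ?thesis using L_zero[OF subsetD[OF FS y]] V.subspace_0[OF subM] by simp
  qed
  have vB: "BP (vy j) [] \<in> Bs" if "j < e" for j using yy[OF that] Nil_W by (simp add: ok_def)
  have surj: "\<exists>z\<in>Sup k. gh k g z = x" if x: "x \<in> F" for x
  proof -
    have "V.span (M \<union> yy ` {..<e}) \<subseteq> gh k g ` Sup k"
    proof (rule V.span_minimal[OF _ gh.subspace_image[OF subspace_Sup]])
      have "yy j \<in> gh k g ` Sup k" if j: "j < e" for j
      proof (rule image_eqI)
        show "un (d + j) (BP (vy j) []) \<in> Sup k"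
          by (rule un_Sup) (use vB[OF j] j in \<open>auto simp: k_def\<close>)
        show "yy j = gh k g (un (d + j) (BP (vy j) []))"
          using gh_un[of "d + j" k "BP (vy j) []" g] vB[OF j] j by (simp add: k_def g_def homP_def)
      qed
      moreover have "M \<subseteq> gh k g ` Sup k"
      proof
        fix x assume "x \<in> M"
        then obtain t where t: "t \<in> T" "x = gh d g0 t" by (auto simp: M_def)
        show "x \<in> gh k g ` Sup k"
          by (rule image_eqI[of _ _ t]) (use t TS SS ghT in \<open>auto dest!: subsetD\<close>)
      qed
      ultimately show "M \<union> yy ` {..<e} \<subseteq> gh k g ` Sup k" by blast
    qed
    then show ?thesis using gen x by blast
  qed
  have fack: "\<exists>t\<in>Hs (Sup k) v w. gh k g t = x" if vw: "ok v w" "x \<in> Hs F v w" for v w x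
  proof -
    obtain t where t: "t \<in> Hs T v w" "gh d g0 t = x" using fac[OF vw] by blast
    then have "t \<in> Hs (Sup k) v w" "t \<in> Sup d" using Hs_mono[of T "Sup k"] TS SS Hs_sub by blast+
    then show ?thesis using ghT t(2) by metis
  qed
  have lift: "\<exists>c. hm Bs (Sup k) c \<and> (\<forall>\<beta>\<in>Bs. h \<beta> = gh k g (c \<beta>))" if h: "hm Bs F h" for h
  proof (rule lift_hom[OF F _ h gF surj fack])
    fix u assume u: "u \<in> Vs"
    have "hm {BI u w | w. eok u w} F h" by (rule hm_mono[OF h order.refl]) auto
    then show "h (BI u []) = 0" by (rule noinj[OF u])
  qed
  define K where "K = {y \<in> Sup k. gh k g y = 0}"
  have K: "subrep k K" unfolding K_def by (rule ker_subrep[OF gF])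
  \<comment> \<open>The summand of each copy of M that is really used: a uniserial in the first
    \<open>d\<close> copies, a projective in the others.\<close>
  define C where "C l = (if l < d then {BU (vj l) (wj l) i | i. i \<le> length (wj l)} else {BP (vy (l - d)) w | w. ok (vy (l - d)) w})" for l
  have C: "\<beta> \<in> C l \<longleftrightarrow> \<gamma> \<in> C l" if "\<beta> \<in> Bs" "lst a \<beta> = Some \<gamma>" for l a \<beta> \<gamma>
    using that by (cases \<beta>) (auto simp: C_def split: if_splits)
  define N1 where "N1 = {y\<in>K. \<forall>l \<beta>. y l \<beta> \<noteq> 0 \<longrightarrow> \<beta> \<in> C l}"
  have N1: "subrep k N1" unfolding N1_def by (rule subrep_support[OF K C])
  \<comment> \<open>Modulo the image of \<open>T\<close> only the tops of the projectives survive in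
    the equation \<open>gh k g y = 0\<close>, and their images \<open>yy j\<close> are independent
    there.\<close>
  have top0: "y (d + j) (BP (vy j) []) = 0" if y: "y \<in> N1" and j: "j < e" for y j
  proof -
    have M1: "ex (g l) (y l) \<in> M" if "l < d" for l
      unfolding ex_def
    proof (intro V.subspace_sum[OF subM] V.subspace_scale[OF subM])
      fix \<beta> assume b: "\<beta> \<in> Bs"
      show "g l \<beta> \<in> M"
      proof (cases "\<exists>i\<le>length (wj l). \<beta> = BU (vj l) (wj l) i")
        case True
        then have "un l \<beta> \<in> T" using that b by (auto simp: T_def UT_def Sup_def un_def split: if_splits)
        moreover have "gh d g0 (un l \<beta>) = g l \<beta>" using gh_un[OF that b] that by (simp add: g_def)
        ultimately show ?thesis unfolding M_def by (metis imageI)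
      next
        case False
        then have "g l \<beta> = 0" using that b by (auto simp: g_def g0_def homU_def split: node.splits)
        then show ?thesis using V.subspace_0[OF subM] by simp
      qed
    qed
    have M2: "ex (g (d + j)) (y (d + j)) - sc (y (d + j) (BP (vy j) [])) (yy j) \<in> M" if j: "j < e" for j
    proof -
      have "homP (vy j) (yy j) \<beta> \<in> M" if b: "\<beta> \<in> Bs - {BP (vy j) []}" for \<beta>
      proof (cases "\<exists>w. \<beta> = BP (vy j) w")
        case True
        then obtain w where w: "\<beta> = BP (vy j) w" "w \<noteq> []" using b by blast
        then have "fold L w (yy j) = L (last w) (fold L (butlast w) (yy j))"
          by (metis append_butlast_last_id comp_apply fold.simps(1) fold_append fold_simps(2) fold_simps(1))
        then show ?thesis using w LM subrepD(5)[OF F] yy[OF j] by (simp add: homP_def)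
      next
        case False
        then have "homP (vy j) (yy j) \<beta> = 0" by (auto simp: homP_def split: node.splits)
        then show ?thesis using V.subspace_0[OF subM] by simp
      qed
      then have "(\<Sum>\<beta>\<in>Bs - {BP (vy j) []}. sc (y (d + j) \<beta>) (homP (vy j) (yy j) \<beta>)) \<in> M"
        by (intro V.subspace_sum[OF subM] V.subspace_scale[OF subM])
      moreover have "ex (g (d + j)) (y (d + j)) = sc (y (d + j) (BP (vy j) [])) (yy j) +
         (\<Sum>\<beta>\<in>Bs - {BP (vy j) []}. sc (y (d + j) \<beta>) (homP (vy j) (yy j) \<beta>))"
        unfolding ex_def using fin_Bs vB[OF j] by (subst sum.remove[of Bs "BP (vy j) []"]) (auto simp: g_def homP_def)
      ultimately show ?thesis by simp
    qed
    have neg: "0 = A + Z \<Longrightarrow> Z = - A" for A Z :: "nat \<Rightarrow> ('v,'e) node \<Rightarrow> 'k"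
      by (metis add.commute eq_neg_iff_add_eq_0)
    have "0 = gh k g y" using y by (simp add: N1_def K_def)
    also have "\<dots> = (\<Sum>l<d. ex (g l) (y l)) + (\<Sum>j<e. ex (g (d + j)) (y (d + j)) - sc (y (d + j) (BP (vy j) [])) (yy j))
       + (\<Sum>j<e. sc (y (d + j) (BP (vy j) [])) (yy j))"
      unfolding gh_def k_def sum_lessThan_add by (simp add: sum_subtractf)
    finally have "(\<Sum>j<e. sc (y (d + j) (BP (vy j) [])) (yy j)) =
      - ((\<Sum>l<d. ex (g l) (y l)) + (\<Sum>j<e. ex (g (d + j)) (y (d + j)) - sc (y (d + j) (BP (vy j) [])) (yy j)))"
      by (rule neg)
    also have "\<dots> \<in> M" using M1 M2
      by (intro V.subspace_neg[OF subM] V.subspace_add[OF subM] V.subspace_sum[OF subM]) auto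
    finally show ?thesis by (rule indep[OF _ j])
  qed
  \<comment> \<open>The kernel of \<open>T\<close> itself, killed by all arrows because the family
    was minimal.\<close>
  define N2 where "N2 = {y\<in>N1. \<forall>l\<ge>d. y l = 0}"
  have "retr N2"
  proof (rule retr_semisimple)
    have "subrep k {y\<in>N1. \<forall>l \<beta>. y l \<beta> \<noteq> 0 \<longrightarrow> \<beta> \<in> (if l < d then UNIV else {})}"
      by (rule subrep_support[OF N1]) auto
    moreover have "{y\<in>N1. \<forall>l \<beta>. y l \<beta> \<noteq> 0 \<longrightarrow> \<beta> \<in> (if l < d then UNIV else {})} = N2"
      unfolding N2_def by (auto simp: fun_eq_iff not_less split: if_splits)
    ultimately show "subrep k N2" by simp
    fix a y assume y: "y \<in> N2"
    have yS: "y \<in> Sup d" using y unfolding N2_def N1_def K_def Sup_def by auto (metis not_le zero_fun_apply)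
    moreover have "\<exists>i\<le>length (wj l). \<beta> = BU (vj l) (wj l) i" if "y l \<beta> \<noteq> 0" for l \<beta>
    proof -
      have "l < d" using yS that by (auto simp: Sup_def)
      moreover have "\<beta> \<in> C l" using y that unfolding N2_def N1_def by blast
      ultimately show ?thesis by (auto simp: C_def)
    qed
    ultimately have "y \<in> T" by (auto simp: T_def UT_def)
    moreover have "gh d g0 y = 0" using ghT[OF yS] y by (simp add: N2_def N1_def K_def)
    ultimately show "L a y = 0" by (rule ker)
  qed
  have "retr N1"
  proof -
    \<comment> \<open>One index for each projective copy \<open>l\<close> and each arrow leaving its
      top vertex, that is, for each uniserial summand of the radicals.\<close>
    define S where "S = {(l, a). d \<le> l \<and> l < k \<and> a \<in> As \<and> src a = vy (l - d)}"
    have S: "finite S" by (rule finite_subset[of _ "{..<k} \<times> As"]) (auto simp: S_def fin_As)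
    have "\<exists>t. t \<in> Hs T (tgt a) (pa a) \<and> gh d g0 t = L a (yy j)" if "a \<in> As" "j < e" for a j
      using fac[OF ok_longest_right[OF pa that(1)] L_in_Hs[OF F _ pa]] that yy by blast
    then obtain t where t: "\<And>a j. a \<in> As \<Longrightarrow> j < e \<Longrightarrow> t a j \<in> Hs T (tgt a) (pa a) \<and> gh d g0 (t a j) = L a (yy j)"
      by metis
    \<comment> \<open>The element \<open>a\<close> of a projective and its correction
      \<open>t\<close> from \<open>T\<close> have the same image in \<open>F\<close>. Their
      difference is the top of a uniserial inside the kernel.\<close>
    define z :: "nat \<times> 'e \<Rightarrow> nat \<Rightarrow> ('v,'e) node \<Rightarrow> 'k" where "z = (\<lambda>(l, a). un l (BP (vy (l - d)) [a]) - t a (l - d))"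
    define \<kappa> where "\<kappa> = (\<lambda>s. homU (tgt (snd s)) (pa (snd s)) (z s))"
    define D where "D a = {BU (tgt a) (pa a) n | n. n \<le> length (pa a)}" for a
    \<comment> \<open>The n-th node of the uniserial after \<open>a\<close> is identified with the
      node of \<open>a # take n (pa a)\<close> in the projective.\<close>
    define f where "f s \<beta> = (case \<beta> of BU v w n \<Rightarrow> BP (vy (fst s - d)) (snd s # take n (pa (snd s))) | _ \<Rightarrow> \<beta>)" for s :: "nat \<times> 'e" and \<beta> :: "('v,'e) node"
    define i where "i s y = (\<lambda>\<beta>. if \<beta> \<in> D (snd s) then y (fst s) (f s \<beta>) else 0)" for s :: "nat \<times> 'e" and y :: "nat \<Rightarrow> ('v,'e) node \<Rightarrow> 'k"
    have okt: "ok (vy (l - d)) (a # take n (pa a))" if "(l, a) \<in> S" for l a n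
    proof -
      have "(a # take n (pa a)) @ drop n (pa a) \<in> W" using pa[of a] that by (auto simp: S_def longest_right_def)
      then have "a # take n (pa a) \<in> W" using W_prefix by blast
      then show ?thesis using that yy[of "l - d"] by (auto simp: ok_def S_def k_def)
    qed
    have okpa: "ok (tgt a) (pa a)" if "a \<in> As" for a by (rule ok_longest_right[OF pa[OF that] that])
    have DB: "D a \<subseteq> Bs" if "a \<in> As" for a using okpa[OF that] by (auto simp: D_def)
    have Lun: "L a (un l (BP (vy (l - d)) []) :: nat \<Rightarrow> ('v,'e) node \<Rightarrow> 'k) = un l (BP (vy (l - d)) [a])" if "(l, a) \<in> S" for l a
    proof -
      have "BP (vy (l - d)) [] \<in> Bs" using vB[of "l - d"] that by (auto simp: S_def k_def)
      then show ?thesis using okt[OF that, of 0] by (simp add: L_un)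
    qed
    have zH: "z (l, a) \<in> Hs N1 (tgt a) (pa a)" if s: "(l, a) \<in> S" for l a
    proof -
      have la: "d \<le> l" "l < k" "a \<in> As" "l - d < e" using s by (auto simp: S_def k_def)
      have "(un l (BP (vy (l - d)) []) :: nat \<Rightarrow> ('v,'e) node \<Rightarrow> 'k) \<in> Sup k" by (rule un_Sup[OF la(2) vB[OF la(4)]])
      then have "(un l (BP (vy (l - d)) [a]) :: nat \<Rightarrow> ('v,'e) node \<Rightarrow> 'k) \<in> Hs (Sup k) (tgt a) (pa a)"
        unfolding Lun[OF s, symmetric] by (rule L_in_Hs[OF subrep_Sup _ pa[OF la(3)]])
      moreover have tT: "t a (l - d) \<in> Hs T (tgt a) (pa a)" using t la by blast
      then have "t a (l - d) \<in> Hs (Sup k) (tgt a) (pa a)" using Hs_mono[of T "Sup k"] TS SS by blast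
      ultimately have zS: "z (l, a) \<in> Hs (Sup k) (tgt a) (pa a)"
        unfolding z_def using V.subspace_diff[OF subspace_Hs[OF subspace_Sup]] by auto
      have tT': "t a (l - d) \<in> T" using tT Hs_sub by blast
      have "gh k g (un l (BP (vy (l - d)) [a])) = L a (yy (l - d))"
        using gh_un[OF la(2), of "BP (vy (l - d)) [a]" g] okt[OF s, of 0] la by (simp add: g_def homP_def)
      moreover have "gh k g (t a (l - d)) = L a (yy (l - d))" using ghT tT' TS t la by (metis subsetD)
      ultimately have "gh k g (z (l, a)) = 0" by (simp add: z_def gh.diff)
      then have "z (l, a) \<in> K" using zS Hs_sub unfolding K_def by blast
      moreover have "\<beta> \<in> C l'" if "z (l, a) l' \<beta> \<noteq> 0" for l' \<beta>
      proof -
        have "t a (l - d) l' \<beta> \<noteq> 0 \<or> (l' = l \<and> \<beta> = BP (vy (l - d)) [a])"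
          using that by (auto simp: z_def un_def split: if_splits)
        then show ?thesis
        proof
          assume n: "t a (l - d) l' \<beta> \<noteq> 0"
          then have "l' < d" using tT' TS by (auto simp: Sup_def)
          moreover have "\<exists>i\<le>length (wj l'). \<beta> = BU (vj l') (wj l') i" using n tT' unfolding T_def UT_def by blast
          ultimately show ?thesis by (auto simp: C_def)
        qed (use okt[OF s, of 0] la in \<open>auto simp: C_def\<close>)
      qed
      ultimately have "z (l, a) \<in> N1" unfolding N1_def by blast
      then show ?thesis using zS unfolding Hs_def by blast
    qed
    show ?thesis
    proof (rule retr_peel[OF N1 S, of \<kappa> i N2])
      show "hm Bs N1 (\<kappa> s)" if "s \<in> S" for s
        using hm_homU[OF N1] zH that by (cases s) (simp add: \<kappa>_def)
      show "khom N1 (i s)" if s: "s \<in> S" for s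
      proof -
        obtain l a where la: "s = (l, a)" "d \<le> l" "l < k" "a \<in> As" "src a = vy (l - d)" using s by (auto simp: S_def)
        have s': "(l, a) \<in> S" using s la(1) by simp
        show ?thesis
        proof (rule khom_coord[where D = "D a" and f = "f s" and l = l])
          fix y \<beta> b assume y: "y \<in> N1" and b: "\<beta> \<in> D a"
          obtain n where n: "\<beta> = BU (tgt a) (pa a) n" "n \<le> length (pa a)" using b by (auto simp: D_def)
          \<comment> \<open>Decisive for \<open>n = 0\<close>: the node of \<open>[a]\<close> has
            the top of the projective as predecessor, while the top of the uniserial has none. The
            two sides agree only because kernel elements vanish at tops.\<close>
          have "y l (BP (vy (l - d)) []) = 0" using top0[OF y, of "l - d"] la by (simp add: k_def)
          then show "(case rst b (f s \<beta>) of None \<Rightarrow> 0 | Some \<gamma> \<Rightarrow> y l \<gamma>) = (case rst b \<beta> of None \<Rightarrow> 0 | Some \<gamma> \<Rightarrow> i s y \<gamma>)"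
            using n la(1) by (cases n) (auto simp: f_def i_def D_def take_Suc_conv_app_nth butlast_append)
        next
          fix \<beta> b \<gamma> assume "\<beta> \<in> Bs" "\<beta> \<notin> D a" "rst b \<beta> = Some \<gamma>"
          then show "\<gamma> \<notin> D a" by (cases \<beta>) (auto simp: D_def split: if_splits)
        next
          fix \<beta> assume "\<beta> \<in> D a"
          then obtain n where n: "\<beta> = BU (tgt a) (pa a) n" "n \<le> length (pa a)" by (auto simp: D_def)
          show "vt (f s \<beta>) = vt \<beta>" using n la(1) by (cases n) (auto simp: f_def take_Suc_conv_app_nth)
          show "f s \<beta> \<in> Bs" using n la(1) okt[OF s'] by (simp add: f_def)
        qed (use DB[OF la(4)] la(1) subrepD[OF N1] in \<open>auto simp: i_def\<close>)
      qed
      show "N2 \<subseteq> N1" by (auto simp: N2_def)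
      fix y assume y: "y \<in> N1"
      have val: "ex (\<kappa> (l', a)) (i (l', a) y) l \<beta> = (if l' = l \<and> (\<exists>n\<le>length (pa a). \<beta> = BP (vy (l - d)) (a # take n (pa a))) then y l \<beta> else 0)"
        if s: "(l', a) \<in> S" and l: "d \<le> l" for l' a l \<beta>
      proof -
        let ?v = "vy (l' - d)"
        have la: "d \<le> l'" "l' < k" "a \<in> As" "l' - d < e" using s by (auto simp: S_def k_def)
        have fz: "fold L (take n (pa a)) (z (l', a)) l \<beta> = un l' (BP ?v (a # take n (pa a))) l \<beta>" for n
        proof -
          have "t a (l' - d) \<in> T" using t[of a "l' - d"] la Hs_sub[of T "tgt a" "pa a"] by blast
          then have "fold L (take n (pa a)) (t a (l' - d)) \<in> Sup d" using subrepD(5)[OF T] TS by blast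
          then have "fold L (take n (pa a)) (t a (l' - d)) l \<beta> = 0" using l unfolding Sup_def by force
          moreover have "fold L (take n (pa a)) (un l' (BP ?v [a]) :: nat \<Rightarrow> ('v,'e) node \<Rightarrow> 'k) = un l' (BP ?v (a # take n (pa a)))"
            using lsts_BP[of ?v "[a]" "take n (pa a)"] okt[OF s, of 0] okt[OF s, of n] by (simp add: wact_un)
          ultimately show ?thesis by (simp add: z_def wact.diff)
        qed
        have "ex (\<kappa> (l', a)) (i (l', a) y) = (\<Sum>\<beta>\<in>D a. sc (i (l', a) y \<beta>) (\<kappa> (l', a) \<beta>))"
          unfolding ex_def using DB[OF la(3)] fin_Bs by (intro sum.mono_neutral_right) (auto simp: i_def)
        also have "D a = BU (tgt a) (pa a) ` {..length (pa a)}" by (auto simp: D_def)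
        also have "(\<Sum>\<beta>\<in>BU (tgt a) (pa a) ` {..length (pa a)}. sc (i (l', a) y \<beta>) (\<kappa> (l', a) \<beta>)) =
          (\<Sum>n\<le>length (pa a). sc (y l' (BP ?v (a # take n (pa a)))) (fold L (take n (pa a)) (z (l', a))))"
          by (subst sum.reindex) (auto simp: inj_on_def i_def D_def f_def \<kappa>_def homU_def intro!: sum.cong)
        finally have *: "ex (\<kappa> (l', a)) (i (l', a) y) l \<beta> =
           (\<Sum>n\<le>length (pa a). y l' (BP ?v (a # take n (pa a))) * un l' (BP ?v (a # take n (pa a))) l \<beta>)"
          by (simp add: sum_fun_apply2 fz)
        show ?thesis
        proof (cases "l' = l \<and> (\<exists>n\<le>length (pa a). \<beta> = BP (vy (l - d)) (a # take n (pa a)))")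
          case True
          then obtain n where n: "l' = l" "n \<le> length (pa a)" "\<beta> = BP (vy (l - d)) (a # take n (pa a))" by blast
          have "ex (\<kappa> (l', a)) (i (l', a) y) l \<beta> = (\<Sum>n'\<le>length (pa a). if n' = n then y l \<beta> else 0)"
            unfolding * using n by (intro sum.cong) (auto simp: un_def dest: arg_cong[of _ _ length])
          then show ?thesis using n by auto
        next
          case False
          then show ?thesis unfolding * by (auto simp: un_def intro!: sum.neutral)
        qed
      qed
      let ?y = "y - (\<Sum>s\<in>S. ex (\<kappa> s) (i s y))"
      have "ex (\<kappa> s) (i s y) \<in> N1" if "s \<in> S" for s
        using hm_homU[OF N1] zH that subrepD(2)[OF N1] by (cases s) (auto simp: \<kappa>_def hm_def intro!: ex_in)
      then have "?y \<in> N1" using y subrepD(2)[OF N1] by (intro V.subspace_diff V.subspace_sum)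
      moreover have "?y l = 0" if l: "d \<le> l" for l
      proof
        fix \<beta>
        have "(\<Sum>s\<in>S. ex (\<kappa> s) (i s y) l \<beta>) = y l \<beta>"
        proof (cases "y l \<beta> = 0")
          case True
          then show ?thesis using val[OF _ l] by (intro trans[OF sum.neutral]) auto
        next
          case False
          then have "l < k" "\<beta> \<in> C l" using y by (auto simp: N1_def K_def Sup_def)
          then obtain w where w: "\<beta> = BP (vy (l - d)) w" "ok (vy (l - d)) w" using l by (auto simp: C_def)
          moreover have "w \<noteq> []" using False w(1) top0[OF y, of "l - d"] l \<open>l < k\<close> by (auto simp: k_def)
          ultimately obtain a u where au: "\<beta> = BP (vy (l - d)) (a # u)" "a # u \<in> W" "src a = vy (l - d)"
            by (cases w) (auto simp: ok_def)
          have aS: "a \<in> As" using W_set[OF au(2)] by simp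
          then have sS: "(l, a) \<in> S" using l \<open>l < k\<close> au(3) by (simp add: S_def)
          obtain r where "pa a = u @ r" using pa[OF aS] au(2) by (auto simp: longest_right_def)
          then have u: "u = take (length u) (pa a)" "length u \<le> length (pa a)" by auto
          have "(\<Sum>s\<in>S. ex (\<kappa> s) (i s y) l \<beta>) = (\<Sum>s\<in>S. if s = (l, a) then y l \<beta> else 0)"
          proof (rule sum.cong)
            fix s assume "s \<in> S"
            then show "ex (\<kappa> s) (i s y) l \<beta> = (if s = (l, a) then y l \<beta> else 0)"
              using val[OF _ l, of "fst s" "snd s" \<beta>] au(1) u by (cases s) auto
          qed simp
          then show ?thesis using S sS by simp
        qed
        then show "?y l \<beta> = 0 \<beta>" by (simp add: sum_fun_apply2)
      qed
      ultimately show "?y \<in> N2" unfolding N2_def by blast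
    qed fact
  qed
  have un: "un l \<beta> \<in> K" if l: "l < k" and b: "\<beta> \<in> Bs - C l" for l \<beta>
  proof -
    have "g l \<beta> = 0"
      using b by (auto simp: g_def g0_def homU_def homP_def C_def split: node.splits if_splits)
    then show ?thesis using gh_un[OF l, of \<beta> g] un_Sup[OF l, of \<beta>] b by (simp add: K_def)
  qed
  have "retr K" by (rule retr_peel_off[OF K C un \<open>retr N1\<close>[unfolded N1_def]])
  then show ?thesis unfolding approx_def K_def using gF lift by blast
qed

end

section \<open>Splitting off injective summands, and the induction on dimension\<close>

context words
begin

interpretation E: Vector_Spaces.linear sc sc "E v" for v by (rule linear_E)
interpretation L: Vector_Spaces.linear sc sc "L a" for a by (rule linear_L)
interpretation wact: Vector_Spaces.linear sc sc "fold L w" for w by (rule linear_wact)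
interpretation gh: Vector_Spaces.linear sc sc "gh k g" for k g by (rule linear_gh)

text \<open>A map that does not kill the simple socle is injective: apply to a relation a longest
  word occurring in it. All other terms die, and what is left is the coefficient of that word times
  the image of the socle.\<close>

lemma injective_independent:
  fixes F :: "(nat \<Rightarrow> ('v,'e) node \<Rightarrow> 'k::field) set"
  assumes F: "subrep m F" and h: "hm {BI u w | w. eok u w} F h" and ne: "h (BI u []) \<noteq> 0" and u: "u \<in> Vs"
  shows "eok u w \<Longrightarrow> fold L r (h (BI u w)) = (if \<exists>w'. w = r @ w' then h (BI u (drop (length r) w)) else 0)" (is "_ \<Longrightarrow> ?act")
    and "(\<Sum>w | eok u w. sc (c w) (h (BI u w))) = 0 \<Longrightarrow> eok u w \<Longrightarrow> c w = 0"
proof -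
  show act: "fold L r (h (BI u w)) = (if \<exists>w'. w = r @ w' then h (BI u (drop (length r) w)) else 0)" if "eok u w" for w r
  proof (induction r rule: rev_induct)
    case (snoc a r)
    show ?case
    proof (cases "\<exists>w'. w = r @ w'")
      case True
      then obtain w' where w': "w = r @ w'" by blast
      have e: "eok u w'" using that w' W_suffix[of r w'] by (auto simp: eok_def split: if_splits)
      then have "L a (h (BI u w')) = (case lst a (BI u w') of None \<Rightarrow> 0 | Some \<gamma> \<Rightarrow> h \<gamma>)"
        using h unfolding hm_def by blast
      then show ?thesis using snoc w' by (cases w') auto
    next
      case False
      then have "\<not> (\<exists>w'. w = (r @ [a]) @ w')" by auto
      then have e: "(if \<exists>w'. w = (r @ [a]) @ w' then h (BI u (drop (length (r @ [a])) w)) else 0) = 0"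
        by (rule if_not_P)
      have "fold L r (h (BI u w)) = 0" using snoc False by (metis if_not_P)
      then have "fold L (r @ [a]) (h (BI u w)) = L a 0" by simp
      then show ?thesis unfolding e by (simp only: L.zero)
    qed
  qed simp
  have fin: "finite {w. eok u w}" by (rule finite_subset[OF _ fin_W]) (auto simp: eok_def)
  show "c w = 0" if z: "(\<Sum>w | eok u w. sc (c w) (h (BI u w))) = 0" and w: "eok u w" for c w
  proof (rule ccontr)
    assume cw: "c w \<noteq> 0"
    let ?D = "{w. eok u w \<and> c w \<noteq> 0}"
    have finD: "finite ?D" using fin by (rule rev_finite_subset) auto
    have Dne: "?D \<noteq> {}" using w cw by auto
    define N where "N = Max (length ` ?D)"
    have "N \<in> length ` ?D" unfolding N_def using finD Dne by (intro Max_in) auto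
    then obtain w0 where w0: "eok u w0" "c w0 \<noteq> 0" "length w0 = N" by auto
    have mx: "length w' \<le> length w0" if "eok u w'" "c w' \<noteq> 0" for w'
      unfolding w0(3) N_def using finD that by (intro Max_ge) auto
    have "0 = fold L w0 (\<Sum>w | eok u w. sc (c w) (h (BI u w)))" unfolding z by (simp add: wact.zero)
    also have "\<dots> = (\<Sum>w | eok u w. sc (c w) (fold L w0 (h (BI u w))))" by (simp add: wact.sum wact.scale)
    also have "\<dots> = (\<Sum>w | eok u w. if w = w0 then sc (c w0) (h (BI u [])) else 0)"
    proof (rule sum.cong)
      fix w assume "w \<in> {w. eok u w}"
      then show "sc (c w) (fold L w0 (h (BI u w))) = (if w = w0 then sc (c w0) (h (BI u [])) else 0)"
        using act[of w w0] mx[of w] by (cases "c w = 0") auto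
    qed simp
    also have "\<dots> = sc (c w0) (h (BI u []))" using w0(1) fin by simp
    finally show False using w0(2) ne by simp
  qed
qed

lemma dim_psubset:
  fixes F :: "(nat \<Rightarrow> ('v,'e) node \<Rightarrow> 'k::field) set"
  assumes F: "F \<subseteq> Sup m" and F': "V.subspace F'" "F' \<subset> F"
  shows "V.dim F' < V.dim F"
proof -
  obtain B where B: "B \<subseteq> F" "V.independent B" "F \<subseteq> V.span B" "finite B" using finite_basis_Sup[OF F] by metis
  have "F' \<subseteq> Sup m" using F F'(2) by blast
  then obtain B' where B': "B' \<subseteq> F'" "V.independent B'" "F' \<subseteq> V.span B'" "finite B'" using finite_basis_Sup by metis
  obtain x where x: "x \<in> F" "x \<notin> F'" using F'(2) by blast
  have "V.span B' \<subseteq> F'" by (rule V.span_minimal[OF B'(1) F'(1)])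
  then have "V.independent (insert x B')" using x(2) B'(2) by (intro V.independent_insertI) auto
  moreover have "insert x B' \<subseteq> V.span B" using x(1) B(3) B'(1) F'(2) by blast
  ultimately have "card (insert x B') \<le> card B" using V.independent_span_bound[OF B(4)] by blast
  moreover have "x \<notin> B'" using x B'(1) by blast
  moreover have "V.dim F = card B" "V.dim F' = card B'"
    using V.basis_card_eq_dim[OF B(1,3,2)] V.basis_card_eq_dim[OF B'(1,3,2)] by simp_all
  ultimately show ?thesis using B'(4) by simp
qed

lemma approx_injective_step:
  fixes F :: "(nat \<Rightarrow> ('v,'e) node \<Rightarrow> 'k::field) set"
  assumes F: "subrep m F" and h: "hm {BI u w | w. eok u w} F h" and ne: "h (BI u []) \<noteq> 0" and u: "u \<in> Vs"
  shows "\<exists>F'. subrep m F' \<and> F' \<subset> F \<and> (approx F' \<longrightarrow> approx F)"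
proof -
  note act = injective_independent(1)[OF F h ne u] and ind = injective_independent(2)[OF F h ne u]
  define Wu where "Wu = {w. eok u w}"
  define s where "s w = h (BI u w)" for w
  have fin: "finite Wu" unfolding Wu_def by (rule finite_subset[OF _ fin_W]) (auto simp: eok_def)
  have inj: "inj_on s Wu"
  proof (rule inj_onI, rule ccontr)
    fix w w' assume w: "w \<in> Wu" "w' \<in> Wu" "s w = s w'" "w \<noteq> w'"
    let ?c = "\<lambda>x. (if x = w then 1 else 0) - (if x = w' then 1 else 0) :: 'k"
    have "(\<Sum>x\<in>Wu. sc (?c x) (s x)) = (\<Sum>x\<in>Wu. if x = w then s w else 0) - (\<Sum>x\<in>Wu. if x = w' then s w' else 0)"
      unfolding sum_subtractf[symmetric] by (intro sum.cong) auto
    then have "(\<Sum>x\<in>Wu. sc (?c x) (s x)) = 0" using w fin by simp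
    then show False using ind[of ?c w] w by (auto simp: Wu_def s_def)
  qed
  have indep: "V.independent (s ` Wu)"
  proof (rule V.independent_if_scalars_zero)
    fix f x assume z: "(\<Sum>x\<in>s ` Wu. sc (f x) x) = 0" and x: "x \<in> s ` Wu"
    have "(\<Sum>w\<in>Wu. sc (f (s w)) (s w)) = 0" using z by (simp add: sum.reindex[OF inj])
    then show "f x = 0" using ind[of "\<lambda>w. f (s w)"] x by (auto simp: Wu_def s_def)
  qed (use fin in simp)
  define B where "B = V.extend_basis (s ` Wu)"
  have B: "s ` Wu \<subseteq> B" "V.independent B" "V.span B = UNIV"
    unfolding B_def using V.extend_basis_superset[OF indep] V.independent_extend_basis[OF indep] V.span_extend_basis[OF indep] by auto
  \<comment> \<open>A functional that is 1 on the socle image \<open>s []\<close> and 0 on the other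
    \<open>s w\<close>. Maps into the injective at \<open>u\<close> correspond to functionals on the
    space at \<open>u\<close>, and this one will induce the retraction.\<close>
  define \<phi> where "\<phi> y = V.representation B y (s [])" for y
  have phi_add: "\<phi> (y + y') = \<phi> y + \<phi> y'" and phi_sc: "\<phi> (sc c y) = c * \<phi> y" for y y' c
    unfolding \<phi>_def by (simp_all add: V.representation_add[OF B(2)] V.representation_scale[OF B(2)] B(3))
  have phi_0: "\<phi> 0 = 0" by (simp add: \<phi>_def V.representation_zero)
  have Nil: "[] \<in> Wu" using u Nil_W by (simp add: Wu_def eok_def)
  have phi_s: "\<phi> (s w) = (if w = [] then 1 else 0)" if "w \<in> Wu" for w
  proof -
    have "s w \<in> B" using B(1) that by blast
    then show ?thesis using inj_onD[OF inj _ that Nil] by (auto simp: \<phi>_def V.representation_basis[OF B(2)])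
  qed
  \<comment> \<open>The coordinate at \<open>BI u w\<close> of the map from \<open>F\<close> to the
    injective induced by \<open>\<phi>\<close>: act with \<open>w\<close>, project to the vertex
    \<open>u\<close>, evaluate.\<close>
  define \<psi> where "\<psi> w y = \<phi> (E u (fold L w y))" for w y
  have psi_add: "\<psi> w (y + y') = \<psi> w y + \<psi> w y'" and psi_sc: "\<psi> w (sc c y) = c * \<psi> w y" and psi_0: "\<psi> w 0 = 0" for w y y' c
    unfolding \<psi>_def by (simp_all add: wact.add wact.scale E.add E.scale phi_add phi_sc phi_0 wact.zero E.zero)
  have psi_sum: "\<psi> w (sum f S) = (\<Sum>x\<in>S. \<psi> w (f x))" for w S and f :: "'e list \<Rightarrow> nat \<Rightarrow> ('v,'e) node \<Rightarrow> 'k"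
    by (induction S rule: infinite_finite_induct)
      (simp_all only: sum.infinite sum.empty sum.insert psi_0 psi_add not_False_eq_True)
  have vs: "E v (s w) = (if (if w = [] then u else src (hd w)) = v then s w else 0)" if "w \<in> Wu" for v w
  proof -
    have "E (vt (BI u w)) (s w) = s w" using h that unfolding hm_def s_def Wu_def by blast
    then have "E (if w = [] then u else src (hd w)) (s w) = s w" by (simp only: vt.simps)
    then show ?thesis using E_E[of v "if w = [] then u else src (hd w)" "s w"] by metis
  qed
  have psi_s: "\<psi> w (s w') = (if w' = w then 1 else 0)" if w: "w \<in> Wu" "w' \<in> Wu" for w w'
  proof (cases "\<exists>r. w' = w @ r")
    case True
    then obtain r where r: "w' = w @ r" by blast
    then have "fold L w (s w') = s r" using act[of w' w] w by (simp add: Wu_def s_def)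
    moreover have "r \<in> Wu" using w(2) r u W_suffix[of w r] Nil_W by (cases "r = []") (auto simp: Wu_def eok_def)
    ultimately show ?thesis using vs[of r u] phi_s[of r] r by (auto simp: \<psi>_def phi_0)
  next
    case False
    then have "fold L w (s w') = 0" using act[of w' w] w by (simp add: Wu_def s_def)
    then show ?thesis using False by (auto simp: \<psi>_def E.zero phi_0)
  qed
  have FS: "F \<subseteq> Sup m" using subrepD(1)[OF F] .
  have psi_L: "\<psi> w (L a y) = (if a # w \<in> Wu then \<psi> (a # w) y else 0)" if y: "y \<in> F" and w: "w \<in> Wu" for a w y
  proof -
    have e: "\<psi> w (L a y) = \<psi> (a # w) y" by (simp add: \<psi>_def)
    have "\<psi> (a # w) y = 0" if n: "a # w \<notin> Wu"
    proof (cases "a # w \<in> W")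
      case True
      then have "w = []" "tgt a \<noteq> u" using n w by (auto simp: Wu_def eok_def split: if_splits)
      then show ?thesis by (simp add: \<psi>_def E_L phi_0)
    next
      case False
      then have "fold L (a # w) y = 0" using wact_zero y FS by blast
      then show ?thesis unfolding \<psi>_def by (simp only: E.zero phi_0)
    qed
    then show ?thesis using e by auto
  qed
  have psi_E: "\<psi> w (E v y) = (if (if w = [] then u else src (hd w)) = v then \<psi> w y else 0)" if y: "y \<in> F" and w: "w \<in> Wu" for v w y
  proof (cases w)
    case Nil
    then show ?thesis by (auto simp: \<psi>_def E_E phi_0)
  next
    case (Cons a w')
    have "y \<in> Sup m" using y FS by blast
    then have "L a (E v y) = (if src a = v then L a y else 0)" by (rule L_E)
    then show ?thesis using Cons by (auto simp: \<psi>_def phi_0)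
  qed
  define F' where "F' = {y\<in>F. \<forall>w\<in>Wu. \<psi> w y = 0}"
  have F': "subrep m F'"
    unfolding subrep_def
  proof (intro conjI ballI allI)
    show "F' \<subseteq> Sup m" using FS by (auto simp: F'_def)
    show "V.subspace F'" using subrepD(2)[OF F] by (auto simp: F'_def V.subspace_def psi_0 psi_add psi_sc)
    fix y assume "y \<in> F'"
    then show "E v y \<in> F'" "L v' y \<in> F'" for v v'
      using psi_E psi_L subrepD(3,4)[OF F] by (auto simp: F'_def)
  qed
  have s0: "s [] \<in> F" using h Nil unfolding hm_def s_def Wu_def by blast
  have sF: "s w \<in> F" if "w \<in> Wu" for w using h that unfolding hm_def s_def Wu_def by blast
  have "s [] \<notin> F'" using psi_s[OF Nil Nil] Nil unfolding F'_def by force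
  then have ps: "F' \<subset> F" using s0 by (auto simp: F'_def)
  have step: "approx F" if ap: "approx F'"
  proof -
    obtain k g where g: "\<And>l. l < k \<Longrightarrow> hm Bs F' (g l)"
      and lift: "\<And>h. hm Bs F' h \<Longrightarrow> \<exists>c. hm Bs (Sup k) c \<and> (\<forall>\<beta>\<in>Bs. h \<beta> = gh k g (c \<beta>))"
      and retr: "retr {y \<in> Sup k. gh k g y = 0}"
      using ap unfolding approx_def by auto
    define gI where "gI \<beta> = (case \<beta> of BI u' w \<Rightarrow> if u' = u then s w else 0 | _ \<Rightarrow> 0)" for \<beta>
    \<comment> \<open>One more copy of M, of which only the injective summand at \<open>u\<close> is
      used.\<close>
    define g' where "g' = g(k := gI)"
    have gI: "hm Bs F gI" unfolding hm_def
    proof (intro ballI)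
      fix \<beta> assume b: "\<beta> \<in> Bs"
      show "gI \<beta> \<in> F \<and> E (vt \<beta>) (gI \<beta>) = gI \<beta> \<and> (\<forall>a. L a (gI \<beta>) = (case lst a \<beta> of None \<Rightarrow> 0 | Some \<gamma> \<Rightarrow> gI \<gamma>))"
      proof (cases "\<exists>w. \<beta> = BI u w")
        case True
        then obtain w where w: "\<beta> = BI u w" "w \<in> Wu" using b by (auto simp: Wu_def)
        have "\<forall>a. L a (s w) = (case lst a \<beta> of None \<Rightarrow> 0 | Some \<gamma> \<Rightarrow> h \<gamma>)"
          using h w unfolding hm_def s_def Wu_def by blast
        then show ?thesis using w sF[OF w(2)] vs[OF w(2)] by (auto simp: gI_def s_def)
      next
        case False
        have "gI \<beta> = 0" using False by (auto simp: gI_def split: node.splits)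
        moreover have "(case lst a \<beta> of None \<Rightarrow> 0 | Some \<gamma> \<Rightarrow> gI \<gamma>) = 0" for a
          using False by (cases \<beta>) (auto simp: gI_def)
        ultimately show ?thesis using subrepD(2)[OF F] V.subspace_0 by auto
      qed
    qed
    have g'F: "hm Bs F (g' l)" if "l < Suc k" for l
      using gI hm_mono[OF g, of l F Bs] ps that by (auto simp: g'_def less_Suc_eq)
    have gh': "gh (Suc k) g' y = gh k g y + ex gI (y k)" for y
      by (simp add: gh_def g'_def)
    have exI_val: "ex gI x = (\<Sum>w\<in>Wu. sc (x (BI u w)) (s w))" for x
    proof -
      have "ex gI x = (\<Sum>\<beta>\<in>BI u ` Wu. sc (x \<beta>) (gI \<beta>))"
        unfolding ex_def using fin_Bs by (intro sum.mono_neutral_right) (auto simp: gI_def Wu_def split: node.splits)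
      also have "\<dots> = (\<Sum>w\<in>Wu. sc (x (BI u w)) (s w))" by (subst sum.reindex) (auto simp: inj_on_def gI_def)
      finally show ?thesis .
    qed
    \<comment> \<open>The retraction onto the injective, landing in the new copy
      \<open>k\<close>.\<close>
    define q :: "(nat \<Rightarrow> ('v,'e) node \<Rightarrow> 'k) \<Rightarrow> nat \<Rightarrow> ('v,'e) node \<Rightarrow> 'k"
      where "q y = (\<lambda>l \<beta>. if l = k then case \<beta> of BI u' w \<Rightarrow> if u' = u \<and> w \<in> Wu then \<psi> w y else 0 | _ \<Rightarrow> 0 else 0)" for y
    have qS: "q y \<in> Sup (Suc k)" for y by (auto simp: q_def Sup_def Wu_def split: node.splits if_splits)
    have qE: "E v (q y) = q (E v y)" if "y \<in> F" for v y
    proof (intro ext)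
      fix l \<beta>
      have "E v (q y) l \<beta> = (if vt \<beta> = v then q y l \<beta> else 0)" by (simp add: E_def ea_def)
      then show "E v (q y) l \<beta> = q (E v y) l \<beta>"
        using psi_E[OF that] by (cases \<beta>) (auto simp: q_def)
    qed
    have qL: "L a (q y) = q (L a y)" if y: "y \<in> F" for a y
    proof (intro ext)
      fix l \<beta>
      have 1: "L a (q y) l \<beta> = (if \<beta> \<in> Bs then case rst a \<beta> of None \<Rightarrow> 0 | Some \<gamma> \<Rightarrow> q y l \<gamma> else 0)"
        by (simp add: L_def la_def)
      show "L a (q y) l \<beta> = q (L a y) l \<beta>"
      proof (cases \<beta>)
        case (BI u' w)
        have "eok u (a # w) \<Longrightarrow> eok u w" using eok_tl[of u "a # w"] by simp
        then show ?thesis using 1 BI psi_L[OF y, of w a] by (auto simp: q_def Wu_def)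
      qed (use 1 in \<open>auto simp: q_def\<close>)
    qed
    have ghq: "gh (Suc k) g' (q y) = (\<Sum>w\<in>Wu. sc (\<psi> w y) (s w))" for y
    proof -
      have "gh k g (q y) = 0" unfolding gh_def by (intro sum.neutral) (auto simp: q_def ex_def)
      then show ?thesis unfolding gh' exI_val by (simp add: q_def)
    qed
    \<comment> \<open>The projection of \<open>F\<close> onto the embedded injective. Subtracting it
      from a vector of \<open>F\<close> leaves the component in \<open>F'\<close>.\<close>
    define \<sigma> where "\<sigma> y = gh (Suc k) g' (q y)" for y
    have sig_F: "\<sigma> y \<in> F" for y unfolding \<sigma>_def by (rule gh_in[OF subrepD(2)[OF F] g'F])
    have psi_sig: "\<psi> w (\<sigma> y) = \<psi> w y" if "w \<in> Wu" for w y
    proof -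
      have "\<psi> w (\<sigma> y) = (\<Sum>w'\<in>Wu. if w' = w then \<psi> w y else 0)"
        unfolding \<sigma>_def ghq psi_sum psi_sc using psi_s[OF that] by (intro sum.cong) auto
      then show ?thesis using that fin by simp
    qed
    have psi_diff: "\<psi> w (y - y') = \<psi> w y - \<psi> w y'" for w y y'
      using psi_add[of w "y - y'" y'] by simp
    have lift': "\<exists>c. hm Bs (Sup (Suc k)) c \<and> (\<forall>\<beta>\<in>Bs. h0 \<beta> = gh (Suc k) g' (c \<beta>))" if h0: "hm Bs F h0" for h0
    proof -
      have h0F: "h0 \<beta> \<in> F" if "\<beta> \<in> Bs" for \<beta> using h0 that by (auto simp: hm_def)
      have q_hm: "E (vt \<beta>) (q (h0 \<beta>)) = q (h0 \<beta>) \<and> (\<forall>a. L a (q (h0 \<beta>)) = (case lst a \<beta> of None \<Rightarrow> 0 | Some \<gamma> \<Rightarrow> q (h0 \<gamma>)))" if b: "\<beta> \<in> Bs" for \<beta>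
      proof -
        have "q 0 = 0" by (auto simp: q_def psi_0 fun_eq_iff split: node.splits)
        then show ?thesis using h0 b qE[OF h0F[OF b]] qL[OF h0F[OF b]] by (auto simp: hm_def split: option.splits)
      qed
      have hq: "hm Bs (Sup (Suc k)) (\<lambda>\<beta>. q (h0 \<beta>))" unfolding hm_def using q_hm qS by blast
      have hs: "E (vt \<beta>) (\<sigma> (h0 \<beta>)) = \<sigma> (h0 \<beta>) \<and> (\<forall>a. L a (\<sigma> (h0 \<beta>)) = (case lst a \<beta> of None \<Rightarrow> 0 | Some \<gamma> \<Rightarrow> \<sigma> (h0 \<gamma>)))" if b: "\<beta> \<in> Bs" for \<beta>
      proof -
        have 1: "E v (\<sigma> y) = gh (Suc k) g' (E v (q y))" and 2: "L a (\<sigma> y) = gh (Suc k) g' (L a (q y))" for v a y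
          unfolding \<sigma>_def by (rule gh_E[OF g'F, symmetric] gh_L[OF g'F, symmetric], assumption)+
        show ?thesis unfolding 1 2 using q_hm[OF b] by (auto simp: gh.zero \<sigma>_def split: option.splits)
      qed
      have "hm Bs F' (\<lambda>\<beta>. h0 \<beta> - \<sigma> (h0 \<beta>))"
        unfolding hm_def
      proof (intro ballI conjI allI)
        fix \<beta> assume b: "\<beta> \<in> Bs"
        show "h0 \<beta> - \<sigma> (h0 \<beta>) \<in> F'"
          using V.subspace_diff[OF subrepD(2)[OF F] h0F[OF b] sig_F] psi_sig by (simp add: F'_def psi_diff)
        show "E (vt \<beta>) (h0 \<beta> - \<sigma> (h0 \<beta>)) = h0 \<beta> - \<sigma> (h0 \<beta>)"
          using hs[OF b] h0 b by (simp add: E.diff hm_def)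
        show "L a (h0 \<beta> - \<sigma> (h0 \<beta>)) = (case lst a \<beta> of None \<Rightarrow> 0 | Some \<gamma> \<Rightarrow> h0 \<gamma> - \<sigma> (h0 \<gamma>))" for a
          using hs[OF b] h0 b by (auto simp: L.diff hm_def split: option.splits)
      qed
      then obtain c1 where c1: "hm Bs (Sup k) c1" "\<And>\<beta>. \<beta> \<in> Bs \<Longrightarrow> h0 \<beta> - \<sigma> (h0 \<beta>) = gh k g (c1 \<beta>)" using lift by blast
      have SS: "Sup k \<subseteq> Sup (Suc k)" unfolding Sup_def using less_SucI by blast
      have c1': "hm Bs (Sup (Suc k)) c1" by (rule hm_mono[OF c1(1) SS order.refl])
      have "hm Bs (Sup (Suc k)) (\<lambda>\<beta>. c1 \<beta> + q (h0 \<beta>))"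
        unfolding hm_def
      proof (intro ballI conjI allI)
        fix \<beta> assume b: "\<beta> \<in> Bs"
        show "c1 \<beta> + q (h0 \<beta>) \<in> Sup (Suc k)" by (rule V.subspace_add[OF subspace_Sup _ qS]) (use c1' b in \<open>simp add: hm_def\<close>)
        show "E (vt \<beta>) (c1 \<beta> + q (h0 \<beta>)) = c1 \<beta> + q (h0 \<beta>)" using c1' hq b by (simp add: E.add hm_def)
        show "L a (c1 \<beta> + q (h0 \<beta>)) = (case lst a \<beta> of None \<Rightarrow> 0 | Some \<gamma> \<Rightarrow> c1 \<gamma> + q (h0 \<gamma>))" for a
          using c1' hq b by (auto simp: L.add hm_def split: option.splits)
      qed
      moreover have "h0 \<beta> = gh (Suc k) g' (c1 \<beta> + q (h0 \<beta>))" if b: "\<beta> \<in> Bs" for \<beta>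
      proof -
        have "c1 \<beta> \<in> Sup k" using c1(1) b by (auto simp: hm_def)
        then have "c1 \<beta> k = 0" by (auto simp: Sup_def fun_eq_iff)
        then have "gh (Suc k) g' (c1 \<beta>) = gh k g (c1 \<beta>)" by (simp add: gh' ex_def)
        then show ?thesis using c1(2)[OF b] by (simp add: gh.add \<sigma>_def[symmetric] algebra_simps)
      qed
      ultimately show ?thesis by blast
    qed
    define K where "K = {y \<in> Sup (Suc k). gh (Suc k) g' y = 0}"
    have K: "subrep (Suc k) K" unfolding K_def by (rule ker_subrep[OF g'F])
    define C where "C l = (if l = k then {BI u w | w. eok u w} else UNIV)" for l
    have C: "\<beta> \<in> C l \<longleftrightarrow> \<gamma> \<in> C l" if "\<beta> \<in> Bs" "lst a \<beta> = Some \<gamma>" for l a \<beta> \<gamma>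
      using that lst_Bs[OF that] by (cases \<beta>) (auto simp: C_def split: if_splits)
    have un: "un l \<beta> \<in> K" if l: "l < Suc k" and b: "\<beta> \<in> Bs - C l" for l \<beta>
    proof -
      have "g' l \<beta> = 0" using b by (auto simp: g'_def gI_def C_def split: node.splits if_splits)
      then show ?thesis using gh_un[OF l, of \<beta> g'] un_Sup[OF l, of \<beta>] b by (simp add: K_def)
    qed
    \<comment> \<open>The sum of \<open>F'\<close> and the embedded injective is direct, as
      \<open>\<psi>\<close> vanishes on the first and reads the coordinates of the second. So the
      new injective summand adds nothing to the kernel.\<close>
    have "{y\<in>K. \<forall>l \<beta>. y l \<beta> \<noteq> 0 \<longrightarrow> \<beta> \<in> C l} = {y \<in> Sup k. gh k g y = 0}"
    proof (intro equalityI subsetI)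
      fix y assume y: "y \<in> {y\<in>K. \<forall>l \<beta>. y l \<beta> \<noteq> 0 \<longrightarrow> \<beta> \<in> C l}"
      then have z: "gh k g y + (\<Sum>w\<in>Wu. sc (y k (BI u w)) (s w)) = 0"
        by (simp add: K_def gh' exI_val)
      have "gh k g y \<in> F'" by (rule gh_in[OF subrepD(2)[OF F'] g])
      then have "y k (BI u w) = 0" if w: "w \<in> Wu" for w
      proof -
        have "0 = \<psi> w (gh k g y + (\<Sum>w\<in>Wu. sc (y k (BI u w)) (s w)))" using z by (simp add: psi_0)
        also have "\<dots> = (\<Sum>w'\<in>Wu. y k (BI u w') * \<psi> w (s w'))"
          using \<open>gh k g y \<in> F'\<close> w by (simp add: psi_add psi_sum psi_sc F'_def)
        also have "\<dots> = (\<Sum>w'\<in>Wu. if w' = w then y k (BI u w) else 0)"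
          using psi_s[OF w] by (intro sum.cong) auto
        finally show ?thesis using w fin by simp
      qed
      moreover have "y k \<beta> \<noteq> 0 \<Longrightarrow> \<exists>w\<in>Wu. \<beta> = BI u w" for \<beta>
        using y by (fastforce simp: C_def Wu_def)
      ultimately have yk: "y k \<beta> = 0" for \<beta> by blast
      then have "y \<in> Sup k" using y unfolding K_def Sup_def by (auto simp: less_Suc_eq)
      moreover have "gh k g y = 0" using z yk by simp
      ultimately show "y \<in> {y \<in> Sup k. gh k g y = 0}" by simp
    next
      fix y assume y: "y \<in> {y \<in> Sup k. gh k g y = 0}"
      then have yk: "y k \<beta> = 0" for \<beta> by (auto simp: Sup_def)
      then have "gh (Suc k) g' y = 0" using y by (simp add: gh' exI_val)
      moreover have "y \<in> Sup (Suc k)" using y unfolding Sup_def by (auto intro: less_SucI)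
      moreover have "\<beta> \<in> C l" if "y l \<beta> \<noteq> 0" for l \<beta> using that yk by (auto simp: C_def)
      ultimately show "y \<in> {y\<in>K. \<forall>l \<beta>. y l \<beta> \<noteq> 0 \<longrightarrow> \<beta> \<in> C l}" by (simp add: K_def)
    qed
    then have r: "retr {y\<in>K. \<forall>l \<beta>. y l \<beta> \<noteq> 0 \<longrightarrow> \<beta> \<in> C l}" using retr by simp
    have "retr K" by (rule retr_peel_off[OF K C un r])
    show ?thesis unfolding approx_def
      by (rule exI[of _ "Suc k"], rule exI[of _ g'])
        (intro conjI allI impI g'F lift' \<open>retr K\<close>[unfolded K_def])
  qed
  show ?thesis by (intro exI[of _ F'] conjI impI F' ps step)
qed

text \<open>Each splitting strictly lowers the dimension, so the induction ends at a representation
  where every map from an injective kills the socle.\<close>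

theorem approx:
  fixes F :: "(nat \<Rightarrow> ('v,'e) node \<Rightarrow> 'k::field) set"
  assumes "subrep m F"
  shows "approx F"
  using assms
proof (induction "V.dim F" arbitrary: F rule: less_induct)
  case less
  show ?case
  proof (cases "\<exists>u h. u \<in> Vs \<and> hm {BI u w | w. eok u w} F h \<and> h (BI u []) \<noteq> 0")
    case True
    then obtain u h where uh: "u \<in> Vs" "hm {BI u w | w. eok u w} F h" "h (BI u []) \<noteq> 0" by (elim exE conjE)
    obtain F' where F': "subrep m F' \<and> F' \<subset> F \<and> (approx F' \<longrightarrow> approx F)"
      using approx_injective_step[OF less.prems uh(2,3,1)] by (elim exE) (rule that)
    have "V.dim F' < V.dim F"
      using dim_psubset[OF subrepD(1)[OF less.prems]] subrepD(2)[of m F'] F' by simp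
    then show ?thesis using less.hyps[of F'] F' by simp
  next
    case False
    show ?thesis
    proof (rule approx_base[OF less.prems])
      fix u and h :: "('v,'e) node \<Rightarrow> nat \<Rightarrow> ('v,'e) node \<Rightarrow> 'k"
      assume "u \<in> Vs" "hm {BI u w | w. eok u w} F h"
      then show "h (BI u []) = 0" using False by (metis (no_types))
    qed
  qed
qed

end

section \<open>Rings of global dimension at most three\<close>

text \<open>The recursion makes congruence free of membership conditions and suits the inductions
  over the number of summands; \<open>rsum_finsum\<close> connects it with the sum in the definition
  of finite generation.\<close>

primrec rsum :: "('a, 'b) ring_scheme \<Rightarrow> nat \<Rightarrow> (nat \<Rightarrow> 'a) \<Rightarrow> 'a" where
  "rsum G 0 f = \<zero>\<^bsub>G\<^esub>"
| "rsum G (Suc k) f = rsum G k f \<oplus>\<^bsub>G\<^esub> f k"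

lemma rsum_cong: "(\<And>i. i < k \<Longrightarrow> f i = g i) \<Longrightarrow> rsum G k f = rsum G k g"
  by (induction k) auto

context abelian_monoid
begin

lemma rsum_closed: "(\<And>i. i < k \<Longrightarrow> f i \<in> carrier G) \<Longrightarrow> rsum G k f \<in> carrier G"
  by (induction k) auto

lemma rsum_add: "(\<And>i. i < k \<Longrightarrow> f i \<in> carrier G) \<Longrightarrow> (\<And>i. i < k \<Longrightarrow> g i \<in> carrier G) \<Longrightarrow>
    rsum G k (\<lambda>i. f i \<oplus>\<^bsub>G\<^esub> g i) = rsum G k f \<oplus>\<^bsub>G\<^esub> rsum G k g"
proof (induction k)
  case (Suc k)
  then show ?case using rsum_closed[of k f] rsum_closed[of k g] by (simp add: a_ac)
qed simp

lemma rsum_finsum: "(\<And>i. i < k \<Longrightarrow> f i \<in> carrier G) \<Longrightarrow> rsum G k f = (\<Oplus>i\<in>{..<k}. f i)"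
  by (induction k) (auto simp: finsum_insert lessThan_Suc a_comm Pi_def)

lemma rsum_zero: "(\<And>i. i < k \<Longrightarrow> f i = \<zero>) \<Longrightarrow> rsum G k f = \<zero>"
  by (induction k) auto

lemma rsum_single: "j < k \<Longrightarrow> x \<in> carrier G \<Longrightarrow> rsum G k (\<lambda>i. if i = j then x else \<zero>) = x"
proof (induction k)
  case (Suc k)
  show ?case
  proof (cases "j = k")
    case True
    then have "rsum G k (\<lambda>i. if i = j then x else \<zero>) = \<zero>" by (intro rsum_zero) auto
    then show ?thesis using True Suc by simp
  next
    case False
    then show ?thesis using Suc by auto
  qed
qed simp

end

lemma hom_zero_group: assumes "abelian_group X" "abelian_group Y" "f \<in> hom (add_monoid X) (add_monoid Y)"
  shows "f \<zero>\<^bsub>X\<^esub> = \<zero>\<^bsub>Y\<^esub>"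
  using group_hom.hom_one[of "add_monoid X" "add_monoid Y" f] abelian_group.a_group[OF assms(1)] abelian_group.a_group[OF assms(2)] assms(3)
  by (simp add: group_hom_def group_hom_axioms_def)

lemma rmod_homD:
  assumes "f \<in> rmod_hom R X Y"
  shows "x \<in> carrier X \<Longrightarrow> f x \<in> carrier Y"
    "x \<in> carrier X \<Longrightarrow> y \<in> carrier X \<Longrightarrow> f (x \<oplus>\<^bsub>X\<^esub> y) = f x \<oplus>\<^bsub>Y\<^esub> f y"
    "x \<in> carrier X \<Longrightarrow> r \<in> carrier R \<Longrightarrow> f (x \<triangleleft>\<^bsub>X\<^esub> r) = f x \<triangleleft>\<^bsub>Y\<^esub> r"
  using assms by (auto simp: rmod_hom_def hom_def)

lemma rmod_homI:
  assumes "\<And>x. x \<in> carrier X \<Longrightarrow> f x \<in> carrier Y"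
    "\<And>x y. x \<in> carrier X \<Longrightarrow> y \<in> carrier X \<Longrightarrow> f (x \<oplus>\<^bsub>X\<^esub> y) = f x \<oplus>\<^bsub>Y\<^esub> f y"
    "\<And>x r. x \<in> carrier X \<Longrightarrow> r \<in> carrier R \<Longrightarrow> f (x \<triangleleft>\<^bsub>X\<^esub> r) = f x \<triangleleft>\<^bsub>Y\<^esub> r"
  shows "f \<in> rmod_hom R X Y"
  using assms by (auto simp: rmod_hom_def hom_def)

lemma rmod_hom_zero: "right_module R X \<Longrightarrow> right_module R Y \<Longrightarrow> f \<in> rmod_hom R X Y \<Longrightarrow> f \<zero>\<^bsub>X\<^esub> = \<zero>\<^bsub>Y\<^esub>"
  by (rule hom_zero_group) (auto simp: right_module_def rmod_hom_def)

section \<open>Linear combinations in right modules and the dual basis lemma\<close>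

definition comb :: "('r, 'm, 'y) rmodule_scheme \<Rightarrow> nat \<Rightarrow> (nat \<Rightarrow> 'm) \<Rightarrow> (nat \<Rightarrow> 'r) \<Rightarrow> 'm" where
  "comb X n x c = rsum X n (\<lambda>t. x t \<triangleleft>\<^bsub>X\<^esub> c t)"

definition Rn :: "('r, 'x) ring_scheme \<Rightarrow> nat \<Rightarrow> (nat \<Rightarrow> 'r) set" where
  "Rn R n = (\<Pi>\<^sub>E i\<in>{..<n}. carrier R)"

lemma RnD: "z \<in> Rn R n \<Longrightarrow> i < n \<Longrightarrow> z i \<in> carrier R" by (auto simp: Rn_def)

context right_module
begin

lemma comb_closed: "(\<And>i. i < n \<Longrightarrow> x i \<in> carrier M) \<Longrightarrow> c \<in> Rn R n \<Longrightarrow> comb M n x c \<in> carrier M"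
  unfolding comb_def by (intro M.rsum_closed ract_closed) (auto simp: Rn_def)

lemma comb_add: "(\<And>i. i < n \<Longrightarrow> x i \<in> carrier M) \<Longrightarrow> c \<in> Rn R n \<Longrightarrow> c' \<in> Rn R n \<Longrightarrow>
    comb M n x (\<lambda>i\<in>{..<n}. c i \<oplus>\<^bsub>R\<^esub> c' i) = comb M n x c \<oplus>\<^bsub>M\<^esub> comb M n x c'"
proof -
  assume a: "\<And>i. i < n \<Longrightarrow> x i \<in> carrier M" "c \<in> Rn R n" "c' \<in> Rn R n"
  have "comb M n x (\<lambda>i\<in>{..<n}. c i \<oplus>\<^bsub>R\<^esub> c' i) = rsum M n (\<lambda>i. x i \<triangleleft>\<^bsub>M\<^esub> c i \<oplus>\<^bsub>M\<^esub> x i \<triangleleft>\<^bsub>M\<^esub> c' i)"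
    unfolding comb_def using a by (intro rsum_cong) (simp add: ract_add_right RnD[of _ R])
  also have "\<dots> = comb M n x c \<oplus>\<^bsub>M\<^esub> comb M n x c'"
    unfolding comb_def using a by (intro M.rsum_add ract_closed) (auto simp: Rn_def)
  finally show ?thesis .
qed

lemma zero_ract: "s \<in> carrier R \<Longrightarrow> \<zero>\<^bsub>M\<^esub> \<triangleleft>\<^bsub>M\<^esub> s = \<zero>\<^bsub>M\<^esub>"
  using ract_add_left[of "\<zero>\<^bsub>M\<^esub>" "\<zero>\<^bsub>M\<^esub>" s] ract_closed[of "\<zero>\<^bsub>M\<^esub>" s]
  by (simp add: M.add.l_cancel_one')

lemma ract_zero: "x \<in> carrier M \<Longrightarrow> x \<triangleleft>\<^bsub>M\<^esub> \<zero>\<^bsub>R\<^esub> = \<zero>\<^bsub>M\<^esub>"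
  using ract_add_right[of x "\<zero>\<^bsub>R\<^esub>" "\<zero>\<^bsub>R\<^esub>"] ract_closed[of x "\<zero>\<^bsub>R\<^esub>"]
  by (simp add: M.add.l_cancel_one')

lemma rsum_ract: "(\<And>i. i < n \<Longrightarrow> f i \<in> carrier M) \<Longrightarrow> s \<in> carrier R \<Longrightarrow>
    rsum M n f \<triangleleft>\<^bsub>M\<^esub> s = rsum M n (\<lambda>i. f i \<triangleleft>\<^bsub>M\<^esub> s)"
  by (induction n) (auto simp: zero_ract ract_add_left M.rsum_closed)

lemma comb_ract: "(\<And>i. i < n \<Longrightarrow> x i \<in> carrier M) \<Longrightarrow> c \<in> Rn R n \<Longrightarrow> s \<in> carrier R \<Longrightarrow>
    comb M n x (\<lambda>i\<in>{..<n}. c i \<otimes>\<^bsub>R\<^esub> s) = comb M n x c \<triangleleft>\<^bsub>M\<^esub> s"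
proof -
  assume a: "\<And>i. i < n \<Longrightarrow> x i \<in> carrier M" "c \<in> Rn R n" "s \<in> carrier R"
  have "comb M n x c \<triangleleft>\<^bsub>M\<^esub> s = rsum M n (\<lambda>t. x t \<triangleleft>\<^bsub>M\<^esub> c t \<triangleleft>\<^bsub>M\<^esub> s)"
    unfolding comb_def using a by (intro rsum_ract ract_closed) (simp_all add: RnD[of _ R])
  also have "\<dots> = comb M n x (\<lambda>i\<in>{..<n}. c i \<otimes>\<^bsub>R\<^esub> s)"
    unfolding comb_def using a by (intro rsum_cong) (simp add: ract_mult RnD[of _ R])
  finally show ?thesis by simp
qed

text \<open>The definition of finite generation uses coefficient functions on the generating set,
  so repetitions among the generators have to be merged.\<close>

lemma fg_moduleI:
  assumes p: "\<And>t. t < n \<Longrightarrow> p t \<in> carrier M" and gen: "\<And>x. x \<in> carrier M \<Longrightarrow> \<exists>c\<in>Rn R n. x = comb M n p c"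
  shows "fg_module R M"
  unfolding fg_module_def
proof (intro conjI exI[of _ "p ` {..<n}"] ballI)
  show "right_module R M" ..
  fix x assume x: "x \<in> carrier M"
  let ?S = "p ` {..<n}"
  define C where "C = {\<Oplus>\<^bsub>M\<^esub>s\<in>?S. s \<triangleleft>\<^bsub>M\<^esub> f s | f. f ` ?S \<subseteq> carrier R}"
  have SM: "?S \<subseteq> carrier M" using p by auto
  have CI: "y \<in> C" if "f ` ?S \<subseteq> carrier R" "y = (\<Oplus>\<^bsub>M\<^esub>s\<in>?S. s \<triangleleft>\<^bsub>M\<^esub> f s)" for f y
    unfolding C_def by (rule CollectI, rule exI[of _ f]) (intro conjI that)
  have CE: "\<exists>f. f ` ?S \<subseteq> carrier R \<and> y = (\<Oplus>\<^bsub>M\<^esub>s\<in>?S. s \<triangleleft>\<^bsub>M\<^esub> f s)" if "y \<in> C" for y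
    using that unfolding C_def by (elim CollectE exE conjE) (intro exI conjI)
  have C0: "\<zero>\<^bsub>M\<^esub> \<in> C"
  proof -
    have "(\<Oplus>\<^bsub>M\<^esub>s\<in>?S. s \<triangleleft>\<^bsub>M\<^esub> \<zero>\<^bsub>R\<^esub>) = (\<Oplus>\<^bsub>M\<^esub>s\<in>?S. \<zero>\<^bsub>M\<^esub>)"
      using SM by (intro M.finsum_cong') (auto simp: ract_zero)
    then have "\<zero>\<^bsub>M\<^esub> = (\<Oplus>\<^bsub>M\<^esub>s\<in>?S. s \<triangleleft>\<^bsub>M\<^esub> (\<lambda>_. \<zero>\<^bsub>R\<^esub>) s)" by (simp add: M.finsum_zero)
    moreover have "(\<lambda>_. \<zero>\<^bsub>R\<^esub>) ` ?S \<subseteq> carrier R" by auto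
    ultimately show ?thesis by (intro CI)
  qed
  have Cadd: "y \<oplus>\<^bsub>M\<^esub> y' \<in> C" if yy: "y \<in> C" "y' \<in> C" for y y'
  proof -
    obtain f f' where f: "f ` ?S \<subseteq> carrier R" "y = (\<Oplus>\<^bsub>M\<^esub>s\<in>?S. s \<triangleleft>\<^bsub>M\<^esub> f s)"
      "f' ` ?S \<subseteq> carrier R" "y' = (\<Oplus>\<^bsub>M\<^esub>s\<in>?S. s \<triangleleft>\<^bsub>M\<^esub> f' s)" using CE[OF yy(1)] CE[OF yy(2)] by (elim exE conjE) (rule that)
    have fC: "f s \<in> carrier R" "f' s \<in> carrier R" if "s \<in> ?S" for s using f(1,3) that by blast+
    have "(\<Oplus>\<^bsub>M\<^esub>s\<in>?S. s \<triangleleft>\<^bsub>M\<^esub> (f s \<oplus>\<^bsub>R\<^esub> f' s)) = (\<Oplus>\<^bsub>M\<^esub>s\<in>?S. s \<triangleleft>\<^bsub>M\<^esub> f s \<oplus>\<^bsub>M\<^esub> s \<triangleleft>\<^bsub>M\<^esub> f' s)"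
    proof (rule M.finsum_cong')
      fix s assume "s \<in> ?S"
      then show "s \<triangleleft>\<^bsub>M\<^esub> (f s \<oplus>\<^bsub>R\<^esub> f' s) = s \<triangleleft>\<^bsub>M\<^esub> f s \<oplus>\<^bsub>M\<^esub> s \<triangleleft>\<^bsub>M\<^esub> f' s" using fC SM by (intro ract_add_right) auto
    qed (use fC SM in \<open>auto intro!: M.a_closed ract_closed\<close>)
    also have "\<dots> = y \<oplus>\<^bsub>M\<^esub> y'"
      unfolding f(2,4) using fC SM by (intro M.finsum_addf) (auto intro!: ract_closed)
    finally have "y \<oplus>\<^bsub>M\<^esub> y' = (\<Oplus>\<^bsub>M\<^esub>s\<in>?S. s \<triangleleft>\<^bsub>M\<^esub> (\<lambda>s. f s \<oplus>\<^bsub>R\<^esub> f' s) s)" by simp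
    moreover have "(\<lambda>s. f s \<oplus>\<^bsub>R\<^esub> f' s) ` ?S \<subseteq> carrier R" using fC by auto
    ultimately show ?thesis by (intro CI)
  qed
  have C1: "p t \<triangleleft>\<^bsub>M\<^esub> c \<in> C" if t: "t < n" "c \<in> carrier R" for t c
  proof -
    let ?f = "\<lambda>s. if s = p t then c else \<zero>\<^bsub>R\<^esub>"
    have "(\<Oplus>\<^bsub>M\<^esub>s\<in>?S. s \<triangleleft>\<^bsub>M\<^esub> ?f s) = (\<Oplus>\<^bsub>M\<^esub>s\<in>?S. if p t = s then p t \<triangleleft>\<^bsub>M\<^esub> c else \<zero>\<^bsub>M\<^esub>)"
      using t p by (intro M.finsum_cong') (auto simp: ract_zero ract_closed)
    also have "\<dots> = p t \<triangleleft>\<^bsub>M\<^esub> c" using t p by (intro M.finsum_singleton) (auto simp: ract_closed)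
    finally have "p t \<triangleleft>\<^bsub>M\<^esub> c = (\<Oplus>\<^bsub>M\<^esub>s\<in>?S. s \<triangleleft>\<^bsub>M\<^esub> ?f s)" by simp
    moreover have "?f ` ?S \<subseteq> carrier R" using t by auto
    ultimately show ?thesis by (intro CI)
  qed
  obtain c where c: "c \<in> Rn R n" "x = comb M n p c" using gen x by blast
  have "rsum M k (\<lambda>t. p t \<triangleleft>\<^bsub>M\<^esub> c t) \<in> C" if "k \<le> n" for k
    using that by (induction k) (auto simp: C0 intro!: Cadd C1 RnD[OF c(1)])
  then have "x \<in> C" using c(2) by (simp add: comb_def)
  then show "\<exists>f. f ` ?S \<subseteq> carrier R \<and> x = (\<Oplus>\<^bsub>M\<^esub>s\<in>?S. s \<triangleleft>\<^bsub>M\<^esub> f s)" by (rule CE)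
qed (use p in auto)

end

lemma fg_moduleE:
  assumes "fg_module R M"
  obtains n p where "right_module R M" "\<And>t. t < n \<Longrightarrow> p t \<in> carrier M" "\<And>x. x \<in> carrier M \<Longrightarrow> \<exists>c\<in>Rn R n. x = comb M n p c"
proof -
  interpret right_module R M using assms by (simp add: fg_module_def)
  obtain S where S: "S \<subseteq> carrier M" "finite S" "\<And>x. x \<in> carrier M \<Longrightarrow> \<exists>f. f ` S \<subseteq> carrier R \<and> x = (\<Oplus>\<^bsub>M\<^esub>s\<in>S. s \<triangleleft>\<^bsub>M\<^esub> f s)"
    using assms unfolding fg_module_def by blast
  obtain p where p: "bij_betw p {..<card S} S" using ex_bij_betw_nat_finite[OF S(2)] by (auto simp: atLeast0LessThan)
  have pS: "p ` {..<card S} = S" "inj_on p {..<card S}" using p by (auto simp: bij_betw_def)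
  show thesis
  proof (rule that[of "card S" p])
    show "right_module R M" ..
    show "p t \<in> carrier M" if "t < card S" for t using that pS S(1) by blast
    fix x assume "x \<in> carrier M"
    then obtain f where f: "f ` S \<subseteq> carrier R" "x = (\<Oplus>\<^bsub>M\<^esub>s\<in>S. s \<triangleleft>\<^bsub>M\<^esub> f s)" using S(3) by blast
    let ?c = "\<lambda>i\<in>{..<card S}. f (p i)"
    have c: "?c \<in> Rn R (card S)" using f(1) pS(1) by (auto simp: Rn_def)
    have "x = (\<Oplus>\<^bsub>M\<^esub>i\<in>{..<card S}. p i \<triangleleft>\<^bsub>M\<^esub> f (p i))"
      unfolding f(2) using M.finsum_reindex[of "\<lambda>s. s \<triangleleft>\<^bsub>M\<^esub> f s" p "{..<card S}"] pS f(1) S(1)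
      by (auto simp: ract_closed subset_eq image_subset_iff)
    also have "\<dots> = rsum M (card S) (\<lambda>i. p i \<triangleleft>\<^bsub>M\<^esub> f (p i))"
      using pS(1) f(1) S(1) by (intro M.rsum_finsum[symmetric] ract_closed) auto
    also have "\<dots> = comb M (card S) p ?c" unfolding comb_def by (intro rsum_cong) auto
    finally show "\<exists>c\<in>Rn R (card S). x = comb M (card S) p c" using c by blast
  qed
qed

lemma hom_comb:
  assumes "right_module R X" "right_module R Y" "f \<in> rmod_hom R X Y" "\<And>i. i < n \<Longrightarrow> x i \<in> carrier X" "c \<in> Rn R n"
  shows "f (comb X n x c) = comb Y n (\<lambda>i. f (x i)) c"
proof -
  interpret X: right_module R X by fact
  have "f (rsum X k (\<lambda>t. x t \<triangleleft>\<^bsub>X\<^esub> c t)) = rsum Y k (\<lambda>t. f (x t) \<triangleleft>\<^bsub>Y\<^esub> c t)" if "k \<le> n" for k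
    using that
  proof (induction k)
    case 0
    then show ?case using rmod_hom_zero[OF assms(1-3)] by simp
  next
    case (Suc k)
    have "rsum X k (\<lambda>t. x t \<triangleleft>\<^bsub>X\<^esub> c t) \<in> carrier X"
      using Suc.prems assms(4) RnD[OF assms(5)] by (intro X.M.rsum_closed X.ract_closed) auto
    then show ?case using Suc assms(4) RnD[OF assms(5)] by (simp add: rmod_homD[OF assms(3)] X.ract_closed)
  qed
  then show ?thesis by (simp add: comb_def)
qed

text \<open>Lift the images of the generators \<open>p t\<close> to \<open>X\<close> and combine the
  lifts with the coordinates \<open>\<iota>\<close>. Additivity and linearity of the coordinates
  make the result a module map.\<close>

lemma projective_dual_basis:
  fixes P :: "'r fgmod"
  assumes P: "right_module R P" and p: "\<And>t. t < r \<Longrightarrow> p t \<in> carrier P"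
    and \<iota>: "\<And>x. x \<in> carrier P \<Longrightarrow> \<iota> x \<in> Rn R r" "\<And>x. x \<in> carrier P \<Longrightarrow> x = comb P r p (\<iota> x)"
    and \<iota>_add: "\<And>x y. x \<in> carrier P \<Longrightarrow> y \<in> carrier P \<Longrightarrow> \<iota> (x \<oplus>\<^bsub>P\<^esub> y) = (\<lambda>i\<in>{..<r}. \<iota> x i \<oplus>\<^bsub>R\<^esub> \<iota> y i)"
    and \<iota>_ract: "\<And>x s. x \<in> carrier P \<Longrightarrow> s \<in> carrier R \<Longrightarrow> \<iota> (x \<triangleleft>\<^bsub>P\<^esub> s) = (\<lambda>i\<in>{..<r}. \<iota> x i \<otimes>\<^bsub>R\<^esub> s)"
  shows "projective_module R P"
  unfolding projective_module_def
proof (intro conjI allI ballI impI)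
  show "fg_module R P"
    by (rule right_module.fg_moduleI[OF P, of r p]) (use p \<iota> in blast)+
  fix X Y :: "'r fgmod" and g f
  assume g: "g \<in> rmod_hom R X Y" and f: "f \<in> rmod_hom R P Y"
    and XY: "fg_module R X \<and> fg_module R Y \<and> g ` carrier X = carrier Y"
  have X: "right_module R X" and Y: "right_module R Y" using XY by (auto simp: fg_module_def)
  interpret X: right_module R X by (rule X)
  have "\<exists>x. x \<in> carrier X \<and> g x = f (p t)" if t: "t < r" for t
  proof -
    have "f (p t) \<in> g ` carrier X" using XY rmod_homD(1)[OF f p[OF t]] by simp
    then show ?thesis by auto
  qed
  then obtain x where x: "\<And>t. t < r \<Longrightarrow> x t \<in> carrier X \<and> g (x t) = f (p t)" by metis
  let ?h = "\<lambda>y. comb X r x (\<iota> y)"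
  have hh: "?h \<in> rmod_hom R P X"
  proof (rule rmod_homI)
    show "?h y \<in> carrier X" if "y \<in> carrier P" for y using x \<iota>(1) that by (intro X.comb_closed) auto
    show "?h (y \<oplus>\<^bsub>P\<^esub> y') = ?h y \<oplus>\<^bsub>X\<^esub> ?h y'" if "y \<in> carrier P" "y' \<in> carrier P" for y y'
      unfolding \<iota>_add[OF that] using x \<iota>(1) that by (intro X.comb_add) auto
    show "?h (y \<triangleleft>\<^bsub>P\<^esub> s) = ?h y \<triangleleft>\<^bsub>X\<^esub> s" if "y \<in> carrier P" "s \<in> carrier R" for y s
      unfolding \<iota>_ract[OF that] using x \<iota>(1) that by (intro X.comb_ract) auto
  qed
  have gh: "g (?h y) = f y" if y: "y \<in> carrier P" for y
  proof -
    have "g (?h y) = comb Y r (\<lambda>t. g (x t)) (\<iota> y)" using x \<iota>(1)[OF y] by (intro hom_comb[OF X Y g]) auto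
    also have "\<dots> = comb Y r (\<lambda>t. f (p t)) (\<iota> y)" unfolding comb_def using x by (intro rsum_cong) auto
    also have "\<dots> = f (comb P r p (\<iota> y))" by (rule hom_comb[OF P Y f p \<iota>(1)[OF y], symmetric])
    also have "comb P r p (\<iota> y) = y" by (rule \<iota>(2)[OF y, symmetric])
    finally show ?thesis .
  qed
  show "\<exists>h\<in>rmod_hom R P X. \<forall>x\<in>carrier P. g (h x) = f x"
    by (rule bexI[OF _ hh], rule ballI, rule gh)
qed

text \<open>The matrix with columns \<open>g l\<close> applied to the column \<open>z\<close>. With
  scalars on the right, multiplication by a matrix from the left is a map of right modules R^k ->
  R^m.\<close>

definition lc :: "('r, 'x) ring_scheme \<Rightarrow> nat \<Rightarrow> nat \<Rightarrow> (nat \<Rightarrow> nat \<Rightarrow> 'r) \<Rightarrow> (nat \<Rightarrow> 'r) \<Rightarrow> nat \<Rightarrow> 'r" where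
  "lc R k m g z = (\<lambda>i\<in>{..<m}. rsum R k (\<lambda>l. g l i \<otimes>\<^bsub>R\<^esub> z l))"

definition zn :: "('r, 'x) ring_scheme \<Rightarrow> nat \<Rightarrow> nat \<Rightarrow> 'r" where
  "zn R n = (\<lambda>i\<in>{..<n}. \<zero>\<^bsub>R\<^esub>)"

text \<open>Elements of an \<open>fgmod\<close> are sets of tuples, so a tuple is wrapped as a
  singleton.\<close>

definition sub_mod :: "('r, 'x) ring_scheme \<Rightarrow> nat \<Rightarrow> (nat \<Rightarrow> 'r) set \<Rightarrow> 'r fgmod" where
  "sub_mod R n U =
    \<lparr>carrier = (\<lambda>x. {x}) ` U, mult = undefined, one = undefined, zero = {zn R n},
     add = (\<lambda>X Y. {\<lambda>i\<in>{..<n}. the_elem X i \<oplus>\<^bsub>R\<^esub> the_elem Y i}),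
     ract = (\<lambda>X r. {\<lambda>i\<in>{..<n}. the_elem X i \<otimes>\<^bsub>R\<^esub> r})\<rparr>"

lemma sub_mod_simps [simp]:
  "carrier (sub_mod R n U) = (\<lambda>x. {x}) ` U"
  "\<zero>\<^bsub>sub_mod R n U\<^esub> = {zn R n}"
  "{x} \<oplus>\<^bsub>sub_mod R n U\<^esub> {y} = {\<lambda>i\<in>{..<n}. x i \<oplus>\<^bsub>R\<^esub> y i}"
  "{x} \<triangleleft>\<^bsub>sub_mod R n U\<^esub> r = {\<lambda>i\<in>{..<n}. x i \<otimes>\<^bsub>R\<^esub> r}"
  by (simp_all add: sub_mod_def)

definition submod :: "('r, 'x) ring_scheme \<Rightarrow> nat \<Rightarrow> (nat \<Rightarrow> 'r) set \<Rightarrow> bool" where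
  "submod R n U \<longleftrightarrow> U \<subseteq> Rn R n \<and> zn R n \<in> U \<and>
    (\<forall>x\<in>U. \<forall>y\<in>U. (\<lambda>i\<in>{..<n}. x i \<oplus>\<^bsub>R\<^esub> y i) \<in> U) \<and>
    (\<forall>x\<in>U. \<forall>r\<in>carrier R. (\<lambda>i\<in>{..<n}. x i \<otimes>\<^bsub>R\<^esub> r) \<in> U)"

text \<open>The right noetherian property in the form that continues a resolution by free modules:
  the kernel of a map out of R^n can be covered again.\<close>

definition fg_submodules :: "('r, 'x) ring_scheme \<Rightarrow> bool" where
  "fg_submodules R \<longleftrightarrow> (\<forall>n U. submod R n U \<longrightarrow>
    (\<exists>m f. (\<forall>i<m. f i \<in> U) \<and> (\<forall>x\<in>U. \<exists>z\<in>Rn R m. x = lc R m n f z)))"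

text \<open>The kernel of R^m -> R^n is a second syzygy of the cokernel. It is covered by R^k
  through \<open>g\<close>, and the kernel of this cover is projective, as witnessed by the dual
  basis \<open>\<kappa>\<close>, \<open>\<iota>\<close>.\<close>

definition projective_second_syzygies :: "('r, 'x) ring_scheme \<Rightarrow> bool" where
  "projective_second_syzygies R \<longleftrightarrow> (\<forall>m n f. (\<forall>i<m. f i \<in> Rn R n) \<longrightarrow>
    (\<exists>k g. (\<forall>l<k. g l \<in> Rn R m \<and> lc R m n f (g l) = zn R n) \<and>
       (\<forall>z\<in>Rn R m. lc R m n f z = zn R n \<longrightarrow> (\<exists>y\<in>Rn R k. z = lc R k m g y)) \<and>
       (\<exists>r \<kappa> \<iota>. (\<forall>t<r. \<kappa> t \<in> Rn R k \<and> lc R k m g (\<kappa> t) = zn R m) \<and>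
          (\<forall>z\<in>Rn R k. lc R k m g z = zn R m \<longrightarrow> \<iota> z \<in> Rn R r \<and> z = lc R r k \<kappa> (\<iota> z) \<and>
             (\<forall>z'\<in>Rn R k. lc R k m g z' = zn R m \<longrightarrow>
                \<iota> (\<lambda>i\<in>{..<k}. z i \<oplus>\<^bsub>R\<^esub> z' i) = (\<lambda>i\<in>{..<r}. \<iota> z i \<oplus>\<^bsub>R\<^esub> \<iota> z' i)) \<and>
             (\<forall>s\<in>carrier R. \<iota> (\<lambda>i\<in>{..<k}. z i \<otimes>\<^bsub>R\<^esub> s) = (\<lambda>i\<in>{..<r}. \<iota> z i \<otimes>\<^bsub>R\<^esub> s))))))"

context ring
begin

lemma rsum_rmult: "(\<And>i. i < k \<Longrightarrow> f i \<in> carrier R) \<Longrightarrow> s \<in> carrier R \<Longrightarrow> rsum R k f \<otimes> s = rsum R k (\<lambda>i. f i \<otimes> s)"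
  by (induction k) (auto simp: l_distr rsum_closed)

lemma zn_Rn: "zn R n \<in> Rn R n" by (auto simp: zn_def Rn_def)

lemma add_Rn: "x \<in> Rn R n \<Longrightarrow> y \<in> Rn R n \<Longrightarrow> (\<lambda>i\<in>{..<n}. x i \<oplus>\<^bsub>R\<^esub> y i) \<in> Rn R n" by (auto simp: Rn_def)
lemma mult_Rn: "x \<in> Rn R n \<Longrightarrow> r \<in> carrier R \<Longrightarrow> (\<lambda>i\<in>{..<n}. x i \<otimes> r) \<in> Rn R n" by (auto simp: Rn_def)

lemma Rn_eqI: "x \<in> Rn R n \<Longrightarrow> y \<in> Rn R n \<Longrightarrow> (\<And>i. i < n \<Longrightarrow> x i = y i) \<Longrightarrow> x = y"
  unfolding Rn_def by (auto intro: PiE_ext)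

lemma submod_Rn: "submod R n (Rn R n)"
  using zn_Rn add_Rn mult_Rn by (simp add: submod_def)

lemma right_module_sub_mod:
  assumes U: "submod R n U"
  shows "right_module R (sub_mod R n U)"
proof -
  let ?M = "sub_mod R n U"
  have UR: "x \<in> U \<Longrightarrow> i < n \<Longrightarrow> x i \<in> carrier R" for x i using U by (auto simp: submod_def Rn_def)
  have ext: "x \<in> U \<Longrightarrow> x \<in> extensional {..<n}" for x using U by (auto simp: submod_def Rn_def PiE_def)
  have z: "zn R n \<in> U" using U by (simp add: submod_def)
  have eq: "x = (\<lambda>i\<in>{..<n}. h i)" if "x \<in> U" "\<And>i. i < n \<Longrightarrow> x i = h i" for x h
    by (rule extensionalityI[OF ext[OF that(1)]]) (use that(2) in auto)
  have "abelian_group ?M"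
  proof (rule abelian_groupI)
    show "x \<oplus>\<^bsub>?M\<^esub> y \<in> carrier ?M" if "x \<in> carrier ?M" "y \<in> carrier ?M" for x y
      using that U by (auto simp: submod_def)
    show "\<zero>\<^bsub>?M\<^esub> \<in> carrier ?M" using z by simp
    show "\<zero>\<^bsub>?M\<^esub> \<oplus>\<^bsub>?M\<^esub> x = x" if x: "x \<in> carrier ?M" for x
    proof -
      obtain u where u: "x = {u}" "u \<in> U" using x by auto
      have "u = (\<lambda>i\<in>{..<n}. zn R n i \<oplus>\<^bsub>R\<^esub> u i)" by (rule eq[OF u(2)]) (simp add: zn_def UR[OF u(2)])
      then show ?thesis using u(1) by simp
    qed
    show "x \<oplus>\<^bsub>?M\<^esub> y \<oplus>\<^bsub>?M\<^esub> z = x \<oplus>\<^bsub>?M\<^esub> (y \<oplus>\<^bsub>?M\<^esub> z)" if "x \<in> carrier ?M" "y \<in> carrier ?M" "z \<in> carrier ?M" for x y z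
      using that UR by (auto simp: a_assoc cong: restrict_cong)
    show "x \<oplus>\<^bsub>?M\<^esub> y = y \<oplus>\<^bsub>?M\<^esub> x" if "x \<in> carrier ?M" "y \<in> carrier ?M" for x y
      using that UR by (auto simp: a_comm cong: restrict_cong)
    fix x assume "x \<in> carrier ?M"
    then obtain u where u: "x = {u}" "u \<in> U" by auto
    \<comment> \<open>Negatives are not among the closure properties of \<open>submod\<close>; they
      arise by acting with minus one.\<close>
    let ?v = "\<lambda>i\<in>{..<n}. u i \<otimes> (\<ominus> \<one>)"
    have "?v \<in> U" using U u by (simp add: submod_def)
    moreover have "{?v} \<oplus>\<^bsub>?M\<^esub> x = \<zero>\<^bsub>?M\<^esub>"
      using u UR by (auto simp: zn_def r_minus l_neg cong: restrict_cong)
    ultimately show "\<exists>y\<in>carrier ?M. y \<oplus>\<^bsub>?M\<^esub> x = \<zero>\<^bsub>?M\<^esub>" by auto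
  qed
  then show ?thesis
  proof (intro right_module.intro right_module_axioms.intro)
    show "x \<triangleleft>\<^bsub>?M\<^esub> r \<in> carrier ?M" if "x \<in> carrier ?M" "r \<in> carrier R" for x r using that U by (auto simp: submod_def)
    show "x \<triangleleft>\<^bsub>?M\<^esub> (r \<oplus>\<^bsub>R\<^esub> s) = x \<triangleleft>\<^bsub>?M\<^esub> r \<oplus>\<^bsub>?M\<^esub> x \<triangleleft>\<^bsub>?M\<^esub> s" if "x \<in> carrier ?M" "r \<in> carrier R" "s \<in> carrier R" for x r s
      using that UR by (auto simp: r_distr cong: restrict_cong)
    show "(x \<oplus>\<^bsub>?M\<^esub> y) \<triangleleft>\<^bsub>?M\<^esub> r = x \<triangleleft>\<^bsub>?M\<^esub> r \<oplus>\<^bsub>?M\<^esub> y \<triangleleft>\<^bsub>?M\<^esub> r" if "x \<in> carrier ?M" "y \<in> carrier ?M" "r \<in> carrier R" for x y r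
      using that UR by (auto simp: l_distr cong: restrict_cong)
    show "x \<triangleleft>\<^bsub>?M\<^esub> (r \<otimes> s) = x \<triangleleft>\<^bsub>?M\<^esub> r \<triangleleft>\<^bsub>?M\<^esub> s" if "x \<in> carrier ?M" "r \<in> carrier R" "s \<in> carrier R" for x r s
      using that UR by (auto simp: m_assoc cong: restrict_cong)
    show "x \<triangleleft>\<^bsub>?M\<^esub> \<one> = x" if x: "x \<in> carrier ?M" for x
    proof -
      obtain u where u: "x = {u}" "u \<in> U" using x by auto
      have "u = (\<lambda>i\<in>{..<n}. u i \<otimes> \<one>)" by (rule eq[OF u(2)]) (simp add: UR[OF u(2)])
      then show ?thesis using u(1) by simp
    qed
  qed (rule ring_axioms)
qed

lemma lc_Rn: "(\<And>l. l < k \<Longrightarrow> g l \<in> Rn R m) \<Longrightarrow> z \<in> Rn R k \<Longrightarrow> lc R k m g z \<in> Rn R m"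
  by (auto simp: lc_def Rn_def intro!: rsum_closed)

lemma lc_add: "(\<And>l. l < k \<Longrightarrow> g l \<in> Rn R m) \<Longrightarrow> z \<in> Rn R k \<Longrightarrow> z' \<in> Rn R k \<Longrightarrow>
    lc R k m g (\<lambda>l\<in>{..<k}. z l \<oplus>\<^bsub>R\<^esub> z' l) = (\<lambda>i\<in>{..<m}. lc R k m g z i \<oplus>\<^bsub>R\<^esub> lc R k m g z' i)"
proof (rule ext)
  fix i assume a: "\<And>l. l < k \<Longrightarrow> g l \<in> Rn R m" "z \<in> Rn R k" "z' \<in> Rn R k"
  show "lc R k m g (\<lambda>l\<in>{..<k}. z l \<oplus>\<^bsub>R\<^esub> z' l) i = (\<lambda>i\<in>{..<m}. lc R k m g z i \<oplus>\<^bsub>R\<^esub> lc R k m g z' i) i"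
  proof (cases "i < m")
    case True
    have gi: "g l i \<in> carrier R" if "l < k" for l using RnD[OF a(1)[OF that] True] .
    note zi = RnD[OF a(2)] RnD[OF a(3)]
    have "rsum R k (\<lambda>l. g l i \<otimes> (\<lambda>l\<in>{..<k}. z l \<oplus>\<^bsub>R\<^esub> z' l) l) = rsum R k (\<lambda>l. g l i \<otimes> z l \<oplus>\<^bsub>R\<^esub> g l i \<otimes> z' l)"
      using gi zi by (intro rsum_cong) (simp add: r_distr)
    also have "\<dots> = rsum R k (\<lambda>l. g l i \<otimes> z l) \<oplus>\<^bsub>R\<^esub> rsum R k (\<lambda>l. g l i \<otimes> z' l)"
      using gi zi by (intro rsum_add m_closed)
    finally show ?thesis using True by (simp add: lc_def)
  qed (simp add: lc_def)
qed

lemma lc_mult: "(\<And>l. l < k \<Longrightarrow> g l \<in> Rn R m) \<Longrightarrow> z \<in> Rn R k \<Longrightarrow> s \<in> carrier R \<Longrightarrow>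
    lc R k m g (\<lambda>l\<in>{..<k}. z l \<otimes> s) = (\<lambda>i\<in>{..<m}. lc R k m g z i \<otimes> s)"
proof (rule ext)
  fix i assume a: "\<And>l. l < k \<Longrightarrow> g l \<in> Rn R m" "z \<in> Rn R k" "s \<in> carrier R"
  show "lc R k m g (\<lambda>l\<in>{..<k}. z l \<otimes> s) i = (\<lambda>i\<in>{..<m}. lc R k m g z i \<otimes> s) i"
  proof (cases "i < m")
    case True
    have gi: "g l i \<in> carrier R" if "l < k" for l using RnD[OF a(1)[OF that] True] .
    note zi = RnD[OF a(2)]
    have "rsum R k (\<lambda>l. g l i \<otimes> z l) \<otimes> s = rsum R k (\<lambda>l. (g l i \<otimes> z l) \<otimes> s)"
      using gi zi a(3) by (intro rsum_rmult m_closed)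
    also have "\<dots> = rsum R k (\<lambda>l. g l i \<otimes> (\<lambda>l\<in>{..<k}. z l \<otimes> s) l)"
      using gi zi a(3) by (intro rsum_cong) (simp add: m_assoc)
    finally show ?thesis using True by (simp add: lc_def)
  qed (simp add: lc_def)
qed

lemma comb_sub_mod:
  assumes "\<And>l. l < k \<Longrightarrow> g l \<in> Rn R m" "z \<in> Rn R k"
  shows "comb (sub_mod R m U) k (\<lambda>l. {g l}) z = {lc R k m g z}"
proof -
  have "rsum (sub_mod R m U) j (\<lambda>l. {g l} \<triangleleft>\<^bsub>sub_mod R m U\<^esub> z l) = {\<lambda>i\<in>{..<m}. rsum R j (\<lambda>l. g l i \<otimes> z l)}" for j
    by (induction j) (auto simp: zn_def cong: restrict_cong)
  then show ?thesis by (simp add: comb_def lc_def)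
qed

lemma submod_kernel:
  assumes "\<And>l. l < k \<Longrightarrow> g l \<in> Rn R m"
  shows "submod R k {z\<in>Rn R k. lc R k m g z = zn R m}"
  unfolding submod_def
proof (intro conjI ballI)
  show "zn R k \<in> {z\<in>Rn R k. lc R k m g z = zn R m}"
    using zn_Rn RnD[OF assms] by (auto simp: lc_def zn_def intro!: restrict_ext rsum_zero)
qed (auto simp: add_Rn mult_Rn lc_add[OF assms] lc_mult[OF assms] zn_def cong: restrict_cong)

lemma projective_sub_mod:
  assumes U: "submod R k U" and \<kappa>: "\<And>t. t < r \<Longrightarrow> \<kappa> t \<in> U"
    and \<iota>: "\<And>z. z \<in> U \<Longrightarrow> \<iota> z \<in> Rn R r" "\<And>z. z \<in> U \<Longrightarrow> z = lc R r k \<kappa> (\<iota> z)"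
    and iadd: "\<And>z z'. z \<in> U \<Longrightarrow> z' \<in> U \<Longrightarrow> \<iota> (\<lambda>i\<in>{..<k}. z i \<oplus>\<^bsub>R\<^esub> z' i) = (\<lambda>i\<in>{..<r}. \<iota> z i \<oplus>\<^bsub>R\<^esub> \<iota> z' i)"
    and imult: "\<And>z s. z \<in> U \<Longrightarrow> s \<in> carrier R \<Longrightarrow> \<iota> (\<lambda>i\<in>{..<k}. z i \<otimes> s) = (\<lambda>i\<in>{..<r}. \<iota> z i \<otimes> s)"
  shows "projective_module R (sub_mod R k U)"
proof (rule projective_dual_basis[OF right_module_sub_mod[OF U], where p = "\<lambda>t. {\<kappa> t}" and r = r and \<iota> = "\<lambda>x. \<iota> (the_elem x)"])
  have \<kappa>R: "\<kappa> t \<in> Rn R k" if "t < r" for t using U \<kappa>[OF that] by (auto simp: submod_def)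
  show "x = comb (sub_mod R k U) r (\<lambda>t. {\<kappa> t}) (\<iota> (the_elem x))" if "x \<in> carrier (sub_mod R k U)" for x
    using that comb_sub_mod[where k = r and g = \<kappa> and m = k and z = "\<iota> (the_elem x)" and U = U] \<kappa>R \<iota> by auto
qed (use \<kappa> \<iota>(1) iadd imult in auto)

lemma projective_free: "projective_module R (sub_mod R n (Rn R n))"
proof (rule projective_sub_mod[OF submod_Rn, where \<iota> = "\<lambda>z. z" and \<kappa> = "\<lambda>t. \<lambda>i\<in>{..<n}. if i = t then \<one> else \<zero>"])
  fix z assume z: "z \<in> Rn R n"
  show "z = lc R n n (\<lambda>t. \<lambda>i\<in>{..<n}. if i = t then \<one> else \<zero>) z"
  proof (rule Rn_eqI[OF z])
    show "lc R n n (\<lambda>t. \<lambda>i\<in>{..<n}. if i = t then \<one> else \<zero>) z \<in> Rn R n"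
      by (rule lc_Rn[OF _ z]) (auto simp: Rn_def)
    fix i assume i: "i < n"
    have "rsum R n (\<lambda>l. (\<lambda>i\<in>{..<n}. if i = l then \<one> else \<zero>) i \<otimes> z l) = rsum R n (\<lambda>l. if l = i then z i else \<zero>)"
      using i RnD[OF z] by (intro rsum_cong) auto
    also have "\<dots> = z i" using i RnD[OF z] by (intro rsum_single) auto
    finally show "z i = lc R n n (\<lambda>t. \<lambda>i\<in>{..<n}. if i = t then \<one> else \<zero>) z i" using i by (simp add: lc_def)
  qed
qed (auto simp: Rn_def)

lemma lc_hom:
  assumes "\<And>l. l < k \<Longrightarrow> g l \<in> Rn R m"
  shows "(\<lambda>X. {lc R k m g (the_elem X)}) \<in> rmod_hom R (sub_mod R k (Rn R k)) (sub_mod R m (Rn R m))"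
  by (rule rmod_homI) (auto simp: lc_Rn[OF assms] lc_add[OF assms] lc_mult[OF assms])

text \<open>The resolution is 0 -> K -> R^k -> R^m -> R^n -> Y -> 0. The term R^m exists by
  \<open>fg\<close>, while R^k and the projective \<open>K\<close> come from \<open>syz\<close>; the
  four projectives \<open>X 1\<close> to \<open>X 4\<close> have length index 3.\<close>

theorem gldim_le_3:
  assumes fg: "fg_submodules R" and syz: "projective_second_syzygies R"
  shows "gldim R \<le> 3"
  unfolding gldim_def
proof (rule Sup_least)
  fix e assume "e \<in> {proj_dim R M | M :: 'a fgmod. fg_module R M}"
  then obtain Y :: "'a fgmod" where e: "e = proj_dim R Y" and Y: "fg_module R Y" by blast
  obtain n p where Ym: "right_module R Y" and p: "\<And>t. t < n \<Longrightarrow> p t \<in> carrier Y"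
    and gen: "\<And>x. x \<in> carrier Y \<Longrightarrow> \<exists>c\<in>Rn R n. x = comb Y n p c" using fg_moduleE[OF Y] by metis
  interpret Y: right_module R Y by (rule Ym)
  define d0 where "d0 = (\<lambda>X :: (nat \<Rightarrow> 'a) set. comb Y n p (the_elem X))"
  have d0: "d0 \<in> rmod_hom R (sub_mod R n (Rn R n)) Y"
    by (rule rmod_homI) (auto simp: d0_def Y.comb_closed[OF p] Y.comb_add[OF p] Y.comb_ract[OF p])
  define U where "U = {z\<in>Rn R n. comb Y n p z = \<zero>\<^bsub>Y\<^esub>}"
  have U: "submod R n U"
    unfolding submod_def
  proof (intro conjI ballI)
    have "comb Y n p (zn R n) = \<zero>\<^bsub>Y\<^esub>"
      unfolding comb_def by (rule Y.M.rsum_zero) (simp add: zn_def Y.ract_zero p)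
    then show "zn R n \<in> U" using zn_Rn by (simp add: U_def)
  qed (auto simp: U_def add_Rn mult_Rn Y.comb_add[OF p] Y.comb_ract[OF p] Y.zero_ract)
  obtain m f where f: "\<And>i. i < m \<Longrightarrow> f i \<in> U" and fgen: "\<And>x. x \<in> U \<Longrightarrow> \<exists>z\<in>Rn R m. x = lc R m n f z"
    using fg U unfolding fg_submodules_def by blast
  have fR: "f i \<in> Rn R n" if "i < m" for i using f[OF that] by (simp add: U_def)
  have allfR: "\<forall>i<m. f i \<in> Rn R n" using fR by blast
  obtain k g r \<kappa> \<iota> where syz': "\<forall>l<k. g l \<in> Rn R m \<and> lc R m n f (g l) = zn R n"
    "\<forall>z\<in>Rn R m. lc R m n f z = zn R n \<longrightarrow> (\<exists>y\<in>Rn R k. z = lc R k m g y)"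
    "\<forall>t<r. \<kappa> t \<in> Rn R k \<and> lc R k m g (\<kappa> t) = zn R m"
    "\<forall>z\<in>Rn R k. lc R k m g z = zn R m \<longrightarrow> \<iota> z \<in> Rn R r \<and> z = lc R r k \<kappa> (\<iota> z) \<and>
             (\<forall>z'\<in>Rn R k. lc R k m g z' = zn R m \<longrightarrow>
                \<iota> (\<lambda>i\<in>{..<k}. z i \<oplus>\<^bsub>R\<^esub> z' i) = (\<lambda>i\<in>{..<r}. \<iota> z i \<oplus>\<^bsub>R\<^esub> \<iota> z' i)) \<and>
             (\<forall>s\<in>carrier R. \<iota> (\<lambda>i\<in>{..<k}. z i \<otimes> s) = (\<lambda>i\<in>{..<r}. \<iota> z i \<otimes> s))"
    using syz[unfolded projective_second_syzygies_def, THEN spec, of m, THEN spec, of n, THEN spec, of f, THEN mp, OF allfR] by (elim exE conjE) (rule that)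
  note g = syz'(1)[rule_format] and ggen = syz'(2)[rule_format] and \<kappa> = syz'(3)[rule_format] and \<iota> = syz'(4)[rule_format]
  have gR: "g l \<in> Rn R m" if "l < k" for l using g[OF that] by simp
  define K where "K = {z\<in>Rn R k. lc R k m g z = zn R m}"
  have K: "submod R k K" unfolding K_def by (rule submod_kernel[OF gR])
  have P4: "projective_module R (sub_mod R k K)"
    by (rule projective_sub_mod[OF K, of r \<kappa> \<iota>]) (use \<kappa> \<iota> in \<open>auto simp: K_def\<close>)
  define X :: "nat \<Rightarrow> 'a fgmod" where "X = (\<lambda>i. if i = 0 then Y else if i = 1 then sub_mod R n (Rn R n) else
     if i = 2 then sub_mod R m (Rn R m) else if i = 3 then sub_mod R k (Rn R k) else sub_mod R k K)"
  define d where "d = (\<lambda>i :: nat. if i = 0 then d0 else if i = 1 then (\<lambda>X. {lc R m n f (the_elem X)}) else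
     if i = 2 then (\<lambda>X. {lc R k m g (the_elem X)}) else (\<lambda>X. X))"
  have le3: "i \<le> 3 \<longleftrightarrow> i = 0 \<or> i = 1 \<or> i = 2 \<or> i = 3" for i :: nat by auto
  have lt3: "i < 3 \<longleftrightarrow> i = 0 \<or> i = 1 \<or> i = 2" for i :: nat by auto
  have zero1: "comb Y n p (lc R m n f z) = \<zero>\<^bsub>Y\<^esub>" if z: "z \<in> Rn R m" for z
  proof -
    have "{lc R m n f z} = comb (sub_mod R n U) m (\<lambda>l. {f l}) z" using comb_sub_mod[OF fR z] by simp
    also have "\<dots> \<in> carrier (sub_mod R n U)"
      using f z by (intro right_module.comb_closed[OF right_module_sub_mod[OF U]]) auto
    finally show ?thesis by (auto simp: U_def)
  qed
  have zero2: "lc R m n f (lc R k m g z) = zn R n" if z: "z \<in> Rn R k" for z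
  proof -
    have "{lc R k m g z} = comb (sub_mod R m {z\<in>Rn R m. lc R m n f z = zn R n}) k (\<lambda>l. {g l}) z"
      using comb_sub_mod[OF gR z] by simp
    also have "\<dots> \<in> carrier (sub_mod R m {z\<in>Rn R m. lc R m n f z = zn R n})"
      using g z by (intro right_module.comb_closed[OF right_module_sub_mod[OF submod_kernel[OF fR]]]) auto
    finally show ?thesis by auto
  qed
  have sing: "{x \<in> (\<lambda>x. {x}) ` A. P x} = (\<lambda>x. {x}) ` {z\<in>A. P {z}}" for A :: "(nat \<Rightarrow> 'a) set" and P
    by auto
  have "has_projective_resolution R Y 3"
    unfolding has_projective_resolution_def
  proof (rule exI[of _ X], rule exI[of _ d], intro conjI)
    show "X 0 = Y" by (simp add: X_def)
    show "\<forall>i\<le>3. projective_module R (X (Suc i))"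
      unfolding le3 by (auto simp: X_def projective_free P4)
    have "(\<lambda>X. X) \<in> rmod_hom R (sub_mod R k K) (sub_mod R k (Rn R k))"
      by (rule rmod_homI) (auto simp: K_def)
    then show "\<forall>i\<le>3. d i \<in> rmod_hom R (X (Suc i)) (X i)"
      unfolding le3 by (auto simp: X_def d_def d0 lc_hom[OF fR] lc_hom[OF gR])
    show "d 0 ` carrier (X 1) = carrier Y"
    proof (intro equalityI subsetI)
      fix y assume "y \<in> carrier Y"
      then obtain c where c: "c \<in> Rn R n" "y = comb Y n p c" using gen by auto
      show "y \<in> d 0 ` carrier (X 1)"
        by (rule image_eqI[of _ _ "{c}"]) (use c in \<open>auto simp: d_def d0_def X_def\<close>)
    qed (use rmod_homD(1)[OF d0] in \<open>auto simp: d_def X_def\<close>)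
    have U1: "lc R m n f ` Rn R m = U"
    proof (intro equalityI subsetI)
      fix x assume "x \<in> lc R m n f ` Rn R m"
      then show "x \<in> U" using zero1 lc_Rn[OF fR] by (auto simp: U_def)
    next
      fix x assume "x \<in> U"
      then obtain z where "z \<in> Rn R m" "x = lc R m n f z" using fgen by auto
      then show "x \<in> lc R m n f ` Rn R m" by simp
    qed
    have U2: "lc R k m g ` Rn R k = {z\<in>Rn R m. lc R m n f z = zn R n}"
    proof (intro equalityI subsetI)
      fix x assume "x \<in> lc R k m g ` Rn R k"
      then show "x \<in> {z\<in>Rn R m. lc R m n f z = zn R n}" using zero2 lc_Rn[OF gR] by auto
    next
      fix x assume "x \<in> {z\<in>Rn R m. lc R m n f z = zn R n}"
      then obtain z where "z \<in> Rn R k" "x = lc R k m g z" using ggen by auto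
      then show "x \<in> lc R k m g ` Rn R k" by simp
    qed
    have e0: "d 1 ` carrier (X 2) = a_kernel (X 1) (X 0) (d 0)"
    proof -
      have "d 1 ` carrier (X 2) = (\<lambda>x. {x}) ` (lc R m n f ` Rn R m)" by (simp add: X_def d_def image_image)
      moreover have "a_kernel (X 1) (X 0) (d 0) = (\<lambda>x. {x}) ` U"
        unfolding a_kernel_def' by (simp add: sing X_def d_def d0_def U_def)
      ultimately show ?thesis unfolding U1 by simp
    qed
    have e1: "d 2 ` carrier (X 3) = a_kernel (X 2) (X 1) (d 1)"
    proof -
      have "d 2 ` carrier (X 3) = (\<lambda>x. {x}) ` (lc R k m g ` Rn R k)" by (simp add: X_def d_def image_image)
      moreover have "a_kernel (X 2) (X 1) (d 1) = (\<lambda>x. {x}) ` {z\<in>Rn R m. lc R m n f z = zn R n}"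
        unfolding a_kernel_def' by (simp add: sing X_def d_def)
      ultimately show ?thesis unfolding U2 by simp
    qed
    have e2: "d 3 ` carrier (X 4) = a_kernel (X 3) (X 2) (d 2)"
    proof -
      have "d 3 ` carrier (X 4) = (\<lambda>x. {x}) ` K" by (simp add: X_def d_def)
      moreover have "a_kernel (X 3) (X 2) (d 2) = (\<lambda>x. {x}) ` K"
        unfolding a_kernel_def' by (simp add: sing X_def d_def K_def)
      ultimately show ?thesis by simp
    qed
    show "\<forall>i<3. d (Suc i) ` carrier (X (Suc (Suc i))) = a_kernel (X (Suc i)) (X i) (d i)"
      unfolding lt3 using e0 e1 e2 by (auto simp: numeral_2_eq_2 numeral_3_eq_3 eval_nat_numeral)
    show "a_kernel (X (Suc 3)) (X 3) (d 3) = {\<zero>\<^bsub>X (Suc 3)\<^esub>}"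
      using K unfolding a_kernel_def' by (auto simp: d_def X_def submod_def)
  qed
  then have "proj_dim R Y \<le> enat 3" unfolding proj_dim_def by (intro Inf_lower) blast
  then show "e \<le> 3" using e by (simp add: numeral_eq_enat)
qed

end

section \<open>Rings of matrices\<close>

text \<open>A maximal independent subset of \<open>U\<close> lies in the span of finitely many unit
  vectors, hence is finite. Taking it inside \<open>U\<close> is what later provides generators of a
  submodule.\<close>

lemma finite_support_span:
  fixes U :: "(nat \<Rightarrow> 'c \<Rightarrow> 'k::field) set"
  assumes B: "finite B" and U: "\<And>y l b. y \<in> U \<Longrightarrow> y l b \<noteq> 0 \<Longrightarrow> l < n \<and> b \<in> B"
  shows "\<exists>S\<subseteq>U. finite S \<and> U \<subseteq> V.span S"
proof -
  let ?T = "(\<lambda>(l,b). un l b :: nat \<Rightarrow> 'c \<Rightarrow> 'k) ` ({..<n} \<times> B)"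
  have "y \<in> V.span ?T" if y: "y \<in> U" for y
  proof -
    have "y = (\<Sum>l<n. \<Sum>b\<in>B. sc (y l b) (un l b))"
    proof (intro ext)
      fix l b
      have "(\<Sum>l'<n. \<Sum>b'\<in>B. sc (y l' b') (un l' b')) l b = (\<Sum>l'<n. if l' = l then (\<Sum>b'\<in>B. if b' = b then y l b else 0) else 0)"
        unfolding sum_fun_apply2 by (intro sum.cong refl) (auto simp: un_def intro!: sum.cong sum.neutral)
      also have "\<dots> = y l b" using U[OF y, of l b] B by auto
      finally show "y l b = (\<Sum>l'<n. \<Sum>b'\<in>B. sc (y l' b') (un l' b')) l b" by simp
    qed
    also have "\<dots> \<in> V.span ?T" by (intro V.span_sum V.span_scale V.span_base) auto
    finally show ?thesis .
  qed
  moreover obtain S where S: "S \<subseteq> U" "V.independent S" "U \<subseteq> V.span S" by (rule V.maximal_independent_subset)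
  moreover have "finite ?T" using B by auto
  ultimately have "finite S" using V.independent_span_bound[of ?T S] by blast
  then show ?thesis using S by blast
qed

definition mapply :: "'b set \<Rightarrow> ('b \<Rightarrow> 'b \<Rightarrow> 'k::field) \<Rightarrow> ('b \<Rightarrow> 'k) \<Rightarrow> 'b \<Rightarrow> 'k" where
  "mapply B m v = (\<lambda>\<gamma>. \<Sum>\<beta>\<in>B. v \<beta> * m \<beta> \<gamma>)"

context words
begin

text \<open>Endomorphisms of M as matrices, the row of a node being its image. Entries outside
  \<open>Bs\<close> are fixed to zero, so that equal endomorphisms have equal matrices.\<close>

definition GM :: "(('v,'e) node \<Rightarrow> ('v,'e) node \<Rightarrow> 'k::field) set" where
  "GM = {m. (\<forall>\<beta>. \<beta> \<notin> Bs \<longrightarrow> m \<beta> = 0) \<and> (\<forall>\<beta>\<in>Bs. (\<forall>\<gamma>. m \<beta> \<gamma> \<noteq> 0 \<longrightarrow> \<gamma> \<in> Bs) \<and> ea (vt \<beta>) (m \<beta>) = m \<beta> \<and>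
     (\<forall>a. la a (m \<beta>) = (case lst a \<beta> of None \<Rightarrow> 0 | Some \<gamma> \<Rightarrow> m \<gamma>)))}"

end

text \<open>By \<open>Phi_mult\<close> the product is composition with the second factor applied
  first, so \<open>R\<close> is the endomorphism ring of the representation M.\<close>

locale realised_ring = words Vs As src tgt W + R: ring R
  for Vs :: "'v set" and As :: "'e set" and src tgt and W and R :: "('r, 'x) ring_scheme" (structure) +
  fixes \<Phi> :: "'r \<Rightarrow> ('v,'e) node \<Rightarrow> ('v,'e) node \<Rightarrow> 'k::field"
  assumes bij: "bij_betw \<Phi> (carrier R) GM"
    and Phi_add: "x \<in> carrier R \<Longrightarrow> y \<in> carrier R \<Longrightarrow> \<Phi> (x \<oplus>\<^bsub>R\<^esub> y) = \<Phi> x + \<Phi> y"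
    and Phi_mult: "x \<in> carrier R \<Longrightarrow> y \<in> carrier R \<Longrightarrow> \<Phi> (x \<otimes> y) \<beta> = mapply Bs (\<Phi> x) (\<Phi> y \<beta>)"
begin

lemma Phi_GM: "x \<in> carrier R \<Longrightarrow> \<Phi> x \<in> GM" using bij by (auto simp: bij_betw_def)

lemma Phi_zero: "\<Phi> \<zero> = 0"
proof -
  have "\<Phi> \<zero> + \<Phi> \<zero> = \<Phi> \<zero>" using Phi_add[of \<zero> \<zero>] by simp
  then show ?thesis by (metis add_cancel_right_right)
qed

lemma Phi_rsum: "(\<And>l. l < k \<Longrightarrow> f l \<in> carrier R) \<Longrightarrow> \<Phi> (rsum R k f) = (\<Sum>l<k. \<Phi> (f l))"
proof (induction k)
  case (Suc k)
  then show ?case using R.rsum_closed[of k f] by (simp only: rsum.simps Phi_add sum.lessThan_Suc less_SucI lessI)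
qed (simp add: Phi_zero del: zero_fun_apply)

definition inv\<Phi> where "inv\<Phi> = inv_into (carrier R) \<Phi>"

lemma inv_Phi: "m \<in> GM \<Longrightarrow> inv\<Phi> m \<in> carrier R" "m \<in> GM \<Longrightarrow> \<Phi> (inv\<Phi> m) = m"
  using bij by (auto simp: inv\<Phi>_def bij_betw_def intro: inv_into_into f_inv_into_f)

lemma inv_Phi_Phi: "x \<in> carrier R \<Longrightarrow> inv\<Phi> (\<Phi> x) = x"
  using bij by (auto simp: inv\<Phi>_def bij_betw_def)

text \<open>A tuple in R^k viewed as a map M -> M^k. This identifies R^k with Hom(M, M^k), and by
  \<open>vec_lc\<close> multiplication by a matrix becomes composition with
  \<open>gh\<close>.\<close>

definition vec :: "nat \<Rightarrow> (nat \<Rightarrow> 'r) \<Rightarrow> ('v,'e) node \<Rightarrow> nat \<Rightarrow> ('v,'e) node \<Rightarrow> 'k" where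
  "vec k z \<beta> = (\<lambda>l. if l < k then \<Phi> (z l) \<beta> else 0)"

lemma vec_out: "z \<in> Rn R k \<Longrightarrow> \<beta> \<notin> Bs \<Longrightarrow> vec k z \<beta> = 0"
  using Phi_GM[OF RnD[of z R k]] by (auto simp: vec_def GM_def fun_eq_iff)

lemma vec_hm: assumes "z \<in> Rn R k" shows "hm Bs (Sup k) (vec k z)"
proof -
  have g: "\<Phi> (z l) \<in> GM" if "l < k" for l using Phi_GM[OF RnD[OF assms that]] .
  show ?thesis unfolding hm_def
  proof (intro ballI conjI allI)
    fix \<beta> assume b: "\<beta> \<in> Bs"
    show "vec k z \<beta> \<in> Sup k" using g b by (auto simp: Sup_def vec_def GM_def split: if_splits)
    have "ea v 0 = (0 :: ('v,'e) node \<Rightarrow> 'k)" for v by (auto simp: ea_def fun_eq_iff)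
    then show "E (vt \<beta>) (vec k z \<beta>) = vec k z \<beta>"
      unfolding E_def using g b by (intro ext) (auto simp: vec_def GM_def)
    have z: "la v 0 = (0 :: ('v,'e) node \<Rightarrow> 'k)" for v by (auto simp: la_def fun_eq_iff split: option.splits)
    show "L a (vec k z \<beta>) = (case lst a \<beta> of None \<Rightarrow> 0 | Some \<gamma> \<Rightarrow> vec k z \<gamma>)" for a
    proof
      fix l
      show "L a (vec k z \<beta>) l = (case lst a \<beta> of None \<Rightarrow> 0 | Some \<gamma> \<Rightarrow> vec k z \<gamma>) l"
      proof (cases "l < k")
        case True
        then have "la a (\<Phi> (z l) \<beta>) = (case lst a \<beta> of None \<Rightarrow> 0 | Some \<gamma> \<Rightarrow> \<Phi> (z l) \<gamma>)" using g b by (auto simp: GM_def)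
        then show ?thesis using True by (simp add: L_def vec_def split: option.splits)
      next
        case False
        then show ?thesis by (simp add: L_def vec_def z split: option.splits)
      qed
    qed
  qed
qed

lemma vec_surj:
  assumes h: "hm Bs (Sup k) h"
  shows "\<exists>z\<in>Rn R k. \<forall>\<beta>\<in>Bs. vec k z \<beta> = h \<beta>"
proof -
  define M where "M l = (\<lambda>\<beta>. if \<beta> \<in> Bs then h \<beta> l else 0)" for l
  have "M l \<in> GM" if l: "l < k" for l
    unfolding GM_def
  proof (intro CollectI conjI allI ballI impI)
    fix \<beta> assume b: "\<beta> \<in> Bs"
    show "\<gamma> \<in> Bs" if "M l \<beta> \<gamma> \<noteq> 0" for \<gamma> using that h b by (auto simp: M_def hm_def Sup_def)
    have "E (vt \<beta>) (h \<beta>) l = h \<beta> l" using h b by (simp add: hm_def)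
    then show "ea (vt \<beta>) (M l \<beta>) = M l \<beta>" using b by (simp add: E_def M_def)
    fix a
    have "L a (h \<beta>) l = (case lst a \<beta> of None \<Rightarrow> 0 | Some \<gamma> \<Rightarrow> h \<gamma>) l" using h b by (simp add: hm_def)
    then show "la a (M l \<beta>) = (case lst a \<beta> of None \<Rightarrow> 0 | Some \<gamma> \<Rightarrow> M l \<gamma>)"
      using b lst_Bs[OF b, of a] by (auto simp: L_def M_def split: option.splits)
  qed (simp add: M_def)
  moreover have "h \<beta> l = 0" if "\<beta> \<in> Bs" "\<not> l < k" for \<beta> l
  proof
    fix \<gamma>
    have "h \<beta> \<in> Sup k" using h that(1) by (simp add: hm_def)
    then show "h \<beta> l \<gamma> = 0 \<gamma>" using that(2) by (auto simp: Sup_def)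
  qed
  ultimately have "(\<lambda>l\<in>{..<k}. inv\<Phi> (M l)) \<in> Rn R k" "\<forall>\<beta>\<in>Bs. vec k (\<lambda>l\<in>{..<k}. inv\<Phi> (M l)) \<beta> = h \<beta>"
    using inv_Phi by (auto simp: Rn_def vec_def M_def)
  then show ?thesis by blast
qed

lemma vec_inj:
  assumes z: "z \<in> Rn R k" "z' \<in> Rn R k" and e: "\<And>\<beta>. \<beta> \<in> Bs \<Longrightarrow> vec k z \<beta> = vec k z' \<beta>"
  shows "z = z'"
proof (rule R.Rn_eqI[OF z])
  fix l assume l: "l < k"
  have GM: "\<Phi> (z l) \<in> GM" "\<Phi> (z' l) \<in> GM" using Phi_GM[OF RnD[OF z(1) l]] Phi_GM[OF RnD[OF z(2) l]] .
  have "\<Phi> (z l) \<beta> = \<Phi> (z' l) \<beta>" for \<beta>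
  proof (cases "\<beta> \<in> Bs")
    case True
    then have "vec k z \<beta> l = vec k z' \<beta> l" using e by simp
    then show ?thesis using l by (simp add: vec_def)
  next
    case False
    then have "\<Phi> (z l) \<beta> = 0" "\<Phi> (z' l) \<beta> = 0" using GM unfolding GM_def by blast+
    then show ?thesis by simp
  qed
  then have "\<Phi> (z l) = \<Phi> (z' l)" by (rule ext)
  then show "z l = z' l" using inv_Phi_Phi RnD[OF z(1) l] RnD[OF z(2) l] by metis
qed

lemma vec_lc:
  assumes g: "\<And>l. l < k \<Longrightarrow> g l \<in> Rn R m" and z: "z \<in> Rn R k"
  shows "vec m (lc R k m g z) \<beta> = gh k (\<lambda>l. vec m (g l)) (vec k z \<beta>)"
proof (intro ext)
  fix i \<gamma>
  show "vec m (lc R k m g z) \<beta> i \<gamma> = gh k (\<lambda>l. vec m (g l)) (vec k z \<beta>) i \<gamma>"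
  proof (cases "i < m")
    case True
    have gi: "g l i \<in> carrier R" and zi: "z l \<in> carrier R" if "l < k" for l
      using RnD[OF g[OF that] True] RnD[OF z that] .
    have "vec m (lc R k m g z) \<beta> i \<gamma> = \<Phi> (rsum R k (\<lambda>l. g l i \<otimes> z l)) \<beta> \<gamma>" using True by (simp add: vec_def lc_def)
    also have "\<dots> = (\<Sum>l<k. \<Phi> (g l i \<otimes> z l)) \<beta> \<gamma>"
      using gi zi by (subst Phi_rsum) auto
    also have "\<dots> = (\<Sum>l<k. mapply Bs (\<Phi> (g l i)) (\<Phi> (z l) \<beta>) \<gamma>)"
      unfolding sum_fun_apply2 using gi zi by (intro sum.cong) (auto simp: Phi_mult)
    also have "\<dots> = gh k (\<lambda>l. vec m (g l)) (vec k z \<beta>) i \<gamma>"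
      unfolding gh_def ex_def sum_fun_apply2 mapply_def using True by (intro sum.cong) (auto simp: vec_def)
    finally show ?thesis .
  next
    case False
    then show ?thesis unfolding gh_def ex_def sum_fun_apply2 by (simp add: vec_def sum_fun_apply2)
  qed
qed

lemma vec_zn: "vec n (zn R n) \<beta> = 0"
  by (auto simp: vec_def zn_def fun_eq_iff Phi_zero)

lemma vec_add: "z \<in> Rn R k \<Longrightarrow> z' \<in> Rn R k \<Longrightarrow> vec k (\<lambda>i\<in>{..<k}. z i \<oplus>\<^bsub>R\<^esub> z' i) \<beta> = vec k z \<beta> + vec k z' \<beta>"
  using RnD[of z R k] RnD[of z' R k] by (auto simp: vec_def fun_eq_iff Phi_add)

lemma vec_mult: "z \<in> Rn R k \<Longrightarrow> s \<in> carrier R \<Longrightarrow> vec k (\<lambda>i\<in>{..<k}. z i \<otimes> s) \<beta> = ex (vec k z) (\<Phi> s \<beta>)"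
  using RnD[of z R k] by (intro ext) (auto simp: vec_def Phi_mult mapply_def ex_def sum_fun_apply2)

lemma kernel_iff:
  assumes "\<And>l. l < k \<Longrightarrow> g l \<in> Rn R m" "z \<in> Rn R k"
  shows "lc R k m g z = zn R m \<longleftrightarrow> (\<forall>\<beta>\<in>Bs. gh k (\<lambda>l. vec m (g l)) (vec k z \<beta>) = 0)"
proof
  assume a: "\<forall>\<beta>\<in>Bs. gh k (\<lambda>l. vec m (g l)) (vec k z \<beta>) = 0"
  show "lc R k m g z = zn R m"
    by (rule vec_inj[OF R.lc_Rn[OF assms] R.zn_Rn]) (use a in \<open>simp_all add: vec_lc[OF assms] vec_zn\<close>)
next
  assume l: "lc R k m g z = zn R m"
  have "gh k (\<lambda>l. vec m (g l)) (vec k z \<beta>) = vec m (zn R m) \<beta>" for \<beta>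
    unfolding l[symmetric] by (rule vec_lc[OF assms, symmetric])
  then show "\<forall>\<beta>\<in>Bs. gh k (\<lambda>l. vec m (g l)) (vec k z \<beta>) = 0" unfolding vec_zn by (intro ballI)
qed

text \<open>The scalar matrices. They make submodules of R^n into subspaces over the field.\<close>

definition scal :: "'k \<Rightarrow> 'r" where
  "scal c = inv\<Phi> (\<lambda>\<beta> \<gamma>. if \<gamma> = \<beta> \<and> \<beta> \<in> Bs then c else 0)"

lemma scal: "scal c \<in> carrier R" "\<Phi> (scal c) = (\<lambda>\<beta> \<gamma>. if \<gamma> = \<beta> \<and> \<beta> \<in> Bs then c else 0)"
proof -
  have "(\<lambda>\<beta> \<gamma>. if \<gamma> = \<beta> \<and> \<beta> \<in> Bs then c else 0) \<in> GM"
    unfolding GM_def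
  proof (intro CollectI conjI allI ballI impI)
    fix \<beta> a assume b: "\<beta> \<in> Bs"
    show "la a (\<lambda>\<gamma>. if \<gamma> = \<beta> \<and> \<beta> \<in> Bs then c else 0) =
      (case lst a \<beta> of None \<Rightarrow> 0 | Some \<gamma> \<Rightarrow> \<lambda>\<gamma>'. if \<gamma>' = \<gamma> \<and> \<gamma> \<in> Bs then c else 0)"
    proof
      fix \<gamma>'
      have i: "rst a \<gamma>' = Some \<beta> \<longleftrightarrow> lst a \<beta> = Some \<gamma>'" if "\<gamma>' \<in> Bs" using lst_iff_rst[OF b that] by simp
      have "la a (\<lambda>\<gamma>. if \<gamma> = \<beta> \<and> \<beta> \<in> Bs then c else 0) \<gamma>' = (if \<gamma>' \<in> Bs \<and> rst a \<gamma>' = Some \<beta> then c else 0)"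
        using b by (auto simp: la_def split: option.splits)
      also have "\<dots> = (if lst a \<beta> = Some \<gamma>' then c else 0)" using i lst_Bs[OF b, of a \<gamma>'] by auto
      finally show "la a (\<lambda>\<gamma>. if \<gamma> = \<beta> \<and> \<beta> \<in> Bs then c else 0) \<gamma>' =
        (case lst a \<beta> of None \<Rightarrow> 0 | Some \<gamma> \<Rightarrow> \<lambda>\<gamma>'. if \<gamma>' = \<gamma> \<and> \<gamma> \<in> Bs then c else 0) \<gamma>'"
        using lst_Bs[OF b, of a] by (auto split: option.splits)
    qed
  qed (auto simp: ea_def fun_eq_iff split: if_splits)
  then show "scal c \<in> carrier R" "\<Phi> (scal c) = (\<lambda>\<beta> \<gamma>. if \<gamma> = \<beta> \<and> \<beta> \<in> Bs then c else 0)"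
    unfolding scal_def using inv_Phi by blast+
qed

text \<open>Flattening matrices to vectors embeds a submodule into a finite dimensional space. A
  finite subset spanning it over the field generates it over \<open>R\<close>, with coefficients
  \<open>scal\<close>.\<close>

lemma fg_submodules: "fg_submodules R"
  unfolding fg_submodules_def
proof (intro allI impI)
  fix n U assume U: "submod R n U"
  have UR: "x \<in> Rn R n" if "x \<in> U" for x using that U by (auto simp: submod_def)
  define flat :: "(nat \<Rightarrow> 'r) \<Rightarrow> nat \<Rightarrow> ('v,'e) node \<times> ('v,'e) node \<Rightarrow> 'k" where "flat x = (\<lambda>l (\<beta>,\<gamma>). vec n x \<beta> l \<gamma>)" for x
  have "l < n \<and> b \<in> Bs \<times> Bs" if yU: "y \<in> flat ` U" and yn: "y l b \<noteq> 0" for y l b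
  proof -
    obtain x \<beta> \<gamma> where x: "x \<in> U" "y = flat x" "b = (\<beta>, \<gamma>)" using yU by (cases b) auto
    then have nz: "vec n x \<beta> l \<gamma> \<noteq> 0" using yn by (simp add: flat_def)
    have "\<beta> \<in> Bs"
    proof (rule ccontr)
      assume "\<beta> \<notin> Bs"
      then show False using nz vec_out[OF UR[OF x(1)], of \<beta>] by simp
    qed
    moreover have "vec n x \<beta> \<in> Sup n" using vec_hm[OF UR[OF x(1)]] calculation by (simp add: hm_def)
    ultimately show ?thesis using nz x(3) by (auto simp: Sup_def)
  qed
  then obtain S where S: "S \<subseteq> flat ` U" "finite S" "flat ` U \<subseteq> V.span S"
    using finite_support_span[of "Bs \<times> Bs" "flat ` U" n] fin_Bs by auto
  obtain p where p: "bij_betw p {..<card S} S" using ex_bij_betw_nat_finite[OF S(2)] by (auto simp: atLeast0LessThan)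
  have "\<forall>i. \<exists>u. i < card S \<longrightarrow> u \<in> U \<and> flat u = p i"
    using p S(1) unfolding bij_betw_def by (metis imageE imageI lessThan_iff subsetD)
  then obtain f where f: "\<And>i. i < card S \<Longrightarrow> f i \<in> U \<and> flat (f i) = p i" by metis
  have fR: "f i \<in> Rn R n" if "i < card S" for i using f[OF that] UR by blast
  show "\<exists>m f. (\<forall>i<m. f i \<in> U) \<and> (\<forall>x\<in>U. \<exists>z\<in>Rn R m. x = lc R m n f z)"
  proof (intro exI[of _ "card S"] exI[of _ f] conjI ballI allI impI)
    fix x assume x: "x \<in> U"
    then have "flat x \<in> V.span S" using S(3) by blast
    then obtain c where c: "flat x = (\<Sum>b\<in>S. sc (c b) b)" using V.span_finite[OF S(2)] by auto
    define z where "z = (\<lambda>i\<in>{..<card S}. scal (c (p i)))"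
    have z: "z \<in> Rn R (card S)" using scal by (auto simp: z_def Rn_def)
    have "flat x = (\<Sum>i<card S. sc (c (p i)) (flat (f i)))"
      unfolding c using p f by (subst sum.reindex_bij_betw[OF p, symmetric]) auto
    then have fx: "vec n x \<beta> l \<gamma> = (\<Sum>i<card S. c (p i) * vec n (f i) \<beta> l \<gamma>)" for \<beta> l \<gamma>
      by (auto simp: flat_def fun_eq_iff sum_fun_apply2)
    have e: "vec n (lc R (card S) n f z) \<beta> = vec n x \<beta>" if b: "\<beta> \<in> Bs" for \<beta>
    proof (intro ext)
      fix l \<gamma>
      have "gh (card S) (\<lambda>i. vec n (f i)) (vec (card S) z \<beta>) l \<gamma> =
        (\<Sum>i<card S. \<Sum>\<delta>\<in>Bs. if \<delta> = \<beta> then c (p i) * vec n (f i) \<beta> l \<gamma> else 0)"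
        unfolding gh_def ex_def sum_fun_apply2 by (intro sum.cong) (auto simp: vec_def z_def scal(2) b)
      also have "\<dots> = vec n x \<beta> l \<gamma>" using fx fin_Bs b by simp
      finally show "vec n (lc R (card S) n f z) \<beta> l \<gamma> = vec n x \<beta> l \<gamma>" using vec_lc[OF fR z] by simp
    qed
    have "x = lc R (card S) n f z"
      by (rule vec_inj[OF UR[OF x] R.lc_Rn[OF fR z]]) (simp_all add: e)
    then show "\<exists>z\<in>Rn R (card S). x = lc R (card S) n f z" using z by blast
  qed (use f in blast)
qed

lemma gh_cong: "(\<And>l \<beta>. l < k \<Longrightarrow> \<beta> \<in> Bs \<Longrightarrow> g l \<beta> = g' l \<beta>) \<Longrightarrow> gh k g y = gh k g' y"
  unfolding gh_def ex_def by (intro sum.cong) auto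

text \<open>By left exactness of Hom(M, -) the kernel of the matrix \<open>f\<close> is Hom(M, F).
  The approximation of \<open>F\<close> supplies the columns \<open>g\<close>, and the maps M -> K
  -> M behind \<open>retr\<close> supply \<open>\<kappa>\<close> and \<open>\<iota>\<close>.\<close>

lemma projective_second_syzygies: "projective_second_syzygies R"
  unfolding projective_second_syzygies_def
proof (intro allI impI)
  fix m n :: nat and f :: "nat \<Rightarrow> nat \<Rightarrow> 'r" assume "\<forall>i<m. f i \<in> Rn R n"
  then have f: "\<And>i. i < m \<Longrightarrow> f i \<in> Rn R n" by blast
  define F where "F = {y \<in> Sup m. gh m (\<lambda>i. vec n (f i)) y = 0}"
  have F: "subrep m F" unfolding F_def by (rule ker_subrep[OF vec_hm[OF f]])
  obtain k g0 where g0: "\<And>l. l < k \<Longrightarrow> hm Bs F (g0 l)"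
    and lift: "\<And>h. hm Bs F h \<Longrightarrow> \<exists>c. hm Bs (Sup k) c \<and> (\<forall>\<beta>\<in>Bs. h \<beta> = gh k g0 (c \<beta>))"
    and retr: "retr {y \<in> Sup k. gh k g0 y = 0}"
    using approx[OF F] unfolding approx_def by auto
  define K where "K = {y \<in> Sup k. gh k g0 y = 0}"
  have K: "subrep k K" unfolding K_def by (rule ker_subrep[OF g0])
  have "\<forall>l. \<exists>z. l < k \<longrightarrow> z \<in> Rn R m \<and> (\<forall>\<beta>\<in>Bs. vec m z \<beta> = g0 l \<beta>)"
    using vec_surj[OF hm_mono[OF g0 subrepD(1)[OF F] order.refl]] by blast
  then obtain g where g: "\<And>l. l < k \<Longrightarrow> g l \<in> Rn R m" and gv: "\<And>l \<beta>. l < k \<Longrightarrow> \<beta> \<in> Bs \<Longrightarrow> vec m (g l) \<beta> = g0 l \<beta>"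
    by metis
  have ghg: "gh k (\<lambda>l. vec m (g l)) y = gh k g0 y" for y by (rule gh_cong) (rule gv)
  obtain ps where ps: "\<And>\<kappa> i. (\<kappa>,i) \<in> set ps \<Longrightarrow> hm Bs K \<kappa> \<and> khom K i" "\<And>y. y \<in> K \<Longrightarrow> y = (\<Sum>(\<kappa>,i)\<leftarrow>ps. ex \<kappa> (i y))"
    using retr unfolding retr_def K_def[symmetric] by fast
  define r where "r = length ps"
  define \<kappa>0 where "\<kappa>0 t = fst (ps!t)" for t
  define i0 where "i0 t = snd (ps!t)" for t
  have hk: "hm Bs K (\<kappa>0 t)" "khom K (i0 t)" if "t < r" for t
    using ps(1)[of "\<kappa>0 t" "i0 t"] nth_mem[of t ps] that by (auto simp: r_def \<kappa>0_def i0_def)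
  have Ky: "y = (\<Sum>t<r. ex (\<kappa>0 t) (i0 t y))" if "y \<in> K" for y
  proof -
    have "(\<Sum>(\<kappa>,i)\<leftarrow>ps. ex \<kappa> (i y)) = (\<Sum>t<r. ex (\<kappa>0 t) (i0 t y))"
      by (simp add: sum_list_sum_nth r_def \<kappa>0_def i0_def case_prod_unfold atLeast0LessThan)
    then show ?thesis using ps(2)[OF that] by simp
  qed
  have "\<forall>t. \<exists>z. t < r \<longrightarrow> z \<in> Rn R k \<and> (\<forall>\<beta>\<in>Bs. vec k z \<beta> = \<kappa>0 t \<beta>)"
    using vec_surj[OF hm_mono[OF hk(1) subrepD(1)[OF K] order.refl]] by blast
  then obtain \<kappa> where \<kappa>: "\<And>t. t < r \<Longrightarrow> \<kappa> t \<in> Rn R k" and \<kappa>v: "\<And>t \<beta>. t < r \<Longrightarrow> \<beta> \<in> Bs \<Longrightarrow> vec k (\<kappa> t) \<beta> = \<kappa>0 t \<beta>"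
    by metis
  \<comment> \<open>The composite of the map M -> K given by \<open>z\<close> with the t-th map K ->
    M of the dual basis, written as a matrix. It is the t-th coordinate of \<open>z\<close>.\<close>
  define im where "im z t = (\<lambda>\<beta>. if \<beta> \<in> Bs then i0 t (vec k z \<beta>) else 0)" for z t
  define \<iota> where "\<iota> z = (\<lambda>t\<in>{..<r}. inv\<Phi> (im z t))" for z
  have vK: "vec k z \<beta> \<in> K" if "z \<in> Rn R k" "lc R k m g z = zn R m" "\<beta> \<in> Bs" for z \<beta>
    using kernel_iff[OF g that(1)] that vec_hm[OF that(1)] by (auto simp: K_def ghg hm_def)
  have im: "im z t \<in> GM" if z: "z \<in> Rn R k" "lc R k m g z = zn R m" and t: "t < r" for z t
    unfolding GM_def
  proof (intro CollectI conjI allI ballI impI)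
    fix \<beta> assume b: "\<beta> \<in> Bs"
    note kh = hk(2)[OF t, unfolded khom_def, rule_format, OF vK[OF z b]]
    show "\<gamma> \<in> Bs" if "im z t \<beta> \<gamma> \<noteq> 0" for \<gamma> using that kh b by (auto simp: im_def)
    have "i0 t (E (vt \<beta>) (vec k z \<beta>)) = ea (vt \<beta>) (i0 t (vec k z \<beta>))" using kh by blast
    moreover have "E (vt \<beta>) (vec k z \<beta>) = vec k z \<beta>" using vec_hm[OF z(1)] b by (simp add: hm_def)
    ultimately show "ea (vt \<beta>) (im z t \<beta>) = im z t \<beta>" using b by (simp add: im_def)
    fix a
    have "i0 t (L a (vec k z \<beta>)) = la a (i0 t (vec k z \<beta>))" using kh by blast
    moreover have "L a (vec k z \<beta>) = (case lst a \<beta> of None \<Rightarrow> 0 | Some \<gamma> \<Rightarrow> vec k z \<gamma>)" using vec_hm[OF z(1)] b by (simp add: hm_def)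
    moreover have "i0 t 0 = 0"
    proof -
      have "i0 t (sc 0 (vec k z \<beta>)) = (\<lambda>\<gamma>. 0 * i0 t (vec k z \<beta>) \<gamma>)" using kh by blast
      then show ?thesis by (simp add: fun_eq_iff)
    qed
    ultimately show "la a (im z t \<beta>) = (case lst a \<beta> of None \<Rightarrow> 0 | Some \<gamma> \<Rightarrow> im z t \<gamma>)"
      using b lst_Bs[OF b, of a] by (auto simp: im_def split: option.splits)
  qed (simp add: im_def)
  have \<iota>: "\<iota> z \<in> Rn R r" "\<And>t. t < r \<Longrightarrow> \<Phi> (\<iota> z t) = im z t" if "z \<in> Rn R k" "lc R k m g z = zn R m" for z
    using inv_Phi im[OF that] by (auto simp: \<iota>_def Rn_def)
  have \<iota>I: "\<iota> z = y" if "z \<in> Rn R k" "lc R k m g z = zn R m" "y \<in> Rn R r" "\<And>t \<beta>. t < r \<Longrightarrow> \<beta> \<in> Bs \<Longrightarrow> \<Phi> (y t) \<beta> = i0 t (vec k z \<beta>)" for z y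
    by (rule vec_inj[OF \<iota>(1)[OF that(1,2)] that(3)]) (auto simp: vec_def \<iota>(2)[OF that(1,2)] im_def that(4) fun_eq_iff)
  have kl: "submod R k {z\<in>Rn R k. lc R k m g z = zn R m}" by (rule R.submod_kernel[OF g])
  show "\<exists>k g. (\<forall>l<k. g l \<in> Rn R m \<and> lc R m n f (g l) = zn R n) \<and>
       (\<forall>z\<in>Rn R m. lc R m n f z = zn R n \<longrightarrow> (\<exists>y\<in>Rn R k. z = lc R k m g y)) \<and>
       (\<exists>r \<kappa> \<iota>. (\<forall>t<r. \<kappa> t \<in> Rn R k \<and> lc R k m g (\<kappa> t) = zn R m) \<and>
          (\<forall>z\<in>Rn R k. lc R k m g z = zn R m \<longrightarrow> \<iota> z \<in> Rn R r \<and> z = lc R r k \<kappa> (\<iota> z) \<and>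
             (\<forall>z'\<in>Rn R k. lc R k m g z' = zn R m \<longrightarrow>
                \<iota> (\<lambda>i\<in>{..<k}. z i \<oplus>\<^bsub>R\<^esub> z' i) = (\<lambda>i\<in>{..<r}. \<iota> z i \<oplus>\<^bsub>R\<^esub> \<iota> z' i)) \<and>
             (\<forall>s\<in>carrier R. \<iota> (\<lambda>i\<in>{..<k}. z i \<otimes> s) = (\<lambda>i\<in>{..<r}. \<iota> z i \<otimes> s))))"
  proof (rule exI[of _ k], rule exI[of _ g], intro conjI)
    show "\<forall>l<k. g l \<in> Rn R m \<and> lc R m n f (g l) = zn R n"
    proof (intro allI impI conjI)
      fix l assume l: "l < k"
      show "g l \<in> Rn R m" by (rule g[OF l])
      show "lc R m n f (g l) = zn R n"
        by (rule iffD2[OF kernel_iff]) (use f g[OF l] gv[OF l] g0[OF l] in \<open>auto simp: hm_def F_def\<close>)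
    qed
    show "\<forall>z\<in>Rn R m. lc R m n f z = zn R n \<longrightarrow> (\<exists>y\<in>Rn R k. z = lc R k m g y)"
    proof (intro ballI impI)
      fix z assume z: "z \<in> Rn R m" "lc R m n f z = zn R n"
      have "hm Bs F (vec m z)"
        using vec_hm[OF z(1)] kernel_iff[OF f z(1)] z(2) by (auto simp: hm_def F_def)
      then obtain c where c: "hm Bs (Sup k) c" "\<And>\<beta>. \<beta> \<in> Bs \<Longrightarrow> vec m z \<beta> = gh k g0 (c \<beta>)" using lift by blast
      obtain y where y: "y \<in> Rn R k" "\<And>\<beta>. \<beta> \<in> Bs \<Longrightarrow> vec k y \<beta> = c \<beta>" using vec_surj[OF c(1)] by blast
      have "z = lc R k m g y"
        by (rule vec_inj[OF z(1) R.lc_Rn[OF g y(1)]]) (simp_all add: vec_lc[OF g y(1)] ghg c(2) y(2))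
      then show "\<exists>y\<in>Rn R k. z = lc R k m g y" using y(1) by blast
    qed
    show "\<exists>r \<kappa> \<iota>. (\<forall>t<r. \<kappa> t \<in> Rn R k \<and> lc R k m g (\<kappa> t) = zn R m) \<and>
          (\<forall>z\<in>Rn R k. lc R k m g z = zn R m \<longrightarrow> \<iota> z \<in> Rn R r \<and> z = lc R r k \<kappa> (\<iota> z) \<and>
             (\<forall>z'\<in>Rn R k. lc R k m g z' = zn R m \<longrightarrow>
                \<iota> (\<lambda>i\<in>{..<k}. z i \<oplus>\<^bsub>R\<^esub> z' i) = (\<lambda>i\<in>{..<r}. \<iota> z i \<oplus>\<^bsub>R\<^esub> \<iota> z' i)) \<and>
             (\<forall>s\<in>carrier R. \<iota> (\<lambda>i\<in>{..<k}. z i \<otimes> s) = (\<lambda>i\<in>{..<r}. \<iota> z i \<otimes> s)))"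
    proof (rule exI[of _ r], rule exI[of _ \<kappa>], rule exI[of _ \<iota>], intro conjI allI ballI impI)
      fix t assume t: "t < r"
      show "\<kappa> t \<in> Rn R k" by (rule \<kappa>[OF t])
      show "lc R k m g (\<kappa> t) = zn R m"
        by (rule iffD2[OF kernel_iff]) (use g \<kappa>[OF t] \<kappa>v[OF t] hk(1)[OF t] in \<open>auto simp: hm_def K_def ghg\<close>)
    next
      fix z assume z: "z \<in> Rn R k" "lc R k m g z = zn R m"
      show "\<iota> z \<in> Rn R r" by (rule \<iota>(1)[OF z])
      show "z = lc R r k \<kappa> (\<iota> z)"
      proof (rule vec_inj[OF z(1) R.lc_Rn[OF \<kappa> \<iota>(1)[OF z]]])
        fix \<beta> assume b: "\<beta> \<in> Bs"
        have "vec k (lc R r k \<kappa> (\<iota> z)) \<beta> = gh r (\<lambda>t. vec k (\<kappa> t)) (vec r (\<iota> z) \<beta>)"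
          by (rule vec_lc[OF \<kappa> \<iota>(1)[OF z]])
        also have "\<dots> = gh r \<kappa>0 (vec r (\<iota> z) \<beta>)" by (rule gh_cong) (rule \<kappa>v)
        also have "\<dots> = (\<Sum>t<r. ex (\<kappa>0 t) (i0 t (vec k z \<beta>)))"
          unfolding gh_def using b by (intro sum.cong) (simp_all add: vec_def[of r] \<iota>(2)[OF z] im_def)
        finally show "vec k z \<beta> = vec k (lc R r k \<kappa> (\<iota> z)) \<beta>" using Ky[OF vK[OF z b]] by simp
      qed
      have cl: "(\<lambda>i\<in>{..<k}. z i \<oplus>\<^bsub>R\<^esub> z' i) \<in> {z\<in>Rn R k. lc R k m g z = zn R m}" if "z' \<in> Rn R k" "lc R k m g z' = zn R m" for z'
        using kl z that unfolding submod_def by blast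
      show "\<iota> (\<lambda>i\<in>{..<k}. z i \<oplus>\<^bsub>R\<^esub> z' i) = (\<lambda>i\<in>{..<r}. \<iota> z i \<oplus>\<^bsub>R\<^esub> \<iota> z' i)" if z': "z' \<in> Rn R k" "lc R k m g z' = zn R m" for z'
      proof (rule \<iota>I)
        fix t \<beta> assume t: "t < r" and b: "\<beta> \<in> Bs"
        note kh = hk(2)[OF t, unfolded khom_def, rule_format, OF vK[OF z b]]
        have "i0 t (vec k z \<beta> + vec k z' \<beta>) = i0 t (vec k z \<beta>) + i0 t (vec k z' \<beta>)" using kh vK[OF z' b] by blast
        then show "\<Phi> ((\<lambda>i\<in>{..<r}. \<iota> z i \<oplus>\<^bsub>R\<^esub> \<iota> z' i) t) \<beta> = i0 t (vec k (\<lambda>i\<in>{..<k}. z i \<oplus>\<^bsub>R\<^esub> z' i) \<beta>)"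
          using t b RnD[OF \<iota>(1)[OF z] t] RnD[OF \<iota>(1)[OF z'] t] \<iota>(2)[OF z t] \<iota>(2)[OF z' t]
          by (simp add: vec_add[OF z(1) z'(1)] Phi_add im_def)
      qed (use cl[OF z'] R.add_Rn \<iota>(1) z z' in auto)
      show "\<iota> (\<lambda>i\<in>{..<k}. z i \<otimes> s) = (\<lambda>i\<in>{..<r}. \<iota> z i \<otimes> s)" if s: "s \<in> carrier R" for s
      proof (rule \<iota>I)
        have "(\<lambda>i\<in>{..<k}. z i \<otimes> s) \<in> {z\<in>Rn R k. lc R k m g z = zn R m}" using kl z s unfolding submod_def by blast
        then show "(\<lambda>i\<in>{..<k}. z i \<otimes> s) \<in> Rn R k" "lc R k m g (\<lambda>i\<in>{..<k}. z i \<otimes> s) = zn R m" by auto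
        show "(\<lambda>i\<in>{..<r}. \<iota> z i \<otimes> s) \<in> Rn R r" by (rule R.mult_Rn[OF \<iota>(1)[OF z] s])
        fix t \<beta> assume t: "t < r" and b: "\<beta> \<in> Bs"
        \<comment> \<open>\<open>khom\<close> provides additivity and homogeneity only on vectors of
          \<open>K\<close>, so each partial sum has to be kept inside \<open>K\<close>.\<close>
        have lin: "i0 t (\<Sum>\<delta>\<in>D. sc (c \<delta>) (vec k z \<delta>)) = (\<lambda>\<gamma>. \<Sum>\<delta>\<in>D. c \<delta> * i0 t (vec k z \<delta>) \<gamma>)" if "finite D" "D \<subseteq> Bs" for D c
          using that
        proof (induction D rule: finite_induct)
          case empty
          note kh = hk(2)[OF t, unfolded khom_def, rule_format, OF vK[OF z b]]
          have "i0 t (sc 0 (vec k z \<beta>)) = (\<lambda>\<gamma>. 0 * i0 t (vec k z \<beta>) \<gamma>)" using kh by blast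
          then show ?case by (simp only: sum.empty V.scale_zero_left mult_zero_left)
        next
          case (insert d D)
          have d: "vec k z d \<in> K" using vK[OF z] insert.prems by blast
          have sd: "sc (c d) (vec k z d) \<in> K" using d subrepD(2)[OF K] V.subspace_scale by blast
          have sD: "(\<Sum>\<delta>\<in>D. sc (c \<delta>) (vec k z \<delta>)) \<in> K"
            using insert.prems vK[OF z] by (intro V.subspace_sum[OF subrepD(2)[OF K]] V.subspace_scale[OF subrepD(2)[OF K]]) auto
          have 1: "i0 t (sc (c d) (vec k z d) + (\<Sum>\<delta>\<in>D. sc (c \<delta>) (vec k z \<delta>))) = i0 t (sc (c d) (vec k z d)) + i0 t (\<Sum>\<delta>\<in>D. sc (c \<delta>) (vec k z \<delta>))"
            using hk(2)[OF t, unfolded khom_def, rule_format, OF sd] sD by blast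
          have 2: "i0 t (sc (c d) (vec k z d)) = (\<lambda>\<gamma>. c d * i0 t (vec k z d) \<gamma>)"
            using hk(2)[OF t, unfolded khom_def, rule_format, OF d] by blast
          have 3: "i0 t (\<Sum>\<delta>\<in>D. sc (c \<delta>) (vec k z \<delta>)) = (\<lambda>\<gamma>. \<Sum>\<delta>\<in>D. c \<delta> * i0 t (vec k z \<delta>) \<gamma>)"
            by (rule insert.IH) (use insert.prems in blast)
          show ?case unfolding sum.insert[OF insert.hyps] 1 2 3 by (rule ext) simp
        qed
        have "\<Phi> (\<iota> z t \<otimes> s) \<beta> = mapply Bs (im z t) (\<Phi> s \<beta>)" using Phi_mult RnD[OF \<iota>(1)[OF z] t] s \<iota>(2)[OF z t] by simp
        also have "\<dots> = (\<lambda>\<gamma>. \<Sum>\<delta>\<in>Bs. \<Phi> s \<beta> \<delta> * i0 t (vec k z \<delta>) \<gamma>)"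
          unfolding mapply_def by (intro ext sum.cong) (auto simp: im_def)
        also have "\<dots> = i0 t (vec k (\<lambda>i\<in>{..<k}. z i \<otimes> s) \<beta>)"
          unfolding vec_mult[OF z(1) s] ex_def by (rule lin[OF fin_Bs order.refl, symmetric])
        finally show "\<Phi> ((\<lambda>i\<in>{..<r}. \<iota> z i \<otimes> s) t) \<beta> = i0 t (vec k (\<lambda>i\<in>{..<k}. z i \<otimes> s) \<beta>)" using t by simp
      qed
    qed
  qed
qed

lemma gldim_realised: "gldim R \<le> 3"
  by (rule R.gldim_le_3[OF fg_submodules projective_second_syzygies])

end

section \<open>Actions of coefficient functions\<close>

lemma ring_endo_ring:
  assumes "right_module R M"
  shows "ring (endo_ring R M)"
proof -
  interpret right_module R M by fact
  let ?E = "endo_ring R M"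
  have E: "f \<in> carrier ?E \<longleftrightarrow> f \<in> rmod_hom R M M \<and> f \<in> extensional (carrier M)" for f by (simp add: endo_ring_def)
  have add: "f \<oplus>\<^bsub>?E\<^esub> g = (\<lambda>x\<in>carrier M. f x \<oplus>\<^bsub>M\<^esub> g x)" and mult: "f \<otimes>\<^bsub>?E\<^esub> g = compose (carrier M) f g" for f g
    by (simp_all add: endo_ring_def)
  have zero: "\<zero>\<^bsub>?E\<^esub> = (\<lambda>x\<in>carrier M. \<zero>\<^bsub>M\<^esub>)" and one: "\<one>\<^bsub>?E\<^esub> = (\<lambda>x\<in>carrier M. x)" by (simp_all add: endo_ring_def)
  have cl: "f x \<in> carrier M" if "f \<in> carrier ?E" "x \<in> carrier M" for f x using that by (auto simp: E dest: rmod_homD)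
  have addh: "f (x \<oplus>\<^bsub>M\<^esub> y) = f x \<oplus>\<^bsub>M\<^esub> f y" if "f \<in> carrier ?E" "x \<in> carrier M" "y \<in> carrier M" for f x y
    using that by (auto simp: E dest: rmod_homD)
  have acth: "f (x \<triangleleft>\<^bsub>M\<^esub> r) = f x \<triangleleft>\<^bsub>M\<^esub> r" if "f \<in> carrier ?E" "x \<in> carrier M" "r \<in> carrier R" for f x r
    using that by (auto simp: E dest: rmod_homD)
  have eqI: "f = g" if "f \<in> carrier ?E" "g \<in> carrier ?E" "\<And>x. x \<in> carrier M \<Longrightarrow> f x = g x" for f g
    using that by (intro extensionalityI[of f "carrier M" g]) (auto simp: E)
  have add_closed: "f \<oplus>\<^bsub>?E\<^esub> g \<in> carrier ?E" if "f \<in> carrier ?E" "g \<in> carrier ?E" for f g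
    unfolding E add using that by (auto intro!: rmod_homI simp: cl addh acth ract_closed ract_add_left M.a_ac)
  have mult_closed: "f \<otimes>\<^bsub>?E\<^esub> g \<in> carrier ?E" if "f \<in> carrier ?E" "g \<in> carrier ?E" for f g
    unfolding E mult using that by (auto intro!: rmod_homI simp: cl addh acth ract_closed compose_def)
  have zero_closed: "\<zero>\<^bsub>?E\<^esub> \<in> carrier ?E"
    unfolding E zero by (auto intro!: rmod_homI simp: ract_closed zero_ract)
  have one_closed: "\<one>\<^bsub>?E\<^esub> \<in> carrier ?E"
    unfolding E one by (auto intro!: rmod_homI simp: ract_closed)
  have addv: "(f \<oplus>\<^bsub>?E\<^esub> g) x = f x \<oplus>\<^bsub>M\<^esub> g x" if "x \<in> carrier M" for f g x using that by (simp add: add)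
  have multv: "(f \<otimes>\<^bsub>?E\<^esub> g) x = f (g x)" if "x \<in> carrier M" for f g x using that by (simp add: mult compose_def)
  have zerov: "\<zero>\<^bsub>?E\<^esub> x = \<zero>\<^bsub>M\<^esub>" if "x \<in> carrier M" for x using that by (simp add: zero)
  have onev: "\<one>\<^bsub>?E\<^esub> x = x" if "x \<in> carrier M" for x using that by (simp add: one)
  have neg: "\<exists>g\<in>carrier ?E. g \<oplus>\<^bsub>?E\<^esub> f = \<zero>\<^bsub>?E\<^esub>" if f: "f \<in> carrier ?E" for f
  proof -
    let ?g = "\<lambda>x\<in>carrier M. \<ominus>\<^bsub>M\<^esub> f x"
    have mr: "\<ominus>\<^bsub>M\<^esub> y \<triangleleft>\<^bsub>M\<^esub> r = \<ominus>\<^bsub>M\<^esub> (y \<triangleleft>\<^bsub>M\<^esub> r)" if y: "y \<in> carrier M" and r: "r \<in> carrier R" for y r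
    proof -
      have "\<ominus>\<^bsub>M\<^esub> y \<triangleleft>\<^bsub>M\<^esub> r \<oplus>\<^bsub>M\<^esub> y \<triangleleft>\<^bsub>M\<^esub> r = \<zero>\<^bsub>M\<^esub>"
        using ract_add_left[of "\<ominus>\<^bsub>M\<^esub> y" y r] y r by (simp add: M.l_neg zero_ract)
      then show ?thesis using y r by (intro M.minus_equality[symmetric] ract_closed) auto
    qed
    have "?g \<in> carrier ?E"
      unfolding E using f by (auto intro!: rmod_homI simp: cl addh acth ract_closed M.minus_add mr)
    moreover have "?g \<oplus>\<^bsub>?E\<^esub> f = \<zero>\<^bsub>?E\<^esub>"
      using f by (intro eqI add_closed zero_closed calculation) (auto simp: addv zerov cl M.l_neg)
    ultimately show ?thesis by blast
  qed
  have "abelian_group ?E"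
    by (rule abelian_groupI)
      (auto intro!: eqI add_closed zero_closed neg simp: addv zerov cl M.a_ac)
  moreover have "monoid ?E"
    by (rule monoidI) (auto intro!: eqI mult_closed one_closed simp: multv onev cl)
  ultimately show ?thesis
    by (intro ringI) (auto intro!: eqI mult_closed add_closed simp: multv addv cl addh)
qed

lemma ring_opposite_ring: assumes "ring R" shows "ring (opposite_ring R)"
proof -
  interpret ring R by fact
  let ?O = "opposite_ring R"
  have s: "carrier ?O = carrier R" "\<zero>\<^bsub>?O\<^esub> = \<zero>\<^bsub>R\<^esub>" "\<one>\<^bsub>?O\<^esub> = \<one>\<^bsub>R\<^esub>" "x \<oplus>\<^bsub>?O\<^esub> y = x \<oplus>\<^bsub>R\<^esub> y" "x \<otimes>\<^bsub>?O\<^esub> y = y \<otimes>\<^bsub>R\<^esub> x" for x y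
    by (simp_all add: opposite_ring_def)
  have "abelian_group ?O"
    by (rule abelian_groupI) (auto simp: s a_ac intro: bexI[of _ "\<ominus>\<^bsub>R\<^esub> _"] l_neg)
  moreover have "monoid ?O" by (rule monoidI) (auto simp: s m_assoc)
  ultimately show ?thesis by (intro ringI) (auto simp: s l_distr r_distr)
qed

context words
begin

text \<open>The nonzero paths. Words are paths read backwards, so \<open>tgt\<close> of the first
  arrow of a path is the vertex where the path starts.\<close>

definition NP :: "('v \<times> 'e list) set" where
  "NP = {(u,p). u \<in> Vs \<and> rev p \<in> W \<and> (p \<noteq> [] \<longrightarrow> tgt (hd p) = u)}"

definition pe :: "'v \<Rightarrow> 'e list \<Rightarrow> 'v" where
  "pe u p = (if p = [] then u else src (last p))"

text \<open>The product of the algebra in the basis of nonzero paths: a path collects the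
  contributions of all its cuts, and products that leave \<open>NP\<close> are dropped.\<close>

definition cmul :: "('v \<times> 'e list \<Rightarrow> 'k::field) \<Rightarrow> ('v \<times> 'e list \<Rightarrow> 'k) \<Rightarrow> 'v \<times> 'e list \<Rightarrow> 'k" where
  "cmul c d x = (if x \<in> NP then \<Sum>i\<le>length (snd x).
     c (fst x, take i (snd x)) * d (pe (fst x) (take i (snd x)), drop i (snd x)) else 0)"

lemma fin_NP: "finite NP"
  by (rule finite_subset[of _ "Vs \<times> rev ` W"]) (auto simp: NP_def fin_Vs fin_W intro: rev_image_eqI)

lemma NP_append:
  assumes "(u, p @ q) \<in> NP"
  shows "(u, p) \<in> NP" "(pe u p, q) \<in> NP"
proof -
  have w: "rev q @ rev p \<in> W" "u \<in> Vs" using assms by (auto simp: NP_def)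
  then have W: "rev q \<in> W" "rev p \<in> W" using W_append by blast+
  show "(u, p) \<in> NP" using assms W w by (cases p) (auto simp: NP_def)
  have "set p \<subseteq> As" using W_set[OF W(2)] by simp
  then have "last p \<in> As" if "p \<noteq> []" using last_in_set[OF that] by blast
  then have v: "pe u p \<in> Vs" using w(2) src_in by (simp add: pe_def)
  have "tgt (hd q) = pe u p" if q: "q \<noteq> []"
  proof (cases p rule: rev_cases)
    case Nil
    then show ?thesis using assms q by (simp add: NP_def pe_def)
  next
    case (snoc p' a)
    obtain b q' where "q = b # q'" using q by (cases q) auto
    then have "rev q' @ [b, a] @ rev p' \<in> W" using w(1) snoc by simp
    then have "[b, a] \<in> W" using W_prefix W_suffix by blast
    then show ?thesis using W_comp snoc \<open>q = b # q'\<close> by (simp add: pe_def)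
  qed
  then show "(pe u p, q) \<in> NP" using W v by (simp add: NP_def)
qed

text \<open>The transpose of \<open>la a\<close>, see \<open>pull_la\<close>. It turns the left
  action of words on a representation into the right action of paths on the dual module.\<close>

definition pull :: "'e \<Rightarrow> (('v,'e) node \<Rightarrow> 'k::field) \<Rightarrow> ('v,'e) node \<Rightarrow> 'k" where
  "pull a x = (\<lambda>\<gamma>. if \<gamma> \<in> Bs then case lst a \<gamma> of None \<Rightarrow> 0 | Some \<beta> \<Rightarrow> x \<beta> else 0)"

definition Ms :: "(('v,'e) node \<Rightarrow> 'k::field) set" where
  "Ms = {x. \<forall>\<beta>. x \<beta> \<noteq> 0 \<longrightarrow> \<beta> \<in> Bs}"

definition pact :: "'v \<times> 'e list \<Rightarrow> (('v,'e) node \<Rightarrow> 'k::field) \<Rightarrow> ('v,'e) node \<Rightarrow> 'k" where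
  "pact y x = fold pull (snd y) (ea (fst y) x)"

definition actc :: "('v \<times> 'e list \<Rightarrow> 'k::field) \<Rightarrow> (('v,'e) node \<Rightarrow> 'k) \<Rightarrow> ('v,'e) node \<Rightarrow> 'k" where
  "actc c x = (\<lambda>\<gamma>. \<Sum>y\<in>NP. c y * pact y x \<gamma>)"

lemma pull_Ms: "pull a x \<in> Ms" by (simp add: pull_def Ms_def)
lemma ea_Ms: "x \<in> Ms \<Longrightarrow> ea v x \<in> Ms" by (simp add: ea_def Ms_def)
lemma fold_pull_Ms: "x \<in> Ms \<Longrightarrow> fold pull p x \<in> Ms" by (induction p arbitrary: x) (auto simp: pull_Ms)
lemma pact_Ms: "x \<in> Ms \<Longrightarrow> pact y x \<in> Ms" by (simp add: pact_def fold_pull_Ms ea_Ms)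
lemma Ms_sum: "(\<And>i. i \<in> S \<Longrightarrow> f i \<in> Ms) \<Longrightarrow> (\<lambda>\<gamma>. \<Sum>i\<in>S. c i * f i \<gamma>) \<in> Ms"
proof -
  assume f: "\<And>i. i \<in> S \<Longrightarrow> f i \<in> Ms"
  have "\<beta> \<in> Bs" if nz: "(\<Sum>i\<in>S. c i * f i \<beta>) \<noteq> 0" for \<beta>
  proof -
    obtain i where "i \<in> S" "c i * f i \<beta> \<noteq> 0" using nz by (rule sum.not_neutral_contains_not_neutral)
    then show ?thesis using f[of i] by (auto simp: Ms_def)
  qed
  then show ?thesis by (simp add: Ms_def)
qed
lemma actc_Ms: "x \<in> Ms \<Longrightarrow> actc c x \<in> Ms" unfolding actc_def by (intro Ms_sum pact_Ms)

lemma pull_sum: "pull a (\<lambda>\<gamma>. \<Sum>i\<in>S. c i * f i \<gamma>) = (\<lambda>\<gamma>. \<Sum>i\<in>S. c i * pull a (f i) \<gamma>)"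
  by (auto simp: pull_def fun_eq_iff split: option.splits)

lemma ea_sum: "ea v (\<lambda>\<gamma>. \<Sum>i\<in>S. c i * f i \<gamma>) = (\<lambda>\<gamma>. \<Sum>i\<in>S. c i * ea v (f i) \<gamma>)"
  by (auto simp: ea_def fun_eq_iff)

lemma fold_pull_sum: "fold pull p (\<lambda>\<gamma>. \<Sum>i\<in>S. c i * f i \<gamma>) = (\<lambda>\<gamma>. \<Sum>i\<in>S. c i * fold pull p (f i) \<gamma>)"
  by (induction p rule: rev_induct) (auto simp: pull_sum)

lemma pact_sum: "pact y (\<lambda>\<gamma>. \<Sum>i\<in>S. c i * f i \<gamma>) = (\<lambda>\<gamma>. \<Sum>i\<in>S. c i * pact y (f i) \<gamma>)"
  by (simp add: pact_def ea_sum fold_pull_sum)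

lemma pact_add: "pact y (x + x') = pact y x + pact y x'"
proof -
  have e: "ea v (x + x') = ea v x + ea v x'" for v and x x' :: "('v,'e) node \<Rightarrow> 'a" by (auto simp: ea_def fun_eq_iff)
  have p: "pull a (x + x') = pull a x + pull a x'" for a and x x' :: "('v,'e) node \<Rightarrow> 'a" by (auto simp: pull_def fun_eq_iff split: option.splits)
  have "fold pull p (x + x') = fold pull p x + fold pull p x'" for p and x x' :: "('v,'e) node \<Rightarrow> 'a"
    by (induction p rule: rev_induct) (simp_all only: fold_append comp_apply fold_simps p)
  then show ?thesis by (simp only: pact_def e)
qed

text \<open>Transposition reverses the order of the letters, hence the \<open>rev\<close>.\<close>

lemma fold_pull_lsts: "\<gamma> \<in> Bs \<Longrightarrow> fold pull p x \<gamma> = (case lsts (rev p) \<gamma> of None \<Rightarrow> 0 | Some \<beta> \<Rightarrow> x \<beta>)"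
proof (induction p arbitrary: \<gamma> rule: rev_induct)
  case (snoc a p)
  have "lsts (rev (p @ [a])) \<gamma> = Option.bind (lst a \<gamma>) (lsts (rev p))"
    using lsts_append[of "[a]" "rev p" \<gamma>] lsts_snoc[of "[]" a \<gamma>] by simp
  then show ?case using snoc lst_Bs[OF snoc.prems, of a] by (auto simp: pull_def split: option.splits)
qed simp

lemma fold_pull_zero: assumes "x \<in> Ms" "rev p \<notin> W" shows "fold pull p x = 0"
proof
  fix \<gamma>
  show "fold pull p x \<gamma> = 0 \<gamma>"
  proof (cases "\<gamma> \<in> Bs")
    case True
    then have "lsts (rev p) \<gamma> = None" using lsts_W[OF True, of "rev p"] assms(2) by (cases "lsts (rev p) \<gamma>") auto
    then show ?thesis using fold_pull_lsts[OF True, of p x] by simp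
  next
    case False
    then show ?thesis using fold_pull_Ms[OF assms(1), of p] by (auto simp: Ms_def)
  qed
qed

lemma pull_zero [simp]: "pull a 0 = 0" by (auto simp: pull_def fun_eq_iff split: option.splits)
lemma fold_pull_0: "fold pull p 0 = 0" by (induction p) (simp_all only: fold_simps pull_zero)

lemma ea_pact: "ea v (pact (u, p) x) = (if pe u p = v then pact (u, p) x else 0)"
proof (cases p rule: rev_cases)
  case Nil
  then show ?thesis by (auto simp: pact_def pe_def ea_def fun_eq_iff)
next
  case (snoc p' a)
  have "ea v (pull a w) = (if src a = v then pull a w else 0)" for w :: "('v,'e) node \<Rightarrow> 'a"
    using src_lst by (fastforce simp: ea_def pull_def fun_eq_iff split: option.splits)
  then show ?thesis using snoc by (simp add: pact_def pe_def)
qed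

lemma pact_pact:
  assumes x: "x \<in> Ms" and y: "(u, p) \<in> NP" and z: "(v, q) \<in> NP"
  shows "pact (v, q) (pact (u, p) x) = (if pe u p = v \<and> (u, p @ q) \<in> NP then pact (u, p @ q) x else 0)"
proof (cases "pe u p = v")
  case True
  have e: "pact (v, q) (pact (u, p) x) = pact (u, p @ q) x"
    using ea_pact[of v u p x] True by (simp add: pact_def)
  have "pact (u, p @ q) x = 0" if "(u, p @ q) \<notin> NP"
  proof -
    have "tgt (hd (p @ q)) = u" if "p @ q \<noteq> []"
      using y z that True by (cases p) (auto simp: NP_def pe_def)
    then have "rev (p @ q) \<notin> W" using that y by (auto simp: NP_def)
    then show ?thesis unfolding pact_def fst_conv snd_conv by (rule fold_pull_zero[OF ea_Ms[OF x]])
  qed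
  then show ?thesis using e True by auto
next
  case False
  have "pact (v, q) (pact (u, p) x) = fold pull q (ea v (pact (u, p) x))" by (simp add: pact_def)
  then show ?thesis using False by (simp add: ea_pact fold_pull_0)
qed

text \<open>A pair of composable nonzero paths with nonzero product is the same as a nonzero path
  with a position to cut it, and the sum over cuts is \<open>cmul\<close>.\<close>

lemma actc_actc:
  assumes x: "x \<in> Ms"
  shows "actc d (actc c x) = actc (cmul c d) x"
proof
  fix \<gamma>
  let ?T = "{(y, z) \<in> NP \<times> NP. pe (fst y) (snd y) = fst z \<and> (fst y, snd y @ snd z) \<in> NP}"
  let ?I = "Sigma NP (\<lambda>r. {..length (snd r)})"
  have tk: "(u, take i r) \<in> NP" "(pe u (take i r), drop i r) \<in> NP" if "(u, r) \<in> NP" for u i r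
    using NP_append[of u "take i r" "drop i r"] that by auto
  have pp: "pact z (pact y x) \<gamma> = (if pe (fst y) (snd y) = fst z \<and> (fst y, snd y @ snd z) \<in> NP
      then pact (fst y, snd y @ snd z) x \<gamma> else 0)" if "y \<in> NP" "z \<in> NP" for y z
    using pact_pact[OF x, of "fst y" "snd y" "fst z" "snd z"] that by auto
  have "actc d (actc c x) \<gamma> = (\<Sum>z\<in>NP. \<Sum>y\<in>NP. d z * (c y * pact z (pact y x) \<gamma>))"
    unfolding actc_def[of d] actc_def[of c] pact_sum by (simp add: sum_distrib_left)
  also have "\<dots> = (\<Sum>y\<in>NP. \<Sum>z\<in>NP. d z * (c y * pact z (pact y x) \<gamma>))" by (rule sum.swap)
  also have "\<dots> = (\<Sum>(y,z)\<in>NP \<times> NP. d z * (c y * pact z (pact y x) \<gamma>))" by (simp add: sum.cartesian_product)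
  also have "\<dots> = (\<Sum>(y,z)\<in>?T. c y * d z * pact (fst y, snd y @ snd z) x \<gamma>)"
  proof (rule sum.mono_neutral_cong_right)
    show "\<forall>i\<in>NP \<times> NP - ?T. (case i of (y,z) \<Rightarrow> d z * (c y * pact z (pact y x) \<gamma>)) = 0"
      using pp by (auto simp: case_prod_unfold split: if_splits)
  qed (use fin_NP pp in \<open>auto simp: case_prod_unfold split: if_splits\<close>)
  also have "\<dots> = (\<Sum>(r,i)\<in>?I. c (fst r, take i (snd r)) * d (pe (fst r) (take i (snd r)), drop i (snd r)) * pact r x \<gamma>)"
    by (rule sum.reindex_bij_witness[where i = "\<lambda>(r,i). ((fst r, take i (snd r)), (pe (fst r) (take i (snd r)), drop i (snd r)))"
          and j = "\<lambda>(y,z). ((fst y, snd y @ snd z), length (snd y))"])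
      (auto intro: tk)
  also have "\<dots> = (\<Sum>r\<in>NP. \<Sum>i\<le>length (snd r). c (fst r, take i (snd r)) * d (pe (fst r) (take i (snd r)), drop i (snd r)) * pact r x \<gamma>)"
    using fin_NP by (subst sum.Sigma) auto
  also have "\<dots> = actc (cmul c d) x \<gamma>"
    unfolding actc_def by (intro sum.cong) (auto simp: cmul_def sum_distrib_right)
  finally show "actc d (actc c x) \<gamma> = actc (cmul c d) x \<gamma>" .
qed

lemma actc_add_left: "actc (c + c') x = actc c x + actc c' x"
  by (auto simp: actc_def fun_eq_iff algebra_simps sum.distrib)

lemma actc_add_right: "actc c (x + x') = actc c x + actc c x'"
  by (auto simp: actc_def fun_eq_iff pact_add algebra_simps sum.distrib)

lemma actc_single: "y \<in> NP \<Longrightarrow> actc (\<lambda>z. if z = y then 1 else 0) x = pact y x"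
proof
  fix \<gamma> assume y: "y \<in> NP"
  have "actc (\<lambda>z. if z = y then 1 else 0) x \<gamma> = (\<Sum>z\<in>NP. if z = y then pact y x \<gamma> else 0)"
    unfolding actc_def by (intro sum.cong) auto
  then show "actc (\<lambda>z. if z = y then 1 else 0) x \<gamma> = pact y x \<gamma>" using y fin_NP by simp
qed

lemma trivial_NP: "(u, []) \<in> NP \<longleftrightarrow> u \<in> Vs" by (simp add: NP_def Nil_W)

lemma actc_scalar:
  assumes x: "x \<in> Ms"
  shows "actc (\<lambda>(u,p). if u \<in> Vs \<and> p = [] then t else 0) x = (\<lambda>\<gamma>. t * x \<gamma>)"
proof
  fix \<gamma>
  have "actc (\<lambda>(u,p). if u \<in> Vs \<and> p = [] then t else 0) x \<gamma> = (\<Sum>y\<in>(\<lambda>u. (u, [])) ` Vs. t * pact y x \<gamma>)"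
    unfolding actc_def using fin_NP by (intro sum.mono_neutral_cong_right) (auto simp: trivial_NP)
  also have "\<dots> = (\<Sum>u\<in>Vs. t * ea u x \<gamma>)" by (subst sum.reindex) (auto simp: inj_on_def pact_def)
  also have "\<dots> = (\<Sum>u\<in>Vs. if u = vt \<gamma> then t * x \<gamma> else 0)" by (intro sum.cong) (auto simp: ea_def)
  also have "\<dots> = t * x \<gamma>" using x vt_Vs[of \<gamma>] fin_Vs by (auto simp: Ms_def)
  finally show "actc (\<lambda>(u,p). if u \<in> Vs \<and> p = [] then t else 0) x \<gamma> = t * x \<gamma>" .
qed

text \<open>The dual of the endomorphism with matrix \<open>m\<close>: the coordinate at a node is
  the pairing of \<open>x\<close> with the row of that node.\<close>

definition mt :: "(('v,'e) node \<Rightarrow> ('v,'e) node \<Rightarrow> 'k::field) \<Rightarrow> (('v,'e) node \<Rightarrow> 'k) \<Rightarrow> ('v,'e) node \<Rightarrow> 'k" where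
  "mt m x = (\<lambda>\<gamma>. \<Sum>\<beta>\<in>Bs. x \<beta> * m \<gamma> \<beta>)"

lemma pull_la: "(\<Sum>\<beta>\<in>Bs. pull a x \<beta> * y \<beta>) = (\<Sum>\<beta>\<in>Bs. x \<beta> * la a y \<beta>)"
proof -
  let ?D = "{\<beta>\<in>Bs. lst a \<beta> \<noteq> None}" and ?R = "{\<gamma>\<in>Bs. rst a \<gamma> \<noteq> None}"
  have "(\<Sum>\<beta>\<in>Bs. pull a x \<beta> * y \<beta>) = (\<Sum>\<beta>\<in>?D. x (the (lst a \<beta>)) * y \<beta>)"
    using fin_Bs by (intro sum.mono_neutral_cong_right) (auto simp: pull_def split: option.splits)
  also have "\<dots> = (\<Sum>\<gamma>\<in>?R. x \<gamma> * la a y \<gamma>)"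
    by (rule sum.reindex_bij_witness[where j = "\<lambda>\<beta>. the (lst a \<beta>)" and i = "\<lambda>\<gamma>. the (rst a \<gamma>)"])
      (auto dest: lst_Bs rst_Bs lst_rst rst_lst simp: la_def)
  also have "\<dots> = (\<Sum>\<beta>\<in>Bs. x \<beta> * la a y \<beta>)"
    using fin_Bs by (intro sum.mono_neutral_left) (auto simp: la_def)
  finally show ?thesis .
qed

lemma mt_Ms: assumes "m \<in> GM" shows "mt m x \<in> Ms"
  unfolding Ms_def mt_def using assms by (auto simp: GM_def)

lemma mt_pull: assumes "m \<in> GM" shows "mt m (pull a x) = pull a (mt m x)"
proof
  fix \<gamma>
  show "mt m (pull a x) \<gamma> = pull a (mt m x) \<gamma>"
  proof (cases "\<gamma> \<in> Bs")
    case True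
    then have "la a (m \<gamma>) = (case lst a \<gamma> of None \<Rightarrow> 0 | Some \<delta> \<Rightarrow> m \<delta>)" using assms by (auto simp: GM_def)
    then show ?thesis using True unfolding mt_def pull_la by (auto simp: pull_def split: option.splits)
  next
    case False
    then show ?thesis using assms by (auto simp: pull_def mt_def GM_def)
  qed
qed

lemma mt_ea: assumes "m \<in> GM" shows "mt m (ea v x) = ea v (mt m x)"
proof
  fix \<gamma>
  show "mt m (ea v x) \<gamma> = ea v (mt m x) \<gamma>"
  proof (cases "\<gamma> \<in> Bs")
    case True
    then have eq: "ea (vt \<gamma>) (m \<gamma>) = m \<gamma>" using assms by (auto simp: GM_def)
    have nz: "vt \<beta> = vt \<gamma>" if "m \<gamma> \<beta> \<noteq> 0" for \<beta>
    proof (rule ccontr)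
      assume "vt \<beta> \<noteq> vt \<gamma>"
      then have "ea (vt \<gamma>) (m \<gamma>) \<beta> = 0" by (simp add: ea_def)
      then show False using eq that by simp
    qed
    have e: "ea v x \<beta> * m \<gamma> \<beta> = (if vt \<gamma> = v then x \<beta> * m \<gamma> \<beta> else 0)" for \<beta>
      using nz[of \<beta>] by (cases "m \<gamma> \<beta> = 0") (auto simp: ea_def)
    show ?thesis unfolding mt_def e by (simp add: ea_def)
  next
    case False
    then show ?thesis using assms by (auto simp: ea_def mt_def GM_def)
  qed
qed

lemma mt_actc: assumes "m \<in> GM" shows "mt m (actc c x) = actc c (mt m x)"
proof -
  have "mt m (fold pull p x) = fold pull p (mt m x)" for p x
    by (induction p rule: rev_induct) (auto simp: mt_pull[OF assms])
  then have p: "mt m (pact y x) = pact y (mt m x)" for y x by (simp add: pact_def mt_ea[OF assms])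
  show ?thesis
  proof
    fix \<gamma>
    have "mt m (actc c x) \<gamma> = (\<Sum>\<beta>\<in>Bs. \<Sum>y\<in>NP. c y * (pact y x \<beta> * m \<gamma> \<beta>))"
      unfolding mt_def actc_def by (simp add: sum_distrib_right mult.assoc)
    also have "\<dots> = (\<Sum>y\<in>NP. c y * mt m (pact y x) \<gamma>)"
      by (subst sum.swap) (simp add: mt_def sum_distrib_left)
    finally show "mt m (actc c x) \<gamma> = actc c (mt m x) \<gamma>" by (simp add: p actc_def)
  qed
qed

definition uv :: "('v,'e) node \<Rightarrow> ('v,'e) node \<Rightarrow> 'k::field" where
  "uv \<beta> = (\<lambda>\<gamma>. if \<gamma> = \<beta> then 1 else 0)"

lemma uv_Ms: "\<beta> \<in> Bs \<Longrightarrow> uv \<beta> \<in> Ms" by (auto simp: uv_def Ms_def)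

lemma Ms_expand: "x \<in> Ms \<Longrightarrow> x = (\<lambda>\<gamma>. \<Sum>\<beta>\<in>Bs. x \<beta> * uv \<beta> \<gamma>)"
proof
  fix \<gamma> assume x: "x \<in> Ms"
  have "(\<Sum>\<beta>\<in>Bs. x \<beta> * uv \<beta> \<gamma>) = (\<Sum>\<beta>\<in>Bs. if \<gamma> = \<beta> then x \<gamma> else 0)" by (intro sum.cong) (auto simp: uv_def)
  then show "x \<gamma> = (\<Sum>\<beta>\<in>Bs. x \<beta> * uv \<beta> \<gamma>)" using x fin_Bs by (auto simp: Ms_def)
qed

lemma mt_uv: "\<beta> \<in> Bs \<Longrightarrow> mt m (uv \<beta>) \<gamma> = m \<gamma> \<beta>"
proof -
  assume b: "\<beta> \<in> Bs"
  have "mt m (uv \<beta>) \<gamma> = (\<Sum>\<beta>'\<in>Bs. if \<beta>' = \<beta> then m \<gamma> \<beta> else 0)" unfolding mt_def by (intro sum.cong) (auto simp: uv_def)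
  then show ?thesis using b fin_Bs by simp
qed

text \<open>\<open>pull a\<close> sends the unit vector at a node to the unit vector at its
  predecessor \<open>rst a\<close>, or to zero. Comparing coordinates in the commutation with
  \<open>pull a\<close> therefore gives the row condition of \<open>GM\<close>.\<close>

lemma matrix_of_linear:
  fixes T :: "(('v,'e) node \<Rightarrow> 'k::field) \<Rightarrow> ('v,'e) node \<Rightarrow> 'k"
  assumes cl: "\<And>x. x \<in> Ms \<Longrightarrow> T x \<in> Ms" and add: "\<And>x y. x \<in> Ms \<Longrightarrow> y \<in> Ms \<Longrightarrow> T (x + y) = T x + T y"
    and sc: "\<And>c x. x \<in> Ms \<Longrightarrow> T (\<lambda>\<gamma>. c * x \<gamma>) = (\<lambda>\<gamma>. c * T x \<gamma>)"
    and pull: "\<And>a x. x \<in> Ms \<Longrightarrow> a \<in> As \<Longrightarrow> T (pull a x) = pull a (T x)"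
    and ea: "\<And>v x. x \<in> Ms \<Longrightarrow> v \<in> Vs \<Longrightarrow> T (ea v x) = ea v (T x)"
  defines "m \<equiv> \<lambda>\<gamma> \<beta>. if \<gamma> \<in> Bs \<and> \<beta> \<in> Bs then T (uv \<beta>) \<gamma> else 0"
  shows "m \<in> GM" "x \<in> Ms \<Longrightarrow> T x = mt m x"
proof -
  have z: "(\<lambda>_. 0) \<in> (Ms :: (('v,'e) node \<Rightarrow> 'k) set)" by (simp add: Ms_def)
  have T0: "T (\<lambda>_. 0) = (\<lambda>_. 0)" using sc[OF z, of 0] by simp
  have lin: "T (\<lambda>\<gamma>. \<Sum>\<beta>\<in>S. c \<beta> * uv \<beta> \<gamma>) = (\<lambda>\<gamma>. \<Sum>\<beta>\<in>S. c \<beta> * T (uv \<beta>) \<gamma>)" if "finite S" "S \<subseteq> Bs" for S c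
    using that
  proof (induction S rule: finite_induct)
    case empty
    then show ?case using T0 by simp
  next
    case (insert b S)
    have uvb: "uv b \<in> Ms" using insert.prems by (intro uv_Ms) simp
    have m1: "(\<lambda>\<gamma>. c b * uv b \<gamma>) \<in> Ms" using insert.prems by (auto simp: Ms_def uv_def)
    have m2: "(\<lambda>\<gamma>. \<Sum>\<beta>\<in>S. c \<beta> * uv \<beta> \<gamma>) \<in> Ms" using insert.prems by (intro Ms_sum uv_Ms) auto
    have e: "T (\<lambda>\<gamma>. \<Sum>\<beta>\<in>S. c \<beta> * uv \<beta> \<gamma>) = (\<lambda>\<gamma>. \<Sum>\<beta>\<in>S. c \<beta> * T (uv \<beta>) \<gamma>)"
      by (rule insert.IH) (use insert.prems in blast)
    have "(\<lambda>\<gamma>. \<Sum>\<beta>\<in>insert b S. c \<beta> * uv \<beta> \<gamma>) = (\<lambda>\<gamma>. c b * uv b \<gamma>) + (\<lambda>\<gamma>. \<Sum>\<beta>\<in>S. c \<beta> * uv \<beta> \<gamma>)"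
      using insert.hyps by (simp add: fun_eq_iff)
    then have 1: "T (\<lambda>\<gamma>. \<Sum>\<beta>\<in>insert b S. c \<beta> * uv \<beta> \<gamma>) = (\<lambda>\<gamma>. c b * T (uv b) \<gamma>) + T (\<lambda>\<gamma>. \<Sum>\<beta>\<in>S. c \<beta> * uv \<beta> \<gamma>)"
      using add[OF m1 m2] sc[OF uvb, of "c b"] by simp
    show ?case unfolding 1 e by (rule ext) (simp add: insert.hyps)
  qed
  show Tm: "T x = mt m x" if x: "x \<in> Ms" for x
  proof
    fix \<gamma>
    have e: "T x \<gamma> = (\<Sum>\<beta>\<in>Bs. x \<beta> * T (uv \<beta>) \<gamma>)"
      using lin[OF fin_Bs order.refl, of x] Ms_expand[OF x] by metis
    show "T x \<gamma> = mt m x \<gamma>"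
    proof (cases "\<gamma> \<in> Bs")
      case True
      then show ?thesis unfolding e mt_def m_def by (intro sum.cong) auto
    next
      case False
      then have "T x \<gamma> = 0" using cl[OF x] by (auto simp: Ms_def)
      then show ?thesis using False by (simp add: mt_def m_def)
    qed
  qed
  show "m \<in> GM"
    unfolding GM_def
  proof (intro CollectI conjI allI ballI impI)
    show "m \<gamma> = 0" if "\<gamma> \<notin> Bs" for \<gamma> using that by (auto simp: m_def fun_eq_iff)
    fix \<gamma> assume g: "\<gamma> \<in> Bs"
    show "\<beta> \<in> Bs" if "m \<gamma> \<beta> \<noteq> 0" for \<beta> using that by (auto simp: m_def split: if_splits)
    show "ea (vt \<gamma>) (m \<gamma>) = m \<gamma>"
    proof
      fix \<beta>
      show "ea (vt \<gamma>) (m \<gamma>) \<beta> = m \<gamma> \<beta>"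
      proof (cases "\<beta> \<in> Bs \<and> vt \<beta> \<noteq> vt \<gamma>")
        case True
        then have 1: "ea (vt \<gamma>) (uv \<beta>) = (\<lambda>_. 0 :: 'k)" by (auto simp: ea_def uv_def fun_eq_iff)
        have "ea (vt \<gamma>) (T (uv \<beta>)) = T (ea (vt \<gamma>) (uv \<beta>))"
          using ea[OF uv_Ms vt_Vs[OF g], of \<beta>] True by metis
        then have "ea (vt \<gamma>) (T (uv \<beta>)) = (\<lambda>_. 0)" unfolding 1 T0 .
        then have "ea (vt \<gamma>) (T (uv \<beta>)) \<gamma> = 0" by (rule fun_cong)
        then show ?thesis using True g by (simp add: ea_def m_def)
      qed (auto simp: ea_def m_def)
    qed
    fix a
    show "la a (m \<gamma>) = (case lst a \<gamma> of None \<Rightarrow> 0 | Some \<delta> \<Rightarrow> m \<delta>)"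
    proof (cases "a \<in> As")
      case False
      then have "lst a \<beta> = None" if "\<beta> \<in> Bs" for \<beta> using lst_As[OF that, of a] by (cases "lst a \<beta>") auto
      moreover have "rst a \<beta> = None" if "\<beta> \<in> Bs" for \<beta>
        using calculation rst_Bs[OF that, of a] rst_lst[OF that, of a] by (cases "rst a \<beta>") auto
      ultimately show ?thesis using g by (auto simp: la_def fun_eq_iff)
    next
      case True
      show ?thesis
      proof
        fix \<beta>
        show "la a (m \<gamma>) \<beta> = (case lst a \<gamma> of None \<Rightarrow> 0 | Some \<delta> \<Rightarrow> m \<delta>) \<beta>"
        proof (cases "\<beta> \<in> Bs")
          case b: True
          have pu: "pull a (uv \<beta>) = (case rst a \<beta> of None \<Rightarrow> (\<lambda>_. 0 :: 'k) | Some \<beta>' \<Rightarrow> uv \<beta>')"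
          proof
            fix \<delta>
            have "\<delta> \<in> Bs \<Longrightarrow> lst a \<delta> = Some \<beta> \<longleftrightarrow> rst a \<beta> = Some \<delta>" using lst_iff_rst[OF _ b] by blast
            then show "pull a (uv \<beta>) \<delta> = (case rst a \<beta> of None \<Rightarrow> (\<lambda>_. 0 :: 'k) | Some \<beta>' \<Rightarrow> uv \<beta>') \<delta>"
              using rst_Bs[OF b, of a] by (auto simp: pull_def uv_def split: option.splits)
          qed
          have "T (pull a (uv \<beta>)) \<gamma> = pull a (T (uv \<beta>)) \<gamma>" using pull[OF uv_Ms[OF b] True] by simp
          moreover have "T (pull a (uv \<beta>)) \<gamma> = la a (m \<gamma>) \<beta>"
            unfolding pu using b g rst_Bs[OF b, of a] T0 by (auto simp: la_def m_def split: option.splits)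
          moreover have "pull a (T (uv \<beta>)) \<gamma> = (case lst a \<gamma> of None \<Rightarrow> 0 | Some \<delta> \<Rightarrow> m \<delta>) \<beta>"
            using b g lst_Bs[OF g, of a] by (auto simp: pull_def m_def split: option.splits)
          ultimately show ?thesis by simp
        next
          case False
          then show ?thesis by (auto simp: la_def m_def split: option.splits)
        qed
      qed
    qed
  qed
qed

lemma pull_arrow: "a \<in> As \<Longrightarrow> pact (tgt a, [a]) x = pull a x"
  using tgt_lst by (fastforce simp: pact_def pull_def ea_def fun_eq_iff split: option.splits)

lemma arrow_NP: "a \<in> As \<Longrightarrow> (tgt a, [a]) \<in> NP"
  using single_W tgt_in by (simp add: NP_def)

end

section \<open>The generator-cogenerator\<close>

text \<open>The algebra enters only through coordinates \<open>cof\<close> with respect to the basis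
  of nonzero paths; the factor algebra of the path algebra is fitted to this at the end.\<close>

locale malg = words Vs As src tgt W + A: ring A
  for Vs :: "'v set" and As :: "'e set" and src tgt and W and A :: "('k::field, 'a, 'z) module_scheme" +
  fixes cof :: "'a \<Rightarrow> 'v \<times> 'e list \<Rightarrow> 'k"
  assumes cof_bij: "bij_betw cof (carrier A) {c. \<forall>x. c x \<noteq> 0 \<longrightarrow> x \<in> NP}"
    and cof_add: "\<And>X Y. X \<in> carrier A \<Longrightarrow> Y \<in> carrier A \<Longrightarrow> cof (X \<oplus>\<^bsub>A\<^esub> Y) = cof X + cof Y"
    and cof_mult: "\<And>X Y. X \<in> carrier A \<Longrightarrow> Y \<in> carrier A \<Longrightarrow> cof (X \<otimes>\<^bsub>A\<^esub> Y) = cmul (cof X) (cof Y)"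
    and cof_one: "cof \<one>\<^bsub>A\<^esub> = (\<lambda>(u,p). if u \<in> Vs \<and> p = [] then 1 else 0)"
    and smult_closed: "\<And>X c. X \<in> carrier A \<Longrightarrow> c \<odot>\<^bsub>A\<^esub> X \<in> carrier A"
    and cof_smult: "\<And>X c. X \<in> carrier A \<Longrightarrow> cof (c \<odot>\<^bsub>A\<^esub> X) = (\<lambda>x. c * cof X x)"
begin

definition CF :: "('v \<times> 'e list \<Rightarrow> 'k) set" where "CF = {c. \<forall>x. c x \<noteq> 0 \<longrightarrow> x \<in> NP}"
definition cl :: "('v \<times> 'e list \<Rightarrow> 'k) \<Rightarrow> 'a" where "cl = inv_into (carrier A) cof"
definition dl :: "'v \<times> 'e list \<Rightarrow> 'v \<times> 'e list \<Rightarrow> 'k" where "dl y = (\<lambda>z. if z = y then 1 else 0)"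
definition sca :: "'k \<Rightarrow> 'v \<times> 'e list \<Rightarrow> 'k" where "sca t = (\<lambda>(u,p). if u \<in> Vs \<and> p = [] then t else 0)"

lemma cof_CF: "X \<in> carrier A \<Longrightarrow> cof X \<in> CF" using cof_bij by (auto simp: bij_betw_def CF_def)
lemma cl: "c \<in> CF \<Longrightarrow> cl c \<in> carrier A" "c \<in> CF \<Longrightarrow> cof (cl c) = c"
  using cof_bij unfolding bij_betw_def CF_def cl_def by (metis inv_into_into, metis f_inv_into_f)
lemma cof_inj: "X \<in> carrier A \<Longrightarrow> Y \<in> carrier A \<Longrightarrow> cof X = cof Y \<Longrightarrow> X = Y"
  using cof_bij by (auto simp: bij_betw_def dest: inj_onD)
lemma cl_cof: "X \<in> carrier A \<Longrightarrow> cl (cof X) = X"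
  using cof_inj cl[OF cof_CF] by blast
lemma dl_CF: "y \<in> NP \<Longrightarrow> dl y \<in> CF" by (simp add: dl_def CF_def)
lemma sca_CF: "sca t \<in> CF" by (auto simp: sca_def CF_def trivial_NP split: if_splits)
lemma actc_dl: "y \<in> NP \<Longrightarrow> actc (dl y) x = pact y x" unfolding dl_def by (rule actc_single)
lemma actc_sca: "x \<in> Ms \<Longrightarrow> actc (sca t) x = (\<lambda>\<gamma>. t * x \<gamma>)" unfolding sca_def by (rule actc_scalar)

definition bb :: "nat \<Rightarrow> ('v,'e) node" where "bb = (SOME b. bij_betw b {..<card Bs} Bs)"

lemma bb: "bij_betw bb {..<card Bs} Bs"
  unfolding bb_def using ex_bij_betw_nat_finite[OF fin_Bs] by (metis atLeast0LessThan someI_ex)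

text \<open>The type \<open>fgmod\<close> prescribes sets of functions from \<open>nat\<close> to
  the algebra. A coefficient function is stored as the singleton of the list of its scalars times
  the unit, in the enumeration \<open>bb\<close>, with a constant value beyond the basis.\<close>

definition en :: "(('v,'e) node \<Rightarrow> 'k) \<Rightarrow> (nat \<Rightarrow> 'a) set" where
  "en x = {\<lambda>i. if i < card Bs then x (bb i) \<odot>\<^bsub>A\<^esub> \<one>\<^bsub>A\<^esub> else \<one>\<^bsub>A\<^esub>}"

definition de where "de = inv_into Ms en"

text \<open>A scalar is recovered from its multiple of the unit by reading the coefficient at a
  trivial path; the vertex of the node provides one.\<close>

lemma en_inj: "inj_on en Ms"
proof (rule inj_onI)
  fix x y assume xy: "x \<in> Ms" "y \<in> Ms" "en x = en y"
  show "x = y"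
  proof
    fix \<beta>
    show "x \<beta> = y \<beta>"
    proof (cases "\<beta> \<in> Bs")
      case True
      have "\<beta> \<in> bb ` {..<card Bs}" unfolding bij_betw_imp_surj_on[OF bb] by (rule True)
      then obtain i where i: "i < card Bs" "bb i = \<beta>" by (elim imageE) simp
      have "(\<lambda>i. if i < card Bs then x (bb i) \<odot>\<^bsub>A\<^esub> \<one>\<^bsub>A\<^esub> else \<one>\<^bsub>A\<^esub>) i = (\<lambda>i. if i < card Bs then y (bb i) \<odot>\<^bsub>A\<^esub> \<one>\<^bsub>A\<^esub> else \<one>\<^bsub>A\<^esub>) i"
        by (rule fun_cong[OF singleton_inject[OF xy(3)[unfolded en_def]]])
      then have "x \<beta> \<odot>\<^bsub>A\<^esub> \<one>\<^bsub>A\<^esub> = y \<beta> \<odot>\<^bsub>A\<^esub> \<one>\<^bsub>A\<^esub>" using i by simp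
      then have "cof (x \<beta> \<odot>\<^bsub>A\<^esub> \<one>\<^bsub>A\<^esub>) (vt \<beta>, []) = cof (y \<beta> \<odot>\<^bsub>A\<^esub> \<one>\<^bsub>A\<^esub>) (vt \<beta>, [])" by simp
      then show ?thesis using vt_Vs[OF True] by (simp add: cof_smult cof_one)
    next
      case False
      then have "x \<beta> = 0" "y \<beta> = 0" using xy(1,2) by (auto simp: Ms_def)
      then show ?thesis by simp
    qed
  qed
qed

lemma de_en: "x \<in> Ms \<Longrightarrow> de (en x) = x" unfolding de_def using en_inj by (rule inv_into_f_f)

definition MM :: "('a, (nat \<Rightarrow> 'a) set) rmodule" where
  "MM = \<lparr>carrier = en ` Ms, mult = undefined, one = undefined, zero = en 0,
     add = (\<lambda>X Y. en (de X + de Y)), ract = (\<lambda>X r. en (actc (cof r) (de X)))\<rparr>"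

lemma MM_simps: "carrier MM = en ` Ms" "\<zero>\<^bsub>MM\<^esub> = en 0"
  "x \<in> Ms \<Longrightarrow> y \<in> Ms \<Longrightarrow> en x \<oplus>\<^bsub>MM\<^esub> en y = en (x + y)"
  "x \<in> Ms \<Longrightarrow> en x \<triangleleft>\<^bsub>MM\<^esub> r = en (actc (cof r) x)"
  by (simp_all add: MM_def de_en)

lemma Ms_add: "x \<in> Ms \<Longrightarrow> y \<in> Ms \<Longrightarrow> x + y \<in> Ms" unfolding Ms_def by (auto simp: plus_fun_def) (metis add.right_neutral)
lemma Ms_0: "0 \<in> Ms" by (simp add: Ms_def)
lemma Ms_neg: "x \<in> Ms \<Longrightarrow> (\<lambda>\<gamma>. - x \<gamma>) \<in> Ms" by (simp add: Ms_def)

lemma right_module_MM: "right_module A MM"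
proof -
  have "abelian_group MM"
  proof (rule abelian_groupI)
    fix X assume "X \<in> carrier MM"
    then obtain x where x: "X = en x" "x \<in> Ms" by (auto simp: MM_simps)
    show "\<zero>\<^bsub>MM\<^esub> \<oplus>\<^bsub>MM\<^esub> X = X" unfolding x(1) MM_simps(2) MM_simps(3)[OF Ms_0 x(2)] by (simp only: add_0_left)
    have "en (\<lambda>\<gamma>. - x \<gamma>) \<oplus>\<^bsub>MM\<^esub> X = en 0"
      unfolding x(1) MM_simps(3)[OF Ms_neg[OF x(2)] x(2)] by (rule arg_cong[of _ _ en]) (simp add: fun_eq_iff)
    then show "\<exists>y\<in>carrier MM. y \<oplus>\<^bsub>MM\<^esub> X = \<zero>\<^bsub>MM\<^esub>" using Ms_neg[OF x(2)] by (auto simp: MM_simps(1,2))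
  qed (auto simp: MM_simps Ms_add Ms_0 ac_simps simp del: plus_fun_apply)
  then show ?thesis
  proof (intro right_module.intro right_module_axioms.intro)
    show "X \<triangleleft>\<^bsub>MM\<^esub> r \<in> carrier MM" if "X \<in> carrier MM" for X r using that by (auto simp: MM_simps actc_Ms)
    show "X \<triangleleft>\<^bsub>MM\<^esub> (r \<oplus>\<^bsub>A\<^esub> s) = X \<triangleleft>\<^bsub>MM\<^esub> r \<oplus>\<^bsub>MM\<^esub> X \<triangleleft>\<^bsub>MM\<^esub> s" if "X \<in> carrier MM" "r \<in> carrier A" "s \<in> carrier A" for X r s
      using that by (auto simp: MM_simps(1) MM_simps(3,4) actc_Ms cof_add actc_add_left simp del: plus_fun_apply)
    show "(X \<oplus>\<^bsub>MM\<^esub> Y) \<triangleleft>\<^bsub>MM\<^esub> r = X \<triangleleft>\<^bsub>MM\<^esub> r \<oplus>\<^bsub>MM\<^esub> Y \<triangleleft>\<^bsub>MM\<^esub> r" if "X \<in> carrier MM" "Y \<in> carrier MM" for X Y r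
      using that by (auto simp: MM_simps(1) MM_simps(3,4) actc_Ms Ms_add actc_add_right)
    show "X \<triangleleft>\<^bsub>MM\<^esub> (r \<otimes>\<^bsub>A\<^esub> s) = X \<triangleleft>\<^bsub>MM\<^esub> r \<triangleleft>\<^bsub>MM\<^esub> s" if "X \<in> carrier MM" "r \<in> carrier A" "s \<in> carrier A" for X r s
      using that by (auto simp: MM_simps(1,4) actc_Ms cof_mult actc_actc)
    show "X \<triangleleft>\<^bsub>MM\<^esub> \<one>\<^bsub>A\<^esub> = X" if "X \<in> carrier MM" for X
      using that actc_sca[of _ 1] by (auto simp: MM_simps(1,4) cof_one sca_def)
  qed (rule A.ring_axioms)
qed

text \<open>Unit vectors index the columns, so the row of a node collects that coordinate of all
  their images. In this arrangement the rows satisfy \<open>GM\<close>.\<close>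

definition \<Phi>\<Phi> :: "((nat \<Rightarrow> 'a) set \<Rightarrow> (nat \<Rightarrow> 'a) set) \<Rightarrow> ('v,'e) node \<Rightarrow> ('v,'e) node \<Rightarrow> 'k" where
  "\<Phi>\<Phi> \<phi> = (\<lambda>\<gamma> \<beta>. if \<gamma> \<in> Bs \<and> \<beta> \<in> Bs then de (\<phi> (en (uv \<beta>))) \<gamma> else 0)"

text \<open>Scalars, arrows and vertices all act through elements of the algebra, namely
  \<open>sca\<close> and \<open>dl\<close>. Linearity over the algebra thus yields every hypothesis
  of \<open>matrix_of_linear\<close>.\<close>

lemma hom_matrix:
  assumes \<phi>: "\<phi> \<in> rmod_hom A MM MM"
  shows "\<Phi>\<Phi> \<phi> \<in> GM" "x \<in> Ms \<Longrightarrow> \<phi> (en x) = en (mt (\<Phi>\<Phi> \<phi>) x)"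
proof -
  define T where "T x = de (\<phi> (en x))" for x
  have enT: "\<phi> (en x) = en (T x)" and TM: "T x \<in> Ms" if "x \<in> Ms" for x
  proof -
    have "\<phi> (en x) \<in> carrier MM" using rmod_homD(1)[OF \<phi>] that by (simp add: MM_simps)
    then obtain y where "\<phi> (en x) = en y" "y \<in> Ms" by (auto simp: MM_simps)
    then show "\<phi> (en x) = en (T x)" "T x \<in> Ms" by (simp_all add: T_def de_en)
  qed
  have Tadd: "T (x + y) = T x + T y" if xy: "x \<in> Ms" "y \<in> Ms" for x y
  proof -
    have "en (T (x + y)) = \<phi> (en x \<oplus>\<^bsub>MM\<^esub> en y)" using xy by (simp only: MM_simps(3) enT[OF Ms_add])
    also have "\<dots> = \<phi> (en x) \<oplus>\<^bsub>MM\<^esub> \<phi> (en y)" using xy by (intro rmod_homD(2)[OF \<phi>]) (auto simp: MM_simps(1))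
    also have "\<dots> = en (T x + T y)" using xy by (simp only: enT MM_simps(3) TM)
    finally show ?thesis using inj_onD[OF en_inj] TM[OF Ms_add[OF xy]] Ms_add[OF TM[OF xy(1)] TM[OF xy(2)]] by blast
  qed
  have Tact: "T (actc c x) = actc c (T x)" if x: "x \<in> Ms" and c: "c \<in> CF" for c x
  proof -
    have "en (T (actc c x)) = \<phi> (en x \<triangleleft>\<^bsub>MM\<^esub> cl c)" using x c by (simp only: MM_simps(4) cl enT[OF actc_Ms])
    also have "\<dots> = \<phi> (en x) \<triangleleft>\<^bsub>MM\<^esub> cl c" using x cl(1)[OF c] by (intro rmod_homD(3)[OF \<phi>]) (auto simp: MM_simps(1))
    also have "\<dots> = en (actc c (T x))" using x c by (simp only: enT MM_simps(4) TM cl)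
    finally show ?thesis using inj_onD[OF en_inj] TM[OF actc_Ms[OF x]] actc_Ms[OF TM[OF x]] by blast
  qed
  have sc: "T (\<lambda>\<gamma>. t * x \<gamma>) = (\<lambda>\<gamma>. t * T x \<gamma>)" if x: "x \<in> Ms" for t x
    using Tact[OF x sca_CF, of t] unfolding actc_sca[OF x] actc_sca[OF TM[OF x]] .
  have pu: "T (pull a x) = pull a (T x)" if x: "x \<in> Ms" and a: "a \<in> As" for a x
    using Tact[OF x dl_CF[OF arrow_NP[OF a]]] unfolding actc_dl[OF arrow_NP[OF a]] pull_arrow[OF a] .
  have ea: "T (ea v x) = ea v (T x)" if x: "x \<in> Ms" and v: "v \<in> Vs" for v x
  proof -
    have n: "(v, []) \<in> NP" using v by (simp add: trivial_NP)
    have "pact (v, []) y = ea v y" for y :: "('v,'e) node \<Rightarrow> 'k" by (simp add: pact_def)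
    then show ?thesis using Tact[OF x dl_CF[OF n]] unfolding actc_dl[OF n] by simp
  qed
  have e: "\<Phi>\<Phi> \<phi> = (\<lambda>\<gamma> \<beta>. if \<gamma> \<in> Bs \<and> \<beta> \<in> Bs then T (uv \<beta>) \<gamma> else 0)" unfolding \<Phi>\<Phi>_def T_def by (rule refl)
  show "\<Phi>\<Phi> \<phi> \<in> GM" unfolding e by (rule matrix_of_linear(1)[of T, OF TM Tadd sc pu ea])
  show "\<phi> (en x) = en (mt (\<Phi>\<Phi> \<phi>) x)" if x: "x \<in> Ms"
    unfolding enT[OF x] e by (rule arg_cong[of _ _ en], rule matrix_of_linear(2)[of T, OF TM Tadd sc pu ea x])
qed

lemma mt_add: "mt m (x + y) = mt m x + mt m y"
  by (auto simp: mt_def fun_eq_iff algebra_simps sum.distrib)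

lemma matrix_hom:
  assumes m: "m \<in> GM"
  defines "\<phi> \<equiv> \<lambda>X\<in>carrier MM. en (mt m (de X))"
  shows "\<phi> \<in> rmod_hom A MM MM" "\<Phi>\<Phi> \<phi> = m"
proof -
  have v: "\<phi> (en x) = en (mt m x)" if "x \<in> Ms" for x using that by (simp add: \<phi>_def MM_simps(1) de_en)
  show "\<phi> \<in> rmod_hom A MM MM"
  proof (rule rmod_homI)
    fix X assume "X \<in> carrier MM"
    then obtain x where x: "X = en x" "x \<in> Ms" by (auto simp: MM_simps)
    show "\<phi> X \<in> carrier MM" using x mt_Ms[OF m] by (simp add: v MM_simps(1))
    show "\<phi> (X \<triangleleft>\<^bsub>MM\<^esub> r) = \<phi> X \<triangleleft>\<^bsub>MM\<^esub> r" for r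
      using x by (simp only: v MM_simps(4) actc_Ms mt_Ms[OF m] mt_actc[OF m])
    fix Y assume "Y \<in> carrier MM"
    then obtain y where y: "Y = en y" "y \<in> Ms" by (auto simp: MM_simps)
    show "\<phi> (X \<oplus>\<^bsub>MM\<^esub> Y) = \<phi> X \<oplus>\<^bsub>MM\<^esub> \<phi> Y"
      using x y by (simp only: v MM_simps(3) Ms_add mt_Ms[OF m] mt_add)
  qed
  show "\<Phi>\<Phi> \<phi> = m"
  proof (intro ext)
    fix \<gamma> \<beta>
    show "\<Phi>\<Phi> \<phi> \<gamma> \<beta> = m \<gamma> \<beta>"
    proof (cases "\<gamma> \<in> Bs \<and> \<beta> \<in> Bs")
      case True
      then show ?thesis by (simp add: \<Phi>\<Phi>_def v uv_Ms de_en mt_Ms[OF m] mt_uv)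
    next
      case False
      then show ?thesis using m by (auto simp: \<Phi>\<Phi>_def GM_def)
    qed
  qed
qed

text \<open>Transposition reverses composition, and so does the opposite ring: the two reversals
  cancel, leaving composition of matrices by rows.\<close>

lemma realised: "realised_ring Vs As src tgt W (opposite_ring (endo_ring A MM)) \<Phi>\<Phi>"
proof (intro realised_ring.intro realised_ring_axioms.intro)
  show "words Vs As src tgt W" by (rule words_axioms)
  show "ring (opposite_ring (endo_ring A MM))" by (rule ring_opposite_ring[OF ring_endo_ring[OF right_module_MM]])
  let ?O = "opposite_ring (endo_ring A MM)"
  have c: "\<phi> \<in> carrier ?O \<longleftrightarrow> \<phi> \<in> rmod_hom A MM MM \<and> \<phi> \<in> extensional (carrier MM)" for \<phi>
    by (simp add: opposite_ring_def endo_ring_def)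
  have inj: "\<phi> = \<psi>" if "\<phi> \<in> carrier ?O" "\<psi> \<in> carrier ?O" "\<Phi>\<Phi> \<phi> = \<Phi>\<Phi> \<psi>" for \<phi> \<psi>
  proof (rule extensionalityI[of \<phi> "carrier MM" \<psi>])
    fix X assume "X \<in> carrier MM"
    then obtain x where x: "X = en x" "x \<in> Ms" by (auto simp: MM_simps)
    show "\<phi> X = \<psi> X" using hom_matrix(2)[of \<phi> x] hom_matrix(2)[of \<psi> x] that x c by simp
  qed (use that c in auto)
  have surj: "m \<in> \<Phi>\<Phi> ` carrier ?O" if m: "m \<in> GM" for m
    by (rule image_eqI[where x = "\<lambda>X\<in>carrier MM. en (mt m (de X))"]) (use matrix_hom[OF m] c in auto)
  show "bij_betw \<Phi>\<Phi> (carrier ?O) GM"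
    unfolding bij_betw_def using inj surj hom_matrix(1) c by (auto intro!: inj_onI)
  fix \<phi> \<psi> assume "\<phi> \<in> carrier ?O" "\<psi> \<in> carrier ?O"
  then have h: "\<phi> \<in> rmod_hom A MM MM" "\<psi> \<in> rmod_hom A MM MM" using c by auto
  note G = hom_matrix(1)[OF h(1)] hom_matrix(1)[OF h(2)]
  note hm = hom_matrix(2)[OF h(1)] hom_matrix(2)[OF h(2)]
  show "\<Phi>\<Phi> (\<phi> \<oplus>\<^bsub>?O\<^esub> \<psi>) = \<Phi>\<Phi> \<phi> + \<Phi>\<Phi> \<psi>"
  proof (intro ext)
    fix \<gamma> \<beta>
    show "\<Phi>\<Phi> (\<phi> \<oplus>\<^bsub>?O\<^esub> \<psi>) \<gamma> \<beta> = (\<Phi>\<Phi> \<phi> + \<Phi>\<Phi> \<psi>) \<gamma> \<beta>"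
    proof (cases "\<gamma> \<in> Bs \<and> \<beta> \<in> Bs")
      case True
      have "(\<phi> \<oplus>\<^bsub>?O\<^esub> \<psi>) (en (uv \<beta>)) = \<phi> (en (uv \<beta>)) \<oplus>\<^bsub>MM\<^esub> \<psi> (en (uv \<beta>))"
        using True imageI[OF uv_Ms, of \<beta> en] by (simp add: opposite_ring_def endo_ring_def MM_simps(1))
      also have "\<dots> = en (mt (\<Phi>\<Phi> \<phi>) (uv \<beta>) + mt (\<Phi>\<Phi> \<psi>) (uv \<beta>))"
        using True by (simp only: hm uv_Ms MM_simps(3) mt_Ms[OF G(1)] mt_Ms[OF G(2)])
      finally have "de ((\<phi> \<oplus>\<^bsub>?O\<^esub> \<psi>) (en (uv \<beta>))) = mt (\<Phi>\<Phi> \<phi>) (uv \<beta>) + mt (\<Phi>\<Phi> \<psi>) (uv \<beta>)"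
        by (simp only: de_en[OF Ms_add[OF mt_Ms[OF G(1)] mt_Ms[OF G(2)]]])
      then show ?thesis using True mt_uv[of \<beta> "\<Phi>\<Phi> \<phi>" \<gamma>] mt_uv[of \<beta> "\<Phi>\<Phi> \<psi>" \<gamma>] by (simp add: \<Phi>\<Phi>_def[of "\<phi> \<oplus>\<^bsub>?O\<^esub> \<psi>"])
    next
      case False
      then show ?thesis by (auto simp: \<Phi>\<Phi>_def)
    qed
  qed
  show "\<Phi>\<Phi> (\<phi> \<otimes>\<^bsub>?O\<^esub> \<psi>) \<gamma> = mapply Bs (\<Phi>\<Phi> \<phi>) (\<Phi>\<Phi> \<psi> \<gamma>)" for \<gamma>
  proof
    fix \<beta>
    show "\<Phi>\<Phi> (\<phi> \<otimes>\<^bsub>?O\<^esub> \<psi>) \<gamma> \<beta> = mapply Bs (\<Phi>\<Phi> \<phi>) (\<Phi>\<Phi> \<psi> \<gamma>) \<beta>"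
    proof (cases "\<gamma> \<in> Bs \<and> \<beta> \<in> Bs")
      case True
      have "(\<phi> \<otimes>\<^bsub>?O\<^esub> \<psi>) (en (uv \<beta>)) = \<psi> (\<phi> (en (uv \<beta>)))"
        using True imageI[OF uv_Ms, of \<beta> en] by (simp add: opposite_ring_def endo_ring_def compose_def MM_simps(1))
      also have "\<dots> = en (mt (\<Phi>\<Phi> \<psi>) (mt (\<Phi>\<Phi> \<phi>) (uv \<beta>)))"
        using True by (simp only: hm uv_Ms mt_Ms[OF G(1)])
      finally have "de ((\<phi> \<otimes>\<^bsub>?O\<^esub> \<psi>) (en (uv \<beta>))) = mt (\<Phi>\<Phi> \<psi>) (mt (\<Phi>\<Phi> \<phi>) (uv \<beta>))"
        by (simp only: de_en[OF mt_Ms[OF G(2)]])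
      then have "\<Phi>\<Phi> (\<phi> \<otimes>\<^bsub>?O\<^esub> \<psi>) \<gamma> \<beta> = mt (\<Phi>\<Phi> \<psi>) (mt (\<Phi>\<Phi> \<phi>) (uv \<beta>)) \<gamma>" using True by (simp add: \<Phi>\<Phi>_def)
      also have "\<dots> = (\<Sum>\<delta>\<in>Bs. \<Phi>\<Phi> \<phi> \<delta> \<beta> * \<Phi>\<Phi> \<psi> \<gamma> \<delta>)"
        unfolding mt_def[of "\<Phi>\<Phi> \<psi>"] using True mt_uv[of \<beta> "\<Phi>\<Phi> \<phi>"] by simp
      finally show ?thesis by (simp add: mapply_def mult.commute)
    next
      case False
      then show ?thesis by (auto simp: \<Phi>\<Phi>_def mapply_def intro!: sum.neutral)
    qed
  qed
qed

lemma gldim_MM: "gldim (opposite_ring (endo_ring A MM)) \<le> 3"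
  by (rule realised_ring.gldim_realised[OF realised])

text \<open>The unit vectors generate already with scalar coefficients \<open>sca t\<close>.\<close>

lemma fg_MM: "fg_module A MM"
proof (rule right_module.fg_moduleI[OF right_module_MM, of "card Bs" "\<lambda>t. en (uv (bb t))"])
  have bB: "bb t \<in> Bs" if "t < card Bs" for t using bb that by (auto simp: bij_betw_def)
  show "en (uv (bb t)) \<in> carrier MM" if "t < card Bs" for t unfolding MM_simps(1) by (rule imageI[OF uv_Ms[OF bB[OF that]]])
  fix X assume "X \<in> carrier MM"
  then obtain x where x: "X = en x" "x \<in> Ms" by (auto simp: MM_simps)
  define c where "c = (\<lambda>t\<in>{..<card Bs}. cl (sca (x (bb t))))"
  have r: "rsum MM k (\<lambda>t. en (uv (bb t)) \<triangleleft>\<^bsub>MM\<^esub> c t) = en (\<lambda>\<gamma>. \<Sum>t<k. x (bb t) * uv (bb t) \<gamma>)" if "k \<le> card Bs" for k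
    using that
  proof (induction k)
    case 0
    then show ?case by (simp add: MM_simps(2)) (rule arg_cong[of _ _ en], simp add: fun_eq_iff)
  next
    case (Suc k)
    have u: "(uv (bb k) :: ('v,'e) node \<Rightarrow> 'k) \<in> Ms" by (intro uv_Ms bB) (use Suc.prems in simp)
    have m1: "(\<lambda>\<gamma>. \<Sum>t<k. x (bb t) * uv (bb t) \<gamma>) \<in> Ms" by (intro Ms_sum uv_Ms bB) (use Suc.prems in simp)
    have m2: "(\<lambda>\<gamma>. x (bb k) * uv (bb k) \<gamma>) \<in> Ms" using u by (simp add: Ms_def)
    have "en (uv (bb k)) \<triangleleft>\<^bsub>MM\<^esub> c k = en (\<lambda>\<gamma>. x (bb k) * uv (bb k) \<gamma>)"
      using Suc.prems unfolding MM_simps(4)[OF u] by (simp add: c_def cl(2)[OF sca_CF] actc_sca[OF u])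
    moreover have "(\<lambda>\<gamma>. \<Sum>t<k. x (bb t) * uv (bb t) \<gamma>) + (\<lambda>\<gamma>. x (bb k) * uv (bb k) \<gamma>) = (\<lambda>\<gamma>. \<Sum>t<Suc k. x (bb t) * uv (bb t) \<gamma>)"
      by (rule ext) simp
    ultimately show ?case using Suc MM_simps(3)[OF m1 m2] by simp
  qed
  have "(\<lambda>\<gamma>. \<Sum>t<card Bs. x (bb t) * uv (bb t) \<gamma>) = x"
  proof
    fix \<gamma>
    have "(\<Sum>t<card Bs. x (bb t) * uv (bb t) \<gamma>) = (\<Sum>\<beta>\<in>Bs. x \<beta> * uv \<beta> \<gamma>)" by (rule sum.reindex_bij_betw[OF bb])
    then show "(\<Sum>t<card Bs. x (bb t) * uv (bb t) \<gamma>) = x \<gamma>" using fun_cong[OF Ms_expand[OF x(2)], of \<gamma>] by simp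
  qed
  then have "X = comb MM (card Bs) (\<lambda>t. en (uv (bb t))) c" unfolding comb_def r[OF order.refl] x(1) by simp
  moreover have "c \<in> Rn A (card Bs)" using cl(1)[OF sca_CF] by (auto simp: c_def Rn_def)
  ultimately show "\<exists>c\<in>Rn A (card Bs). X = comb MM (card Bs) (\<lambda>t. en (uv (bb t))) c" by blast
qed

definition MC :: "(('v,'e) node \<Rightarrow> bool) \<Rightarrow> (('v,'e) node \<Rightarrow> 'k) set" where
  "MC C = {x\<in>Ms. \<forall>\<beta>. x \<beta> \<noteq> 0 \<longrightarrow> C \<beta>}"

text \<open>The action pulls functions back along \<open>lst\<close>, so a set of nodes supports a
  submodule when it is closed under predecessors.\<close>

lemma rsubmodule_MC:
  assumes C: "\<And>\<beta> a \<gamma>. \<beta> \<in> Bs \<Longrightarrow> lst a \<beta> = Some \<gamma> \<Longrightarrow> C \<gamma> \<Longrightarrow> C \<beta>"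
  shows "rsubmodule A MM (en ` MC C)"
proof -
  interpret M: right_module A MM by (rule right_module_MM)
  have sub: "MC C \<subseteq> Ms" by (auto simp: MC_def)
  have add: "x + y \<in> MC C" if "x \<in> MC C" "y \<in> MC C" for x y
    using that Ms_add[of x y] unfolding MC_def by (auto simp: plus_fun_def) (metis add.right_neutral)
  have neg: "(\<lambda>\<gamma>. - x \<gamma>) \<in> MC C" if "x \<in> MC C" for x using that by (simp add: MC_def Ms_def)
  have pu: "pull a x \<in> MC C" if x: "x \<in> MC C" for a x
    using x C pull_Ms[of a x] unfolding MC_def by (auto simp: pull_def split: option.splits if_splits)
  have "fold pull p x \<in> MC C" if "x \<in> MC C" for p x using that by (induction p arbitrary: x) (auto simp: pu)
  moreover have "ea v x \<in> MC C" if "x \<in> MC C" for v x using that by (simp add: MC_def Ms_def ea_def)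
  ultimately have pa: "pact y x \<in> MC C" if "x \<in> MC C" for y x using that by (simp add: pact_def)
  have act: "actc c x \<in> MC C" if x: "x \<in> MC C" for c x
  proof -
    have "C \<beta>" if nz: "actc c x \<beta> \<noteq> 0" for \<beta>
    proof -
      obtain y where "c y * pact y x \<beta> \<noteq> 0" using nz unfolding actc_def by (rule sum.not_neutral_contains_not_neutral)
      then show ?thesis using pa[OF x, of y] by (auto simp: MC_def)
    qed
    then show ?thesis using actc_Ms[of x c] x by (simp add: MC_def)
  qed
  show ?thesis unfolding rsubmodule_def
  proof (intro conjI ballI)
    show "subgroup (en ` MC C) (add_monoid MM)"
    proof (rule group.subgroupI[OF M.M.a_group])
      show "en ` MC C \<subseteq> carrier (add_monoid MM)" using sub by (auto simp: MM_simps)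
      show "en ` MC C \<noteq> {}" using Ms_0 by (auto simp: MC_def)
      fix X assume "X \<in> en ` MC C"
      then obtain x where x: "X = en x" "x \<in> MC C" by auto
      have xM: "x \<in> Ms" using x sub by auto
      have "en (\<lambda>\<gamma>. - x \<gamma>) \<oplus>\<^bsub>MM\<^esub> en x = \<zero>\<^bsub>MM\<^esub>"
        unfolding MM_simps(3)[OF Ms_neg[OF xM] xM] MM_simps(2) by (rule arg_cong[of _ _ en]) (simp add: fun_eq_iff)
      then have "\<ominus>\<^bsub>MM\<^esub> X = en (\<lambda>\<gamma>. - x \<gamma>)"
        unfolding x(1) using xM Ms_neg[OF xM] by (intro M.M.minus_equality) (auto simp: MM_simps(1))
      then show "inv\<^bsub>add_monoid MM\<^esub> X \<in> en ` MC C" using neg[OF x(2)] by (simp add: a_inv_def)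
      fix Y assume "Y \<in> en ` MC C"
      then obtain y where y: "Y = en y" "y \<in> MC C" by auto
      then show "X \<otimes>\<^bsub>add_monoid MM\<^esub> Y \<in> en ` MC C"
        using x add[OF x(2) y(2)] sub by (auto simp: MM_simps(3) subset_iff simp del: plus_fun_apply)
    qed
    show "X \<triangleleft>\<^bsub>MM\<^esub> r \<in> en ` MC C" if "X \<in> en ` MC C" for X r
      using that act sub by (auto simp: MM_simps(4) subset_iff)
  qed
qed

text \<open>If \<open>C\<close> is closed in both directions, so is its negation, and the functions
  supported off \<open>C\<close> form the complement.\<close>

lemma direct_summand_MC:
  assumes C: "\<And>\<beta> a \<gamma>. \<beta> \<in> Bs \<Longrightarrow> lst a \<beta> = Some \<gamma> \<Longrightarrow> C \<gamma> \<longleftrightarrow> C \<beta>"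
  shows "direct_summand A MM (en ` MC C)"
  unfolding direct_summand_def
proof (intro conjI exI[of _ "en ` MC (\<lambda>\<beta>. \<not> C \<beta>)"])
  show "rsubmodule A MM (en ` MC C)" using C by (intro rsubmodule_MC) blast
  show "rsubmodule A MM (en ` MC (\<lambda>\<beta>. \<not> C \<beta>))" using C by (intro rsubmodule_MC) blast
  have i: "MC C \<inter> MC (\<lambda>\<beta>. \<not> C \<beta>) = {0}" by (auto simp: MC_def Ms_0 fun_eq_iff)
  have sub: "MC D \<subseteq> Ms" for D by (auto simp: MC_def)
  show "en ` MC C \<inter> en ` MC (\<lambda>\<beta>. \<not> C \<beta>) = {\<zero>\<^bsub>MM\<^esub>}"
    unfolding inj_on_image_Int[OF en_inj sub sub, symmetric] i MM_simps(2) by simp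
  show "en ` MC C <+>\<^bsub>MM\<^esub> en ` MC (\<lambda>\<beta>. \<not> C \<beta>) = carrier MM"
  proof (intro equalityI subsetI)
    fix X assume "X \<in> en ` MC C <+>\<^bsub>MM\<^esub> en ` MC (\<lambda>\<beta>. \<not> C \<beta>)"
    then obtain x y where xy: "x \<in> MC C" "y \<in> MC (\<lambda>\<beta>. \<not> C \<beta>)" "X = en x \<oplus>\<^bsub>MM\<^esub> en y" by (auto simp: set_add_def')
    have "x \<in> Ms" "y \<in> Ms" using xy sub by blast+
    then show "X \<in> carrier MM" using xy(3) by (simp only: MM_simps(1,3) Ms_add image_eqI)
  next
    fix X assume "X \<in> carrier MM"
    then obtain x where x: "X = en x" "x \<in> Ms" by (auto simp: MM_simps)
    define y z where "y = (\<lambda>\<beta>. if C \<beta> then x \<beta> else 0)" and "z = (\<lambda>\<beta>. if C \<beta> then 0 else x \<beta>)"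
    have yz: "y \<in> MC C" "z \<in> MC (\<lambda>\<beta>. \<not> C \<beta>)" using x(2) by (auto simp: y_def z_def MC_def Ms_def)
    have "y + z = x" by (auto simp: y_def z_def fun_eq_iff)
    then have "en y \<oplus>\<^bsub>MM\<^esub> en z = X" using MM_simps(3)[of y z] yz sub x(1) by (metis subsetD)
    then show "X \<in> en ` MC C <+>\<^bsub>MM\<^esub> en ` MC (\<lambda>\<beta>. \<not> C \<beta>)" using yz by (auto simp: set_add_def')
  qed
qed

end

fun isBP :: "('v,'e) node \<Rightarrow> bool" where "isBP (BP v w) = True" | "isBP \<beta> = False"
fun isBI :: "('v,'e) node \<Rightarrow> bool" where "isBI (BI v w) = True" | "isBI \<beta> = False"

section \<open>The summands A and D(A) of the module\<close>

context malg
begin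

lemma lst_isBP: "lst a \<beta> = Some \<gamma> \<Longrightarrow> isBP \<gamma> = isBP \<beta>"
  and lst_isBI: "lst a \<beta> = Some \<gamma> \<Longrightarrow> isBI \<gamma> = isBI \<beta>"
  by (cases \<beta>; auto split: if_splits)+

lemma lsts_isBI: "lsts w \<beta> = Some \<gamma> \<Longrightarrow> isBI \<gamma> = isBI \<beta>"
  by (induction w arbitrary: \<gamma> rule: rev_induct) (auto simp: lsts_snoc bind_eq_Some_conv lst_isBI)

lemma NP_eok: "(u, p) \<in> NP \<longleftrightarrow> eok u (rev p)"
  by (auto simp: NP_def eok_def last_rev)

text \<open>The sum of all socle nodes, which plays the part of the unit of A: a nonzero path
  \<open>(v, q)\<close> moves it to the node \<open>BI v (rev q)\<close>, so the \<open>BI\<close>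
  part is free on this element.\<close>

definition sock :: "('v,'e) node \<Rightarrow> 'k" where
  "sock \<gamma> = (if \<exists>u\<in>Vs. \<gamma> = BI u [] then 1 else 0)"

lemma sock_Ms: "sock \<in> Ms" by (auto simp: sock_def Ms_def eok_def Nil_W)

lemma pact_sock: assumes y: "(v, q) \<in> NP" shows "pact (v, q) sock \<gamma> = (if \<gamma> = BI v (rev q) then 1 else 0)"
proof (cases "\<gamma> \<in> Bs")
  case True
  have v: "v \<in> Vs" using y by (simp add: NP_def)
  show ?thesis
  proof (cases \<gamma>)
    case (BI u w)
    show ?thesis unfolding pact_def snd_conv fst_conv fold_pull_lsts[OF True] unfolding BI lsts_BI
      using v by (auto simp: ea_def sock_def)
  next
    case (BP u w)
    then have "\<not> isBI \<beta>" if "lsts (rev q) \<gamma> = Some \<beta>" for \<beta> using lsts_isBI[OF that] by simp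
    then have "ea v sock \<beta> = 0" if "lsts (rev q) \<gamma> = Some \<beta>" for \<beta> using that by (auto simp: ea_def sock_def)
    then show ?thesis unfolding pact_def snd_conv fst_conv fold_pull_lsts[OF True] using BP by (auto split: option.splits)
  next
    case (BU u w i)
    then have "\<not> isBI \<beta>" if "lsts (rev q) \<gamma> = Some \<beta>" for \<beta> using lsts_isBI[OF that] by simp
    then have "ea v sock \<beta> = 0" if "lsts (rev q) \<gamma> = Some \<beta>" for \<beta> using that by (auto simp: ea_def sock_def)
    then show ?thesis unfolding pact_def snd_conv fst_conv fold_pull_lsts[OF True] using BU by (auto split: option.splits)
  qed
next
  case False
  have "pact (v, q) sock \<in> Ms" by (rule pact_Ms[OF sock_Ms])
  then have "pact (v, q) sock \<gamma> = 0" using False by (auto simp: Ms_def)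
  moreover have "BI v (rev q) \<in> Bs" using y by (simp add: NP_eok)
  ultimately show ?thesis using False by auto
qed

lemma actc_sock: "actc c sock \<gamma> = (\<Sum>y\<in>NP. if \<gamma> = BI (fst y) (rev (snd y)) then c y else 0)"
  unfolding actc_def by (rule sum.cong[OF refl]) (auto simp: pact_sock split: prod.splits)

lemma actc_sock_BI: "(u, p) \<in> NP \<Longrightarrow> actc c sock (BI u (rev p)) = c (u, p)"
proof -
  assume y: "(u, p) \<in> NP"
  have "actc c sock (BI u (rev p)) = (\<Sum>y\<in>NP. if y = (u, p) then c (u, p) else 0)"
    unfolding actc_sock by (rule sum.cong) auto
  then show ?thesis using y fin_NP by simp
qed

lemma actc_sock_MC: "actc c sock \<in> MC isBI"
proof -
  have "isBI \<gamma>" if nz: "actc c sock \<gamma> \<noteq> 0" for \<gamma>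
  proof -
    obtain y where "(if \<gamma> = BI (fst y) (rev (snd y)) then c y else 0) \<noteq> 0"
      using nz unfolding actc_sock by (rule sum.not_neutral_contains_not_neutral)
    then show ?thesis by (cases \<gamma>) (auto split: if_splits)
  qed
  then show ?thesis by (simp add: MC_def actc_Ms[OF sock_Ms])
qed

definition gI :: "'a \<Rightarrow> ('v,'e) node \<Rightarrow> 'k" where "gI X = actc (cof X) sock"

lemma gI_inj: assumes "X \<in> carrier A" "Y \<in> carrier A" "gI X = gI Y" shows "X = Y"
proof (rule cof_inj[OF assms(1,2)], rule ext)
  fix y :: "'v \<times> 'e list"
  obtain u p where y: "y = (u, p)" by (cases y)
  show "cof X y = cof Y y"
  proof (cases "y \<in> NP")
    case True
    then show ?thesis using actc_sock_BI[of u p "cof X"] actc_sock_BI[of u p "cof Y"] assms(3) y by (simp add: gI_def)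
  next
    case False
    then have "cof X y = 0" "cof Y y = 0" using cof_CF[OF assms(1)] cof_CF[OF assms(2)] y by (auto simp: CF_def)
    then show ?thesis by simp
  qed
qed

lemma gI_surj: assumes x: "x \<in> MC isBI" shows "\<exists>X\<in>carrier A. gI X = x"
proof -
  define c where "c = (\<lambda>(u, p). x (BI u (rev p)))"
  have xM: "x \<beta> \<noteq> 0 \<Longrightarrow> \<beta> \<in> Bs \<and> isBI \<beta>" for \<beta> using x by (auto simp: MC_def Ms_def)
  have "x (BI u w) \<noteq> 0 \<Longrightarrow> eok u w" for u w using xM[of "BI u w"] by simp
  then have c: "c \<in> CF" by (auto simp: CF_def c_def NP_eok)
  have "actc c sock = x"
  proof
    fix \<gamma>
    show "actc c sock \<gamma> = x \<gamma>"
    proof (cases "\<gamma> \<in> Bs \<and> isBI \<gamma>")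
      case True
      then obtain u w where g: "\<gamma> = BI u (rev (rev w))" "eok u (rev (rev w))" by (cases \<gamma>) auto
      then show ?thesis using actc_sock_BI[of u "rev w" c] by (simp add: c_def NP_eok)
    next
      case False
      then have "actc c sock \<gamma> = 0" using actc_sock_MC[of c] by (auto simp: MC_def Ms_def)
      then show ?thesis using xM[of \<gamma>] False by auto
    qed
  qed
  then show ?thesis using cl[OF c] by (auto simp: gI_def intro!: bexI[of _ "cl c"])
qed

text \<open>The pairing of \<open>x\<close> with \<open>X\<close> sums the coefficients of \<open>x \<triangleleft> X\<close> at the trivial paths.\<close>

definition pair :: "(('v,'e) node \<Rightarrow> 'k) \<Rightarrow> 'a \<Rightarrow> 'k" where
  "pair x = (\<lambda>X\<in>carrier A. \<Sum>v\<in>Vs. actc (cof X) x (BP v []))"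

lemma BP_NP: "(u, p) \<in> NP \<Longrightarrow> ok (pe u p) (rev p) \<and> vt (BP (pe u p) (rev p)) = u"
proof -
  assume y: "(u, p) \<in> NP"
  have "set (rev p) \<subseteq> As" using y W_set[of "rev p"] by (simp add: NP_def)
  then have "p \<noteq> [] \<Longrightarrow> src (last p) \<in> Vs" using src_in last_in_set by auto
  then show ?thesis using y by (auto simp: NP_def ok_def pe_def hd_rev last_rev)
qed

lemma NP_BP: "ok v w \<Longrightarrow> (vt (BP v w), rev w) \<in> NP \<and> pe (vt (BP v w)) (rev w) = v"
  using vt_Vs[of "BP v w"] by (auto simp: NP_def ok_def pe_def hd_rev last_rev)

text \<open>Evaluated at the tops of the projectives, a path contributes only at its own end vertex,
  and there it reads the coordinate at the node of the whole path.\<close>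

lemma pair_eq:
  assumes X: "X \<in> carrier A" and x: "x \<in> Ms"
  shows "pair x X = (\<Sum>y\<in>NP. cof X y * x (BP (pe (fst y) (snd y)) (rev (snd y))))"
proof -
  have p: "(\<Sum>v\<in>Vs. pact y x (BP v [])) = x (BP (pe (fst y) (snd y)) (rev (snd y)))" if y: "y \<in> NP" for y
  proof -
    obtain u p where up: "y = (u, p)" by (cases y)
    have b: "ok (pe u p) (rev p)" "vt (BP (pe u p) (rev p)) = u" using BP_NP y up by auto
    have q: "pe u p \<in> Vs" using b(1) by (simp add: ok_def)
    have "pact y x (BP v []) = (if v = pe u p then x (BP (pe u p) (rev p)) else 0)" if v: "v \<in> Vs" for v
    proof -
      have o: "ok v []" using v by (simp add: ok_def Nil_W)
      then have B: "BP v [] \<in> Bs" by simp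
      have e: "pact y x (BP v []) = (if ok v (rev p) then ea u x (BP v (rev p)) else 0)"
        unfolding up pact_def snd_conv fst_conv fold_pull_lsts[OF B] by (simp add: lsts_BP[OF o])
      show ?thesis
      proof (cases "ok v (rev p) \<and> vt (BP v (rev p)) = u")
        case True
        then have "pe u p = v" using NP_BP[of v "rev p"] by simp
        then show ?thesis using e True b by (simp add: ea_def del: vt.simps)
      next
        case False
        then have "v \<noteq> pe u p" using b by auto
        then show ?thesis using e False by (auto simp: ea_def simp del: vt.simps)
      qed
    qed
    then have "(\<Sum>v\<in>Vs. pact y x (BP v [])) = (\<Sum>v\<in>Vs. if v = pe u p then x (BP (pe u p) (rev p)) else 0)"
      by (intro sum.cong) auto
    then show ?thesis using q fin_Vs up by simp
  qed
  have "pair x X = (\<Sum>v\<in>Vs. \<Sum>y\<in>NP. cof X y * pact y x (BP v []))" using X by (simp add: pair_def actc_def)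
  also have "\<dots> = (\<Sum>y\<in>NP. \<Sum>v\<in>Vs. cof X y * pact y x (BP v []))" by (rule sum.swap)
  also have "\<dots> = (\<Sum>y\<in>NP. cof X y * x (BP (pe (fst y) (snd y)) (rev (snd y))))"
    by (rule sum.cong) (simp_all add: sum_distrib_left[symmetric] p)
  finally show ?thesis .
qed

lemma CF_add: "c \<in> CF \<Longrightarrow> d \<in> CF \<Longrightarrow> c + d \<in> CF"
  unfolding CF_def by (auto simp: plus_fun_def) (metis add.right_neutral)

lemma cl_add: assumes "c \<in> CF" "d \<in> CF" shows "cl (c + d) = cl c \<oplus>\<^bsub>A\<^esub> cl d"
proof (rule cof_inj)
  show "cof (cl (c + d)) = cof (cl c \<oplus>\<^bsub>A\<^esub> cl d)" using assms CF_add[OF assms] by (simp only: cl cof_add)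
qed (use assms CF_add[OF assms] cl in auto)

lemma cl_smult: assumes "c \<in> CF" shows "cl (\<lambda>x. t * c x) = t \<odot>\<^bsub>A\<^esub> cl c"
proof (rule cof_inj)
  have s: "(\<lambda>x. t * c x) \<in> CF" using assms by (simp add: CF_def)
  show "cof (cl (\<lambda>x. t * c x)) = cof (t \<odot>\<^bsub>A\<^esub> cl c)" using s assms by (simp only: cl cof_smult)
  show "cl (\<lambda>x. t * c x) \<in> carrier A" using s cl by blast
qed (use assms cl smult_closed in auto)

lemma dual_simps:
  "carrier (dual_module A) = {\<phi> \<in> extensional (carrier A).
       (\<forall>x \<in> carrier A. \<forall>y \<in> carrier A. \<phi> (x \<oplus>\<^bsub>A\<^esub> y) = \<phi> x + \<phi> y) \<and>
       (\<forall>c. \<forall>x \<in> carrier A. \<phi> (c \<odot>\<^bsub>A\<^esub> x) = c * \<phi> x)}"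
  "\<phi> \<oplus>\<^bsub>dual_module A\<^esub> \<psi> = (\<lambda>x\<in>carrier A. \<phi> x + \<psi> x)"
  "\<phi> \<triangleleft>\<^bsub>dual_module A\<^esub> r = (\<lambda>x\<in>carrier A. \<phi> (r \<otimes>\<^bsub>A\<^esub> x))"
  by (simp_all add: dual_module_def)

text \<open>Additivity and homogeneity suffice to expand over the finite basis of nonzero paths, one
  path at a time.\<close>

lemma dual_expand:
  assumes \<phi>: "\<phi> \<in> carrier (dual_module A)" and X: "X \<in> carrier A"
  shows "\<phi> X = (\<Sum>y\<in>NP. cof X y * \<phi> (cl (dl y)))"
proof -
  have ad: "\<phi> (x \<oplus>\<^bsub>A\<^esub> y) = \<phi> x + \<phi> y" if "x \<in> carrier A" "y \<in> carrier A" for x y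
    using \<phi> that by (simp add: dual_simps)
  have sm: "\<phi> (c \<odot>\<^bsub>A\<^esub> x) = c * \<phi> x" if "x \<in> carrier A" for c x
    using \<phi> that by (simp add: dual_simps)
  define c where "c = cof X"
  have c: "c \<in> CF" using cof_CF[OF X] by (simp add: c_def)
  have "finite S \<Longrightarrow> S \<subseteq> NP \<Longrightarrow> \<phi> (cl (\<lambda>z. if z \<in> S then c z else 0)) = (\<Sum>y\<in>S. c y * \<phi> (cl (dl y)))" for S
  proof (induction S rule: finite_induct)
    case empty
    have z: "(\<lambda>z. 0) \<in> CF" by (simp add: CF_def)
    have "\<phi> (cl (\<lambda>z. 0 * 0)) = 0 * \<phi> (cl (\<lambda>z. 0))" unfolding cl_smult[OF z] by (rule sm[OF cl(1)[OF z]])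
    then show ?case by simp
  next
    case (insert y S)
    have y: "y \<in> NP" using insert by simp
    have s: "(\<lambda>z. if z \<in> S then c z else 0) \<in> CF" using c by (simp add: CF_def)
    have t: "(\<lambda>z. c y * dl y z) \<in> CF" using dl_CF[OF y] by (simp add: CF_def)
    have e: "(\<lambda>z. if z \<in> insert y S then c z else 0) = (\<lambda>z. c y * dl y z) + (\<lambda>z. if z \<in> S then c z else 0)"
      using insert(2) by (auto simp: fun_eq_iff dl_def)
    show ?case unfolding e cl_add[OF t s] ad[OF cl(1)[OF t] cl(1)[OF s]]
      unfolding cl_smult[OF dl_CF[OF y]] sm[OF cl(1)[OF dl_CF[OF y]]]
      using insert by simp
  qed
  from this[OF fin_NP order.refl]
  have "\<phi> (cl (\<lambda>z. if z \<in> NP then c z else 0)) = (\<Sum>y\<in>NP. c y * \<phi> (cl (dl y)))" .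
  moreover have "(\<lambda>z. if z \<in> NP then c z else 0) = c" using c by (auto simp: CF_def fun_eq_iff)
  ultimately show ?thesis using cl_cof[OF X] by (simp add: c_def)
qed

lemma pair_dual: assumes x: "x \<in> Ms" shows "pair x \<in> carrier (dual_module A)"
  unfolding dual_simps
proof (intro CollectI conjI ballI allI)
  show "pair x \<in> extensional (carrier A)" by (simp add: pair_def)
  fix X c assume X: "X \<in> carrier A"
  show "pair x (c \<odot>\<^bsub>A\<^esub> X) = c * pair x X"
    unfolding pair_eq[OF X x] pair_eq[OF smult_closed[OF X] x] cof_smult[OF X] sum_distrib_left by (simp add: mult.assoc)
  fix Y assume Y: "Y \<in> carrier A"
  show "pair x (X \<oplus>\<^bsub>A\<^esub> Y) = pair x X + pair x Y"
    unfolding pair_eq[OF X x] pair_eq[OF Y x] pair_eq[OF A.a_closed[OF X Y] x] cof_add[OF X Y]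
    by (simp add: algebra_simps sum.distrib)
qed

lemma pair_add: "pair (x + y) = pair x \<oplus>\<^bsub>dual_module A\<^esub> pair y"
  unfolding dual_simps by (rule ext) (auto simp: pair_def actc_add_right sum.distrib)

lemma pair_act: "x \<in> Ms \<Longrightarrow> r \<in> carrier A \<Longrightarrow> pair (actc (cof r) x) = pair x \<triangleleft>\<^bsub>dual_module A\<^esub> r"
  unfolding dual_simps by (rule ext) (auto simp: pair_def actc_actc cof_mult)

text \<open>Pairing with the element of a single path isolates the coordinate at one
  \<open>BP\<close> node, and every \<open>BP\<close> node arises from a path by
  \<open>NP_BP\<close>.\<close>

lemma pair_inj:
  assumes x: "x \<in> MC isBP" and y: "y \<in> MC isBP" and e: "pair x = pair y"
  shows "x = y"
proof
  fix \<gamma>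
  have xM: "x \<in> Ms" and yM: "y \<in> Ms" using x y by (auto simp: MC_def)
  show "x \<gamma> = y \<gamma>"
  proof (cases "\<gamma> \<in> Bs \<and> isBP \<gamma>")
    case True
    then obtain v w where g: "\<gamma> = BP v w" "ok v w" by (cases \<gamma>) auto
    define z where "z = (vt \<gamma>, rev w)"
    have z: "z \<in> NP" "pe (fst z) (snd z) = v" using NP_BP[OF g(2)] g(1) by (simp_all add: z_def del: vt.simps)
    have "pair t (cl (dl z)) = t \<gamma>" if t: "t \<in> Ms" for t
    proof -
      have "pair t (cl (dl z)) = (\<Sum>y\<in>NP. if y = z then t \<gamma> else 0)"
        unfolding pair_eq[OF cl(1)[OF dl_CF[OF z(1)]] t] cl(2)[OF dl_CF[OF z(1)]] using z(2) g(1)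
        by (intro sum.cong) (auto simp: dl_def z_def)
      then show ?thesis using z(1) fin_NP by simp
    qed
    then show ?thesis using xM yM e by metis
  next
    case False
    then have "x \<gamma> = 0" "y \<gamma> = 0" using x y by (auto simp: MC_def Ms_def)
    then show ?thesis by simp
  qed
qed

lemma pair_surj: assumes \<phi>: "\<phi> \<in> carrier (dual_module A)" shows "\<exists>x\<in>MC isBP. pair x = \<phi>"
proof -
  define x where "x = (\<lambda>\<beta>. case \<beta> of BP v w \<Rightarrow> if ok v w then \<phi> (cl (dl (vt (BP v w), rev w))) else 0 | _ \<Rightarrow> 0)"
  have x: "x \<in> MC isBP" "x \<in> Ms" by (auto simp: MC_def Ms_def x_def split: node.splits if_splits)
  have "pair x = \<phi>"
  proof (rule extensionalityI[of _ "carrier A"])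
    show "pair x \<in> extensional (carrier A)" by (simp add: pair_def)
    show "\<phi> \<in> extensional (carrier A)" using \<phi> by (simp add: dual_simps)
    fix X assume X: "X \<in> carrier A"
    have "x (BP (pe (fst y) (snd y)) (rev (snd y))) = \<phi> (cl (dl y))" if "y \<in> NP" for y
      using BP_NP[of "fst y" "snd y"] that by (simp add: x_def del: vt.simps)
    then show "pair x X = \<phi> X" unfolding pair_eq[OF X x(2)] dual_expand[OF \<phi> X] by (intro sum.cong) auto
  qed
  then show ?thesis using x by blast
qed

definition gP :: "('a \<Rightarrow> 'k) \<Rightarrow> ('v,'e) node \<Rightarrow> 'k" where "gP = inv_into (MC isBP) pair"

lemma gP: "\<phi> \<in> carrier (dual_module A) \<Longrightarrow> gP \<phi> \<in> MC isBP" "\<phi> \<in> carrier (dual_module A) \<Longrightarrow> pair (gP \<phi>) = \<phi>"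
proof -
  assume "\<phi> \<in> carrier (dual_module A)"
  then have "\<phi> \<in> pair ` MC isBP" using pair_surj by blast
  then show "gP \<phi> \<in> MC isBP" "pair (gP \<phi>) = \<phi>" unfolding gP_def by (rule inv_into_into, rule f_inv_into_f)
qed

lemma MC_closed:
  assumes "\<And>\<beta> a \<gamma>. \<beta> \<in> Bs \<Longrightarrow> lst a \<beta> = Some \<gamma> \<Longrightarrow> C \<gamma> \<Longrightarrow> C \<beta>" "x \<in> MC C" "y \<in> MC C" "r \<in> carrier A"
  shows "x + y \<in> MC C" "actc (cof r) x \<in> MC C"
proof -
  have s: "rsubmodule A MM (en ` MC C)" using assms(1) by (rule rsubmodule_MC)
  have xy: "x \<in> Ms" "y \<in> Ms" using assms(2,3) by (auto simp: MC_def)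
  have m: "z \<in> MC C" if "en z \<in> en ` MC C" "z \<in> Ms" for z
    using that inj_on_image_mem_iff[OF en_inj, of z "MC C"] by (auto simp: MC_def)
  have "en x \<oplus>\<^bsub>MM\<^esub> en y \<in> en ` MC C"
    using s assms(2,3) subgroup.m_closed[of "en ` MC C" "add_monoid MM" "en x" "en y"] by (auto simp: rsubmodule_def)
  then show "x + y \<in> MC C" unfolding MM_simps(3)[OF xy] by (rule m) (rule Ms_add[OF xy])
  have "en x \<triangleleft>\<^bsub>MM\<^esub> r \<in> en ` MC C" using s assms(2,4) by (auto simp: rsubmodule_def)
  then show "actc (cof r) x \<in> MC C" unfolding MM_simps(4)[OF xy(1)] by (rule m) (rule actc_Ms[OF xy(1)])
qed

lemma gP_hom:
  assumes "\<phi> \<in> carrier (dual_module A)" "\<psi> \<in> carrier (dual_module A)" "r \<in> carrier A"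
  shows "gP (\<phi> \<oplus>\<^bsub>dual_module A\<^esub> \<psi>) = gP \<phi> + gP \<psi>" "gP (\<phi> \<triangleleft>\<^bsub>dual_module A\<^esub> r) = actc (cof r) (gP \<phi>)"
proof -
  have C: "gP \<phi> + gP \<psi> \<in> MC isBP" "actc (cof r) (gP \<phi>) \<in> MC isBP"
    using MC_closed[OF _ gP(1)[OF assms(1)] gP(1)[OF assms(2)] assms(3)] lst_isBP by blast+
  have M: "gP \<phi> \<in> Ms" using gP(1)[OF assms(1)] by (simp add: MC_def)
  have a: "pair (gP \<phi> + gP \<psi>) = \<phi> \<oplus>\<^bsub>dual_module A\<^esub> \<psi>" by (simp only: pair_add gP assms)
  have b: "pair (actc (cof r) (gP \<phi>)) = \<phi> \<triangleleft>\<^bsub>dual_module A\<^esub> r" by (simp only: pair_act[OF M assms(3)] gP assms)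
  have i: "inj_on pair (MC isBP)" using pair_inj by (auto intro: inj_onI)
  show "gP (\<phi> \<oplus>\<^bsub>dual_module A\<^esub> \<psi>) = gP \<phi> + gP \<psi>" unfolding a[symmetric] gP_def[of] by (subst inv_into_f_f[OF i C(1)[unfolded gP_def]]) (rule refl)
  show "gP (\<phi> \<triangleleft>\<^bsub>dual_module A\<^esub> r) = actc (cof r) (gP \<phi>)" unfolding b[symmetric] gP_def[of] by (subst inv_into_f_f[OF i C(2)[unfolded gP_def]]) (rule refl)
qed

lemma gI_hom: "X \<in> carrier A \<Longrightarrow> Y \<in> carrier A \<Longrightarrow> gI (X \<oplus>\<^bsub>A\<^esub> Y) = gI X + gI Y"
  "X \<in> carrier A \<Longrightarrow> Y \<in> carrier A \<Longrightarrow> gI (X \<otimes>\<^bsub>A\<^esub> Y) = actc (cof Y) (gI X)"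
  by (simp_all only: gI_def cof_add actc_add_left cof_mult actc_actc[OF sock_Ms])

lemma in_add_MM: "in_add A MM (direct_sum2 (regular_module A) (dual_module A))"
proof -
  \<comment> \<open>Two summands suffice: index 0 receives A through \<open>gI\<close>, and every
    other index, hence 1, receives D(A) through the inverse of \<open>pair\<close>.\<close>
  define U where "U i = (if i = 0 then en ` MC isBI else en ` MC isBP)" for i :: nat
  define N where "N i = MM\<lparr>carrier := U i\<rparr>" for i
  define f where "f = (\<lambda>(X, \<phi>). \<lambda>i\<in>{..<2::nat}. if i = 0 then en (gI X) else en (gP \<phi>))"
  let ?S = "direct_sum2 (regular_module A) (dual_module A)" and ?T = "direct_sum 2 N"
  have reg: "carrier (regular_module A) = carrier A" "add (regular_module A) = add A" "ract (regular_module A) = mult A"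
    by (simp_all add: regular_module_def ring.defs rmodule.defs)
  have S: "carrier ?S = carrier A \<times> carrier (dual_module A)"
    "(X, \<phi>) \<oplus>\<^bsub>?S\<^esub> (Y, \<psi>) = (X \<oplus>\<^bsub>A\<^esub> Y, \<phi> \<oplus>\<^bsub>dual_module A\<^esub> \<psi>)"
    "(X, \<phi>) \<triangleleft>\<^bsub>?S\<^esub> r = (X \<otimes>\<^bsub>A\<^esub> r, \<phi> \<triangleleft>\<^bsub>dual_module A\<^esub> r)" for X Y \<phi> \<psi> r
    by (simp_all add: direct_sum2_def reg)
  have T: "carrier ?T = (\<Pi>\<^sub>E i\<in>{..<2}. U i)" "x \<oplus>\<^bsub>?T\<^esub> y = (\<lambda>i\<in>{..<2}. x i \<oplus>\<^bsub>MM\<^esub> y i)"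
    "x \<triangleleft>\<^bsub>?T\<^esub> r = (\<lambda>i\<in>{..<2}. x i \<triangleleft>\<^bsub>MM\<^esub> r)" for x y r
    by (simp_all add: direct_sum_def N_def)
  have two: "i < 2 \<longleftrightarrow> i = 0 \<or> i = 1" for i :: nat by auto
  have M: "MC C \<subseteq> Ms" for C by (auto simp: MC_def)
  have I: "gI X \<in> MC isBI" for X unfolding gI_def by (rule actc_sock_MC)
  have IM: "gI X \<in> Ms" for X using I M by blast
  have PM: "gP \<phi> \<in> Ms" if "\<phi> \<in> carrier (dual_module A)" for \<phi> using gP(1)[OF that] M by blast
  have f0: "f (X, \<phi>) 0 = en (gI X)" "f (X, \<phi>) 1 = en (gP \<phi>)" for X \<phi> by (simp_all add: f_def)
  have hom: "f \<in> rmod_hom A ?S ?T"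
  proof (rule rmod_homI)
    fix x assume "x \<in> carrier ?S"
    then obtain X \<phi> where x: "x = (X, \<phi>)" "X \<in> carrier A" "\<phi> \<in> carrier (dual_module A)" by (auto simp: S)
    show "f x \<in> carrier ?T" unfolding T x f_def using I gP(1)[OF x(3)] by (auto simp: U_def)
    { fix r assume r: "r \<in> carrier A"
      show "f (x \<triangleleft>\<^bsub>?S\<^esub> r) = f x \<triangleleft>\<^bsub>?T\<^esub> r"
        unfolding x(1) T S f_def prod.case using x(2,3) r
        by (intro restrict_ext) (auto simp: gI_hom gP_hom[OF x(3) x(3)] MM_simps(4) IM PM) }
    fix y assume "y \<in> carrier ?S"
    then obtain Y \<psi> where y: "y = (Y, \<psi>)" "Y \<in> carrier A" "\<psi> \<in> carrier (dual_module A)" by (auto simp: S)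
    show "f (x \<oplus>\<^bsub>?S\<^esub> y) = f x \<oplus>\<^bsub>?T\<^esub> f y"
      unfolding x(1) y(1) T S f_def prod.case using x(2,3) y(2,3)
      by (intro restrict_ext) (auto simp: gI_hom gP_hom(1)[OF x(3) y(3) y(2)] MM_simps(3) IM PM simp del: plus_fun_apply)
  qed
  have inj: "inj_on f (carrier ?S)"
  proof (rule inj_onI)
    fix x y assume "x \<in> carrier ?S" "y \<in> carrier ?S" and e: "f x = f y"
    then obtain X \<phi> Y \<psi> where x: "x = (X, \<phi>)" "X \<in> carrier A" "\<phi> \<in> carrier (dual_module A)"
      and y: "y = (Y, \<psi>)" "Y \<in> carrier A" "\<psi> \<in> carrier (dual_module A)" by (auto simp: S)
    have "f (X, \<phi>) 0 = f (Y, \<psi>) 0" "f (X, \<phi>) 1 = f (Y, \<psi>) 1" using e unfolding x(1) y(1) by simp_all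
    then have h: "en (gI X) = en (gI Y)" "en (gP \<phi>) = en (gP \<psi>)" unfolding f0 .
    have "X = Y" by (rule gI_inj[OF x(2) y(2) inj_onD[OF en_inj h(1) IM IM]])
    moreover have "gP \<phi> = gP \<psi>" by (rule inj_onD[OF en_inj h(2) PM[OF x(3)] PM[OF y(3)]])
    then have "pair (gP \<phi>) = pair (gP \<psi>)" by (rule arg_cong[of _ _ pair])
    then have "\<phi> = \<psi>" unfolding gP(2)[OF x(3)] gP(2)[OF y(3)] .
    ultimately show "x = y" unfolding x(1) y(1) by simp
  qed
  have "z \<in> f ` carrier ?S" if z: "z \<in> carrier ?T" for z
  proof -
    have "z 0 \<in> U 0" "z 1 \<in> U 1" using z by (auto simp: T PiE_iff)
    then obtain x p where xp: "z 0 = en x" "x \<in> MC isBI" "z 1 = en p" "p \<in> MC isBP" by (auto simp: U_def)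
    obtain X where X: "X \<in> carrier A" "gI X = x" using gI_surj[OF xp(2)] by blast
    have d: "pair p \<in> carrier (dual_module A)" using xp(4) M by (intro pair_dual) blast
    have "gP (pair p) = p" using pair_inj[OF gP(1)[OF d] xp(4) gP(2)[OF d]] .
    then have "z i = f (X, pair p) i" for i
      using xp X(2) z two[of i] by (cases "i < 2") (auto simp: f_def T PiE_def extensional_def)
    then have "z = f (X, pair p)" by (rule ext)
    then show ?thesis using X(1) d by (auto simp: S)
  qed
  then have "bij_betw f (carrier ?S) (carrier ?T)"
    using inj rmod_homD(1)[OF hom] by (auto simp: bij_betw_def)
  then have iso: "rmod_isomorphic A ?S ?T" using hom unfolding rmod_isomorphic_def by blast
  have "direct_summand A MM (en ` MC isBI)" using lst_isBI by (intro direct_summand_MC) blast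
  moreover have "direct_summand A MM (en ` MC isBP)" using lst_isBP by (intro direct_summand_MC) blast
  ultimately have ds: "direct_summand A MM (U i)" for i by (simp add: U_def)
  have "N = (\<lambda>i. MM\<lparr>carrier := U i\<rparr>)" by (rule ext) (rule N_def)
  then show ?thesis unfolding in_add_def using iso ds by (intro exI[of _ 2] exI[of _ U] conjI allI impI) simp_all
qed

lemma repdim_le_3: "repdim A \<le> 3"
proof -
  have "generator_cogenerator A MM" using fg_MM in_add_MM by (simp add: generator_cogenerator_def)
  then have "repdim A \<le> gldim (opposite_ring (endo_ring A MM))"
    unfolding repdim_def by (intro Inf_lower) blast
  then show ?thesis using gldim_MM by (rule order_trans)
qed

end

section \<open>Path algebras\<close>

lemma ring_cong:
  assumes "ring R" and s: "carrier S = carrier R" "mult S = mult R" "one S = one R" "zero S = zero R" "add S = add R"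
  shows "ring S"
proof -
  interpret R: ring R by fact
  show ?thesis
  proof (rule ringI)
    show "abelian_group S"
    proof (rule abelian_groupI)
      fix x assume "x \<in> carrier S"
      then show "\<exists>y\<in>carrier S. y \<oplus>\<^bsub>S\<^esub> x = \<zero>\<^bsub>S\<^esub>" unfolding s using R.l_neg R.a_inv_closed by blast
    qed (auto simp: s R.a_ac)
    show "monoid S" by (rule monoidI) (auto simp: s R.m_assoc)
  qed (auto simp: s R.l_distr R.r_distr)
qed

lemma split_append: "{(p, q). p @ q = r} = (\<lambda>i. (take i r, drop i r)) ` {..length r}"
proof (intro equalityI subsetI)
  fix x assume "x \<in> {(p, q). p @ q = r}"
  then show "x \<in> (\<lambda>i. (take i r, drop i r)) ` {..length r}"
    by (intro image_eqI[where x = "length (fst x)"]) auto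
qed auto

section \<open>Nonzero paths as coordinates of the factor algebra\<close>

locale qalg = fin_digraph Q for Q :: "('v, 'e) pre_digraph" +
  fixes I :: "('v \<times> 'e list \<Rightarrow> 'k::field) set"
  assumes adm: "admissible_ideal Q I" and mono: "monomial_ideal Q I" and condS: "condition_S Q I"
begin

abbreviation PA :: "('k, 'v \<times> 'e list \<Rightarrow> 'k) module" where "PA \<equiv> path_algebra Q"
abbreviation QP where "QP \<equiv> quiver_paths Q"
abbreviation ep :: "'v \<times> 'e list \<Rightarrow> 'v \<times> 'e list \<Rightarrow> 'k" where "ep \<equiv> path_elem"

lemma ideal_I: "ideal I PA" using adm by (simp add: admissible_ideal_def)

interpretation P: ideal I PA by (rule ideal_I)

definition pl :: "'v \<Rightarrow> 'e list \<Rightarrow> 'v" where "pl u p = (if p = [] then u else head Q (last p))"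

lemma awlast_pl: "awlast u p = pl u p"
proof (induction p arbitrary: u)
  case (Cons a p)
  have "awalk_verts v p \<noteq> []" for v by (cases p) auto
  then show ?case using Cons[of "head Q a"] by (simp add: pl_def)
qed (simp add: pl_def)

lemma QP_Nil: "(u, []) \<in> QP \<longleftrightarrow> u \<in> verts Q" by (auto simp: quiver_paths_def awalk_Nil_iff)
lemma QP_Cons: "(u, a # p) \<in> QP \<longleftrightarrow> a \<in> arcs Q \<and> u = tail Q a \<and> (head Q a, p) \<in> QP"
  by (auto simp: quiver_paths_def awalk_Cons_iff)

lemma QP_set: "(u, p) \<in> QP \<Longrightarrow> u \<in> verts Q \<and> set p \<subseteq> arcs Q"
proof (induction p arbitrary: u)
  case (Cons a p)
  then show ?case unfolding QP_Cons by auto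
qed (simp add: QP_Nil)

lemma QP_append: "(u, p @ q) \<in> QP \<longleftrightarrow> (u, p) \<in> QP \<and> (pl u p, q) \<in> QP"
proof (induction p arbitrary: u)
  case Nil
  then show ?case using QP_set by (auto simp: QP_Nil pl_def)
next
  case (Cons a p)
  have "pl u (a # p) = pl (head Q a) p" by (simp add: pl_def)
  then show ?case unfolding append_Cons QP_Cons Cons by auto
qed

lemma PA_simps: "carrier PA = {f. {x. f x \<noteq> 0} \<subseteq> QP \<and> finite {x. f x \<noteq> 0}}" "\<zero>\<^bsub>PA\<^esub> = (\<lambda>x. 0)"
  "f \<oplus>\<^bsub>PA\<^esub> g = (\<lambda>x. f x + g x)" "c \<odot>\<^bsub>PA\<^esub> f = (\<lambda>x. c * f x)"
  "\<one>\<^bsub>PA\<^esub> = (\<lambda>(u, p). if u \<in> verts Q \<and> p = [] then 1 else 0)"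
  by (simp_all add: path_algebra_def)

lemma mult_PA: "(f \<otimes>\<^bsub>PA\<^esub> g) (u, r) = (\<Sum>i\<le>length r. f (u, take i r) * g (pl u (take i r), drop i r))"
proof -
  have i: "inj_on (\<lambda>i. (take i r, drop i r)) {..length r}"
    by (rule inj_onI) (metis Pair_inject atMost_iff length_take min.absorb2)
  have "(f \<otimes>\<^bsub>PA\<^esub> g) (u, r) = (\<Sum>(p, q) | p @ q = r. f (u, p) * g (pl u p, q))"
    by (simp add: path_algebra_def awlast_pl)
  also have "\<dots> = (\<Sum>i\<le>length r. f (u, take i r) * g (pl u (take i r), drop i r))"
    unfolding split_append by (simp add: sum.reindex[OF i])
  finally show ?thesis .
qed

lemma ep_mult: "ep (u, p) \<otimes>\<^bsub>PA\<^esub> ep (v, q) = (if pl u p = v then ep (u, p @ q) else (\<lambda>x. 0))"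
proof (rule ext)
  fix x :: "'v \<times> 'e list"
  obtain u' r where x: "x = (u', r)" by (cases x)
  let ?C = "u' = u \<and> r = p @ q \<and> pl u p = v"
  have "(ep (u, p) \<otimes>\<^bsub>PA\<^esub> ep (v, q)) x = (\<Sum>i\<le>length r. if i = length p \<and> ?C then 1 else 0)"
    unfolding x mult_PA
  proof (rule sum.cong[OF refl])
    fix i assume i: "i \<in> {..length r}"
    have "take i r = p \<and> drop i r = q \<longleftrightarrow> i = length p \<and> r = p @ q"
      using i append_take_drop_id[of i r] by auto
    then show "ep (u, p) (u', take i r) * ep (v, q) (pl u' (take i r), drop i r) = (if i = length p \<and> ?C then 1 else 0)"
      by (auto simp: path_elem_def)
  qed
  also have "\<dots> = (if ?C then 1 else 0)" by (cases ?C) auto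
  finally show "(ep (u, p) \<otimes>\<^bsub>PA\<^esub> ep (v, q)) x = (if pl u p = v then ep (u, p @ q) else (\<lambda>x. 0)) x"
    unfolding x by (auto simp: path_elem_def)
qed

lemma ep_carrier: "x \<in> QP \<Longrightarrow> ep x \<in> carrier PA" by (auto simp: PA_simps path_elem_def)

lemma scale_carrier: "f \<in> carrier PA \<Longrightarrow> (\<lambda>x. c * f x) \<in> carrier PA"
  unfolding PA_simps by (auto elim: rev_finite_subset)

text \<open>An ideal is closed under multiplication by ring elements only, so scaling is expressed
  as multiplication by a multiple of the unit.\<close>

lemma scale_I: assumes "f \<in> I" shows "(\<lambda>x. c * f x) \<in> I"
proof -
  have f: "f \<in> carrier PA" using assms by (rule P.a_Hcarr)
  have "(\<lambda>x. c * \<one>\<^bsub>PA\<^esub> x) \<otimes>\<^bsub>PA\<^esub> f = (\<lambda>x. c * f x)"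
  proof (rule ext)
    fix x :: "'v \<times> 'e list"
    obtain u r where x: "x = (u, r)" by (cases x)
    have z: "f (u, r) = 0" if "u \<notin> verts Q"
    proof (rule ccontr)
      assume "f (u, r) \<noteq> 0"
      then have "(u, r) \<in> QP" using f by (auto simp: PA_simps)
      then show False using QP_set that by blast
    qed
    have "((\<lambda>x. c * \<one>\<^bsub>PA\<^esub> x) \<otimes>\<^bsub>PA\<^esub> f) x = (\<Sum>i\<le>length r. if i = 0 then c * f (u, r) else 0)"
      unfolding x mult_PA by (rule sum.cong) (auto simp: PA_simps pl_def z)
    then show "((\<lambda>x. c * \<one>\<^bsub>PA\<^esub> x) \<otimes>\<^bsub>PA\<^esub> f) x = c * f x" unfolding x by simp
  qed
  moreover have "(\<lambda>x. c * \<one>\<^bsub>PA\<^esub> x) \<otimes>\<^bsub>PA\<^esub> f \<in> I"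
    by (rule P.I_l_closed[OF assms scale_carrier[OF P.one_closed]])
  ultimately show ?thesis by simp
qed

lemma neg_PA: assumes "f \<in> carrier PA" shows "\<ominus>\<^bsub>PA\<^esub> f = (\<lambda>x. - f x)"
proof (rule P.minus_equality)
  show "(\<lambda>x. - f x) \<oplus>\<^bsub>PA\<^esub> f = \<zero>\<^bsub>PA\<^esub>" by (simp add: PA_simps)
  show "(\<lambda>x. - f x) \<in> carrier PA" using assms by (simp add: PA_simps)
qed (rule assms)

lemma diff_PA: "f \<in> carrier PA \<Longrightarrow> g \<in> carrier PA \<Longrightarrow> f \<ominus>\<^bsub>PA\<^esub> g = (\<lambda>x. f x - g x)"
  unfolding a_minus_def neg_PA PA_simps(3) by simp

lemma mult_support:
  assumes "f \<in> carrier PA" "g \<in> carrier PA" "(f \<otimes>\<^bsub>PA\<^esub> g) x \<noteq> 0"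
  obtains u p q where "x = (u, p @ q)" "f (u, p) \<noteq> 0" "g (pl u p, q) \<noteq> 0" "(u, p @ q) \<in> QP"
proof -
  obtain u r where x: "x = (u, r)" by (cases x)
  obtain i where "f (u, take i r) * g (pl u (take i r), drop i r) \<noteq> 0"
    using assms(3) unfolding x mult_PA by (rule sum.not_neutral_contains_not_neutral)
  then have n: "f (u, take i r) \<noteq> 0" "g (pl u (take i r), drop i r) \<noteq> 0" by auto
  then have "(u, take i r) \<in> QP" "(pl u (take i r), drop i r) \<in> QP" using assms(1,2) by (auto simp: PA_simps)
  then have "(u, take i r @ drop i r) \<in> QP" unfolding QP_append by blast
  then show ?thesis using n x by (intro that[of u "take i r" "drop i r"]) simp_all
qed

text \<open>Every path in the support of a product is a concatenation of paths from the two
  supports. So a property of paths inherited by extensions on both sides cuts out an ideal; it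
  serves for the arrow ideal and for \<open>I\<close>.\<close>

lemma ideal_support:
  assumes r: "\<And>u p q. Pr (u, p) \<Longrightarrow> (u, p @ q) \<in> QP \<Longrightarrow> Pr (u, p @ q)"
    and l: "\<And>u p q. Pr (pl u p, q) \<Longrightarrow> (u, p @ q) \<in> QP \<Longrightarrow> Pr (u, p @ q)"
  shows "ideal {f \<in> carrier PA. \<forall>x. f x \<noteq> 0 \<longrightarrow> Pr x} PA" (is "ideal ?K PA")
proof (rule idealI)
  show "ring PA" by (rule P.ring_axioms)
  show "subgroup ?K (add_monoid PA)"
  proof (rule group.subgroupI[OF P.a_group])
    have "(\<lambda>x. 0) \<in> ?K" using P.zero_closed unfolding PA_simps(2) by simp
    then show "?K \<noteq> {}" by blast
    fix f assume f: "f \<in> ?K"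
    have "\<ominus>\<^bsub>PA\<^esub> f \<in> ?K" using f P.a_inv_closed[of f] neg_PA[of f] by auto
    then show "inv\<^bsub>add_monoid PA\<^esub> f \<in> ?K" by (simp add: a_inv_def)
    fix g assume g: "g \<in> ?K"
    have "f \<oplus>\<^bsub>PA\<^esub> g \<in> carrier PA" using f g by auto
    moreover have "Pr x" if "(f \<oplus>\<^bsub>PA\<^esub> g) x \<noteq> 0" for x
      using that f g unfolding PA_simps(3) by (cases x; cases "f x = 0") auto
    ultimately show "f \<otimes>\<^bsub>add_monoid PA\<^esub> g \<in> ?K" by auto
  qed auto
  fix f g assume f: "f \<in> ?K" and g: "g \<in> carrier PA"
  have fc: "f \<in> carrier PA" using f by simp
  have "Pr x" if nz: "(g \<otimes>\<^bsub>PA\<^esub> f) x \<noteq> 0" for x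
  proof -
    obtain u p q where "x = (u, p @ q)" "g (u, p) \<noteq> 0" "f (pl u p, q) \<noteq> 0" "(u, p @ q) \<in> QP"
      by (rule mult_support[OF g fc nz])
    then show ?thesis using f l by auto
  qed
  then show "g \<otimes>\<^bsub>PA\<^esub> f \<in> ?K" using fc g by auto
  have "Pr x" if nz: "(f \<otimes>\<^bsub>PA\<^esub> g) x \<noteq> 0" for x
  proof -
    obtain u p q where "x = (u, p @ q)" "f (u, p) \<noteq> 0" "g (pl u p, q) \<noteq> 0" "(u, p @ q) \<in> QP"
      by (rule mult_support[OF fc g nz])
    then show ?thesis using f r by auto
  qed
  then show "f \<otimes>\<^bsub>PA\<^esub> g \<in> ?K" using fc g by auto
qed

lemma ep_I_append: assumes "(u, p @ q) \<in> QP" "ep (u, p) \<in> I \<or> ep (pl u p, q) \<in> I" shows "ep (u, p @ q) \<in> I"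
proof -
  have c: "ep (u, p) \<in> carrier PA" "ep (pl u p, q) \<in> carrier PA" using assms(1) ep_carrier by (auto simp: QP_append)
  have e: "ep (u, p @ q) = ep (u, p) \<otimes>\<^bsub>PA\<^esub> ep (pl u p, q)" by (simp add: ep_mult)
  show ?thesis unfolding e using assms(2) c P.I_l_closed P.I_r_closed by blast
qed

lemma arrow_QP: "a \<in> arcs Q \<Longrightarrow> (tail Q a, [a]) \<in> QP" by (simp add: QP_Cons QP_Nil)

lemma arrows_carrier: "(arrow_elem Q :: 'e \<Rightarrow> 'v \<times> 'e list \<Rightarrow> 'k) ` arcs Q \<subseteq> carrier PA"
  using ep_carrier[OF arrow_QP] by (auto simp: arrow_elem_def)

lemma arrow_ideal_support:
  "arrow_ideal Q \<subseteq> {f \<in> carrier PA. \<forall>x. f x \<noteq> 0 \<longrightarrow> snd x \<noteq> []}"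
  unfolding arrow_ideal_def
proof (rule P.genideal_minimal)
  show "ideal {f \<in> carrier PA. \<forall>x. f x \<noteq> 0 \<longrightarrow> snd x \<noteq> []} PA" by (rule ideal_support) auto
  have "arrow_elem Q a (u, []) = (0 :: 'k)" for a u
    by (simp add: arrow_elem_def path_elem_def)
  then show "arrow_elem Q ` arcs Q \<subseteq> {f \<in> carrier PA. \<forall>x. f x \<noteq> 0 \<longrightarrow> snd x \<noteq> []}"
    using arrows_carrier by auto
qed

lemma power_support:
  "f \<in> ideal_power PA (arrow_ideal Q) m \<Longrightarrow> f \<in> carrier PA \<and> (\<forall>x. f x \<noteq> 0 \<longrightarrow> m \<le> length (snd x))"
proof (induction m arbitrary: f)
  case (Suc m)
  from Suc.prems have "f \<in> ideal_prod PA (ideal_power PA (arrow_ideal Q) m) (arrow_ideal Q)" by simp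
  then show ?case
  proof (induction rule: ideal_prod.induct)
    case (prod i j)
    have i: "i \<in> carrier PA" "\<And>x. i x \<noteq> 0 \<Longrightarrow> m \<le> length (snd x)" using Suc.IH[OF prod(1)] by auto
    have j: "j \<in> carrier PA" "\<And>x. j x \<noteq> 0 \<Longrightarrow> snd x \<noteq> []" using prod(2) arrow_ideal_support by auto
    have "Suc m \<le> length (snd x)" if nz: "(i \<otimes>\<^bsub>PA\<^esub> j) x \<noteq> 0" for x
    proof -
      obtain u p q where x: "x = (u, p @ q)" "i (u, p) \<noteq> 0" "j (pl u p, q) \<noteq> 0" "(u, p @ q) \<in> QP"
        by (rule mult_support[OF i(1) j(1) nz])
      have "m \<le> length p" "q \<noteq> []" using i(2)[OF x(2)] j(2)[OF x(3)] by auto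
      then have "0 < length q" "m \<le> length p" by auto
      then show ?thesis unfolding x(1) snd_conv length_append by linarith
    qed
    then show ?case using i(1) j(1) by blast
  next
    case (sum f g)
    have "Suc m \<le> length (snd x)" if nz: "(f \<oplus>\<^bsub>PA\<^esub> g) x \<noteq> 0" for x
      using nz sum unfolding PA_simps(3) by (cases x; cases "f x = 0") auto
    then show ?case using sum by blast
  qed
qed simp

lemma path_power: "(u, p) \<in> QP \<Longrightarrow> length p = m \<Longrightarrow> ep (u, p) \<in> ideal_power PA (arrow_ideal Q) m"
proof (induction m arbitrary: p)
  case 0
  then show ?case using ep_carrier by simp
next
  case (Suc m)
  then obtain p' a where p: "p = p' @ [a]" by (metis length_0_conv nat.distinct(1) rev_exhaust)
  have q: "(u, p') \<in> QP" "(pl u p', [a]) \<in> QP" using Suc.prems(1) unfolding p QP_append by auto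
  have a: "a \<in> arcs Q" "pl u p' = tail Q a" using q(2) by (simp_all add: QP_Cons)
  have e: "ep (u, p) = ep (u, p') \<otimes>\<^bsub>PA\<^esub> arrow_elem Q a" unfolding arrow_elem_def ep_mult using a(2) p by simp
  have "(arrow_elem Q a :: 'v \<times> 'e list \<Rightarrow> 'k) \<in> arrow_ideal Q"
    using P.genideal_self[OF arrows_carrier] a(1) by (auto simp: arrow_ideal_def)
  moreover have "ep (u, p') \<in> ideal_power PA (arrow_ideal Q) m" using Suc.IH[OF q(1)] Suc.prems(2) p by simp
  ultimately show ?case unfolding e ideal_power.simps(2) by (intro ideal_prod.prod)
qed

lemma ep_I_length: "ep x \<in> I \<Longrightarrow> 2 \<le> length (snd x)"
proof -
  assume "ep x \<in> I"
  then have "ep x \<in> ideal_power PA (arrow_ideal Q) 2" using adm by (auto simp: admissible_ideal_def)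
  moreover have "ep x x \<noteq> 0" by (simp add: path_elem_def)
  ultimately show ?thesis using power_support by blast
qed

text \<open>The functions supported on paths in \<open>I\<close> form an ideal that contains the
  generating paths, hence contain \<open>I\<close>; the converse adds up a finite support. So the
  classes of the paths outside \<open>I\<close> form a basis of the quotient.\<close>

lemma mem_I: "f \<in> I \<longleftrightarrow> f \<in> carrier PA \<and> (\<forall>x. f x \<noteq> 0 \<longrightarrow> ep x \<in> I)"
proof
  let ?K = "{f \<in> carrier PA. \<forall>x. f x \<noteq> 0 \<longrightarrow> ep x \<in> I}"
  obtain S where S: "S \<subseteq> QP" "I = Idl\<^bsub>PA\<^esub> (path_elem ` S)" using mono by (auto simp: monomial_ideal_def)
  have c: "ep ` S \<subseteq> carrier PA" using S(1) ep_carrier by auto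
  have "I \<subseteq> ?K"
    unfolding S(2)
  proof (rule P.genideal_minimal)
    show "ideal {f \<in> carrier PA. \<forall>x. f x \<noteq> 0 \<longrightarrow> ep x \<in> Idl\<^bsub>PA\<^esub> (path_elem ` S)} PA"
      unfolding S(2)[symmetric] by (rule ideal_support) (auto intro: ep_I_append)
    have s: "ep ` S \<subseteq> I" unfolding S(2) by (rule P.genideal_self[OF c])
    have "ep y \<in> I" if "y' \<in> S" "ep y' y \<noteq> 0" for y y' using that s by (auto simp: path_elem_def split: if_splits)
    then show "path_elem ` S \<subseteq> {f \<in> carrier PA. \<forall>x. f x \<noteq> 0 \<longrightarrow> ep x \<in> Idl\<^bsub>PA\<^esub> (path_elem ` S)}"
      unfolding S(2)[symmetric] using c by auto
  qed
  then show "f \<in> I \<Longrightarrow> f \<in> carrier PA \<and> (\<forall>x. f x \<noteq> 0 \<longrightarrow> ep x \<in> I)" by blast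
  assume f: "f \<in> carrier PA \<and> (\<forall>x. f x \<noteq> 0 \<longrightarrow> ep x \<in> I)"
  have "finite T \<Longrightarrow> (\<forall>x\<in>T. ep x \<in> I) \<Longrightarrow> (\<lambda>x. if x \<in> T then f x else 0) \<in> I" for T
  proof (induction T rule: finite_induct)
    case empty
    then show ?case using additive_subgroup.zero_closed[OF P.additive_subgroup_axioms] by (simp add: PA_simps)
  next
    case (insert y T)
    have e: "(\<lambda>x. if x \<in> insert y T then f x else 0) = (\<lambda>x. f y * ep y x) \<oplus>\<^bsub>PA\<^esub> (\<lambda>x. if x \<in> T then f x else 0)"
      using insert(2) by (auto simp: PA_simps path_elem_def fun_eq_iff)
    show ?case unfolding e using insert
      by (intro additive_subgroup.a_closed[OF P.additive_subgroup_axioms] scale_I) auto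
  qed
  from this[of "{x. f x \<noteq> 0}"] have "(\<lambda>x. if x \<in> {x. f x \<noteq> 0} then f x else 0) \<in> I" using f by (auto simp: PA_simps)
  moreover have "(\<lambda>x. if x \<in> {x. f x \<noteq> 0} then f x else 0) = f" by auto
  ultimately show "f \<in> I" by simp
qed

text \<open>Words are read against the direction of paths, since \<open>words\<close> acts from the left.\<close>

definition WQ :: "'e list set" where "WQ = insert [] (rev ` snd ` {x \<in> QP. ep x \<notin> I})"

lemma WQ_iff: "w \<noteq> [] \<Longrightarrow> w \<in> WQ \<longleftrightarrow> (\<exists>u. (u, rev w) \<in> QP \<and> ep (u, rev w) \<notin> I)"
proof
  assume "w \<noteq> []" "w \<in> WQ"
  then obtain x where "x \<in> QP" "ep x \<notin> I" "w = rev (snd x)" by (auto simp: WQ_def)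
  then show "\<exists>u. (u, rev w) \<in> QP \<and> ep (u, rev w) \<notin> I" by (cases x) auto
next
  assume "\<exists>u. (u, rev w) \<in> QP \<and> ep (u, rev w) \<notin> I"
  then obtain u where "(u, rev w) \<in> {x \<in> QP. ep x \<notin> I}" by auto
  then have "rev (snd (u, rev w)) \<in> rev ` snd ` {x \<in> QP. ep x \<notin> I}" by (intro imageI)
  then show "w \<in> WQ" by (simp add: WQ_def)
qed

text \<open>A path longer than \<open>m\<close> has an initial part in the m-th power of the arrow
  ideal, hence in \<open>I\<close>; nonzero paths are therefore of bounded length over finitely many
  arrows.\<close>

lemma fin_WQ: "finite WQ"
proof -
  obtain m where m: "ideal_power PA (arrow_ideal Q) m \<subseteq> I" using adm by (auto simp: admissible_ideal_def)
  have "{x \<in> QP. ep x \<notin> I} \<subseteq> verts Q \<times> {p. set p \<subseteq> arcs Q \<and> length p \<le> m}"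
  proof
    fix x assume "x \<in> {x \<in> QP. ep x \<notin> I}"
    then obtain u p where x: "x = (u, p)" "(u, p) \<in> QP" "ep (u, p) \<notin> I" by (cases x) auto
    have "length p \<le> m"
    proof (rule ccontr)
      assume "\<not> length p \<le> m"
      then have l: "length (take m p) = m" by simp
      have q: "(u, take m p @ drop m p) \<in> QP" using x(2) by simp
      then have "ep (u, take m p) \<in> I" using path_power[OF _ l] m unfolding QP_append by blast
      then show False using ep_I_append[OF q] x(3) by simp
    qed
    then show "x \<in> verts Q \<times> {p. set p \<subseteq> arcs Q \<and> length p \<le> m}" using QP_set[OF x(2)] x(1) by simp
  qed
  moreover have "finite (verts Q \<times> {p. set p \<subseteq> arcs Q \<and> length p \<le> m})"
    using finite_lists_length_le[OF finite_arcs] by simp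
  ultimately show ?thesis unfolding WQ_def by (auto intro: finite_subset)
qed

lemma WQ_2: assumes "[a, b] \<in> WQ"
  shows "a \<in> arcs Q" "b \<in> arcs Q" "head Q b = tail Q a" "arrow_elem Q b \<otimes>\<^bsub>PA\<^esub> arrow_elem Q a \<notin> I"
proof -
  obtain u where u: "(u, [b, a]) \<in> QP" "ep (u, [b, a]) \<notin> I" using assms WQ_iff[of "[a, b]"] by auto
  then have q: "a \<in> arcs Q" "b \<in> arcs Q" "u = tail Q b" "head Q b = tail Q a" by (auto simp: QP_Cons)
  show "arrow_elem Q b \<otimes>\<^bsub>PA\<^esub> arrow_elem Q a \<notin> I"
    using u(2) q(3,4) by (simp add: arrow_elem_def ep_mult pl_def)
  show "a \<in> arcs Q" "b \<in> arcs Q" "head Q b = tail Q a" using q by auto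
qed

lemma condS_in: "a \<in> arcs Q \<Longrightarrow> c \<in> arcs Q \<Longrightarrow> c' \<in> arcs Q \<Longrightarrow>
    arrow_elem Q c \<otimes>\<^bsub>PA\<^esub> arrow_elem Q a \<notin> I \<Longrightarrow> arrow_elem Q c' \<otimes>\<^bsub>PA\<^esub> arrow_elem Q a \<notin> I \<Longrightarrow> c = c'"
  and condS_out: "a \<in> arcs Q \<Longrightarrow> c \<in> arcs Q \<Longrightarrow> c' \<in> arcs Q \<Longrightarrow>
    arrow_elem Q a \<otimes>\<^bsub>PA\<^esub> arrow_elem Q c \<notin> I \<Longrightarrow> arrow_elem Q a \<otimes>\<^bsub>PA\<^esub> arrow_elem Q c' \<notin> I \<Longrightarrow> c = c'"
  using condS unfolding condition_S_def by blast+

text \<open>Reversal exchanges \<open>head\<close> and \<open>tail\<close> and also the halves of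
  (S): \<open>W_right\<close> comes from uniqueness of the incoming arrow, \<open>W_left\<close>
  from that of the outgoing one.\<close>

lemma words_WQ: "words (verts Q) (arcs Q) (head Q) (tail Q) WQ"
proof
  show "finite WQ" by (rule fin_WQ)
  show "[] \<in> WQ" by (simp add: WQ_def)
  show "[a] \<in> WQ" if "a \<in> arcs Q" for a
    using arrow_QP[OF that] ep_I_length[of "(tail Q a, [a])"] by (auto simp: WQ_iff)
  show "set w \<subseteq> arcs Q" if "w \<in> WQ" for w
    using that QP_set[of _ "rev w"] by (cases "w = []") (auto simp: WQ_iff)
  show "u \<in> WQ \<and> w \<in> WQ" if uw: "u @ w \<in> WQ" for u w
  proof (cases "u @ w = []")
    case False
    then obtain v where v: "(v, rev w @ rev u) \<in> QP" "ep (v, rev w @ rev u) \<notin> I" using uw WQ_iff[of "u @ w"] by auto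
    then have "(v, rev w) \<in> QP" "(pl v (rev w), rev u) \<in> QP" "ep (v, rev w) \<notin> I" "ep (pl v (rev w), rev u) \<notin> I"
      using ep_I_append[OF v(1)] by (auto simp: QP_append)
    then show ?thesis using WQ_iff[of u] WQ_iff[of w] by (cases "u = []"; cases "w = []") (auto simp: WQ_def)
  qed (use uw in simp)
  show "tail Q a = head Q b" if "[a, b] \<in> WQ" for a b using WQ_2(3)[OF that] by simp
  show "b = c" if "[a, b] \<in> WQ" "[a, c] \<in> WQ" for a b c
    by (rule condS_in[OF WQ_2(1)[OF that(1)] WQ_2(2)[OF that(1)] WQ_2(2)[OF that(2)] WQ_2(4)[OF that(1)] WQ_2(4)[OF that(2)]])
  show "a = b" if "[a, c] \<in> WQ" "[b, c] \<in> WQ" for a b c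
    by (rule condS_out[OF WQ_2(2)[OF that(1)] WQ_2(1)[OF that(1)] WQ_2(1)[OF that(2)] WQ_2(4)[OF that(1)] WQ_2(4)[OF that(2)]])
  show "finite (verts Q)" "finite (arcs Q)" by (rule finite_verts, rule finite_arcs)
  show "head Q a \<in> verts Q" "tail Q a \<in> verts Q" if "a \<in> arcs Q" for a
    using that by (rule head_in_verts, rule tail_in_verts)
qed

interpretation w: words "verts Q" "arcs Q" "head Q" "tail Q" WQ by (rule words_WQ)

lemma pe_pl: "w.pe u p = pl u p" by (simp add: w.pe_def pl_def)

lemma NP_iff: "x \<in> w.NP \<longleftrightarrow> x \<in> QP \<and> ep x \<notin> I"
proof -
  obtain u p where x: "x = (u, p)" by (cases x)
  show ?thesis
  proof (cases p)
    case Nil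
    then show ?thesis using ep_I_length[of "(u, [])"] unfolding x w.NP_def by (auto simp: WQ_def QP_Nil)
  next
    case (Cons a q)
    have "v = tail Q a" if "(v, p) \<in> QP" for v using that Cons by (simp add: QP_Cons)
    then show ?thesis using WQ_iff[of "rev p"] QP_set[of u p] Cons unfolding x by (auto simp: w.NP_def)
  qed
qed

definition rs :: "('v \<times> 'e list \<Rightarrow> 'k) \<Rightarrow> 'v \<times> 'e list \<Rightarrow> 'k" where
  "rs f = (\<lambda>x. if x \<in> w.NP then f x else 0)"

definition qcof :: "('v \<times> 'e list \<Rightarrow> 'k) set \<Rightarrow> 'v \<times> 'e list \<Rightarrow> 'k" where
  "qcof X = rs (SOME f. f \<in> carrier PA \<and> X = I +>\<^bsub>PA\<^esub> f)"

text \<open>\<open>mem_I\<close> tests the difference path by path, and a path where the functions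
  differ is a genuine path of the quiver. What matters is thus the restriction to nonzero paths,
  which makes \<open>qcof\<close> well defined.\<close>

lemma coset_eq:
  assumes "f \<in> carrier PA" "g \<in> carrier PA"
  shows "I +>\<^bsub>PA\<^esub> f = I +>\<^bsub>PA\<^esub> g \<longleftrightarrow> rs f = rs g"
proof -
  have d: "(\<lambda>x. f x - g x) \<in> carrier PA" using P.minus_closed[OF assms] by (simp add: diff_PA assms)
  have "I +>\<^bsub>PA\<^esub> f = I +>\<^bsub>PA\<^esub> g \<longleftrightarrow> (\<lambda>x. f x - g x) \<in> I"
    using P.quotient_eq_iff_same_a_r_cos[OF ideal_I assms] by (simp add: diff_PA assms)
  also have "\<dots> \<longleftrightarrow> (\<forall>x. f x \<noteq> g x \<longrightarrow> ep x \<in> I)" using d by (simp add: mem_I[of "\<lambda>x. f x - g x"])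
  also have "\<dots> \<longleftrightarrow> rs f = rs g"
  proof -
    have "x \<in> QP" if "f x \<noteq> g x" for x
    proof -
      have "f x - g x \<noteq> 0" using that by simp
      then show ?thesis using d unfolding PA_simps(1) by blast
    qed
    then have s: "x \<in> w.NP" if "f x \<noteq> g x" "ep x \<notin> I" for x using that NP_iff by blast
    have h: "f x = g x" if "rs f = rs g" "x \<in> w.NP" for x using fun_cong[OF that(1), of x] that(2) by (simp add: rs_def)
    show ?thesis
    proof
      assume A: "\<forall>x. f x \<noteq> g x \<longrightarrow> ep x \<in> I"
      show "rs f = rs g"
      proof (rule ext)
        fix x
        have "x \<in> w.NP \<Longrightarrow> f x = g x" using A NP_iff[of x] by blast
        then show "rs f x = rs g x" by (simp add: rs_def)
      qed
    next
      assume e: "rs f = rs g"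
      show "\<forall>x. f x \<noteq> g x \<longrightarrow> ep x \<in> I" using h[OF e] s by blast
    qed
  qed
  finally show ?thesis .
qed

lemma qcof_coset: assumes f: "f \<in> carrier PA" shows "qcof (I +>\<^bsub>PA\<^esub> f) = rs f"
proof -
  let ?g = "SOME g. g \<in> carrier PA \<and> I +>\<^bsub>PA\<^esub> f = I +>\<^bsub>PA\<^esub> g"
  have g: "?g \<in> carrier PA \<and> I +>\<^bsub>PA\<^esub> f = I +>\<^bsub>PA\<^esub> ?g" by (rule someI[of _ f]) (simp add: f)
  have "rs f = rs ?g" using coset_eq[OF f conjunct1[OF g]] conjunct2[OF g] by (rule iffD1)
  then show ?thesis unfolding qcof_def by (rule sym)
qed

abbreviation QA :: "('k, ('v \<times> 'e list \<Rightarrow> 'k) set) module" where "QA \<equiv> quotient_algebra PA I"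

lemma QA_simps: "carrier QA = {I +>\<^bsub>PA\<^esub> f |f. f \<in> carrier PA}" "\<one>\<^bsub>QA\<^esub> = I +>\<^bsub>PA\<^esub> \<one>\<^bsub>PA\<^esub>"
  "f \<in> carrier PA \<Longrightarrow> g \<in> carrier PA \<Longrightarrow> (I +>\<^bsub>PA\<^esub> f) \<oplus>\<^bsub>QA\<^esub> (I +>\<^bsub>PA\<^esub> g) = I +>\<^bsub>PA\<^esub> (f \<oplus>\<^bsub>PA\<^esub> g)"
  "f \<in> carrier PA \<Longrightarrow> g \<in> carrier PA \<Longrightarrow> (I +>\<^bsub>PA\<^esub> f) \<otimes>\<^bsub>QA\<^esub> (I +>\<^bsub>PA\<^esub> g) = I +>\<^bsub>PA\<^esub> (f \<otimes>\<^bsub>PA\<^esub> g)"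
  "c \<odot>\<^bsub>QA\<^esub> X = (\<Union>x\<in>X. I +>\<^bsub>PA\<^esub> (c \<odot>\<^bsub>PA\<^esub> x))"
  by (auto simp: quotient_algebra_def ring.defs module.defs FactRing_def A_RCOSETS_def' P.rcoset_mult_add P.a_rcos_sum)

text \<open>The scalar multiple of a coset is a union over its representatives, and by
  \<open>coset_eq\<close> all members of this union coincide.\<close>

lemma smult_coset: assumes f: "f \<in> carrier PA" shows "c \<odot>\<^bsub>QA\<^esub> (I +>\<^bsub>PA\<^esub> f) = I +>\<^bsub>PA\<^esub> (\<lambda>x. c * f x)"
proof -
  have e: "I +>\<^bsub>PA\<^esub> (c \<odot>\<^bsub>PA\<^esub> g) = I +>\<^bsub>PA\<^esub> (\<lambda>x. c * f x)" if g: "g \<in> I +>\<^bsub>PA\<^esub> f" for g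
  proof -
    have gc: "g \<in> carrier PA" using P.a_r_coset_subset_G[OF P.a_subset f] g by blast
    have "I +>\<^bsub>PA\<^esub> f = I +>\<^bsub>PA\<^esub> g" by (rule P.a_repr_independence'[OF g f])
    then have "rs f = rs g" using coset_eq[OF f gc] by simp
    moreover have "rs (\<lambda>x. c * h x) = (\<lambda>x. c * rs h x)" for h by (auto simp: rs_def)
    ultimately have "rs (\<lambda>x. c * g x) = rs (\<lambda>x. c * f x)" by simp
    then show ?thesis unfolding PA_simps(4) using coset_eq[OF scale_carrier[OF gc] scale_carrier[OF f]] by blast
  qed
  have "f \<in> I +>\<^bsub>PA\<^esub> f" by (rule P.a_rcos_self[OF f])
  then show ?thesis unfolding QA_simps(5) using e by blast
qed

lemma malg_QA: "malg (verts Q) (arcs Q) (head Q) (tail Q) WQ QA qcof"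
proof (intro malg.intro malg_axioms.intro)
  show "words (verts Q) (arcs Q) (head Q) (tail Q) WQ" by (rule words_WQ)
  show "ring QA"
    by (rule ring_cong[OF P.quotient_is_ring]) (simp_all add: quotient_algebra_def ring.defs module.defs)
  show "bij_betw qcof (carrier QA) {c. \<forall>x. c x \<noteq> 0 \<longrightarrow> x \<in> w.NP}"
    unfolding bij_betw_def
  proof (intro conjI equalityI subsetI)
    show "inj_on qcof (carrier QA)"
    proof (rule inj_onI)
      fix X Y assume "X \<in> carrier QA" "Y \<in> carrier QA" and e: "qcof X = qcof Y"
      then obtain f g where fg: "X = I +>\<^bsub>PA\<^esub> f" "Y = I +>\<^bsub>PA\<^esub> g" "f \<in> carrier PA" "g \<in> carrier PA"
        by (auto simp: QA_simps(1))
      show "X = Y" using e coset_eq[OF fg(3,4)] unfolding fg(1,2) qcof_coset[OF fg(3)] qcof_coset[OF fg(4)] by blast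
    qed
    show "c \<in> {c. \<forall>x. c x \<noteq> 0 \<longrightarrow> x \<in> w.NP}" if "c \<in> qcof ` carrier QA" for c
      using that by (auto simp: QA_simps(1) qcof_coset rs_def split: if_splits)
    fix c :: "'v \<times> 'e list \<Rightarrow> 'k" assume c: "c \<in> {c. \<forall>x. c x \<noteq> 0 \<longrightarrow> x \<in> w.NP}"
    then have s: "{x. c x \<noteq> 0} \<subseteq> w.NP" by auto
    have "c \<in> carrier PA" using s finite_subset[OF s w.fin_NP] NP_iff by (auto simp: PA_simps)
    moreover have "rs c = c" using c by (auto simp: rs_def fun_eq_iff)
    ultimately show "c \<in> qcof ` carrier QA"
      by (intro image_eqI[where x = "I +>\<^bsub>PA\<^esub> c"]) (auto simp: qcof_coset QA_simps(1))
  qed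
  show "qcof \<one>\<^bsub>QA\<^esub> = (\<lambda>(u, p). if u \<in> verts Q \<and> p = [] then 1 else 0)"
    unfolding QA_simps(2) qcof_coset[OF P.one_closed] unfolding PA_simps by (auto simp: rs_def fun_eq_iff w.trivial_NP)
  fix X assume "X \<in> carrier QA"
  then obtain f where f: "X = I +>\<^bsub>PA\<^esub> f" "f \<in> carrier PA" by (auto simp: QA_simps(1))
  show "c \<odot>\<^bsub>QA\<^esub> X \<in> carrier QA" for c
    unfolding f(1) smult_coset[OF f(2)] using scale_carrier[OF f(2)] by (auto simp: QA_simps(1))
  show "qcof (c \<odot>\<^bsub>QA\<^esub> X) = (\<lambda>x. c * qcof X x)" for c
    unfolding f(1) smult_coset[OF f(2)] qcof_coset[OF f(2)] qcof_coset[OF scale_carrier[OF f(2)]] by (auto simp: rs_def)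
  fix Y assume "Y \<in> carrier QA"
  then obtain g where g: "Y = I +>\<^bsub>PA\<^esub> g" "g \<in> carrier PA" by (auto simp: QA_simps(1))
  show "qcof (X \<oplus>\<^bsub>QA\<^esub> Y) = qcof X + qcof Y"
    unfolding f(1) g(1) QA_simps(3)[OF f(2) g(2)] qcof_coset[OF P.a_closed[OF f(2) g(2)]] qcof_coset[OF f(2)] qcof_coset[OF g(2)]
    unfolding PA_simps by (auto simp: rs_def fun_eq_iff)
  show "qcof (X \<otimes>\<^bsub>QA\<^esub> Y) = w.cmul (qcof X) (qcof Y)"
    unfolding f(1) g(1) QA_simps(4)[OF f(2) g(2)] qcof_coset[OF P.m_closed[OF f(2) g(2)]] qcof_coset[OF f(2)] qcof_coset[OF g(2)]
  proof (rule ext)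
    fix x :: "'v \<times> 'e list"
    obtain u r where x: "x = (u, r)" by (cases x)
    show "rs (f \<otimes>\<^bsub>PA\<^esub> g) x = w.cmul (rs f) (rs g) x"
    proof (cases "x \<in> w.NP")
      case True
      \<comment> \<open>Both pieces of a nonzero path are nonzero, so cutting functions down to
        \<open>NP\<close> before or after multiplying gives the same coefficient.\<close>
      have "(u, take i r) \<in> w.NP" "(pl u (take i r), drop i r) \<in> w.NP" for i
        using w.NP_append[of u "take i r" "drop i r"] True x by (auto simp: pe_pl)
      then show ?thesis using True unfolding x by (simp add: rs_def w.cmul_def mult_PA pe_pl)
    next
      case False
      then show ?thesis by (simp add: rs_def w.cmul_def)
    qed
  qed
qed

lemma repdim_QA: "repdim QA \<le> 3"
  by (rule malg.repdim_le_3[OF malg_QA])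

end

theorem corollary2:
  fixes Q :: "('v, 'e) pre_digraph"
    and I :: "('v \<times> 'e list \<Rightarrow> 'k::alg_closed_field) set"
  assumes "fin_digraph Q"
    and "admissible_ideal Q I"
    and "monomial_ideal Q I"
    and "condition_S Q I"
  shows "repdim (quotient_algebra (path_algebra Q) I) \<le> 3"
  by (rule qalg.repdim_QA) (use assms in \<open>simp add: qalg_def qalg_axioms_def\<close>)

end
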